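(* Let $\{T^t\}_{t\in\mathbb R}$ be a measure-preserving measurable flow on a Lebesgue space $(X,\mu)$ with $\mu(X)=1$. Let $A\colon\mathbb R\times X\to GL(m,\mathbb R)$ be a cocycle over $\{T^t\}$, i.e. a measurable function with $A(t+s,x)=A(s,T^tx)A(t,x)$ for all $t,s\in\mathbb R$, $x\in X$, and suppose that $\ln^+\|A(t,\cdot)\|\in L^1(X,\mu)$ and $\ln^+\|A(t,\cdot)^{-1}\|\in L^1(X,\mu)$ for each $t\in\mathbb R$. Then for $\mu$-almost every $x$: (i) there exists the limit in density $$\operatorname{d-lim}_{t\to\infty}\bigl(A^*(t,x)A(t,x)\bigr)^{\frac1{2t}}=:\Lambda(x);$$ (ii) there exists a measurable (in $x$) splitting $\mathbb R^m=\bigoplus_{i=1}^{k(x)}U_i(x)$ such that $$U_i(T^tx)=A(t,x)U_i(x)$$ and $$\operatorname{d-lim}_{t\to\pm\infty}\frac1{|t|}\ln\|A(t,x)v\|=\pm\chi_i(x),\qquad v\in U_i(x)\setminus\{0\},$$ uniformly over unit vectors $v\in U_i(x)$. The functions $k(x)$, $\chi_i(x)$ and $\dim U_i(x)$ are $T^t$-invariant, and $\exp(\chi_i(x))$ are the eigenvalues of the matrix $\Lambda(x)$ with multiplicities $\dim U_i(x)$. Moreover, the convergence in (i) and (ii) holds along the complements of subsets of the time axis of finite Lebesgue measure, and these subsets can be chosen measurably dependent on $x$ (so that, in place of the density-zero exceptional set, the limits are ordinary limits as $t\to\infty$, respectively $t\to\pm\infty$, with $t$ restricted to the complement of a set $\tau(x)$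 of finite Lebesgue measure).
   Context: $\lambda$ denotes Lebesgue measure on $\mathbb R$. The upper density of a Borel set $\tau\subset\mathbb R_+$ is $\limsup_{t\to\infty}\lambda(\tau\cap[0,t])/t$. A function $f(t)$ converges in density to $l$ as $t\to\infty$, written $\operatorname{d-lim}_{t\to\infty}f(t)=l$, if there is a set $\tau\subset\mathbb R_+$ of density $0$ such that $\lim_{t\to\infty,\,t\notin\tau}f(t)=l$; $\operatorname{d-lim}_{t\to-\infty}$ is defined symmetrically, by replacing $t$ with $-t$. The flow is measurable in the sense that $(t,x)\mapsto T^tx$ is measurable. $A^*$ denotes the transpose, $\|\cdot\|$ the Euclidean norm on $\mathbb R^m$ or the induced operator norm, $\ln^+=\max(\ln,0)$, and $(A^*A)^{1/(2t)}$ is the positive definite power of the positive definite matrix $A^*A$. Measurable dependence of a set $\tau(x)\subset\mathbb R$ on $x$ means that $\{(t,x):t\in\tau(x)\}$ is a measurable subset of $\mathbb R\times X$. *)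

theory Defs
  imports "HOL-Probability.Probability"
begin

section \<open>Lebesgue spaces\<close>

definition measure_iso :: "'a measure \<Rightarrow> 'b measure \<Rightarrow> ('a \<Rightarrow> 'b) \<Rightarrow> bool" where
  "measure_iso M N f \<longleftrightarrow>
     bij_betw f (space M) (space N) \<and> f \<in> M \<rightarrow>\<^sub>M N \<and>
     the_inv_into (space M) f \<in> N \<rightarrow>\<^sub>M M \<and> distr M N f = N"

text \<open>
  Lebesgue (Rokhlin) probability spaces: complete, and isomorphic modulo null sets to the disjoint
  union of an interval \<open>[0, a]\<close> with Lebesgue measure and countably many atoms. The continuous part
  is \<open>Y\<close>, the atoms are the points of \<open>C\<close>; a purely atomic space is covered by
  \<open>a = 0\<close>, \<open>Y = {}\<close>, \<open>Z = {0}\<close>.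
\<close>
definition lebesgue_space :: "'x measure \<Rightarrow> bool" where
  "lebesgue_space M \<longleftrightarrow> prob_space M \<and> complete_measure M \<and>
     (\<exists>C Y a Z f. countable C \<and> C \<subseteq> space M \<and> (\<forall>c\<in>C. {c} \<in> sets M) \<and>
        Y \<in> sets M \<and> C \<inter> Y = {} \<and> space M - (C \<union> Y) \<in> null_sets M \<and>
        0 \<le> a \<and> Z \<in> null_sets lebesgue \<and>
        measure_iso (restrict_space M Y) (lebesgue_on ({0..a::real} - Z)) f)"


section \<open>Flows and cocycles\<close>

text \<open>
  The measurable structure on \<open>\<real> \<times> X\<close> is the completion of the product: \<open>M\<close> is complete, and
  with respect to the uncompleted product already the rotation flow on the circle with the
  Lebesgue-measurable sets fails to be jointly measurable.
\<close>
definition time_product :: "'x measure \<Rightarrow> (real \<times> 'x) measure" where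
  "time_product M = completion (lborel \<Otimes>\<^sub>M M)"

definition mp_flow :: "'x measure \<Rightarrow> (real \<Rightarrow> 'x \<Rightarrow> 'x) \<Rightarrow> bool" where
  "mp_flow M T \<longleftrightarrow>
     (\<lambda>(t, x). T t x) \<in> time_product M \<rightarrow>\<^sub>M M \<and>
     (\<forall>t. T t \<in> M \<rightarrow>\<^sub>M M \<and> distr M M (T t) = M) \<and>
     (\<forall>x\<in>space M. T 0 x = x) \<and>
     (\<forall>t s. \<forall>x\<in>space M. T (t + s) x = T t (T s x))"

definition GL_cocycle ::
    "'x measure \<Rightarrow> (real \<Rightarrow> 'x \<Rightarrow> 'x) \<Rightarrow> (real \<Rightarrow> 'x \<Rightarrow> real^'m^'m) \<Rightarrow> bool" where
  "GL_cocycle M T A \<longleftrightarrow>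
     (\<lambda>(t, x). A t x) \<in> borel_measurable (time_product M) \<and>
     (\<forall>t. \<forall>x\<in>space M. invertible (A t x)) \<and>
     (\<forall>t s. \<forall>x\<in>space M. A (t + s) x = A s (T t x) ** A t x)"

definition ln_plus :: "real \<Rightarrow> real" where
  "ln_plus r = max (ln r) 0"

text \<open>The type class norm of \<^typ>\<open>real^'m^'m\<close> is not the operator norm.\<close>
definition mat_norm :: "real^'m^'m \<Rightarrow> real" where
  "mat_norm B = onorm (\<lambda>v. B *v v)"


section \<open>Linear algebra\<close>

definition diag_mat :: "real^'m \<Rightarrow> real^'m^'m" where
  "diag_mat d = (\<chi> i j. if i = j then d $ i else 0)"

text \<open>
  The power \<open>S\<^sup>s\<close> of a symmetric positive definite matrix: raise the eigenvalues to the power \<open>s\<close> in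
  any orthonormal eigenbasis. The result does not depend on the diagonalisation; for other \<open>S\<close>
  the value is unspecified.
\<close>
definition posdef_powr :: "real^'m^'m \<Rightarrow> real \<Rightarrow> real^'m^'m" where
  "posdef_powr S s = (THE P. \<exists>Q d. orthogonal_matrix Q \<and> (\<forall>i. 0 < d $ i) \<and>
     S = Q ** diag_mat d ** transpose Q \<and>
     P = Q ** diag_mat (\<chi> i. d $ i powr s) ** transpose Q)"

definition eigenspace :: "real^'m^'m \<Rightarrow> real \<Rightarrow> (real^'m) set" where
  "eigenspace L c = {v. L *v v = c *\<^sub>R v}"

definition eigenvalues :: "real^'m^'m \<Rightarrow> real set" where
  "eigenvalues L = {c. \<exists>v. v \<noteq> 0 \<and> L *v v = c *\<^sub>R v}"

text \<open>The \<open>c i\<close>, \<open>i \<in> I\<close>, list without repetition the eigenvalues of \<open>L\<close>, and \<open>d i\<close> is the multiplicity of \<open>c i\<close>.\<close>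
definition eigenvalues_with_mult ::
    "real^'m^'m \<Rightarrow> 'i set \<Rightarrow> ('i \<Rightarrow> real) \<Rightarrow> ('i \<Rightarrow> nat) \<Rightarrow> bool" where
  "eigenvalues_with_mult L I c d \<longleftrightarrow>
     inj_on c I \<and> eigenvalues L = c ` I \<and> (\<forall>i\<in>I. dim (eigenspace L (c i)) = d i)"

definition direct_sum_decomp :: "'i set \<Rightarrow> ('i \<Rightarrow> (real^'m) set) \<Rightarrow> bool" where
  "direct_sum_decomp I U \<longleftrightarrow> (\<forall>i\<in>I. subspace (U i)) \<and>
     (\<forall>v. \<exists>!u. u \<in> (\<Pi>\<^sub>E i\<in>I. U i) \<and> v = (\<Sum>i\<in>I. u i))"

text \<open>
  Measurability of \<open>x \<mapsto> (k x, U 1 x, \<dots>, U (k x) x)\<close>. A subspace-valued map is measurable if the set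
  of points where its value meets a given open set is measurable; this is measurability for the Borel
  structure of the Grassmannians. \<open>U i\<close> is only considered where \<open>i \<le> k x\<close>.
\<close>
definition measurable_splitting ::
    "'x measure \<Rightarrow> ('x \<Rightarrow> nat) \<Rightarrow> (nat \<Rightarrow> 'x \<Rightarrow> (real^'m) set) \<Rightarrow> bool" where
  "measurable_splitting M k U \<longleftrightarrow> k \<in> M \<rightarrow>\<^sub>M count_space UNIV \<and>
     (\<forall>i\<ge>1. \<forall>G. open G \<longrightarrow> {x \<in> space M. i \<le> k x \<and> U i x \<inter> G \<noteq> {}} \<in> sets M)"


section \<open>Convergence in density\<close>

definition upper_density :: "real set \<Rightarrow> ereal" where
  "upper_density \<tau> = Limsup at_top (\<lambda>t. ereal (measure lborel (\<tau> \<inter> {0..t}) / t))"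

definition density_zero :: "real set \<Rightarrow> bool" where
  "density_zero \<tau> \<longleftrightarrow> \<tau> \<in> sets borel \<and> \<tau> \<subseteq> {0..} \<and> upper_density \<tau> = 0"

definition off :: "real filter \<Rightarrow> real set \<Rightarrow> real filter" where
  "off F \<tau> = inf F (principal (- \<tau>))"

definition dlim_at_top :: "(real \<Rightarrow> 'a::topological_space) \<Rightarrow> 'a \<Rightarrow> bool" where
  "dlim_at_top f l \<longleftrightarrow> (\<exists>\<tau>. density_zero \<tau> \<and> (f \<longlongrightarrow> l) (off at_top \<tau>))"

definition dlim_at_bot :: "(real \<Rightarrow> 'a::topological_space) \<Rightarrow> 'a \<Rightarrow> bool" where
  "dlim_at_bot f l \<longleftrightarrow> dlim_at_top (\<lambda>t. f (- t)) l"

text \<open>Uniform convergence in density: one exceptional set serves all \<open>v \<in> S\<close>.\<close>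
definition unif_dlim_at_top ::
    "'v set \<Rightarrow> (real \<Rightarrow> 'v \<Rightarrow> 'a::metric_space) \<Rightarrow> ('v \<Rightarrow> 'a) \<Rightarrow> bool" where
  "unif_dlim_at_top S f l \<longleftrightarrow> (\<exists>\<tau>. density_zero \<tau> \<and> uniform_limit S f l (off at_top \<tau>))"

definition unif_dlim_at_bot ::
    "'v set \<Rightarrow> (real \<Rightarrow> 'v \<Rightarrow> 'a::metric_space) \<Rightarrow> ('v \<Rightarrow> 'a) \<Rightarrow> bool" where
  "unif_dlim_at_bot S f l \<longleftrightarrow> unif_dlim_at_top S (\<lambda>t. f (- t)) l"


section \<open>Quantities in the multiplicative ergodic theorem\<close>

definition cocycle_root :: "(real \<Rightarrow> 'x \<Rightarrow> real^'m^'m) \<Rightarrow> 'x \<Rightarrow> real \<Rightarrow> real^'m^'m" where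
  "cocycle_root A x t = posdef_powr (transpose (A t x) ** A t x) (1 / (2 * t))"

definition growth_rate :: "(real \<Rightarrow> 'x \<Rightarrow> real^'m^'m) \<Rightarrow> 'x \<Rightarrow> real \<Rightarrow> real^'m \<Rightarrow> real" where
  "growth_rate A x t v = 1 / \<bar>t\<bar> * ln (norm (A t x *v v))"

end

theory Submission
  imports Defs
begin

text \<open>
  Sample the flow at integer times, write \<open>C n x = A n x\<close>, and let \<open>slow C c x\<close> be the subspace of
  the vectors whose forward growth exponent is at most \<open>c\<close>. Almost everywhere, (a) a vector of
  backward exponent at most \<open>c\<close> grows forward at least like \<open>exp (- c n)\<close>, because subadditive growth
  bounds can be moved along the orbit; (b) the orthogonal complement of \<open>slow C c\<close> is contained in
  the slow space of level \<open>- c\<close> of the dual cocycle, because otherwise the argument of Karlsson and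
  Margulis gives a vector outside \<open>slow C c\<close> whose quotient component decays too fast. By (a) and (b)
  the forward and backward slow spaces are transversal, so their intersections form the splitting;
  and every limit point of \<open>(A\<^sup>* A)\<^bsup>1/2t\<^esup>\<close> has the forward slow spaces as its spectral flag, so the
  limit exists.

  Between integer times, \<open>\<integral> ln\<^sup>+ \<parallel>A(s,x)\<parallel> + ln\<^sup>+ \<parallel>A(s,x)\<^sup>-\<^sup>1\<parallel>\<close> is subadditive and even in \<open>s\<close>, hence bounded
  on \<open>[0,1]\<close>. So the set of times \<open>t\<close> with \<open>n = \<lfloor>t\<rfloor>\<close> at which the logarithmic size of \<open>A(t - n, T\<^sup>n x)\<close>
  exceeds \<open>\<bar>n\<bar> / (j + 1)\<close> has finite measure for almost all \<open>x\<close>, and after dropping finitely many \<open>n\<close>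
  for each \<open>j\<close> the union over \<open>j\<close> is the exceptional set.
\<close>

text \<open>The hypotheses control \<open>ln_plus (mat_norm (A t x))\<close> for each single t and
  say nothing about its supremum over a time interval. Between integers only a mean over the phase
  space is bounded, so some real times have to be discarded. All almost-everywhere growth bounds are
  one-sided. Each comes from integrating over the strictly invariant set where the bound fails and
  comparing with an upper estimate of the same integral; no ergodicity enters. That forward and
  backward slow spaces span comes from duality: a vector orthogonal to both lies, by (b), in a
  forward and in a backward slow space of the dual cocycle, and (a), applied to the dual cocycle,
  lets these two meet only in 0. A last obstacle is equivariance. The splitting built from integer
  times is equivariant under a given real time s outside a null set that depends on s, and there are
  uncountably many s. By Fubini almost every x is good for almost every s, and the final splitting
  is recovered from these s alone, which makes it equivariant under every time.\<close>

section \<open>The maximal ergodic theorem\<close>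

text \<open>\<^term>\<open>up u \<gamma>\<close> says that the upper limit of \<^term>\<open>u n / real n\<close> is greater than \<^term>\<open>\<gamma>\<close>.\<close>
definition up :: "(nat \<Rightarrow> real) \<Rightarrow> real \<Rightarrow> bool" where
  "up u \<gamma> \<longleftrightarrow> (\<exists>j::nat. \<forall>N. \<exists>n\<ge>N. u n > (\<gamma> + 1 / real (Suc j)) * real n)"

lemma upI:
  assumes "0 < \<delta>" "\<And>N. \<exists>n\<ge>N. u n > (\<gamma> + \<delta>) * real n"
  shows "up u \<gamma>"
proof -
  obtain j where j: "1 / real (Suc j) < \<delta>"
    using assms(1) nat_approx_posE by blast
  have "\<exists>n\<ge>N. u n > (\<gamma> + 1 / real (Suc j)) * real n" for N
  proof -
    obtain n where n: "n \<ge> N" "u n > (\<gamma> + \<delta>) * real n" using assms(2) by blast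
    have "(\<gamma> + 1 / real (Suc j)) * real n \<le> (\<gamma> + \<delta>) * real n"
      using j by (intro mult_right_mono) auto
    with n show ?thesis by (intro exI[of _ n]) linarith
  qed
  then show ?thesis unfolding up_def by blast
qed

lemma upE:
  assumes "up u \<gamma>"
  obtains \<delta> where "0 < \<delta>" "\<And>N. \<exists>n\<ge>N. u n > (\<gamma> + \<delta>) * real n"
proof -
  obtain j :: nat where "\<forall>N. \<exists>n\<ge>N. u n > (\<gamma> + 1 / real (Suc j)) * real n"
    using assms unfolding up_def by blast
  then show thesis by (intro that[of "1 / real (Suc j)"]) (simp, blast)
qed

lemma not_up_iff:
  "\<not> up u \<gamma> \<longleftrightarrow> (\<forall>\<delta>>0. \<exists>N. \<forall>n\<ge>N. u n \<le> (\<gamma> + \<delta>) * real n)"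
proof
  assume "\<not> up u \<gamma>"
  then show "\<forall>\<delta>>0. \<exists>N. \<forall>n\<ge>N. u n \<le> (\<gamma> + \<delta>) * real n"
    using upI[where u = u and \<gamma> = \<gamma>] by (meson not_le)
next
  assume *: "\<forall>\<delta>>0. \<exists>N. \<forall>n\<ge>N. u n \<le> (\<gamma> + \<delta>) * real n"
  show "\<not> up u \<gamma>"
  proof
    assume "up u \<gamma>"
    then obtain \<delta> where "0 < \<delta>" "\<And>N. \<exists>n\<ge>N. u n > (\<gamma> + \<delta>) * real n" by (rule upE) blast
    with * show False by (meson not_le)
  qed
qed

lemma up_frequently:
  assumes "up u \<gamma>"
  shows "\<exists>n\<ge>N. u n > \<gamma> * real n"
proof -
  obtain \<delta> where \<delta>: "0 < \<delta>" "\<And>N. \<exists>n\<ge>N. u n > (\<gamma> + \<delta>) * real n" using assms by (rule upE) blast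
  obtain n where n: "n \<ge> N" "u n > (\<gamma> + \<delta>) * real n" using \<delta>(2) by blast
  have "(\<gamma> + \<delta>) * real n \<ge> \<gamma> * real n" using \<delta>(1) by (intro mult_right_mono) auto
  with n show ?thesis by force
qed

lemma up_antimono: "up u \<gamma>' \<Longrightarrow> \<gamma> \<le> \<gamma>' \<Longrightarrow> up u \<gamma>"
proof -
  assume "up u \<gamma>'" and le: "\<gamma> \<le> \<gamma>'"
  then obtain \<delta> where \<delta>: "0 < \<delta>" "\<And>N. \<exists>n\<ge>N. u n > (\<gamma>' + \<delta>) * real n" by (rule_tac upE) blast+
  have "\<exists>n\<ge>N. u n > (\<gamma> + \<delta>) * real n" for N
  proof -
    obtain n where n: "n \<ge> N" "u n > (\<gamma>' + \<delta>) * real n" using \<delta>(2) by blast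
    have "(\<gamma> + \<delta>) * real n \<le> (\<gamma>' + \<delta>) * real n" using le by (intro mult_right_mono) auto
    with n show ?thesis by force
  qed
  with \<delta>(1) show ?thesis by (rule upI)
qed

text \<open>Since \<open>up\<close> has a margin built in, failure of an upper bound at \<gamma> is
  already failure at one of countably many larger levels. Almost-everywhere bounds are therefore
  proved at each level \<open>\<gamma> + 1 / real (Suc j)\<close> and then combined.\<close>

lemma up_gap:
  assumes "up u \<gamma>"
  shows "\<exists>j::nat. up u (\<gamma> + 1 / real (Suc j))"
proof -
  obtain \<delta> where \<delta>: "0 < \<delta>" "\<And>N. \<exists>n\<ge>N. u n > (\<gamma> + \<delta>) * real n" using assms by (rule upE) blast
  obtain j where j: "1 / real (Suc j) < \<delta> / 2"
    using \<delta>(1) nat_approx_posE[of "\<delta>/2"] by auto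
  have "up u (\<gamma> + \<delta> / 2)"
    using \<delta> by (intro upI[of "\<delta>/2"]) (auto simp: algebra_simps)
  then show ?thesis using j up_antimono[of u "\<gamma> + \<delta>/2" "\<gamma> + 1 / real (Suc j)"] by (intro exI[of _ j]) auto
qed

lemma up_perturb:
  assumes "up u \<gamma>" and le: "\<And>\<epsilon>. 0 < \<epsilon> \<Longrightarrow> \<exists>N. \<forall>n\<ge>N. u n \<le> v n + \<epsilon> * real n"
  shows "up v \<gamma>"
proof -
  obtain \<delta> where \<delta>: "0 < \<delta>" "\<And>N. \<exists>n\<ge>N. u n > (\<gamma> + \<delta>) * real n" using assms(1) by (rule upE) blast
  obtain N0 where N0: "\<forall>n\<ge>N0. u n \<le> v n + (\<delta> / 2) * real n" using le[of "\<delta>/2"] \<delta>(1) by auto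
  show ?thesis
  proof (rule upI[of "\<delta>/2"])
    fix N
    obtain n where n: "n \<ge> max N N0" "u n > (\<gamma> + \<delta>) * real n" using \<delta>(2) by blast
    have "(\<gamma> + \<delta> / 2) * real n = (\<gamma> + \<delta>) * real n - (\<delta> / 2) * real n" by (simp add: field_simps)
    also have "\<dots> < v n" using N0 n by force
    finally show "\<exists>n\<ge>N. v n > (\<gamma> + \<delta> / 2) * real n" using n(1) by auto
  qed (use \<delta> in auto)
qed

lemma up_add_const:
  assumes "up u \<gamma>" "\<And>n. u n \<le> v n + K"
  shows "up v \<gamma>"
proof (rule up_perturb[OF assms(1)])
  fix \<epsilon> :: real assume "0 < \<epsilon>"
  obtain N where N: "real N > K / \<epsilon>" using reals_Archimedean2 by blast
  have "u n \<le> v n + \<epsilon> * real n" if "n \<ge> N" for n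
  proof -
    have "K < \<epsilon> * real N" using N \<open>0 < \<epsilon>\<close> by (simp add: field_simps)
    also have "\<dots> \<le> \<epsilon> * real n" using that \<open>0 < \<epsilon>\<close> by simp
    finally show ?thesis using assms(2)[of n] by linarith
  qed
  then show "\<exists>N. \<forall>n\<ge>N. u n \<le> v n + \<epsilon> * real n" by blast
qed

lemma up_Suc: "up (\<lambda>n. u (Suc n)) \<gamma> \<longleftrightarrow> up u \<gamma>"
proof
  assume "up (\<lambda>n. u (Suc n)) \<gamma>"
  then obtain \<delta> where \<delta>: "0 < \<delta>" "\<And>N. \<exists>n\<ge>N. u (Suc n) > (\<gamma> + \<delta>) * real n" by (rule upE) blast
  \<comment> \<open>Chosen so that \<open>\<bar>\<gamma>\<bar> + \<delta>\<close> is below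
    \<open>\<delta> / 2 * n\<close> for n at least \<open>N0\<close>: half of the margin pays for
    the index shift.\<close>
  obtain N0 where N0: "real N0 > 2 * (\<bar>\<gamma>\<bar> + \<delta>) / \<delta>" using reals_Archimedean2 by blast
  show "up u \<gamma>"
  proof (rule upI[of "\<delta>/2"])
    fix N
    obtain n where n: "n \<ge> max N N0" "u (Suc n) > (\<gamma> + \<delta>) * real n" using \<delta>(2) by blast
    have "2 * (\<bar>\<gamma>\<bar> + \<delta>) < \<delta> * real N0" using N0 \<delta>(1) by (simp add: field_simps)
    also have "\<dots> \<le> \<delta> * real n" using n(1) \<delta>(1) by simp
    finally have "(\<gamma> + \<delta> / 2) * real (Suc n) \<le> (\<gamma> + \<delta>) * real n"
      using abs_ge_self[of \<gamma>] \<delta>(1) by (simp add: field_simps)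
    then show "\<exists>n\<ge>N. u n > (\<gamma> + \<delta> / 2) * real n" using n by (intro exI[of _ "Suc n"]) auto
  qed (use \<delta> in auto)
next
  assume "up u \<gamma>"
  then obtain \<delta> where \<delta>: "0 < \<delta>" "\<And>N. \<exists>n\<ge>N. u n > (\<gamma> + \<delta>) * real n" by (rule upE) blast
  obtain N0 where N0: "real N0 > 2 * (\<bar>\<gamma>\<bar> + \<delta>) / \<delta>" using reals_Archimedean2 by blast
  show "up (\<lambda>n. u (Suc n)) \<gamma>"
  proof (rule upI[of "\<delta>/2"])
    fix N
    obtain n where n: "n \<ge> Suc (max N N0)" "u n > (\<gamma> + \<delta>) * real n" using \<delta>(2) by blast
    then obtain k where k: "n = Suc k" "k \<ge> max N N0" by (cases n) auto
    have "2 * (\<bar>\<gamma>\<bar> + \<delta>) < \<delta> * real N0" using N0 \<delta>(1) by (simp add: field_simps)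
    also have "\<dots> \<le> \<delta> * real k" using k(2) \<delta>(1) by simp
    finally have "(\<gamma> + \<delta> / 2) * real k \<le> (\<gamma> + \<delta>) * real (Suc k)"
      using \<delta>(1) by (simp add: algebra_simps)
    then show "\<exists>n\<ge>N. u (Suc n) > (\<gamma> + \<delta> / 2) * real n" using n k by (intro exI[of _ k]) auto
  qed (use \<delta> in auto)
qed

lemma measurable_up [measurable]:
  assumes [measurable]: "\<And>n. u n \<in> borel_measurable M"
  shows "Measurable.pred M (\<lambda>x. up (\<lambda>n. u n x) \<gamma>)"
  unfolding up_def by measurable

text \<open>Cesaro averaging: K absorbs the finitely many terms that are not yet below
  \<epsilon>.\<close>

lemma sum_le_eventually_small:
  fixes r :: "nat \<Rightarrow> real"
  assumes "r \<longlonglongrightarrow> 0" "0 < \<epsilon>"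
  shows "\<exists>K. \<forall>n. (\<Sum>j<n. r j) \<le> K + \<epsilon> * real n"
proof -
  obtain N where N: "\<And>n. n \<ge> N \<Longrightarrow> r n < \<epsilon>"
    using order_tendstoD(2)[OF assms] by (auto simp: eventually_sequentially)
  have "(\<Sum>j<n. r j) \<le> (\<Sum>j<N. \<bar>r j\<bar>) + \<epsilon> * real n" for n
  proof (induction n)
    case 0 show ?case by (simp add: sum_nonneg)
  next
    case (Suc n)
    show ?case
    proof (cases "n < N")
      case True
      have "(\<Sum>j<Suc n. r j) \<le> (\<Sum>j<Suc n. \<bar>r j\<bar>)" by (intro sum_mono) auto
      also have "\<dots> \<le> (\<Sum>j<N. \<bar>r j\<bar>)" using True by (intro sum_mono2) auto
      finally show ?thesis using assms(2) by (smt (verit) mult_nonneg_nonneg of_nat_0_le_iff)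
    next
      case False
      then show ?thesis using N[of n] Suc by (simp add: algebra_simps)
    qed
  qed
  then show ?thesis by blast
qed

text \<open>The iterates are given as a family with \<open>\<theta>_add\<close> instead of powers of
  one map, so that the flow sampled at integers and run forwards or backwards is an instance as it
  stands.\<close>

locale semiflow = prob_space M for M :: "'x measure" +
  fixes \<theta> :: "nat \<Rightarrow> 'x \<Rightarrow> 'x"
  assumes meas_\<theta> [measurable]: "\<theta> n \<in> M \<rightarrow>\<^sub>M M"
    and distr_\<theta>: "distr M M (\<theta> n) = M"
    and \<theta>_0: "x \<in> space M \<Longrightarrow> \<theta> 0 x = x"
    and \<theta>_add: "x \<in> space M \<Longrightarrow> \<theta> (n + m) x = \<theta> m (\<theta> n x)"
begin

lemma \<theta>_space [simp]: "x \<in> space M \<Longrightarrow> \<theta> n x \<in> space M"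
  using measurable_space[OF meas_\<theta>] by blast

lemma \<theta>_Suc: "x \<in> space M \<Longrightarrow> \<theta> (Suc n) x = \<theta> n (\<theta> 1 x)"
  using \<theta>_add[of x 1 n] by simp

lemma integral_\<theta>:
  fixes f :: "'x \<Rightarrow> real"
  assumes "f \<in> borel_measurable M"
  shows "(\<integral>x. f (\<theta> n x) \<partial>M) = (\<integral>x. f x \<partial>M)"
  using integral_distr[OF meas_\<theta>[of n], of f] assms distr_\<theta> by simp

lemma integrable_\<theta>:
  fixes f :: "'x \<Rightarrow> real"
  assumes "integrable M f"
  shows "integrable M (\<lambda>x. f (\<theta> n x))"
  using integrable_distr[OF meas_\<theta>[of n], of f] assms distr_\<theta> by simp

text \<open>Invariance is required at every point, not just modulo null sets. The sets used later
  are given by growth conditions along orbits, which are invariant in this strict sense, and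
  iterating then produces no exceptional points.\<close>

definition inv_set :: "'x set \<Rightarrow> bool" where
  "inv_set B \<longleftrightarrow> B \<in> sets M \<and> (\<forall>x\<in>space M. \<theta> 1 x \<in> B \<longleftrightarrow> x \<in> B)"

lemma inv_set_space: "inv_set B \<Longrightarrow> x \<in> B \<Longrightarrow> x \<in> space M"
  using sets.sets_into_space by (force simp: inv_set_def)

lemma inv_setD:
  assumes "inv_set B" "x \<in> space M"
  shows "\<theta> n x \<in> B \<longleftrightarrow> x \<in> B"
  using assms(2)
proof (induction n arbitrary: x)
  case 0 then show ?case by (simp add: \<theta>_0)
next
  case (Suc n)
  have "\<theta> 1 x \<in> space M" using Suc.prems by simp
  then have "\<theta> n (\<theta> 1 x) \<in> B \<longleftrightarrow> \<theta> 1 x \<in> B" by (rule Suc.IH)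
  then show ?case using assms(1) Suc.prems unfolding \<theta>_Suc[OF Suc.prems] inv_set_def by blast
qed

lemma integral_inv_set:
  fixes f :: "'x \<Rightarrow> real"
  assumes B: "inv_set B" and f: "f \<in> borel_measurable M"
  shows "(\<integral>x. indicator B x * f (\<theta> n x) \<partial>M) = (\<integral>x. indicator B x * f x \<partial>M)"
proof -
  have [measurable]: "B \<in> sets M" "f \<in> borel_measurable M" using B f by (auto simp: inv_set_def)
  have "(\<integral>x. indicator B x * f (\<theta> n x) \<partial>M) = (\<integral>x. indicator B (\<theta> n x) * f (\<theta> n x) \<partial>M)"
    by (intro Bochner_Integration.integral_cong refl) (simp add: indicator_def inv_setD[OF B])
  also have "\<dots> = (\<integral>x. indicator B x * f x \<partial>M)"
    by (rule integral_\<theta>[of "\<lambda>x. indicator B x * f x"]) measurable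
  finally show ?thesis .
qed

lemma integrable_ind: 
  fixes f :: "'x \<Rightarrow> real"
  shows "B \<in> sets M \<Longrightarrow> integrable M f \<Longrightarrow> integrable M (\<lambda>x. indicator B x * f x)"
  using integrable_real_mult_indicator[of B M f] by (simp add: mult.commute)

definition bsum :: "('x \<Rightarrow> real) \<Rightarrow> nat \<Rightarrow> 'x \<Rightarrow> real" where
  "bsum f n x = (\<Sum>i<n. f (\<theta> i x))"

lemma bsum_0 [simp]: "bsum f 0 x = 0" by (simp add: bsum_def)

lemma bsum_Suc: "bsum f (Suc n) x = bsum f n x + f (\<theta> n x)" by (simp add: bsum_def)

lemma bsum_Suc_left: "x \<in> space M \<Longrightarrow> bsum f (Suc n) x = f x + bsum f n (\<theta> 1 x)"
  unfolding bsum_def sum.lessThan_Suc_shift by (simp only: \<theta>_0 \<theta>_Suc)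

lemma measurable_bsum [measurable]:
  assumes [measurable]: "f \<in> borel_measurable M"
  shows "bsum f n \<in> borel_measurable M"
  unfolding bsum_def[abs_def] by measurable

lemma bsum_nonneg: "(\<And>x. x \<in> space M \<Longrightarrow> 0 \<le> f x) \<Longrightarrow> x \<in> space M \<Longrightarrow> 0 \<le> bsum f n x"
  by (simp add: bsum_def sum_nonneg)

lemma integrable_bsum: "integrable M f \<Longrightarrow> integrable M (bsum f n)"
  unfolding bsum_def[abs_def] by (rule Bochner_Integration.integrable_sum) (rule integrable_\<theta>)

lemma integral_bsum: 
  assumes "integrable M f" shows "(\<integral>x. bsum f n x \<partial>M) = real n * (\<integral>x. f x \<partial>M)"
proof -
  have "(\<integral>x. bsum f n x \<partial>M) = (\<Sum>i<n. \<integral>x. f (\<theta> i x) \<partial>M)"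
    unfolding bsum_def by (intro Bochner_Integration.integral_sum integrable_\<theta> assms)
  also have "\<dots> = (\<Sum>i<n. \<integral>x. f x \<partial>M)"
    by (simp add: integral_\<theta> borel_measurable_integrable[OF assms])
  finally show ?thesis by simp
qed

text \<open>The maximum of the Birkhoff sums of length at most N, the empty sum included. Peeling
  off the first point of the orbit is the identity on which Garsia's proof of the maximal ergodic
  theorem rests.\<close>

primrec mx :: "('x \<Rightarrow> real) \<Rightarrow> nat \<Rightarrow> 'x \<Rightarrow> real" where
  "mx f 0 = (\<lambda>x. 0)"
| "mx f (Suc N) = (\<lambda>x. max 0 (f x + mx f N (\<theta> 1 x)))"

lemma mx_nonneg: "0 \<le> mx f N x" by (cases N) auto

lemma integrable_mx: "integrable M f \<Longrightarrow> integrable M (mx f N)"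
proof (induction N)
  case (Suc N)
  then show ?case
    using integrable_\<theta>[of "mx f N" 1] by (auto intro!: Bochner_Integration.integrable_max)
qed auto

lemma mx_mono: "mx f N x \<le> mx f (Suc N) x"
proof (induction N arbitrary: x)
  case (Suc N)
  show ?case using Suc[of "\<theta> 1 x"] by auto
qed auto

lemma bsum_le_mx: "x \<in> space M \<Longrightarrow> n \<le> N \<Longrightarrow> bsum f n x \<le> mx f N x"
proof (induction N arbitrary: n x)
  case (Suc N)
  show ?case
  proof (cases n)
    case 0 then show ?thesis by (simp add: mx_nonneg)
  next
    case (Suc k)
    then show ?thesis using Suc.IH[of "\<theta> 1 x" k] Suc.prems by (simp add: bsum_Suc_left)
  qed
qed auto

text \<open>Garsia's argument. Where the running maximum \<open>?m\<close> is positive, f dominates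
  \<open>?m\<close> minus its shift; elsewhere that difference is at most 0. The difference
  integrates to 0 over an invariant set, so f has nonnegative integral over the part of B where the
  maximum is positive. As N grows, these parts exhaust B up to a null set.\<close>

lemma maximal_ergodic_pos:
  assumes f: "integrable M f" and B: "inv_set B"
    and ae: "AE x in M. x \<in> B \<longrightarrow> (\<exists>n. bsum f n x > 0)"
  shows "0 \<le> (\<integral>x. indicator B x * f x \<partial>M)"
proof -
  have [measurable]: "B \<in> sets M" "f \<in> borel_measurable M" "\<And>N. mx f N \<in> borel_measurable M"
    using B f integrable_mx[OF f] by (auto simp: inv_set_def)
  define g where "g N x = indicator {x. mx f N x > 0} x * (indicator B x * f x)" for N x
  have lim: "(\<lambda>N. \<integral>x. g N x \<partial>M) \<longlonglongrightarrow> (\<integral>x. indicator B x * f x \<partial>M)"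
  proof (rule integral_dominated_convergence[where w = "\<lambda>x. \<bar>f x\<bar>"])
    show "AE x in M. (\<lambda>N. g N x) \<longlonglongrightarrow> indicator B x * f x"
      using ae AE_space
    proof eventually_elim
      case (elim x)
      show ?case
      proof (cases "x \<in> B")
        case True
        then obtain n where n: "bsum f n x > 0" using elim by auto
        have "g N x = indicator B x * f x" if "N \<ge> n" for N
          using bsum_le_mx[of x n N f] elim n that by (simp add: g_def)
        then have "eventually (\<lambda>N. g N x = indicator B x * f x) sequentially"
          by (auto simp: eventually_sequentially)
        then show ?thesis by (rule tendsto_eventually)
      qed (simp add: g_def)
    qed
    show "AE x in M. norm (g N x) \<le> \<bar>f x\<bar>" for N by (auto simp: g_def indicator_def)
  qed (use f in \<open>auto simp: g_def\<close>)
  have int_g: "integrable M (g N)" for N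
    unfolding g_def by (rule Bochner_Integration.integrable_bound[OF f]) (auto simp: indicator_def)
  have "0 \<le> (\<integral>x. g N x \<partial>M)" for N
  proof (cases N)
    case 0 then show ?thesis by (simp add: g_def)
  next
    case (Suc K)
    let ?m = "mx f (Suc K)"
    have i1: "integrable M (\<lambda>x. indicator B x * ?m x)" "integrable M (\<lambda>x. indicator B x * ?m (\<theta> 1 x))"
      using integrable_mx[OF f, of "Suc K"] integrable_\<theta>[OF integrable_mx[OF f], of "Suc K" 1]
      by (auto intro!: integrable_ind simp del: mx.simps)
    have "0 = (\<integral>x. indicator B x * ?m x \<partial>M) - (\<integral>x. indicator B x * ?m (\<theta> 1 x) \<partial>M)"
      using integral_inv_set[OF B, of ?m 1] by (simp del: mx.simps)
    also have "\<dots> = (\<integral>x. indicator B x * ?m x - indicator B x * ?m (\<theta> 1 x) \<partial>M)"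
      using i1 by (intro Bochner_Integration.integral_diff[symmetric])
    also have "\<dots> \<le> (\<integral>x. g N x \<partial>M)"
    proof (rule integral_mono)
      show "integrable M (\<lambda>x. indicator B x * ?m x - indicator B x * ?m (\<theta> 1 x))" using i1 by auto
      fix x
      show "indicator B x * ?m x - indicator B x * ?m (\<theta> 1 x) \<le> g N x"
      proof (cases "?m x > 0")
        case True
        then have "?m x = f x + mx f K (\<theta> 1 x)" by auto
        then have "?m x - ?m (\<theta> 1 x) \<le> f x" using mx_mono[of f K "\<theta> 1 x"] by linarith
        then show ?thesis using True Suc by (simp add: g_def indicator_def del: mx.simps)
      next
        case False
        then have "?m x = 0" using mx_nonneg[of f "Suc K" x] by linarith
        then show ?thesis using mx_nonneg[of f "Suc K" "\<theta> 1 x"] False Suc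
          by (simp add: g_def indicator_def del: mx.simps)
      qed
    qed (rule int_g)
    finally show ?thesis .
  qed
  then show ?thesis by (intro LIMSEQ_le_const[OF lim]) auto
qed

text \<open>The previous lemma for \<open>f x - \<alpha>\<close>. An n as in the hypothesis is
  automatically positive, because the inequality is strict.\<close>

lemma maximal_ergodic:
  assumes f: "integrable M f" and B: "inv_set B"
    and ae: "AE x in M. x \<in> B \<longrightarrow> (\<exists>n. bsum f n x > \<alpha> * real n)"
  shows "\<alpha> * measure M B \<le> (\<integral>x. indicator B x * f x \<partial>M)"
proof -
  have [measurable]: "B \<in> sets M" using B by (simp add: inv_set_def)
  have b: "bsum (\<lambda>x. f x - \<alpha>) n x = bsum f n x - \<alpha> * real n" for n x
    by (simp add: bsum_def sum_subtractf)
  have "0 \<le> (\<integral>x. indicator B x * (f x - \<alpha>) \<partial>M)"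
    using ae by (intro maximal_ergodic_pos B) (use f b in auto)
  also have "\<dots> = (\<integral>x. indicator B x * f x - \<alpha> * indicator B x \<partial>M)"
    by (intro Bochner_Integration.integral_cong) (auto simp: algebra_simps)
  also have "\<dots> = (\<integral>x. indicator B x * f x \<partial>M) - \<alpha> * measure M B"
    by (subst Bochner_Integration.integral_diff)
       (auto intro: integrable_ind f integrable_real_indicator simp: less_top[symmetric])
  finally show ?thesis by simp
qed

text \<open>The function f is not assumed integrable, so two equal integrals cannot simply be
  cancelled. Truncating f at height N does not enlarge its increments; hence h dominates the
  increments of all truncations, and for each truncation invariance of the measure gives 0.\<close>

lemma integral_coboundary:
  fixes f h :: "'x \<Rightarrow> real"
  assumes [measurable]: "f \<in> borel_measurable M" and h: "integrable M h"
    and le: "\<And>x. x \<in> space M \<Longrightarrow> \<bar>f (\<theta> 1 x) - f x\<bar> \<le> h x" and B: "inv_set B"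
  shows "(\<integral>x. indicator B x * (f (\<theta> 1 x) - f x) \<partial>M) = 0"
proof -
  have [measurable]: "B \<in> sets M" "h \<in> borel_measurable M" using B h by (auto simp: inv_set_def)
  define c where "c N x = max (- real N) (min (real N) (f x))" for N x
  have [measurable]: "c N \<in> borel_measurable M" for N unfolding c_def[abs_def] by measurable
  have ic: "integrable M (c N)" for N
    by (rule integrable_const_bound[of _ "real N"]) (auto simp: c_def)
  have "(\<lambda>N. \<integral>x. indicator B x * (c N (\<theta> 1 x) - c N x) \<partial>M) \<longlonglongrightarrow> (\<integral>x. indicator B x * (f (\<theta> 1 x) - f x) \<partial>M)"
  proof (rule integral_dominated_convergence[where w = h])
    have cl: "(\<lambda>N. c N x) \<longlonglongrightarrow> f x" for x
    proof -
      obtain n where n: "real n > \<bar>f x\<bar>" using reals_Archimedean2 by blast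
      have "c N x = f x" if "N \<ge> n" for N
      proof -
        have "real n \<le> real N" using that by simp
        then show ?thesis using n by (auto simp: c_def)
      qed
      then show ?thesis by (intro tendsto_eventually) (auto simp: eventually_sequentially)
    qed
    show "AE x in M. (\<lambda>N. indicator B x * (c N (\<theta> 1 x) - c N x)) \<longlonglongrightarrow> indicator B x * (f (\<theta> 1 x) - f x)"
      by (intro AE_I2 tendsto_intros cl)
    show "AE x in M. norm (indicator B x * (c N (\<theta> 1 x) - c N x)) \<le> h x" for N
    proof (rule AE_I2)
      fix x assume x: "x \<in> space M"
      have "\<bar>c N (\<theta> 1 x) - c N x\<bar> \<le> \<bar>f (\<theta> 1 x) - f x\<bar>" by (auto simp: c_def)
      then show "norm (indicator B x * (c N (\<theta> 1 x) - c N x)) \<le> h x"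
        using le[OF x] by (auto simp: indicator_def)
    qed
  qed (use h in auto)
  moreover have "(\<integral>x. indicator B x * (c N (\<theta> 1 x) - c N x) \<partial>M) = 0" for N
  proof -
    have "(\<integral>x. indicator B x * (c N (\<theta> 1 x) - c N x) \<partial>M) 
      = (\<integral>x. indicator B x * c N (\<theta> 1 x) - indicator B x * c N x \<partial>M)"
      by (simp add: algebra_simps)
    also have "\<dots> = (\<integral>x. indicator B x * c N (\<theta> 1 x) \<partial>M) - (\<integral>x. indicator B x * c N x \<partial>M)"
      by (intro Bochner_Integration.integral_diff integrable_ind integrable_\<theta> ic) auto
    finally show ?thesis using integral_inv_set[OF B, of "c N" 1] by simp
  qed
  ultimately show ?thesis by (simp add: LIMSEQ_const_iff)
qed

text \<open>The increment of f has the Birkhoff sums \<open>f (\<theta> n x) - f x\<close>. On the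
  invariant set where f grows along the orbit at a rate above \<open>1 / real (Suc j)\<close>, the
  maximal ergodic theorem bounds the integral of the increment below by that multiple of the
  measure; but a coboundary integrates to 0.\<close>

lemma not_up_tempered:
  fixes f h :: "'x \<Rightarrow> real"
  assumes [measurable]: "f \<in> borel_measurable M" and h: "integrable M h"
    and le: "\<And>x. x \<in> space M \<Longrightarrow> \<bar>f (\<theta> 1 x) - f x\<bar> \<le> h x"
  shows "AE x in M. \<not> up (\<lambda>n. f (\<theta> n x)) 0"
proof -
  have "AE x in M. \<not> up (\<lambda>n. f (\<theta> n x)) (1 / real (Suc j))" for j
  proof -
    define B where "B = {x \<in> space M. up (\<lambda>n. f (\<theta> n x)) (1 / real (Suc j))}"
    have Bm [measurable]: "B \<in> sets M" unfolding B_def by measurable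
    have B: "inv_set B" unfolding inv_set_def
    proof (intro conjI Bm ballI)
      fix x assume x: "x \<in> space M"
      have "(\<lambda>n. f (\<theta> n (\<theta> 1 x))) = (\<lambda>n. f (\<theta> (Suc n) x))" by (simp only: \<theta>_Suc[OF x])
      then show "(\<theta> 1 x \<in> B) = (x \<in> B)"
        using x up_Suc[of "\<lambda>n. f (\<theta> n x)"] by (simp add: B_def)
    qed
    let ?d = "\<lambda>x. f (\<theta> 1 x) - f x"
    have d: "integrable M ?d"
    proof (rule Bochner_Integration.integrable_bound[OF h])
      show "AE x in M. norm (f (\<theta> 1 x) - f x) \<le> norm (h x)"
      proof (rule AE_I2)
        fix x assume "x \<in> space M"
        then show "norm (f (\<theta> 1 x) - f x) \<le> norm (h x)" using le[of x] by simp
      qed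
    qed measurable
    have bs: "bsum ?d n x = f (\<theta> n x) - f x" if "x \<in> space M" for n x
    proof (induction n)
      case (Suc n)
      have "\<theta> 1 (\<theta> n x) = \<theta> (Suc n) x" using \<theta>_add[OF that, of n 1] by simp
      then show ?case using Suc by (simp add: bsum_Suc)
    qed (simp add: \<theta>_0 that)
    have "(1 / real (Suc j)) * measure M B \<le> (\<integral>x. indicator B x * ?d x \<partial>M)"
    proof (rule maximal_ergodic[OF d B])
      show "AE x in M. x \<in> B \<longrightarrow> (\<exists>n. 1 / real (Suc j) * real n < bsum ?d n x)"
      proof (intro AE_I2 impI)
        fix x assume x: "x \<in> space M" "x \<in> B"
        then have "up (\<lambda>n. f (\<theta> n x)) (1 / real (Suc j))" by (simp add: B_def)
        then have "up (\<lambda>n. bsum ?d n x) (1 / real (Suc j))"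
          by (rule up_add_const[where K = "f x"]) (simp add: bs[OF x(1)] del: One_nat_def)
        then show "\<exists>n. 1 / real (Suc j) * real n < bsum ?d n x"
          using up_frequently by blast
      qed
    qed
    also have "\<dots> = 0" by (rule integral_coboundary[OF _ h le B]) auto
    finally have "measure M B \<le> 0" 
      using mult_le_cancel_left_pos[of "1 / real (Suc j)" "measure M B" 0] by simp
    then have "B \<in> null_sets M" using Bm measure_nonneg[of M B]
      by (auto simp: null_sets_def emeasure_eq_measure)
    then have "AE x in M. x \<notin> B" by (rule AE_not_in)
    then show ?thesis using AE_space by eventually_elim (auto simp: B_def)
  qed
  then have "AE x in M. \<forall>j. \<not> up (\<lambda>n. f (\<theta> n x)) (1 / real (Suc j))" by (simp add: AE_all_countable)
  then show ?thesis by eventually_elim (use up_gap[of _ 0] in auto)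
qed

lemma tempered:
  fixes f h :: "'x \<Rightarrow> real"
  assumes [measurable]: "f \<in> borel_measurable M" and h: "integrable M h"
    and le: "\<And>x. x \<in> space M \<Longrightarrow> \<bar>f (\<theta> 1 x) - f x\<bar> \<le> h x"
  shows "AE x in M. \<forall>\<epsilon>>0. \<exists>K. \<forall>n. f (\<theta> n x) \<le> K + \<epsilon> * real n"
proof -
  have "AE x in M. \<not> up (\<lambda>n. f (\<theta> n x)) 0"
    using assms by (intro not_up_tempered[where h = h]) auto
  then show ?thesis
  proof eventually_elim
  case (elim x)
  show ?case
  proof (intro allI impI)
    fix \<epsilon> :: real assume "0 < \<epsilon>"
    then obtain N where N: "\<And>n. n \<ge> N \<Longrightarrow> f (\<theta> n x) \<le> \<epsilon> * real n"
      using elim by (auto simp: not_up_iff)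
    define K where "K = (\<Sum>n<N. \<bar>f (\<theta> n x)\<bar>)"
    have "f (\<theta> n x) \<le> K + \<epsilon> * real n" for n
    proof (cases "n \<ge> N")
      case True
      then show ?thesis using N[of n] by (simp add: K_def add_increasing sum_nonneg)
    next
      case False
      then have "\<bar>f (\<theta> n x)\<bar> \<le> K" unfolding K_def by (intro member_le_sum) auto
      then show ?thesis using \<open>0 < \<epsilon>\<close> by (smt (verit) mult_nonneg_nonneg of_nat_0_le_iff)
    qed
    then show "\<exists>K. \<forall>n. f (\<theta> n x) \<le> K + \<epsilon> * real n" by blast
  qed
qed
qed

lemma tempered_integrable:
  assumes f: "integrable M f"
  shows "AE x in M. \<forall>\<epsilon>>0. \<exists>K. \<forall>n. f (\<theta> n x) \<le> K + \<epsilon> * real n"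
proof (rule tempered)
  show "f \<in> borel_measurable M" using f by (rule borel_measurable_integrable)
  show "integrable M (\<lambda>x. \<bar>f (\<theta> 1 x)\<bar> + \<bar>f x\<bar>)" using f integrable_\<theta>[OF f, of 1] by auto
  show "\<bar>f (\<theta> 1 x) - f x\<bar> \<le> \<bar>f (\<theta> 1 x)\<bar> + \<bar>f x\<bar>" for x by (rule abs_triangle_ineq4)
qed

end

section \<open>Subadditive sequences over a measure-preserving map\<close>

lemma up_shift: "up (\<lambda>n. u (n + p)) \<gamma> \<longleftrightarrow> up u \<gamma>"
proof (induction p)
  case (Suc p)
  show ?case using up_Suc[of "\<lambda>n. u (n + p)" \<gamma>] Suc by simp
qed simp

lemma up_scale:
  assumes "up u \<gamma>" "0 < c"
  shows "up (\<lambda>n. c * u n) (c * \<gamma>)"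
proof -
  obtain \<delta> where \<delta>: "0 < \<delta>" "\<And>N. \<exists>n\<ge>N. u n > (\<gamma> + \<delta>) * real n" using assms(1) by (rule upE) blast
  show ?thesis
  proof (rule upI[of "c * \<delta>"])
    fix N
    obtain n where n: "n \<ge> N" "u n > (\<gamma> + \<delta>) * real n" using \<delta>(2) by blast
    have "c * ((\<gamma> + \<delta>) * real n) < c * u n" using n(2) assms(2) by simp
    then show "\<exists>n\<ge>N. c * u n > (c * \<gamma> + c * \<delta>) * real n"
      using n(1) by (intro exI[of _ n]) (simp add: algebra_simps)
  qed (use \<delta> assms in auto)
qed

lemma le_of_linear_bound:
  fixes d :: real
  assumes "\<And>\<epsilon>. 0 < \<epsilon> \<Longrightarrow> \<exists>K. \<forall>n::nat. real n * d \<le> K + \<epsilon> * real n"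
  shows "d \<le> 0"
proof (rule ccontr)
  assume "\<not> d \<le> 0"
  then obtain K where K: "\<And>n::nat. real n * d \<le> K + d / 2 * real n" using assms[of "d/2"] by auto
  obtain n :: nat where "real n > 2 * K / d" using reals_Archimedean2 by blast
  with \<open>\<not> d \<le> 0\<close> have "real n * d > 2 * K" by (simp add: field_simps)
  with K[of n] show False by (simp add: field_simps)
qed

context semiflow
begin

lemma bsum_add: "x \<in> space M \<Longrightarrow> bsum f (n + m) x = bsum f n x + bsum f m (\<theta> n x)"
proof (induction m)
  case (Suc m)
  then show ?case using \<theta>_add[of x n m] by (simp add: bsum_Suc)
qed simp

text \<open>Domination by the Birkhoff sums of \<phi> makes every \<open>a n\<close> integrable over
  B. The last clause complements subadditivity: together they say that passing from x to
  \<open>\<theta> 1 x\<close> changes the sequence, up to an index shift, by an amount independent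
  of n, so that the sets \<open>{x \<in> B. up (\<lambda>n. a n x) \<gamma>}\<close> are
  invariant.\<close>

definition subadd :: "'x set \<Rightarrow> (nat \<Rightarrow> 'x \<Rightarrow> real) \<Rightarrow> ('x \<Rightarrow> real) \<Rightarrow> bool" where
  "subadd B a \<phi> \<longleftrightarrow> inv_set B \<and> integrable M \<phi> \<and> (\<forall>x\<in>space M. 0 \<le> \<phi> x) \<and>
     (\<forall>n. a n \<in> borel_measurable M) \<and>
     (\<forall>x\<in>B. \<forall>n m. a (n + m) x \<le> a n x + a m (\<theta> n x)) \<and>
     (\<forall>x\<in>B. \<forall>n. \<bar>a n x\<bar> \<le> bsum \<phi> n x) \<and>
     (\<forall>x\<in>B. \<forall>n. a n (\<theta> 1 x) \<le> \<phi> x + a (Suc n) x)"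

lemma subadd_subset:
  "subadd B a \<phi> \<Longrightarrow> inv_set B' \<Longrightarrow> B' \<subseteq> B \<Longrightarrow> subadd B' a \<phi>"
  by (auto simp: subadd_def)

lemma inv_set_up:
  assumes sa: "subadd B a \<phi>"
  shows "inv_set {x \<in> B. up (\<lambda>n. a n x) \<gamma>}"
proof -
  have [measurable]: "B \<in> sets M" "\<And>n. a n \<in> borel_measurable M" and B: "inv_set B"
    using sa by (auto simp: subadd_def inv_set_def)
  have "{x \<in> B. up (\<lambda>n. a n x) \<gamma>} = B \<inter> {x \<in> space M. up (\<lambda>n. a n x) \<gamma>}"
    using inv_set_space[OF B] by auto
  also have "\<dots> \<in> sets M" by measurable
  finally have m: "{x \<in> B. up (\<lambda>n. a n x) \<gamma>} \<in> sets M" .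
  have "up (\<lambda>n. a n (\<theta> 1 x)) \<gamma> \<longleftrightarrow> up (\<lambda>n. a n x) \<gamma>" if x: "x \<in> B" for x
  proof
    assume "up (\<lambda>n. a n (\<theta> 1 x)) \<gamma>"
    then have "up (\<lambda>n. a (Suc n) x) \<gamma>"
    proof (rule up_add_const)
      show "a n (\<theta> 1 x) \<le> a (Suc n) x + \<phi> x" for n
        using sa x by (simp add: subadd_def add.commute)
    qed
    then show "up (\<lambda>n. a n x) \<gamma>" by (simp only: up_Suc[of "\<lambda>n. a n x"])
  next
    assume "up (\<lambda>n. a n x) \<gamma>"
    then have "up (\<lambda>n. a (Suc n) x) \<gamma>" by (simp only: up_Suc[of "\<lambda>n. a n x"])
    then show "up (\<lambda>n. a n (\<theta> 1 x)) \<gamma>"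
    proof (rule up_add_const)
      have "a (1 + n) x \<le> a 1 x + a n (\<theta> 1 x)" for n
        using sa x unfolding subadd_def by blast
      then show "a (Suc n) x \<le> a n (\<theta> 1 x) + a 1 x" for n by (simp add: add.commute)
    qed
  qed
  then show ?thesis
    using m inv_setD[OF B, of _ 1] unfolding inv_set_def by blast
qed

text \<open>Moving a window of p consecutive indices one step to the right replaces
  \<open>a N x\<close> by \<open>a (N + p) x\<close>, at the price of one term
  \<open>a p (\<theta> N x)\<close>. Working with whole windows avoids division by p with
  remainder.\<close>

lemma subadd_sum_le:
  assumes sa: "subadd B a \<phi>" and x: "x \<in> B"
  shows "(\<Sum>j<p. a (N + j) x) \<le> (\<Sum>j<p. a j x) + bsum (a p) N x"
proof (induction N)
  case (Suc N)
  have "(\<Sum>j<p. a (Suc N + j) x) + a N x = (\<Sum>j<Suc p. a (N + j) x)"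
    by (subst sum.lessThan_Suc_shift) (simp add: add.commute)
  then have "(\<Sum>j<p. a (Suc N + j) x) = (\<Sum>j<p. a (N + j) x) + a (N + p) x - a N x" by simp
  also have "\<dots> \<le> (\<Sum>j<p. a (N + j) x) + a p (\<theta> N x)"
    using sa x by (simp add: subadd_def) (smt (verit))
  finally show ?case using Suc by (simp add: bsum_Suc)
qed simp

text \<open>The defect is a Birkhoff sum of fixed length p read at time N, which is sublinear in N
  almost everywhere.\<close>

lemma subadd_step_le:
  assumes sa: "subadd B a \<phi>" and x: "x \<in> B" and j: "j < p"
  shows "a (N + p) x \<le> a (N + j) x + bsum \<phi> p (\<theta> N x)"
proof -
  have B: "inv_set B" and \<phi>: "\<And>y. y \<in> space M \<Longrightarrow> 0 \<le> \<phi> y" using sa by (auto simp: subadd_def)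
  have xs: "x \<in> space M" using inv_set_space[OF B x] .
  have y: "\<theta> (N + j) x \<in> B" using inv_setD[OF B xs] x by simp
  have "a ((N + j) + (p - j)) x \<le> a (N + j) x + a (p - j) (\<theta> (N + j) x)"
    using sa x unfolding subadd_def by blast
  moreover have "a (p - j) (\<theta> (N + j) x) \<le> bsum \<phi> (p - j) (\<theta> (N + j) x)"
    using sa y unfolding subadd_def by (meson abs_le_D1)
  moreover have "bsum \<phi> p (\<theta> N x) = bsum \<phi> j (\<theta> N x) + bsum \<phi> (p - j) (\<theta> (N + j) x)"
    using bsum_add[of "\<theta> N x" \<phi> j "p - j"] j xs \<theta>_add[OF xs, of N j] by simp
  moreover have "0 \<le> bsum \<phi> j (\<theta> N x)" using \<phi> xs by (intro bsum_nonneg) auto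
  ultimately show ?thesis using j by simp
qed

text \<open>One half of Kingman's theorem, for upper limits. Averaging over a window bounds
  \<open>p * a (N + p) x\<close> by the Birkhoff sum of \<open>a p\<close> and a sublinear error.
  Hence these Birkhoff sums exceed the rate \<open>p * \<gamma>\<close>, and the maximal ergodic
  theorem applies to \<open>a p\<close> on B.\<close>

lemma subadditive_integral_ge:
  assumes sa: "subadd B a \<phi>" and up: "\<And>x. x \<in> B \<Longrightarrow> up (\<lambda>n. a n x) \<gamma>" and p: "0 < p"
  shows "real p * \<gamma> * measure M B \<le> (\<integral>x. indicator B x * a p x \<partial>M)"
proof -
  have B: "inv_set B" and \<phi>: "\<And>y. y \<in> space M \<Longrightarrow> 0 \<le> \<phi> y" "integrable M \<phi>"
    and [measurable]: "B \<in> sets M" "\<And>n. a n \<in> borel_measurable M"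
    using sa by (auto simp: subadd_def inv_set_def)
  define f where "f x = indicator B x * a p x" for x
  have f: "integrable M f"
  proof (rule Bochner_Integration.integrable_bound[OF integrable_bsum[OF \<phi>(2), of p]])
    show "AE x in M. norm (f x) \<le> norm (bsum \<phi> p x)"
    proof (rule AE_I2)
      fix x
      have "\<bar>a p x\<bar> \<le> bsum \<phi> p x" if "x \<in> B" using sa that unfolding subadd_def by blast
      then show "norm (f x) \<le> norm (bsum \<phi> p x)" by (auto simp: f_def indicator_def)
    qed
  qed (simp add: f_def[abs_def])
  have "AE x in M. \<forall>\<epsilon>>0. \<exists>K. \<forall>n. bsum \<phi> p (\<theta> n x) \<le> K + \<epsilon> * real n"
    by (rule tempered_integrable[OF integrable_bsum[OF \<phi>(2)]])
  then have "AE x in M. x \<in> B \<longrightarrow> (\<exists>n. bsum f n x > (real p * \<gamma>) * real n)"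
  proof eventually_elim
    case (elim x)
    show ?case
    proof
      assume x: "x \<in> B"
      then have xs: "x \<in> space M" using inv_set_space[OF B] by blast
      have bf: "bsum f n x = bsum (a p) n x" for n
        unfolding bsum_def f_def using inv_setD[OF B xs] x by simp
      define C where "C = (\<Sum>j<p. a j x)"
      have main: "real p * a (N + p) x \<le> bsum f N x + C + real p * bsum \<phi> p (\<theta> N x)" for N
      proof -
        have "real p * a (N + p) x = (\<Sum>j<p. a (N + p) x)" by simp
        also have "\<dots> \<le> (\<Sum>j<p. a (N + j) x + bsum \<phi> p (\<theta> N x))"
          by (intro sum_mono subadd_step_le[OF sa x]) auto
        also have "\<dots> = (\<Sum>j<p. a (N + j) x) + real p * bsum \<phi> p (\<theta> N x)"
          by (simp add: sum.distrib)
        finally show ?thesis using subadd_sum_le[OF sa x, where p = p and N = N] by (simp add: bf C_def)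
      qed
      have "up (\<lambda>n. a (n + p) x) \<gamma>" using up[OF x] by (simp only: up_shift[of "\<lambda>n. a n x"])
      then have "up (\<lambda>n. real p * a (n + p) x) (real p * \<gamma>)" using p by (intro up_scale) auto
      then have "up (\<lambda>n. bsum f n x) (real p * \<gamma>)"
      proof (rule up_perturb)
        fix \<epsilon> :: real assume \<epsilon>: "0 < \<epsilon>"
        \<comment> \<open>The tempered error enters p times and may use one half of \<epsilon>; the
          other half pays for the constants.\<close>
        define \<epsilon>' where "\<epsilon>' = \<epsilon> / (2 * real p)"
        have "0 < \<epsilon>'" using \<epsilon> p by (simp add: \<epsilon>'_def)
        then obtain K where K: "\<And>n. bsum \<phi> p (\<theta> n x) \<le> K + \<epsilon>' * real n" using elim by blast
        obtain N where N: "real N > 2 * (C + real p * K) / \<epsilon>" using reals_Archimedean2 by blast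
        have "real p * a (n + p) x \<le> bsum f n x + \<epsilon> * real n" if "n \<ge> N" for n
        proof -
          have "real p * bsum \<phi> p (\<theta> n x) \<le> real p * (K + \<epsilon>' * real n)" 
            using K by (intro mult_left_mono) auto
          also have "\<dots> = real p * K + \<epsilon> / 2 * real n" using p by (simp add: \<epsilon>'_def field_simps)
          finally have "real p * a (n + p) x \<le> bsum f n x + (C + real p * K) + \<epsilon> / 2 * real n"
            using main[of n] by linarith
          moreover have "C + real p * K \<le> \<epsilon> / 2 * real n"
          proof -
            have "2 * (C + real p * K) < \<epsilon> * real N" using N \<epsilon> by (simp add: field_simps)
            also have "\<dots> \<le> \<epsilon> * real n" using that \<epsilon> by simp
            finally show ?thesis by simp
          qed
          ultimately show ?thesis by (simp add: field_simps)
        qed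
        then show "\<exists>N. \<forall>n\<ge>N. real p * a (n + p) x \<le> bsum f n x + \<epsilon> * real n" by blast
      qed
      then show "\<exists>n. bsum f n x > (real p * \<gamma>) * real n" using up_frequently by blast
    qed
  qed
  then have "(real p * \<gamma>) * measure M B \<le> (\<integral>x. indicator B x * f x \<partial>M)"
    by (rule maximal_ergodic[OF f B])
  also have "\<dots> = (\<integral>x. indicator B x * a p x \<partial>M)"
    by (intro Bochner_Integration.integral_cong) (auto simp: f_def indicator_def)
  finally show ?thesis .
qed

text \<open>Composition with \<open>\<theta> n\<close> destroys pointwise asymptotics but preserves
  the distribution of \<open>b n\<close>. The bound on b, weakened to convergence of integrals of
  clipped averages, therefore survives. On the invariant set D where c grows too fast,
  \<open>subadditive_integral_ge\<close> gives a lower bound for the integral of \<open>c n\<close>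
  that contradicts it unless D is null. Subadditivity of c is what leads back from integrals to
  almost every point.\<close>

lemma AE_not_up_pushforward:
  assumes sa: "subadd B c \<phi>"
    and [measurable]: "\<And>n. b n \<in> borel_measurable M"
    and cb: "\<And>n x. x \<in> B \<Longrightarrow> c n x = b n (\<theta> n x)"
    and nup: "\<And>x. x \<in> B \<Longrightarrow> \<not> up (\<lambda>n. b n x) \<gamma>"
  shows "AE x in M. x \<in> B \<longrightarrow> \<not> up (\<lambda>n. c n x) \<gamma>"
proof -
  have B: "inv_set B" and \<phi>: "\<And>y. y \<in> space M \<Longrightarrow> 0 \<le> \<phi> y" "integrable M \<phi>"
    and [measurable]: "B \<in> sets M" "\<And>n. c n \<in> borel_measurable M"
    using sa by (auto simp: subadd_def inv_set_def)
  have [measurable]: "\<phi> \<in> borel_measurable M" using \<phi> by auto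
  have "AE x in M. x \<in> B \<longrightarrow> \<not> up (\<lambda>n. c n x) (\<gamma> + 1 / real (Suc j))" for j
  proof -
    define \<gamma>' where "\<gamma>' = \<gamma> + 1 / real (Suc j)"
    define D where "D = {x \<in> B. up (\<lambda>n. c n x) \<gamma>'}"
    have D: "inv_set D" unfolding D_def by (rule inv_set_up[OF sa])
    have [measurable]: "D \<in> sets M" using D by (simp add: inv_set_def)
    have saD: "subadd D c \<phi>" using sa D by (rule subadd_subset) (auto simp: D_def)
    \<comment> \<open>The part of \<phi> above height K. It controls \<open>c n\<close> where the
      clipping at K is active, and its cost per time step, the integral of \<open>\<psi> K\<close>,
      vanishes as K grows.\<close>
    define \<psi> where "\<psi> K x = max 0 (\<phi> x - K)" for K x
    have i\<psi>: "integrable M (\<psi> K)" for K unfolding \<psi>_def using \<phi> by auto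
    have key: "\<gamma>' * measure M D \<le> \<gamma> * measure M D + (\<integral>x. \<psi> K x \<partial>M)" if K: "K \<ge> \<gamma>" for K
    proof -
      \<comment> \<open>Clipped below at \<gamma>, so that a one-sided bound on \<open>b n\<close>
        already forces convergence to \<gamma>, and above at K, so that dominated convergence
        applies.\<close>
      define cl where "cl n y = max \<gamma> (min K (b n y / real n))" for n y
      have cl_bd: "\<bar>cl n y\<bar> \<le> \<bar>\<gamma>\<bar> + \<bar>K\<bar>" for n y by (auto simp: cl_def)
      have [measurable]: "cl n \<in> borel_measurable M" for n unfolding cl_def[abs_def] by measurable
      have lim: "(\<lambda>n. \<integral>x. indicator D x * cl n x \<partial>M) \<longlonglongrightarrow> (\<integral>x. indicator D x * \<gamma> \<partial>M)"
      proof (rule integral_dominated_convergence[where w = "\<lambda>x. \<bar>\<gamma>\<bar> + \<bar>K\<bar>"])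
        show "AE x in M. (\<lambda>n. indicator D x * cl n x) \<longlonglongrightarrow> indicator D x * \<gamma>"
        proof (rule AE_I2)
          fix x
          show "(\<lambda>n. indicator D x * cl n x) \<longlonglongrightarrow> indicator D x * \<gamma>"
          proof (cases "x \<in> D")
            case True
            then have "\<not> up (\<lambda>n. b n x) \<gamma>" using nup by (auto simp: D_def)
            then have ev: "\<forall>\<delta>>0. \<exists>N. \<forall>n\<ge>N. b n x \<le> (\<gamma> + \<delta>) * real n" by (simp only: not_up_iff)
            have "(\<lambda>n. cl n x) \<longlonglongrightarrow> \<gamma>"
            proof (rule LIMSEQ_I)
              fix r :: real assume r: "0 < r"
              then obtain N where N: "\<And>n. n \<ge> N \<Longrightarrow> b n x \<le> (\<gamma> + r / 2) * real n"
                using ev by (meson half_gt_zero)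
              have "norm (cl n x - \<gamma>) < r" if "n \<ge> Suc N" for n
              proof -
                have "b n x / real n \<le> \<gamma> + r / 2" using N[of n] that by (simp add: field_simps)
                then show ?thesis using r K by (auto simp: cl_def)
              qed
              then show "\<exists>no. \<forall>n\<ge>no. norm (cl n x - \<gamma>) < r" by blast
            qed
            then show ?thesis by (intro tendsto_intros)
          qed simp
        qed
        show "AE x in M. norm (indicator D x * cl n x) \<le> \<bar>\<gamma>\<bar> + \<bar>K\<bar>" for n
          using cl_bd by (intro AE_I2) (auto simp: indicator_def)
      qed auto
      have "\<gamma>' * measure M D \<le> (\<integral>x. indicator D x * cl n x \<partial>M) + (\<integral>x. \<psi> K x \<partial>M)" if n: "n > 0" for n
      proof -
        have ic: "integrable M (\<lambda>x. indicator D x * c n x)"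
        proof (rule Bochner_Integration.integrable_bound[OF integrable_bsum[OF \<phi>(2), of n]])
          show "AE x in M. norm (indicator D x * c n x) \<le> norm (bsum \<phi> n x)"
          proof (rule AE_I2)
            fix x
            have "\<bar>c n x\<bar> \<le> bsum \<phi> n x" if "x \<in> D" using saD that unfolding subadd_def by blast
            then show "norm (indicator D x * c n x) \<le> norm (bsum \<phi> n x)" by (auto simp: indicator_def)
          qed
        qed simp
        have icl: "integrable M (\<lambda>x. indicator D x * cl n (\<theta> n x))"
          using cl_bd by (intro integrable_const_bound[of _ "\<bar>\<gamma>\<bar> + \<bar>K\<bar>"]) (auto simp: indicator_def)
        have "real n * \<gamma>' * measure M D \<le> (\<integral>x. indicator D x * c n x \<partial>M)"
          by (rule subadditive_integral_ge[OF saD _ n]) (simp add: D_def)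
        also have "\<dots> \<le> (\<integral>x. real n * (indicator D x * cl n (\<theta> n x)) + bsum (\<psi> K) n x \<partial>M)"
        proof (rule integral_mono)
          show "integrable M (\<lambda>x. real n * (indicator D x * cl n (\<theta> n x)) + bsum (\<psi> K) n x)"
            using icl integrable_bsum[OF i\<psi>] by auto
          fix x assume xs: "x \<in> space M"
          have nn: "0 \<le> bsum (\<psi> K) n x" by (intro bsum_nonneg xs) (simp add: \<psi>_def)
          show "indicator D x * c n x \<le> real n * (indicator D x * cl n (\<theta> n x)) + bsum (\<psi> K) n x"
          proof (cases "x \<in> D")
            case True
            then have xB: "x \<in> B" by (auto simp: D_def)
            have "c n x \<le> bsum \<phi> n x" using sa xB unfolding subadd_def by (meson abs_le_D1)
            also have "\<dots> \<le> bsum (\<lambda>x. K + \<psi> K x) n x" unfolding bsum_def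
              by (intro sum_mono) (auto simp: \<psi>_def)
            also have "\<dots> = real n * K + bsum (\<psi> K) n x" by (simp add: bsum_def sum.distrib)
            finally have le: "c n x \<le> real n * K + bsum (\<psi> K) n x" .
            have "c n x \<le> real n * cl n (\<theta> n x) + bsum (\<psi> K) n x"
            proof (cases "b n (\<theta> n x) / real n \<le> K")
              case True
              then have "b n (\<theta> n x) / real n \<le> cl n (\<theta> n x)" by (auto simp: cl_def)
              then have "c n x \<le> real n * cl n (\<theta> n x)" using n cb[OF xB, of n] by (simp add: field_simps)
              with nn show ?thesis by simp
            next
              case False
              then have "cl n (\<theta> n x) = K" using K by (auto simp: cl_def)
              with le show ?thesis by simp
            qed
            with True show ?thesis by simp
          qed (use nn in simp)
        qed (rule ic)
        also have "\<dots> = real n * (\<integral>x. indicator D x * cl n (\<theta> n x) \<partial>M) + real n * (\<integral>x. \<psi> K x \<partial>M)"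
          using icl integrable_bsum[OF i\<psi>] by (subst Bochner_Integration.integral_add) (auto simp: integral_bsum[OF i\<psi>])
        also have "(\<integral>x. indicator D x * cl n (\<theta> n x) \<partial>M) = (\<integral>x. indicator D x * cl n x \<partial>M)"
          by (rule integral_inv_set[OF D]) auto
        finally have "real n * (\<gamma>' * measure M D) \<le> real n * ((\<integral>x. indicator D x * cl n x \<partial>M) + (\<integral>x. \<psi> K x \<partial>M))"
          by (simp add: algebra_simps)
        then show ?thesis using n by simp
      qed
      then have "\<gamma>' * measure M D \<le> (\<integral>x. indicator D x * \<gamma> \<partial>M) + (\<integral>x. \<psi> K x \<partial>M)"
        by (intro LIMSEQ_le_const[OF tendsto_add[OF lim tendsto_const]] exI[of _ 1]) auto
      then show ?thesis by (simp add: mult.commute)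
    qed
    have "(\<lambda>i. \<integral>x. \<psi> (real i) x \<partial>M) \<longlonglongrightarrow> (\<integral>x. 0 \<partial>M)"
    proof (rule integral_dominated_convergence[where w = \<phi>])
      show "AE x in M. (\<lambda>i. \<psi> (real i) x) \<longlonglongrightarrow> 0"
      proof (rule AE_I2)
        fix x
        obtain N where N: "real N > \<phi> x" using reals_Archimedean2 by blast
        have "\<psi> (real i) x = 0" if "i \<ge> N" for i
        proof -
          have "real N \<le> real i" using that by simp
          then show ?thesis using N by (simp add: \<psi>_def)
        qed
        then show "(\<lambda>i. \<psi> (real i) x) \<longlonglongrightarrow> 0"
          by (intro tendsto_eventually) (auto simp: eventually_sequentially)
      qed
      show "AE x in M. norm (\<psi> (real i) x) \<le> \<phi> x" for i
        using \<phi>(1) by (intro AE_I2) (auto simp: \<psi>_def)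
    qed (use \<phi> in \<open>auto simp: \<psi>_def\<close>)
    then have lim2: "(\<lambda>i. \<gamma> * measure M D + (\<integral>x. \<psi> (real i) x \<partial>M)) \<longlonglongrightarrow> \<gamma> * measure M D + 0"
      by (intro tendsto_intros) simp
    obtain i0 :: nat where i0: "real i0 > \<gamma>" using reals_Archimedean2 by blast
    have "\<gamma>' * measure M D \<le> \<gamma> * measure M D + 0"
    proof (rule LIMSEQ_le_const[OF lim2], intro exI[of _ i0] allI impI)
      fix i assume "i0 \<le> i"
      then have "real i0 \<le> real i" by simp
      then show "\<gamma>' * measure M D \<le> \<gamma> * measure M D + (\<integral>x. \<psi> (real i) x \<partial>M)" using i0 by (intro key) simp
    qed
    then have "(1 / real (Suc j)) * measure M D \<le> 0" by (simp add: \<gamma>'_def algebra_simps)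
    then have "measure M D \<le> 0" 
      using mult_le_cancel_left_pos[of "1 / real (Suc j)" "measure M D" 0] by simp
    then have "D \<in> null_sets M" using measure_nonneg[of M D]
      by (auto simp: null_sets_def emeasure_eq_measure)
    then have "AE x in M. x \<notin> D" by (rule AE_not_in)
    then show ?thesis by eventually_elim (auto simp: D_def \<gamma>'_def)
  qed
  then have "AE x in M. \<forall>j. x \<in> B \<longrightarrow> \<not> up (\<lambda>n. c n x) (\<gamma> + 1 / real (Suc j))"
    unfolding AE_all_countable by blast
  then show ?thesis by eventually_elim (use up_gap in blast)
qed

text \<open>At a good time every initial piece of the orbit, of length k, accounts for at least
  \<open>\<gamma> * k\<close> of \<open>a n x\<close>. For the inverse quotient cocycle below, this
  turns a vector chosen at time n into one that is controlled at all times up to n.\<close>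

definition good_time :: "(nat \<Rightarrow> 'x \<Rightarrow> real) \<Rightarrow> real \<Rightarrow> nat \<Rightarrow> 'x \<Rightarrow> bool" where
  "good_time a \<gamma> n x \<longleftrightarrow> (\<forall>k\<in>{1..n}. a n x \<ge> a (n - k) (\<theta> k x) + \<gamma> * real k)"

text \<open>Read the orbit from the left. If the remaining length is not a good time, some initial
  piece of length k accounts for less than \<open>\<gamma> * k\<close> and is skipped at no cost. If
  it is good, one step is taken and paid for by \<phi> and \<open>\<bar>\<gamma>\<bar>\<close>. So
  only good remaining lengths are paid for.\<close>

lemma subadd_le_good_sum:
  assumes sa: "subadd B a \<phi>" and x: "x \<in> B"
  shows "a n x - real n * \<gamma> \<le>
    (\<Sum>k<n. if good_time a \<gamma> (n - k) (\<theta> k x) then \<phi> (\<theta> k x) + \<bar>\<gamma>\<bar> else 0)"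
  using x
proof (induction n arbitrary: x rule: less_induct)
  case (less n)
  have B: "inv_set B" and \<phi>: "\<And>y. y \<in> space M \<Longrightarrow> 0 \<le> \<phi> y" using sa by (auto simp: subadd_def)
  have xs: "x \<in> space M" using inv_set_space[OF B less.prems] .
  define h where "h j y = (if good_time a \<gamma> j y then \<phi> y + \<bar>\<gamma>\<bar> else 0)" for j y
  define H where "H n x = (\<Sum>k<n. h (n - k) (\<theta> k x))" for n x
  have h0: "0 \<le> h j y" if "y \<in> space M" for j y using \<phi>[OF that] by (simp add: h_def)
  \<comment> \<open>Skipping k steps drops nonnegative summands only.\<close>
  have tail: "H (n - k) (\<theta> k x) \<le> H n x" if "k \<le> n" for k
  proof -
    have "H (n - k) (\<theta> k x) = (\<Sum>i<n-k. h (n - k - i) (\<theta> i (\<theta> k x)))" by (simp add: H_def)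
    also have "\<dots> = (\<Sum>i<n-k. h (n - (k + i)) (\<theta> (k + i) x))" using \<theta>_add[OF xs, of k] by simp
    also have "\<dots> = (\<Sum>i\<in>{k..<n}. h (n - i) (\<theta> i x))"
      using that by (intro sum.reindex_bij_witness[of _ "\<lambda>i. i - k" "\<lambda>i. k + i"]) auto
    also have "\<dots> \<le> H n x" unfolding H_def using xs by (intro sum_mono2 h0) auto
    finally show ?thesis .
  qed
  have "a n x - real n * \<gamma> \<le> H n x"
  proof (cases "n = 0")
    case True
    have "\<bar>a 0 x\<bar> \<le> bsum \<phi> 0 x" using sa less.prems unfolding subadd_def by blast
    with True show ?thesis by (simp add: H_def)
  next
    case n: False
    show ?thesis
    proof (cases "good_time a \<gamma> n x")
      case True
      obtain m where m: "n = Suc m" using n by (cases n) auto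
      have "H n x = \<phi> x + \<bar>\<gamma>\<bar> + H m (\<theta> 1 x)"
        unfolding H_def m sum.lessThan_Suc_shift using True m xs
        by (simp add: h_def \<theta>_0 \<theta>_Suc[OF xs] del: One_nat_def)
      moreover have "a m (\<theta> 1 x) - real m * \<gamma> \<le> H m (\<theta> 1 x)"
        using less.IH[of m "\<theta> 1 x"] inv_setD[OF B xs, of 1] less.prems m
        by (simp add: H_def h_def del: One_nat_def)
      moreover have "a (1 + m) x \<le> a 1 x + a m (\<theta> 1 x)" using sa less.prems unfolding subadd_def by blast
      moreover have "a 1 x \<le> \<phi> x"
      proof -
        have "\<bar>a 1 x\<bar> \<le> bsum \<phi> 1 x" using sa less.prems unfolding subadd_def by blast
        then show ?thesis using xs by (simp add: bsum_def \<theta>_0)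
      qed
      ultimately show ?thesis using m by (simp add: algebra_simps)
    next
      case False
      then obtain k where k: "k \<in> {1..n}" "a n x < a (n - k) (\<theta> k x) + \<gamma> * real k"
        by (auto simp: good_time_def not_le)
      have "a (n - k) (\<theta> k x) - real (n - k) * \<gamma> \<le> H (n - k) (\<theta> k x)"
        using less.IH[of "n - k" "\<theta> k x"] inv_setD[OF B xs, of k] less.prems k
        by (simp add: H_def h_def)
      also have "\<dots> \<le> H n x" using k by (intro tail) auto
      finally show ?thesis using k by (simp add: of_nat_diff algebra_simps)
    qed
  qed
  then show ?case by (simp add: H_def h_def)
qed

text \<open>This is the lemma of Karlsson and Margulis.\<close>
lemma null_of_no_good_times:
  assumes sa: "subadd B a \<phi>" and up: "\<And>x. x \<in> B \<Longrightarrow> up (\<lambda>n. a n x) \<gamma>"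
    and fin: "AE x in M. x \<in> B \<longrightarrow> (\<exists>N. \<forall>n\<ge>N. \<not> good_time a \<gamma> n x)"
  shows "AE x in M. x \<notin> B"
proof -
  have B: "inv_set B" and \<phi>: "\<And>y. y \<in> space M \<Longrightarrow> 0 \<le> \<phi> y" "integrable M \<phi>"
    and [measurable]: "B \<in> sets M" "\<And>n. a n \<in> borel_measurable M"
    using sa by (auto simp: subadd_def inv_set_def)
  have [measurable]: "\<phi> \<in> borel_measurable M" using \<phi> by auto
  have "AE x in M. x \<in> B \<longrightarrow> \<not> up (\<lambda>n. a n x) (\<gamma> + 1 / real (Suc j))" for j
  proof -
    define \<gamma>' where "\<gamma>' = \<gamma> + 1 / real (Suc j)"
    define D where "D = {x \<in> B. up (\<lambda>n. a n x) \<gamma>'}"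
    have D: "inv_set D" unfolding D_def by (rule inv_set_up[OF sa])
    have [measurable]: "D \<in> sets M" using D by (simp add: inv_set_def)
    have saD: "subadd D a \<phi>" using sa D by (rule subadd_subset) (auto simp: D_def)
    define h where "h n x = (if good_time a \<gamma> n x then \<phi> x + \<bar>\<gamma>\<bar> else 0)" for n x
    have [measurable]: "h n \<in> borel_measurable M" for n
      unfolding h_def[abs_def] good_time_def by measurable
    have hb: "\<bar>h n x\<bar> \<le> \<phi> x + \<bar>\<gamma>\<bar>" if "x \<in> space M" for n x using \<phi>(1)[OF that] by (simp add: h_def)
    have ih: "integrable M (h n)" for n
    proof (rule Bochner_Integration.integrable_bound[of M "\<lambda>x. \<phi> x + \<bar>\<gamma>\<bar>"])
      show "AE x in M. norm (h n x) \<le> norm (\<phi> x + \<bar>\<gamma>\<bar>)" using hb \<phi>(1) by (intro AE_I2) simp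
    qed (use \<phi> in auto)
    \<comment> \<open>The mean payment over D when \<open>Suc n\<close> steps remain. It tends to 0
      because almost every point of B has only finitely many good times.\<close>
    define r where "r n = (\<integral>x. indicator D x * h (Suc n) x \<partial>M)" for n
    have "r \<longlonglongrightarrow> (\<integral>x. 0 \<partial>M)" unfolding r_def
    proof (rule integral_dominated_convergence[where w = "\<lambda>x. \<phi> x + \<bar>\<gamma>\<bar>"])
      show "AE x in M. (\<lambda>n. indicator D x * h (Suc n) x) \<longlonglongrightarrow> 0"
        using fin
      proof eventually_elim
        case (elim x)
        show ?case
        proof (cases "x \<in> D")
          case True
          then obtain N where "\<forall>n\<ge>N. \<not> good_time a \<gamma> n x" using elim by (auto simp: D_def)
          then have "eventually (\<lambda>n. indicator D x * h (Suc n) x = 0) sequentially"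
            by (auto simp: eventually_sequentially h_def intro!: exI[of _ N])
          then show ?thesis by (rule tendsto_eventually)
        qed simp
      qed
      show "AE x in M. norm (indicator D x * h (Suc n) x) \<le> \<phi> x + \<bar>\<gamma>\<bar>" for n
        using hb \<phi>(1) by (intro AE_I2) (auto simp: indicator_def)
    qed (use \<phi> in auto)
    then have r0: "r \<longlonglongrightarrow> 0" by simp
    \<comment> \<open>As D and the measure are invariant, the mean payment at step k depends only on
      the remaining length n - k; the payments are thus the values of r in reverse order.\<close>
    have bound: "real n * ((\<gamma>' - \<gamma>) * measure M D) \<le> (\<Sum>j<n. r j)" for n
    proof (cases "n = 0")
      case False
      have ic: "integrable M (\<lambda>x. indicator D x * a n x)"
      proof (rule Bochner_Integration.integrable_bound[OF integrable_bsum[OF \<phi>(2), of n]])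
        show "AE x in M. norm (indicator D x * a n x) \<le> norm (bsum \<phi> n x)"
        proof (rule AE_I2)
          fix x
          have "\<bar>a n x\<bar> \<le> bsum \<phi> n x" if "x \<in> D" using saD that unfolding subadd_def by blast
          then show "norm (indicator D x * a n x) \<le> norm (bsum \<phi> n x)" by (auto simp: indicator_def)
        qed
      qed simp
      have ihk: "integrable M (\<lambda>x. indicator D x * h (n - k) (\<theta> k x))" for k
        using integrable_\<theta>[OF ih] by (intro integrable_ind) auto
      have i1: "integrable M (\<lambda>x. \<Sum>k<n. indicator D x * h (n - k) (\<theta> k x))"
        by (rule Bochner_Integration.integrable_sum) (rule ihk)
      have i2: "integrable M (\<lambda>x. (real n * \<gamma>) * indicator D x)"
        by (auto intro!: integrable_real_indicator simp: less_top[symmetric])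
      have "real n * \<gamma>' * measure M D \<le> (\<integral>x. indicator D x * a n x \<partial>M)"
        using False by (intro subadditive_integral_ge[OF saD]) (auto simp: D_def)
      also have "\<dots> \<le> (\<integral>x. (\<Sum>k<n. indicator D x * h (n - k) (\<theta> k x)) + (real n * \<gamma>) * indicator D x \<partial>M)"
      proof (rule integral_mono[OF ic])
        show "integrable M (\<lambda>x. (\<Sum>k<n. indicator D x * h (n - k) (\<theta> k x)) + (real n * \<gamma>) * indicator D x)"
          using i1 i2 by (rule Bochner_Integration.integrable_add)
        show "indicator D x * a n x \<le> (\<Sum>k<n. indicator D x * h (n - k) (\<theta> k x)) + (real n * \<gamma>) * indicator D x" for x
          using subadd_le_good_sum[OF saD, of x n \<gamma>] by (auto simp: indicator_def h_def)
      qed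
      also have "\<dots> = (\<Sum>k<n. \<integral>x. indicator D x * h (n - k) (\<theta> k x) \<partial>M) + real n * \<gamma> * measure M D"
        using ihk by (simp only: Bochner_Integration.integral_add[OF i1 i2] Bochner_Integration.integral_sum) simp
      also have "(\<Sum>k<n. \<integral>x. indicator D x * h (n - k) (\<theta> k x) \<partial>M) = (\<Sum>k<n. r (n - Suc k))"
        unfolding r_def by (intro sum.cong refl) (subst integral_inv_set[OF D], auto simp: Suc_diff_Suc)
      also have "\<dots> = (\<Sum>j<n. r j)" by (rule sum.nat_diff_reindex)
      finally show ?thesis by (simp add: algebra_simps)
    qed simp
    \<comment> \<open>The left-hand side of \<open>bound\<close> is linear in n, while the sums of
      the null sequence r are sublinear.\<close>
    have "(\<gamma>' - \<gamma>) * measure M D \<le> 0"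
    proof (rule le_of_linear_bound)
      fix \<epsilon> :: real assume "0 < \<epsilon>"
      then obtain K where "\<forall>n. (\<Sum>j<n. r j) \<le> K + \<epsilon> * real n"
        using sum_le_eventually_small[OF r0] by blast
      then show "\<exists>K. \<forall>n. real n * ((\<gamma>' - \<gamma>) * measure M D) \<le> K + \<epsilon> * real n"
        using bound order.trans by blast
    qed
    then have "measure M D \<le> 0" 
      using mult_le_cancel_left_pos[of "1 / real (Suc j)" "measure M D" 0] by (simp add: \<gamma>'_def)
    then have "D \<in> null_sets M" using measure_nonneg[of M D]
      by (auto simp: null_sets_def emeasure_eq_measure)
    then have "AE x in M. x \<notin> D" by (rule AE_not_in)
    then show ?thesis by eventually_elim (auto simp: D_def \<gamma>'_def)
  qed
  then have "AE x in M. \<forall>j. x \<in> B \<longrightarrow> \<not> up (\<lambda>n. a n x) (\<gamma> + 1 / real (Suc j))"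
    unfolding AE_all_countable by blast
  then show ?thesis by eventually_elim (use up_gap up in blast)
qed

end

section \<open>Orthogonal projections and measurable fields of subspaces\<close>

lemma transpose_inner: "(transpose A *v x) \<bullet> y = x \<bullet> ((A::real^'n^'m) *v y)"
  by (simp add: dot_lmul_matrix)

lemma symmetric_matrixI:
  fixes P :: "real^'m^'m"
  assumes "\<And>v w. (P *v v) \<bullet> w = v \<bullet> (P *v w)"
  shows "transpose P = P"
proof -
  have "transpose P *v v = P *v v" for v
    by (rule vector_eq_ldot[THEN iffD1]) (metis assms transpose_inner inner_commute)
  then show ?thesis by (simp add: matrix_eq)
qed

lemma mat_norm_bound: "norm (B *v v) \<le> mat_norm B * norm v"
  unfolding mat_norm_def by (rule onorm) (rule matrix_vector_mul_bounded_linear)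

lemma mat_norm_le: "(\<And>v. norm (B *v v) \<le> K * norm v) \<Longrightarrow> mat_norm B \<le> K"
  unfolding mat_norm_def by (rule onorm_le)

lemma mat_norm_nonneg [simp]: "0 \<le> mat_norm B"
  unfolding mat_norm_def by (rule onorm_pos_le) (rule matrix_vector_mul_bounded_linear)

lemma mat_norm_mult: "mat_norm (A ** B) \<le> mat_norm A * mat_norm B"
proof (rule mat_norm_le)
  fix v
  have "norm ((A ** B) *v v) \<le> mat_norm A * norm (B *v v)"
    by (metis mat_norm_bound matrix_vector_mul_assoc)
  also have "\<dots> \<le> mat_norm A * (mat_norm B * norm v)"
    by (intro mult_left_mono mat_norm_bound mat_norm_nonneg)
  finally show "norm ((A ** B) *v v) \<le> mat_norm A * mat_norm B * norm v" by (simp add: mult.assoc)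
qed

lemma mat_norm_mat_1 [simp]: "mat_norm (mat 1 :: real^'m^'m) = 1"
  by (simp add: mat_norm_def onorm_id[unfolded id_def])

lemma mat_norm_transpose: "mat_norm (transpose A) = mat_norm (A :: real^'m^'m)"
proof -
  have *: "mat_norm (transpose A) \<le> mat_norm A" for A :: "real^'m^'m"
  proof (rule mat_norm_le)
    fix v
    let ?w = "transpose A *v v"
    have "norm ?w * norm ?w = ?w \<bullet> ?w" by (simp add: dot_square_norm power2_eq_square)
    also have "\<dots> = v \<bullet> (A *v ?w)" by (rule transpose_inner)
    also have "\<dots> \<le> norm v * norm (A *v ?w)" by (rule norm_cauchy_schwarz)
    also have "\<dots> \<le> norm v * (mat_norm A * norm ?w)" by (intro mult_left_mono mat_norm_bound) auto
    finally have "norm ?w * norm ?w \<le> (mat_norm A * norm v) * norm ?w" by (simp add: algebra_simps)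
    then show "norm ?w \<le> mat_norm A * norm v"
      by (cases "norm ?w = 0") (auto simp: mult_le_cancel_right)
  qed
  from *[of A] *[of "transpose A"] show ?thesis by simp
qed

lemma mat_norm_attained:
  fixes B :: "real^'m^'m"
  obtains u where "norm u = 1" "norm (B *v u) = mat_norm B"
proof -
  have "compact (sphere (0::real^'m) 1)" by (rule compact_sphere)
  moreover have "axis undefined 1 \<in> sphere (0::real^'m) 1" by (simp add: norm_axis_1)
  moreover have "continuous_on (sphere 0 1) (\<lambda>v. norm (B *v v))"
    by (intro continuous_intros)
  ultimately obtain u where u: "u \<in> sphere 0 1" "\<And>v. v \<in> sphere 0 1 \<Longrightarrow> norm (B *v v) \<le> norm (B *v u)"
    using continuous_attains_sup[of "sphere 0 1" "\<lambda>v. norm (B *v v)"] by blast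
  have "norm (B *v v) \<le> norm (B *v u) * norm v" for v
  proof (cases "v = 0")
    case False
    have "norm (B *v (v /\<^sub>R norm v)) \<le> norm (B *v u)" using False by (intro u(2)) simp
    then show ?thesis using False by (simp add: matrix_vector_mult_scaleR field_simps)
  qed simp
  then have "mat_norm B \<le> norm (B *v u)" by (rule mat_norm_le)
  moreover have "norm (B *v u) \<le> mat_norm B" using mat_norm_bound[of B u] u(1) by simp
  ultimately show thesis using u(1) by (intro that[of u]) auto
qed

lemma mat_norm_pos:
  assumes "B *v v \<noteq> 0" shows "0 < mat_norm B"
proof -
  have "0 < norm (B *v v)" using assms by simp
  also have "\<dots> \<le> mat_norm B * norm v" by (rule mat_norm_bound)
  finally show ?thesis by (simp add: zero_less_mult_iff)
qed

lemma mat_norm_diff: "\<bar>mat_norm A - mat_norm B\<bar> \<le> mat_norm (A - B)"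
proof -
  have *: "mat_norm A \<le> mat_norm B + mat_norm (A - B)" for A B :: "real^'m^'m"
  proof (rule mat_norm_le)
    fix v
    have "A *v v = B *v v + (A - B) *v v" by (simp add: algebra_simps)
    then have "norm (A *v v) \<le> norm (B *v v) + norm ((A - B) *v v)" by (metis norm_triangle_ineq)
    also have "\<dots> \<le> mat_norm B * norm v + mat_norm (A - B) * norm v"
      by (intro add_mono mat_norm_bound)
    finally show "norm (A *v v) \<le> (mat_norm B + mat_norm (A - B)) * norm v" by (simp add: algebra_simps)
  qed
  have "mat_norm (B - A) \<le> mat_norm (A - B)"
  proof (rule mat_norm_le)
    fix v
    have "(B - A) *v v = - ((A - B) *v v)" by (simp add: algebra_simps)
    then show "norm ((B - A) *v v) \<le> mat_norm (A - B) * norm v" using mat_norm_bound[of "A - B" v] by simp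
  qed
  then show ?thesis using *[of A B] *[of B A] by linarith
qed

lemma measurable_matrix_iff:
  fixes f :: "'x \<Rightarrow> real^'n^'m"
  shows "f \<in> borel_measurable M \<longleftrightarrow> (\<forall>i j. (\<lambda>x. f x $ i $ j) \<in> borel_measurable M)"
  by (auto simp: borel_measurable_euclidean_space[of f] Basis_vec_def inner_axis)

lemma measurable_vec_iff:
  fixes f :: "'x \<Rightarrow> real^'m"
  shows "f \<in> borel_measurable M \<longleftrightarrow> (\<forall>i. (\<lambda>x. f x $ i) \<in> borel_measurable M)"
  by (auto simp: borel_measurable_euclidean_space[of f] Basis_vec_def inner_axis)

lemma measurable_matrix_nth [measurable (raw)]:
  fixes f :: "'x \<Rightarrow> real^'n^'m"
  shows "f \<in> borel_measurable M \<Longrightarrow> (\<lambda>x. f x $ i $ j) \<in> borel_measurable M"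
  by (simp add: measurable_matrix_iff)

lemma measurable_vec_nth' [measurable (raw)]:
  fixes f :: "'x \<Rightarrow> real^'m"
  shows "f \<in> borel_measurable M \<Longrightarrow> (\<lambda>x. f x $ i) \<in> borel_measurable M"
  by (simp add: measurable_vec_iff)

lemma measurable_matrix_vector_mult [measurable (raw)]:
  fixes f :: "'x \<Rightarrow> real^'n^'m" and g :: "'x \<Rightarrow> real^'n"
  assumes [measurable]: "f \<in> borel_measurable M" "g \<in> borel_measurable M"
  shows "(\<lambda>x. f x *v g x) \<in> borel_measurable M"
  unfolding measurable_vec_iff matrix_vector_mult_def by simp

lemma measurable_matrix_mult [measurable (raw)]:
  fixes f :: "'x \<Rightarrow> real^'n^'m" and g :: "'x \<Rightarrow> real^'k^'n"
  assumes [measurable]: "f \<in> borel_measurable M" "g \<in> borel_measurable M"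
  shows "(\<lambda>x. f x ** g x) \<in> borel_measurable M"
  unfolding measurable_matrix_iff matrix_matrix_mult_def by simp

lemma measurable_transpose [measurable (raw)]:
  fixes f :: "'x \<Rightarrow> real^'n^'m"
  assumes [measurable]: "f \<in> borel_measurable M"
  shows "(\<lambda>x. transpose (f x)) \<in> borel_measurable M"
  unfolding measurable_matrix_iff transpose_def by simp

lemma continuous_on_mat_norm: "continuous_on UNIV (mat_norm :: real^'m^'m \<Rightarrow> real)"
proof -
  have bd: "\<bar>mat_norm A - mat_norm B\<bar> \<le> real CARD('m) * real CARD('m) * norm (A - B)" for A B :: "real^'m^'m"
  proof -
    have "\<bar>(A - B) $ i $ j\<bar> \<le> norm (A - B)" for i j
      by (meson Finite_Cartesian_Product.norm_nth_le component_le_norm_cart order.trans)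
    then have "mat_norm (A - B) \<le> real CARD('m) * real CARD('m) * norm (A - B)"
      unfolding mat_norm_def by (rule onorm_le_matrix_component)
    then show ?thesis using mat_norm_diff[of A B] by linarith
  qed
  show ?thesis
  proof (rule continuous_on_eq_continuous_at[THEN iffD2], simp, intro ballI)
    fix B :: "real^'m^'m"
    have "((\<lambda>A. real CARD('m) * real CARD('m) * norm (A - B)) \<longlongrightarrow> real CARD('m) * real CARD('m) * norm (B - B)) (at B)"
      by (intro tendsto_intros)
    then have "((\<lambda>A. mat_norm A - mat_norm B) \<longlongrightarrow> 0) (at B)"
      by (intro Lim_null_comparison[of "\<lambda>A. mat_norm A - mat_norm B"]) (auto intro!: always_eventually bd)
    then show "isCont mat_norm B" by (simp add: isCont_def LIM_zero_iff)
  qed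
qed

lemma measurable_mat_norm [measurable (raw)]:
  fixes f :: "'x \<Rightarrow> real^'m^'m"
  assumes [measurable]: "f \<in> borel_measurable M"
  shows "(\<lambda>x. mat_norm (f x)) \<in> borel_measurable M"
  using measurable_compose[OF assms borel_measurable_continuous_onI[OF continuous_on_mat_norm]] .

section \<open>Orthogonal projections as matrices\<close>

definition is_proj :: "(real^'m) set \<Rightarrow> real^'m^'m \<Rightarrow> bool" where
  "is_proj F P \<longleftrightarrow> transpose P = P \<and> (\<forall>v. P *v v \<in> F) \<and> (\<forall>v\<in>F. P *v v = v)"

text \<open>Encoding a subspace by its orthogonal projection turns subspace-valued maps into
  matrix-valued ones, which can be multiplied with the cocycle. For a subspace F the choice is
  unique.\<close>

definition proj_mat :: "(real^'m) set \<Rightarrow> real^'m^'m" where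
  "proj_mat F = (SOME P. is_proj F P)"

lemma is_proj_proj_mat:
  fixes F :: "(real^'m) set"
  assumes "subspace F" shows "is_proj F (proj_mat F)"
proof -
  obtain B where B: "B \<subseteq> F" "pairwise orthogonal B" "\<And>b. b \<in> B \<Longrightarrow> norm b = 1"
      "independent B" "card B = dim F" "span B = F"
    using orthonormal_basis_subspace[OF assms] by metis
  have fin: "finite B" using B(4) by (rule independent_imp_finite)
  have *: "\<forall>x\<in>B. \<forall>y\<in>B. x \<bullet> y = (if x=y then 1 else 0)"
    using B(2,3) norm_eq_1 by (auto simp: orthogonal_def pairwise_def)
  define f where "f v = (\<Sum>b\<in>B. (v \<bullet> b) *\<^sub>R b)" for v
  have lf: "linear f"
    by (rule linearI) (simp_all add: f_def algebra_simps inner_add_left sum.distrib scaleR_sum_right)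
  have mf: "matrix f *v v = f v" for v using matrix_vector_mul(2)[OF lf] by metis
  have "is_proj F (matrix f)"
    unfolding is_proj_def mf
  proof (intro conjI allI ballI)
    show "transpose (matrix f) = matrix f"
      by (rule symmetric_matrixI)
         (simp add: mf f_def inner_sum_left inner_sum_right inner_commute mult.commute)
    show "f v \<in> F" for v unfolding f_def using B(1) assms by (intro subspace_sum subspace_scale) auto
    fix v assume "v \<in> F"
    then obtain u where u: "v = (\<Sum>b\<in>B. u b *\<^sub>R b)"
      using B(6) span_finite[OF fin] by auto
    have "v \<bullet> b = u b" if "b \<in> B" for b
    proof -
      have "v \<bullet> b = (\<Sum>b'\<in>B. u b' * (b' \<bullet> b))" by (simp add: u inner_sum_left)
      also have "\<dots> = (\<Sum>b'\<in>B. if b' = b then u b' else 0)" using * that by (intro sum.cong) auto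
      also have "\<dots> = u b" using fin that by simp
      finally show ?thesis .
    qed
    then show "f v = v" unfolding f_def by (subst (2) u) simp
  qed
  then show ?thesis unfolding proj_mat_def by (rule someI)
qed

lemma
  fixes F :: "(real^'m) set"
  assumes "subspace F"
  shows transpose_proj_mat: "transpose (proj_mat F) = proj_mat F"
    and proj_mat_in: "proj_mat F *v v \<in> F"
    and proj_mat_id: "v \<in> F \<Longrightarrow> proj_mat F *v v = v"
  using is_proj_proj_mat[OF assms] by (auto simp: is_proj_def)

lemma proj_mat_inner: "subspace F \<Longrightarrow> (proj_mat F *v v) \<bullet> w = v \<bullet> (proj_mat F *v w)"
  using transpose_inner[of "proj_mat F"] by (simp add: transpose_proj_mat)

lemma proj_mat_residual: "subspace F \<Longrightarrow> w \<in> F \<Longrightarrow> (v - proj_mat F *v v) \<bullet> w = 0"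
  by (simp add: inner_diff_left proj_mat_inner proj_mat_id)

lemma proj_mat_pythagoras:
  assumes "subspace F"
  shows "(norm v)\<^sup>2 = (norm (proj_mat F *v v))\<^sup>2 + (norm (v - proj_mat F *v v))\<^sup>2"
proof -
  have "orthogonal (proj_mat F *v v) (v - proj_mat F *v v)"
    using proj_mat_residual[OF assms proj_mat_in[OF assms], of v v] by (simp add: orthogonal_def inner_commute)
  from norm_add_Pythagorean[OF this] show ?thesis by simp
qed

lemma norm_proj_mat_le: "subspace F \<Longrightarrow> norm (proj_mat F *v v) \<le> norm v"
  using proj_mat_pythagoras[of F v] by (simp add: power2_le_imp_le)

lemma norm_proj_mat_residual_le: "subspace F \<Longrightarrow> norm (v - proj_mat F *v v) \<le> norm v"
  using proj_mat_pythagoras[of F v] by (simp add: power2_le_imp_le)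

lemma range_proj_mat:
  assumes "subspace F" shows "range (\<lambda>v. proj_mat F *v v) = F"
proof
  show "range (\<lambda>v. proj_mat F *v v) \<subseteq> F" using proj_mat_in[OF assms] by auto
  show "F \<subseteq> range (\<lambda>v. proj_mat F *v v)"
  proof
    fix v assume "v \<in> F"
    then have "v = proj_mat F *v v" using proj_mat_id[OF assms] by simp
    then show "v \<in> range (\<lambda>v. proj_mat F *v v)" by (rule range_eqI)
  qed
qed

lemma proj_mat_eq_0_iff: "subspace F \<Longrightarrow> proj_mat F = 0 \<longleftrightarrow> F = {0}"
proof
  assume F: "subspace F" and 0: "proj_mat F = 0"
  then show "F = {0}" using proj_mat_id[OF F] subspace_0[OF F] by force
next
  assume F: "subspace F" "F = {0}"
  then have "proj_mat F *v v = 0 *v v" for v using proj_mat_in[OF F(1), of v] by auto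
  then show "proj_mat F = 0" by (subst matrix_eq) blast
qed

lemma proj_mat_orthogonal_comp:
  assumes F: "subspace F"
  shows "proj_mat (F\<^sup>\<bottom>) = mat 1 - proj_mat F"
proof -
  have F': "subspace (F\<^sup>\<bottom>)" by (rule subspace_orthogonal_comp)
  have "proj_mat (F\<^sup>\<bottom>) *v v = (mat 1 - proj_mat F) *v v" for v
  proof -
    have a: "v - proj_mat F *v v \<in> F\<^sup>\<bottom>"
      using proj_mat_residual[OF F, of _ v] by (auto simp: orthogonal_comp_def orthogonal_def inner_commute)
    have "(proj_mat (F\<^sup>\<bottom>) *v (proj_mat F *v v)) \<bullet> w = 0" for w
    proof -
      have "(proj_mat (F\<^sup>\<bottom>) *v (proj_mat F *v v)) \<bullet> w = (proj_mat F *v v) \<bullet> (proj_mat (F\<^sup>\<bottom>) *v w)"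
        by (rule proj_mat_inner[OF F'])
      also have "\<dots> = 0" using proj_mat_in[OF F', of w] proj_mat_in[OF F, of v]
        by (auto simp: orthogonal_comp_def orthogonal_def)
      finally show ?thesis .
    qed
    then have b: "proj_mat (F\<^sup>\<bottom>) *v (proj_mat F *v v) = 0" by (metis inner_eq_zero_iff)
    have "proj_mat (F\<^sup>\<bottom>) *v v = proj_mat (F\<^sup>\<bottom>) *v (v - proj_mat F *v v) + proj_mat (F\<^sup>\<bottom>) *v (proj_mat F *v v)"
      by (simp add: algebra_simps)
    also have "\<dots> = v - proj_mat F *v v" using proj_mat_id[OF F' a] b by simp
    finally show ?thesis by (simp add: algebra_simps)
  qed
  then show ?thesis by (subst matrix_eq) blast
qed

text \<open>The trace of a projection is its rank. The use is that the trace is visibly measurable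
  in the projection.\<close>

lemma dim_eq_trace:
  fixes F :: "(real^'m) set"
  assumes F: "subspace F"
  shows "real (dim F) = (\<Sum>i\<in>UNIV. proj_mat F $ i $ i)"
proof -
  obtain B where B: "B \<subseteq> F" "pairwise orthogonal B" "\<And>b. b \<in> B \<Longrightarrow> norm b = 1"
      "independent B" "card B = dim F" "span B = F"
    using orthonormal_basis_subspace[OF F] by metis
  have fin: "finite B" using B(4) by (rule independent_imp_finite)
  have *: "\<forall>x\<in>B. \<forall>y\<in>B. x \<bullet> y = (if x=y then 1 else 0)"
    using B(2,3) norm_eq_1 by (auto simp: orthogonal_def pairwise_def)
  have P: "proj_mat F *v v = (\<Sum>b\<in>B. (v \<bullet> b) *\<^sub>R b)" for v
  proof -
    obtain u where u: "proj_mat F *v v = (\<Sum>b\<in>B. u b *\<^sub>R b)"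
      using B(6) span_finite[OF fin] proj_mat_in[OF F, of v] by auto
    have "v \<bullet> b = u b" if "b \<in> B" for b
    proof -
      have "v \<bullet> b = v \<bullet> (proj_mat F *v b)" using that B(1) proj_mat_id[OF F] by auto
      also have "\<dots> = (proj_mat F *v v) \<bullet> b" by (rule proj_mat_inner[OF F, symmetric])
      also have "\<dots> = (\<Sum>b'\<in>B. u b' * (b' \<bullet> b))" by (simp add: u inner_sum_left)
      also have "\<dots> = (\<Sum>b'\<in>B. if b' = b then u b' else 0)" using * that by (intro sum.cong) auto
      also have "\<dots> = u b" using fin that by simp
      finally show ?thesis .
    qed
    then show ?thesis by (simp add: u)
  qed
  have "proj_mat F $ i $ i = (\<Sum>b\<in>B. (b $ i)\<^sup>2)" for i
  proof -
    have "proj_mat F $ i $ i = (proj_mat F *v axis i 1) $ i"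
      by (simp add: matrix_vector_mul_component inner_axis)
    also have "\<dots> = (\<Sum>b\<in>B. (b $ i)\<^sup>2)"
      unfolding P by (simp add: inner_axis' power2_eq_square)
    finally show ?thesis .
  qed
  then have "(\<Sum>i\<in>UNIV. proj_mat F $ i $ i) = (\<Sum>i\<in>UNIV. \<Sum>b\<in>B. (b $ i)\<^sup>2)" by simp
  also have "\<dots> = (\<Sum>b\<in>B. \<Sum>i\<in>UNIV. (b $ i)\<^sup>2)" by (rule sum.swap)
  also have "\<dots> = (\<Sum>b\<in>B. (norm b)\<^sup>2)"
    by (simp add: norm_eq_sqrt_inner inner_vec_def power2_eq_square sum_nonneg)
  also have "\<dots> = real (dim F)" using B(3,5) by simp
  finally show ?thesis by simp
qed

text \<open>The condition that \<open>measurable_splitting\<close> imposes on each summand, here for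
  a field that is defined on all of M.\<close>

definition mfield :: "'x measure \<Rightarrow> ('x \<Rightarrow> (real^'m) set) \<Rightarrow> bool" where
  "mfield M F \<longleftrightarrow> (\<forall>G. open G \<longrightarrow> {x \<in> space M. F x \<inter> G \<noteq> {}} \<in> sets M)"

lemma infdist_subspace:
  assumes F: "subspace F" shows "infdist v F = norm (v - proj_mat F *v v)"
proof (rule antisym)
  show "infdist v F \<le> norm (v - proj_mat F *v v)"
    using infdist_le[OF proj_mat_in[OF F]] by (simp add: dist_norm)
  have "F \<noteq> {}" using subspace_0[OF F] by auto
  then show "norm (v - proj_mat F *v v) \<le> infdist v F"
  proof (subst infdist_notempty, simp, rule cINF_greatest)
    fix a assume a: "a \<in> F"
    have d: "proj_mat F *v v - a \<in> F" using a proj_mat_in[OF F] F by (simp add: subspace_diff)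
    have "orthogonal (v - proj_mat F *v v) (proj_mat F *v v - a)"
      using proj_mat_residual[OF F d] by (simp add: orthogonal_def)
    from norm_add_Pythagorean[OF this]
    have "(norm (v - a))\<^sup>2 = (norm (v - proj_mat F *v v))\<^sup>2 + (norm (proj_mat F *v v - a))\<^sup>2" by simp
    then show "norm (v - proj_mat F *v v) \<le> dist v a" by (simp add: dist_norm power2_le_imp_le)
  qed
qed

text \<open>\<open>F x\<close> meets the ball of radius r about v exactly when the distance from v
  to \<open>F x\<close> is below r, so distances are measurable. By Pythagoras they determine the
  quadratic form of the projection, and polarisation recovers its entries.\<close>

lemma mfield_imp_measurable_proj:
  fixes F :: "'x \<Rightarrow> (real^'m) set"
  assumes F: "\<And>x. x \<in> space M \<Longrightarrow> subspace (F x)" and mf: "mfield M F"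
  shows "(\<lambda>x. proj_mat (F x)) \<in> borel_measurable M"
proof -
  have inf_m: "(\<lambda>x. infdist v (F x)) \<in> borel_measurable M" for v
  proof (subst borel_measurable_iff_less, intro allI)
    fix r
    have "{x \<in> space M. infdist v (F x) < r} = {x \<in> space M. F x \<inter> ball v r \<noteq> {}}"
    proof (intro Collect_cong conj_cong refl)
      fix x assume x: "x \<in> space M"
      have ne: "F x \<noteq> {}" using subspace_0[OF F[OF x]] by auto
      show "infdist v (F x) < r \<longleftrightarrow> F x \<inter> ball v r \<noteq> {}"
      proof
        assume "infdist v (F x) < r"
        then show "F x \<inter> ball v r \<noteq> {}"
          using proj_mat_in[OF F[OF x], of v] by (auto simp: infdist_subspace[OF F[OF x]] dist_norm)
      next
        assume "F x \<inter> ball v r \<noteq> {}"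
        then show "infdist v (F x) < r" using infdist_le by (fastforce intro: le_less_trans)
      qed
    qed
    also have "\<dots> \<in> sets M" using mf by (simp add: mfield_def)
    finally show "{x \<in> space M. infdist v (F x) < r} \<in> sets M" .
  qed
  have q: "(\<lambda>x. (proj_mat (F x) *v v) \<bullet> v) \<in> borel_measurable M" for v
  proof -
    have "(proj_mat (F x) *v v) \<bullet> v = (norm v)\<^sup>2 - (infdist v (F x))\<^sup>2" if "x \<in> space M" for x
    proof -
      have "(proj_mat (F x) *v v) \<bullet> v = (proj_mat (F x) *v v) \<bullet> (proj_mat (F x) *v v)"
        using proj_mat_residual[OF F[OF that] proj_mat_in[OF F[OF that]], of v v]
        by (simp add: inner_diff_right inner_diff_left inner_commute)
      then show ?thesis using proj_mat_pythagoras[OF F[OF that], of v]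
        by (simp add: infdist_subspace[OF F[OF that]] dot_square_norm)
    qed
    moreover have "(\<lambda>x. (norm v)\<^sup>2 - (infdist v (F x))\<^sup>2) \<in> borel_measurable M" using inf_m by simp
    ultimately show ?thesis by (simp cong: measurable_cong)
  qed
  show ?thesis unfolding measurable_matrix_iff
  proof (intro allI)
    fix i j
    let ?p = "axis i 1 + axis j 1 :: real^'m" and ?d = "axis i 1 - axis j 1 :: real^'m"
    have eq: "proj_mat (F x) $ i $ j = ((proj_mat (F x) *v ?p) \<bullet> ?p - (proj_mat (F x) *v ?d) \<bullet> ?d) / 4"
      if "x \<in> space M" for x
    proof -
      let ?P = "proj_mat (F x)"
      have s: "(?P *v axis i 1) \<bullet> axis j 1 = (?P *v axis j 1) \<bullet> axis i 1"
        using proj_mat_inner[OF F[OF that]] by (metis inner_commute)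
      have "?P $ i $ j = (?P *v axis j 1) \<bullet> axis i 1"
        by (simp add: inner_axis matrix_vector_mul_component)
      with s show ?thesis by (simp add: algebra_simps inner_add_left inner_add_right inner_diff_left inner_diff_right matrix_vector_right_distrib matrix_vector_mult_diff_distrib)
    qed
    have "(\<lambda>x. ((proj_mat (F x) *v ?p) \<bullet> ?p - (proj_mat (F x) *v ?d) \<bullet> ?d) / 4) \<in> borel_measurable M"
      using q by simp
    then show "(\<lambda>x. proj_mat (F x) $ i $ j) \<in> borel_measurable M"
      by (rule measurable_cong[THEN iffD2, rotated]) (rule eq)
  qed
qed

text \<open>A countable dense set of arguments suffices, since the matrix acts continuously and G is
  open.\<close>

lemma mfield_range:
  fixes B :: "'x \<Rightarrow> real^'n^'m"
  assumes [measurable]: "B \<in> borel_measurable M"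
  shows "mfield M (\<lambda>x. range (\<lambda>v. B x *v v))"
  unfolding mfield_def
proof (intro allI impI)
  fix G :: "(real^'m) set" assume G: "open G"
  obtain D :: "(real^'n) set" where D: "countable D" "\<And>X. open X \<Longrightarrow> X \<noteq> {} \<Longrightarrow> \<exists>d\<in>D. d \<in> X"
    using countable_dense_setE by blast
  have [measurable]: "G \<in> sets borel" using G by simp
  have "{x \<in> space M. range (\<lambda>v. B x *v v) \<inter> G \<noteq> {}} = (\<Union>d\<in>D. {x \<in> space M. B x *v d \<in> G})"
  proof (intro set_eqI iffI)
    fix x assume "x \<in> {x \<in> space M. range (\<lambda>v. B x *v v) \<inter> G \<noteq> {}}"
    then obtain v where x: "x \<in> space M" "B x *v v \<in> G" by auto
    have "open ((\<lambda>v. B x *v v) -` G)"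
      by (intro open_vimage G continuous_intros)
    then obtain d where "d \<in> D" "B x *v d \<in> G" using D(2)[of "(\<lambda>v. B x *v v) -` G"] x(2) by auto
    then show "x \<in> (\<Union>d\<in>D. {x \<in> space M. B x *v d \<in> G})" using x by auto
  qed auto
  also have "\<dots> \<in> sets M" using D(1) by (intro sets.countable_UN') (auto simp del: measurable_matrix_vector_mult)
  finally show "{x \<in> space M. range (\<lambda>v. B x *v v) \<inter> G \<noteq> {}} \<in> sets M" .
qed

lemma mfield_cong: "(\<And>x. x \<in> space M \<Longrightarrow> F x = G x) \<Longrightarrow> mfield M F \<longleftrightarrow> mfield M G"
  unfolding mfield_def by (intro all_cong imp_cong refl arg_cong2[of _ _ _ _ "(\<in>)"]) auto

lemma mfield_iff_measurable_proj:
  assumes F: "\<And>x. x \<in> space M \<Longrightarrow> subspace (F x)"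
  shows "mfield M F \<longleftrightarrow> (\<lambda>x. proj_mat (F x)) \<in> borel_measurable M"
proof
  assume "(\<lambda>x. proj_mat (F x)) \<in> borel_measurable M"
  then have "mfield M (\<lambda>x. range (\<lambda>v. proj_mat (F x) *v v))" by (rule mfield_range)
  then show "mfield M F" using F by (simp add: range_proj_mat cong: mfield_cong)
qed (rule mfield_imp_measurable_proj[OF F])

lemma mfield_orthogonal_comp:
  assumes F: "\<And>x. x \<in> space M \<Longrightarrow> subspace (F x)" and mf: "mfield M F"
  shows "mfield M (\<lambda>x. (F x)\<^sup>\<bottom>)"
proof -
  have [measurable]: "(\<lambda>x. proj_mat (F x)) \<in> borel_measurable M" 
    by (rule mfield_imp_measurable_proj[OF F mf])
  have "(\<lambda>x. mat 1 - proj_mat (F x)) \<in> borel_measurable M" by simp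
  then show ?thesis
    by (subst mfield_iff_measurable_proj)
       (auto simp: subspace_orthogonal_comp proj_mat_orthogonal_comp F cong: measurable_cong)
qed

text \<open>An open set can meet two subspaces without meeting their intersection, so the definition
  does not help directly. Instead, the intersection is the kernel of the sum of the two residual
  projections, both positive semidefinite; as that sum is symmetric, its kernel is the orthogonal
  complement of its range.\<close>

lemma mfield_Int:
  assumes F: "\<And>x. x \<in> space M \<Longrightarrow> subspace (F x)" "mfield M F"
    and G: "\<And>x. x \<in> space M \<Longrightarrow> subspace (G x)" "mfield M G"
  shows "mfield M (\<lambda>x. F x \<inter> G x)"
proof -
  have [measurable]: "(\<lambda>x. proj_mat (F x)) \<in> borel_measurable M" "(\<lambda>x. proj_mat (G x)) \<in> borel_measurable M"
    using F G by (auto intro: mfield_imp_measurable_proj)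
  define B where "B x = (mat 1 - proj_mat (F x)) + (mat 1 - proj_mat (G x))" for x
  have [measurable]: "B \<in> borel_measurable M" unfolding B_def[abs_def] by simp
  have sub: "subspace (range (\<lambda>v. B x *v v))" for x
    by (intro linear_subspace_image) (auto simp: subspace_UNIV)
  have "F x \<inter> G x = (range (\<lambda>v. B x *v v))\<^sup>\<bottom>" if x: "x \<in> space M" for x
  proof -
    have Bv: "B x *v v = (v - proj_mat (F x) *v v) + (v - proj_mat (G x) *v v)" for v
      by (simp only: B_def matrix_vector_mult_add_rdistrib matrix_vector_mult_diff_rdistrib matrix_vector_mul_lid)
    have Bsym: "(B x *v v) \<bullet> w = v \<bullet> (B x *v w)" for v w
      unfolding Bv inner_add_left inner_add_right inner_diff_left inner_diff_right
      using proj_mat_inner[OF F(1)[OF x]] proj_mat_inner[OF G(1)[OF x]] by simp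
    have "w \<in> (range (\<lambda>v. B x *v v))\<^sup>\<bottom> \<longleftrightarrow> B x *v w = 0" for w
    proof -
      have "w \<in> (range (\<lambda>v. B x *v v))\<^sup>\<bottom> \<longleftrightarrow> (\<forall>v. v \<bullet> (B x *v w) = 0)"
        by (auto simp: orthogonal_comp_def orthogonal_def Bsym)
      also have "\<dots> \<longleftrightarrow> B x *v w = 0" by (metis inner_eq_zero_iff inner_zero_right)
      finally show ?thesis .
    qed
    moreover have "B x *v w = 0 \<longleftrightarrow> w \<in> F x \<inter> G x" for w
    proof
      assume 0: "B x *v w = 0"
      define p where "p = w - proj_mat (F x) *v w"
      define q where "q = w - proj_mat (G x) *v w"
      have "B x *v w = p + q" by (simp add: Bv p_def q_def)
      then have "p \<bullet> w + q \<bullet> w = 0" using 0 by (simp add: inner_add_left[symmetric])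
      moreover have "p \<bullet> w = p \<bullet> p" 
        using proj_mat_residual[OF F(1)[OF x] proj_mat_in[OF F(1)[OF x]], of w w]
        by (simp add: p_def inner_diff_right)
      moreover have "q \<bullet> w = q \<bullet> q" 
        using proj_mat_residual[OF G(1)[OF x] proj_mat_in[OF G(1)[OF x]], of w w]
        by (simp add: q_def inner_diff_right)
      ultimately have "p \<bullet> p = 0" "q \<bullet> q = 0" by (smt (verit) inner_ge_zero)+
      then have "proj_mat (F x) *v w = w" "proj_mat (G x) *v w = w" by (auto simp: p_def q_def)
      then show "w \<in> F x \<inter> G x" using proj_mat_in[OF F(1)[OF x], of w] proj_mat_in[OF G(1)[OF x], of w] by simp
    next
      assume "w \<in> F x \<inter> G x"
      then show "B x *v w = 0" using proj_mat_id[OF F(1)[OF x], of w] proj_mat_id[OF G(1)[OF x], of w]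
        by (simp add: Bv)
    qed
    ultimately show ?thesis by blast
  qed
  moreover have "mfield M (\<lambda>x. (range (\<lambda>v. B x *v v))\<^sup>\<bottom>)"
    by (intro mfield_orthogonal_comp sub mfield_range) simp
  ultimately show ?thesis by (simp cong: mfield_cong)
qed

lemma mfield_dim:
  assumes F: "\<And>x. x \<in> space M \<Longrightarrow> subspace (F x)" "mfield M F"
  shows "(\<lambda>x. dim (F x)) \<in> M \<rightarrow>\<^sub>M count_space UNIV"
proof -
  have [measurable]: "(\<lambda>x. proj_mat (F x)) \<in> borel_measurable M"
    using F by (rule mfield_imp_measurable_proj)
  have "(\<lambda>x. nat \<lfloor>\<Sum>i\<in>UNIV. proj_mat (F x) $ i $ i\<rfloor>) \<in> M \<rightarrow>\<^sub>M count_space UNIV" by measurable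
  then show ?thesis by (simp add: dim_eq_trace[symmetric] F cong: measurable_cong)
qed

text \<open>The witness ranges over an uncountable set. By compactness it exists iff for every L
  some point of a countable dense set satisfies the constraints with index up to L with tolerance
  \<open>1 / real (Suc L)\<close>: a limit of such approximate witnesses is exact.\<close>

lemma measurable_ex_compact:
  fixes f :: "nat \<Rightarrow> 'x \<Rightarrow> 'v::{metric_space, second_countable_topology} \<Rightarrow> real"
  assumes K: "compact K" and [measurable]: "\<And>n v. (\<lambda>x. f n x v) \<in> borel_measurable M"
    and cont: "\<And>n x. x \<in> space M \<Longrightarrow> continuous_on UNIV (f n x)"
  shows "{x \<in> space M. \<exists>v\<in>K. \<forall>n. f n x v \<le> 0} \<in> sets M"
proof -
  obtain D where D: "countable D" "D \<subseteq> K" "K \<subseteq> closure D" using separable by blast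
  have "{x \<in> space M. \<exists>v\<in>K. \<forall>n. f n x v \<le> 0} =
      {x \<in> space M. \<forall>L. \<exists>q\<in>D. \<forall>n\<in>{..L}. f n x q < 1 / real (Suc L)}"
  proof (intro Collect_cong conj_cong refl iffI allI)
    fix x L assume x: "x \<in> space M" and "\<exists>v\<in>K. \<forall>n. f n x v \<le> 0"
    then obtain v where v: "v \<in> K" "\<And>n. f n x v \<le> 0" by blast
    have "open (\<Inter>n\<in>{..L}. f n x -` {..<1 / real (Suc L)})"
      by (intro open_INT) (auto intro!: open_vimage cont x)
    moreover have "v \<in> (\<Inter>n\<in>{..L}. f n x -` {..<1 / real (Suc L)})"
      by (auto intro!: le_less_trans[OF v(2)])
    moreover have "v \<in> closure D" using v D by auto
    ultimately obtain q where "q \<in> D" "q \<in> (\<Inter>n\<in>{..L}. f n x -` {..<1 / real (Suc L)})"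
      using open_Int_closure_eq_empty[of "\<Inter>n\<in>{..L}. f n x -` {..<1 / real (Suc L)}" D] by blast
    then show "\<exists>q\<in>D. \<forall>n\<in>{..L}. f n x q < 1 / real (Suc L)" by auto
  next
    fix x assume x: "x \<in> space M" and "\<forall>L. \<exists>q\<in>D. \<forall>n\<in>{..L}. f n x q < 1 / real (Suc L)"
    then obtain q where q: "\<And>L. q L \<in> D" "\<And>L n. n \<le> L \<Longrightarrow> f n x (q L) < 1 / real (Suc L)"
      by (metis atMost_iff)
    then have "\<forall>L. q L \<in> K" using D by auto
    then obtain v r where v: "v \<in> K" "strict_mono r" "(q \<circ> r) \<longlonglongrightarrow> v"
      using K unfolding compact_def by meson
    have "f n x v \<le> 0" for n
    proof (rule LIMSEQ_le)
      have "isCont (f n x) v" using cont[OF x] by (simp add: continuous_on_eq_continuous_at)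
      then show "(\<lambda>L. f n x ((q \<circ> r) L)) \<longlonglongrightarrow> f n x v" using v(3) by (rule isCont_tendsto_compose)
      show "(\<lambda>L. 1 / real (Suc L)) \<longlonglongrightarrow> 0" using LIMSEQ_Suc[OF lim_inverse_n] by (simp add: inverse_eq_divide)
      have "f n x ((q \<circ> r) L) \<le> 1 / real (Suc L)" if "L \<ge> n" for L
      proof -
        have "L \<le> r L" using v(2) by (rule seq_suble)
        then have "f n x (q (r L)) < 1 / real (Suc (r L))" using that by (intro q(2)) auto
        also have "\<dots> \<le> 1 / real (Suc L)" using \<open>L \<le> r L\<close> by (intro divide_left_mono) auto
        finally show ?thesis by simp
      qed
      then show "\<exists>N. \<forall>L\<ge>N. f n x ((q \<circ> r) L) \<le> 1 / real (Suc L)" by blast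
    qed
    then show "\<exists>v\<in>K. \<forall>n. f n x v \<le> 0" using v(1) by blast
  qed
  also have "\<dots> = (\<Inter>L. \<Union>q\<in>D. {x \<in> space M. \<forall>n\<in>{..L}. f n x q < 1 / real (Suc L)})" by auto
  also have "\<dots> \<in> sets M"
  proof (intro sets.countable_INT)
    show "range (\<lambda>L. \<Union>q\<in>D. {x \<in> space M. \<forall>n\<in>{..L}. f n x q < 1 / real (Suc L)}) \<subseteq> sets M"
    proof clarify
      fix L
      have "{x \<in> space M. \<forall>n\<in>{..L}. f n x q < 1 / real (Suc L)} \<in> sets M" for q by measurable
      then show "(\<Union>q\<in>D. {x \<in> space M. \<forall>n\<in>{..L}. f n x q < 1 / real (Suc L)}) \<in> sets M"
        using D(1) by (intro sets.countable_UN') auto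
    qed
  qed auto
  finally show ?thesis .
qed

lemma subspace_chain_stabilizes:
  fixes S :: "nat \<Rightarrow> 'a::euclidean_space set"
  assumes sub: "\<And>n. subspace (S n)" and dec: "\<And>n. S (Suc n) \<subseteq> S n"
  obtains J where "\<And>n. n \<ge> J \<Longrightarrow> S n = S J"
proof -
  obtain J where J: "\<And>n. dim (S J) \<le> dim (S n)"
    using ex_has_least_nat[of "\<lambda>_. True" 0 "\<lambda>n. dim (S n)"] by auto
  have "S n = S J" if "n \<ge> J" for n
    using sub lift_Suc_antimono_le[of S, OF dec that] J by (intro subspace_dim_equal) auto
  then show thesis by (rule that)
qed

text \<open>At each x the dimensions stabilise, so the intersection equals one of the terms and
  meets G as soon as all terms do.\<close>

lemma mfield_decreasing_INT:
  assumes F: "\<And>j x. x \<in> space M \<Longrightarrow> subspace (F j x)" "\<And>j. mfield M (F j)"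
    and dec: "\<And>j x. x \<in> space M \<Longrightarrow> F (Suc j) x \<subseteq> F j x"
  shows "mfield M (\<lambda>x. \<Inter>j. F j x)"
  unfolding mfield_def
proof (intro allI impI)
  fix G :: "(real^'b) set" assume G: "open G"
  have "{x \<in> space M. (\<Inter>j. F j x) \<inter> G \<noteq> {}} = (\<Inter>j. {x \<in> space M. F j x \<inter> G \<noteq> {}})"
  proof (intro set_eqI iffI)
    fix x assume "x \<in> (\<Inter>j. {x \<in> space M. F j x \<inter> G \<noteq> {}})"
    then have x: "x \<in> space M" "\<And>j. F j x \<inter> G \<noteq> {}" by auto
    obtain J where J: "\<And>n. n \<ge> J \<Longrightarrow> F n x = F J x"
      using subspace_chain_stabilizes[of "\<lambda>n. F n x"] F(1) dec x(1) by blast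
    have "F J x \<subseteq> F j x" for j
    proof (cases "j \<ge> J")
      case True
      then show ?thesis using J[OF True] by blast
    next
      case False
      then show ?thesis using lift_Suc_antimono_le[of "\<lambda>j. F j x" j J] dec[OF x(1)] by auto
    qed
    then have "(\<Inter>j. F j x) = F J x" by auto
    then show "x \<in> {x \<in> space M. (\<Inter>j. F j x) \<inter> G \<noteq> {}}" using x by auto
  qed auto
  also have "\<dots> \<in> sets M" using F(2) G by (intro sets.countable_INT) (auto simp: mfield_def)
  finally show "{x \<in> space M. (\<Inter>j. F j x) \<inter> G \<noteq> {}} \<in> sets M" .
qed

section \<open>Slow subspaces of a linear cocycle\<close>

text \<open>With respect to F, G and their orthogonal complements A is block triangular. The first
  identity makes norms along an invariant subbundle submultiplicative; the second does so for the
  quotient, realised on the orthogonal complement.\<close>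

lemma proj_mat_intertwine:
  assumes F: "subspace F" and G: "subspace G" and AF: "\<And>v. v \<in> F \<Longrightarrow> A *v v \<in> G"
  shows "A ** proj_mat F = proj_mat G ** (A ** proj_mat F)"
    and "(mat 1 - proj_mat G) ** A = ((mat 1 - proj_mat G) ** A) ** (mat 1 - proj_mat F)"
proof -
  show *: "A ** proj_mat F = proj_mat G ** (A ** proj_mat F)"
    unfolding matrix_eq
    by (simp add: matrix_vector_mul_assoc[symmetric] proj_mat_id[OF G] AF proj_mat_in[OF F])
  have 0: "((mat 1 - proj_mat G) ** A) *v (proj_mat F *v v) = 0" for v
    using proj_mat_id[OF G AF[OF proj_mat_in[OF F, of v]]]
    by (simp add: matrix_vector_mul_assoc[symmetric] matrix_vector_mult_diff_rdistrib)
  show "(mat 1 - proj_mat G) ** A = ((mat 1 - proj_mat G) ** A) ** (mat 1 - proj_mat F)"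
    unfolding matrix_eq
  proof
    fix v
    let ?B = "(mat 1 - proj_mat G) ** A"
    have "(?B ** (mat 1 - proj_mat F)) *v v = ?B *v (v - proj_mat F *v v)"
      by (simp add: matrix_vector_mul_assoc[symmetric] matrix_vector_mult_diff_rdistrib)
    also have "\<dots> = ?B *v v - ?B *v (proj_mat F *v v)" by (rule matrix_vector_mult_diff_distrib)
    also have "\<dots> = ?B *v v" unfolding 0 by simp
    finally show "?B *v v = (?B ** (mat 1 - proj_mat F)) *v v" by simp
  qed
qed

lemma mat_norm_proj_mat_le: "subspace F \<Longrightarrow> mat_norm (proj_mat F) \<le> 1"
  by (rule mat_norm_le) (simp add: norm_proj_mat_le)

lemma mat_norm_residual_le: "subspace F \<Longrightarrow> mat_norm (mat 1 - proj_mat F) \<le> 1"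
  by (rule mat_norm_le) (simp add: norm_proj_mat_residual_le matrix_vector_mult_diff_rdistrib)

lemma ex_global_bound:
  fixes f g :: "nat \<Rightarrow> real"
  assumes "\<exists>N. \<forall>n\<ge>N. f n \<le> g n" "\<And>n. 0 < g n"
  shows "\<exists>K>0. \<forall>n. f n \<le> K * g n"
proof -
  obtain N where N: "\<And>n. n \<ge> N \<Longrightarrow> f n \<le> g n" using assms(1) by blast
  define K where "K = 1 + (\<Sum>n<N. \<bar>f n\<bar> / g n)"
  have nn: "0 \<le> (\<Sum>n<N. \<bar>f n\<bar> / g n)" using assms(2) by (intro sum_nonneg) (simp add: less_imp_le)
  have "f n \<le> K * g n" for n
  proof (cases "n \<ge> N")
    case True
    have "1 * g n \<le> K * g n" using nn assms(2)[of n] by (intro mult_right_mono) (auto simp: K_def)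
    then show ?thesis using N[OF True] by simp
  next
    case False
    then have "\<bar>f n\<bar> / g n \<le> (\<Sum>n<N. \<bar>f n\<bar> / g n)"
      using assms(2) by (intro member_le_sum) (auto simp: less_imp_le)
    then have "\<bar>f n\<bar> / g n \<le> K" by (simp add: K_def)
    then show ?thesis using assms(2)[of n] by (simp add: field_simps)
  qed
  moreover have "0 < K" using nn by (simp add: K_def)
  ultimately show ?thesis by blast
qed

text \<open>Exponential bounds with a constant stand for an upper limit of logarithms, so the zero
  vector is no special case. Only nonnegative indices enter, but C is indexed by integers: the
  backward slow space is the same definition for \<open>\<lambda>n. C (-n)\<close>.\<close>

definition slow :: "(int \<Rightarrow> 'x \<Rightarrow> real^'m^'m) \<Rightarrow> real \<Rightarrow> 'x \<Rightarrow> (real^'m) set" where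
  "slow C c x = {v. \<forall>\<epsilon>>0. \<exists>K. \<forall>n::nat. norm (C (int n) x *v v) \<le> K * exp ((c + \<epsilon>) * real n)}"

lemma slowD:
  assumes "v \<in> slow C c x" "0 < \<epsilon>"
  shows "\<exists>K\<ge>0. \<forall>n::nat. norm (C (int n) x *v v) \<le> K * exp ((c + \<epsilon>) * real n)"
proof -
  obtain K where K: "\<And>n::nat. norm (C (int n) x *v v) \<le> K * exp ((c + \<epsilon>) * real n)"
    using assms unfolding slow_def by blast
  have "0 \<le> K" using order.trans[OF norm_ge_zero K[of 0]] by simp
  with K show ?thesis by blast
qed

lemma slowI:
  assumes "\<And>i::nat. \<exists>K. \<forall>n::nat. norm (C (int n) x *v v) \<le> K * exp ((c + 1 / real (Suc i)) * real n)"
  shows "v \<in> slow C c x"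
  unfolding slow_def mem_Collect_eq
proof (intro allI impI)
  fix \<epsilon> :: real assume "0 < \<epsilon>"
  then obtain i :: nat where i: "1 / real (Suc i) < \<epsilon>" using nat_approx_posE by blast
  obtain K where K: "\<And>n::nat. norm (C (int n) x *v v) \<le> K * exp ((c + 1 / real (Suc i)) * real n)"
    using assms by blast
  have K0: "0 \<le> K" using order.trans[OF norm_ge_zero K[of 0]] by simp
  have "norm (C (int n) x *v v) \<le> K * exp ((c + \<epsilon>) * real n)" for n :: nat
  proof -
    have "(c + 1 / real (Suc i)) * real n \<le> (c + \<epsilon>) * real n" using i by (intro mult_right_mono) auto
    then have "K * exp ((c + 1 / real (Suc i)) * real n) \<le> K * exp ((c + \<epsilon>) * real n)"
      using K0 by (intro mult_left_mono) auto
    with K[of n] show ?thesis by linarith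
  qed
  then show "\<exists>K. \<forall>n::nat. norm (C (int n) x *v v) \<le> K * exp ((c + \<epsilon>) * real n)" by blast
qed

lemma subspace_slow: "subspace (slow C c x)"
proof (rule subspaceI)
  show "0 \<in> slow C c x" by (auto simp: slow_def intro!: exI[of _ 0])
next
  fix v w assume v: "v \<in> slow C c x" and w: "w \<in> slow C c x"
  show "v + w \<in> slow C c x" unfolding slow_def mem_Collect_eq
  proof (intro allI impI)
    fix \<epsilon> :: real assume "0 < \<epsilon>"
    obtain K where K: "\<And>n::nat. norm (C (int n) x *v v) \<le> K * exp ((c + \<epsilon>) * real n)"
      using slowD[OF v \<open>0 < \<epsilon>\<close>] by blast
    obtain L where L: "\<And>n::nat. norm (C (int n) x *v w) \<le> L * exp ((c + \<epsilon>) * real n)"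
      using slowD[OF w \<open>0 < \<epsilon>\<close>] by blast
    have "norm (C (int n) x *v (v + w)) \<le> (K + L) * exp ((c + \<epsilon>) * real n)" for n :: nat
      using K[of n] L[of n] norm_triangle_ineq[of "C (int n) x *v v" "C (int n) x *v w"]
      by (simp add: matrix_vector_right_distrib distrib_right)
    then show "\<exists>K. \<forall>n::nat. norm (C (int n) x *v (v + w)) \<le> K * exp ((c + \<epsilon>) * real n)" by blast
  qed
next
  fix r v assume v: "v \<in> slow C c x"
  show "r *\<^sub>R v \<in> slow C c x" unfolding slow_def mem_Collect_eq
  proof (intro allI impI)
    fix \<epsilon> :: real assume "0 < \<epsilon>"
    obtain K where K: "\<And>n::nat. norm (C (int n) x *v v) \<le> K * exp ((c + \<epsilon>) * real n)"
      using slowD[OF v \<open>0 < \<epsilon>\<close>] by blast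
    have "norm (C (int n) x *v (r *\<^sub>R v)) \<le> (\<bar>r\<bar> * K) * exp ((c + \<epsilon>) * real n)" for n :: nat
      using mult_left_mono[OF K[of n], of "\<bar>r\<bar>"] by (simp add: matrix_vector_mult_scaleR mult.assoc)
    then show "\<exists>K. \<forall>n::nat. norm (C (int n) x *v (r *\<^sub>R v)) \<le> K * exp ((c + \<epsilon>) * real n)" by blast
  qed
qed

lemma slow_mono:
  assumes "c \<le> d" shows "slow C c x \<subseteq> slow C d x"
proof
  fix v assume v: "v \<in> slow C c x"
  show "v \<in> slow C d x"
    unfolding slow_def mem_Collect_eq
  proof (intro allI impI)
    fix \<epsilon> :: real assume "0 < \<epsilon>"
    then have e: "0 < d - c + \<epsilon>" using assms by simp
    have "c + (d - c + \<epsilon>) = d + \<epsilon>" by simp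
    then show "\<exists>K. \<forall>n::nat. norm (C (int n) x *v v) \<le> K * exp ((d + \<epsilon>) * real n)"
      using slowD[OF v e] by auto
  qed
qed

lemma slow_right_limit:
  assumes "\<And>r. c < r \<Longrightarrow> v \<in> slow C r x" shows "v \<in> slow C c x"
  unfolding slow_def mem_Collect_eq
proof (intro allI impI)
  fix \<epsilon> :: real assume "0 < \<epsilon>"
  then have v: "v \<in> slow C (c + \<epsilon>/2) x" "0 < \<epsilon> / 2" using assms by auto
  have "c + \<epsilon>/2 + \<epsilon>/2 = c + \<epsilon>" by simp
  then show "\<exists>K. \<forall>n::nat. norm (C (int n) x *v v) \<le> K * exp ((c + \<epsilon>) * real n)"
    using slowD[OF v] by metis
qed

text \<open>The constant in \<open>slow\<close> depends on the vector. Adding up the constants of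
  the projected coordinate vectors gives one for the whole subspace.\<close>

lemma slow_uniform:
  assumes "0 < \<epsilon>"
  obtains K where "0 < K" "\<And>n::nat. mat_norm (C (int n) x ** proj_mat (slow C c x)) \<le> K * exp ((c + \<epsilon>) * real n)"
    "\<And>(n::nat) v. v \<in> slow C c x \<Longrightarrow> norm (C (int n) x *v v) \<le> K * exp ((c + \<epsilon>) * real n) * norm v"
proof -
  let ?F = "slow C c x"
  let ?P = "proj_mat ?F"
  have "\<exists>K\<ge>0. \<forall>n::nat. norm (C (int n) x *v (?P *v axis i 1)) \<le> K * exp ((c + \<epsilon>) * real n)" for i
  proof (rule slowD[OF _ assms])
    show "?P *v axis i 1 \<in> ?F" by (rule proj_mat_in[OF subspace_slow])
  qed
  then obtain k where k: "\<And>i. 0 \<le> k i"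
    "\<And>i (n::nat). norm (C (int n) x *v (?P *v axis i 1)) \<le> k i * exp ((c + \<epsilon>) * real n)" by metis
  define K where "K = 1 + (\<Sum>i\<in>UNIV. k i)"
  have K: "0 < K" using k(1) by (simp add: K_def add_pos_nonneg sum_nonneg)
  have main: "norm ((C (int n) x ** ?P) *v v) \<le> K * exp ((c + \<epsilon>) * real n) * norm v" for n :: nat and v
  proof -
    have "v = (\<Sum>i\<in>UNIV. (v $ i) *\<^sub>R axis i 1)" using basis_expansion[of v] by (simp add: scalar_mult_eq_scaleR)
    then have "(C (int n) x ** ?P) *v v = (C (int n) x ** ?P) *v (\<Sum>i\<in>UNIV. (v $ i) *\<^sub>R axis i 1)"
      by (rule arg_cong)
    also have "\<dots> = (\<Sum>i\<in>UNIV. (C (int n) x ** ?P) *v ((v $ i) *\<^sub>R axis i 1))"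
      by (rule linear_sum[OF matrix_vector_mul_linear])
    also have "\<dots> = (\<Sum>i\<in>UNIV. (v $ i) *\<^sub>R ((C (int n) x ** ?P) *v axis i 1))"
      by (simp only: matrix_vector_mult_scaleR)
    also have "norm \<dots> \<le> (\<Sum>i\<in>UNIV. norm v * (k i * exp ((c + \<epsilon>) * real n)))"
    proof (intro sum_norm_le)
      fix i
      have "norm ((v $ i) *\<^sub>R ((C (int n) x ** ?P) *v axis i 1)) = \<bar>v $ i\<bar> * norm (C (int n) x *v (?P *v axis i 1))"
        by (simp add: matrix_vector_mul_assoc)
      also have "\<dots> \<le> norm v * (k i * exp ((c + \<epsilon>) * real n))"
        by (intro mult_mono component_le_norm_cart k) auto
      finally show "norm ((v $ i) *\<^sub>R ((C (int n) x ** ?P) *v axis i 1)) \<le> norm v * (k i * exp ((c + \<epsilon>) * real n))" .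
    qed
    also have "\<dots> = (\<Sum>i\<in>UNIV. k i) * exp ((c + \<epsilon>) * real n) * norm v"
      by (simp add: sum_distrib_right sum_distrib_left mult.commute mult.left_commute)
    also have "\<dots> \<le> K * exp ((c + \<epsilon>) * real n) * norm v"
      by (intro mult_right_mono) (auto simp: K_def)
    finally show ?thesis .
  qed
  show thesis
  proof (rule that[OF K])
    show "mat_norm (C (int n) x ** ?P) \<le> K * exp ((c + \<epsilon>) * real n)" for n :: nat
      by (rule mat_norm_le) (rule main)
    show "norm (C (int n) x *v v) \<le> K * exp ((c + \<epsilon>) * real n) * norm v" if "v \<in> ?F" for n :: nat and v
      using main[of n v] proj_mat_id[OF subspace_slow that] by (simp add: matrix_vector_mul_assoc[symmetric])
  qed
qed

text \<open>The function \<phi> bounds the logarithmic size of one step and of its inverse, which is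
  \<open>C (-1) (T 1 x)\<close>. The assumptions are closed under time reversal and under passing to
  inverse transposes, so each result proved here is available for these cocycles as well.\<close>

locale lin_cocycle = prob_space M for M :: "'x measure" +
  fixes T :: "int \<Rightarrow> 'x \<Rightarrow> 'x" and C :: "int \<Rightarrow> 'x \<Rightarrow> real^'m^'m" and \<phi> :: "'x \<Rightarrow> real"
  assumes T_meas [measurable]: "\<And>n. T n \<in> M \<rightarrow>\<^sub>M M"
    and T_distr: "\<And>n. distr M M (T n) = M"
    and T_0: "\<And>x. x \<in> space M \<Longrightarrow> T 0 x = x"
    and T_add: "\<And>x m n. x \<in> space M \<Longrightarrow> T (m + n) x = T m (T n x)"
    and C_meas [measurable]: "\<And>n. C n \<in> borel_measurable M"
    and C_0: "\<And>x. x \<in> space M \<Longrightarrow> C 0 x = mat 1"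
    and C_add: "\<And>x n m. x \<in> space M \<Longrightarrow> C (n + m) x = C m (T n x) ** C n x"
    and \<phi>_int: "integrable M \<phi>" and \<phi>_nonneg: "\<And>x. x \<in> space M \<Longrightarrow> 0 \<le> \<phi> x"
    and C_le: "\<And>x. x \<in> space M \<Longrightarrow> mat_norm (C 1 x) \<le> exp (\<phi> x)"
    and C_inv_le: "\<And>x. x \<in> space M \<Longrightarrow> mat_norm (C (-1) (T 1 x)) \<le> exp (\<phi> x)"
begin

lemma T_space [simp]: "x \<in> space M \<Longrightarrow> T n x \<in> space M"
  using measurable_space[OF T_meas] by blast

lemma T_inv [simp]: "x \<in> space M \<Longrightarrow> T (-n) (T n x) = x" "x \<in> space M \<Longrightarrow> T n (T (-n) x) = x"
  using T_add[of x "-n" n] T_add[of x n "-n"] T_0 by auto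

lemma C_inv: 
  assumes "x \<in> space M"
  shows "C (-n) (T n x) ** C n x = mat 1" "C n x ** C (-n) (T n x) = mat 1"
proof -
  show "C (-n) (T n x) ** C n x = mat 1" using C_add[of x n "-n"] C_0 assms by simp
  show "C n x ** C (-n) (T n x) = mat 1" using C_add[of "T n x" "-n" n] C_0 assms by simp
qed

lemma C_invv:
  assumes "x \<in> space M"
  shows "C (-n) (T n x) *v (C n x *v v) = v" "C n x *v (C (-n) (T n x) *v v) = v"
  using C_inv[OF assms, of n] by (simp_all add: matrix_vector_mul_assoc)

sublocale fwd: semiflow M "\<lambda>n. T (int n)"
proof
  show "T (int (n + m)) x = T (int m) (T (int n) x)" if "x \<in> space M" for x n m
    using T_add[OF that, of "int m" "int n"] by (simp add: add.commute)
qed (auto simp: T_distr T_0)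

text \<open>A backward step from x inverts the forward step from \<open>T (-1) x\<close>, so \<phi>
  has to be read there.\<close>

lemma rev_cocycle: "lin_cocycle M (\<lambda>n. T (-n)) (\<lambda>n. C (-n)) (\<lambda>x. \<phi> (T (-1) x))"
proof
  show "T (- (m + n)) x = T (- m) (T (- n) x)" if "x \<in> space M" for x m n
    using T_add[OF that, of "-m" "-n"] by simp
  show "C (- (n + m)) x = C (- m) (T (- n) x) ** C (- n) x" if "x \<in> space M" for x n m
    using C_add[OF that, of "-n" "-m"] by simp
  show "integrable M (\<lambda>x. \<phi> (T (- 1) x))"
    using integrable_distr[of "T (-1)" M M \<phi>] \<phi>_int T_distr by simp
  show "mat_norm (C (- 1) x) \<le> exp (\<phi> (T (- 1) x))" if "x \<in> space M" for x
    using C_inv_le[of "T (-1) x"] that by simp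
  show "mat_norm (C (- (- 1)) (T (- 1) x)) \<le> exp (\<phi> (T (- 1) x))" if "x \<in> space M" for x
    using C_le[of "T (-1) x"] that by simp
qed (auto simp: T_distr T_0 C_0 \<phi>_nonneg)

text \<open>Inversion and transposition both reverse products, so together they keep the cocycle
  rule over the same T. The bounds on a step and on its inverse change places, which leaves \<phi>
  as it is.\<close>

lemma dual_cocycle: "lin_cocycle M T (\<lambda>n x. transpose (C (-n) (T n x))) \<phi>"
proof
  show "transpose (C (- (n + m)) (T (n + m) x)) = transpose (C (- m) (T m (T n x))) ** transpose (C (- n) (T n x))"
    if x: "x \<in> space M" for x n m
  proof -
    have "C (- (n + m)) (T (n + m) x) = C (-m + -n) (T m (T n x))"
      using T_add[OF x, of m n] by (simp add: add.commute)
    also have "\<dots> = C (-n) (T (-m) (T m (T n x))) ** C (-m) (T m (T n x))"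
      using x by (intro C_add) simp
    finally show ?thesis using x by (simp add: matrix_transpose_mul)
  qed
  show "mat_norm (transpose (C (- 1) (T 1 x))) \<le> exp (\<phi> x)" if "x \<in> space M" for x
    using C_inv_le[OF that] by (simp add: mat_norm_transpose)
  show "mat_norm (transpose (C (- (- 1)) (T (- 1) (T 1 x)))) \<le> exp (\<phi> x)" if "x \<in> space M" for x
    using C_le[OF that] that T_inv(1)[OF that, of 1] by (simp add: mat_norm_transpose)
qed (auto simp: T_distr T_0 C_0 \<phi>_nonneg \<phi>_int intro: T_add)

lemma mat_norm_C_le:
  assumes "x \<in> space M"
  shows "mat_norm (C (int n) x) \<le> exp (fwd.bsum \<phi> n x)"
    and "mat_norm (C (- int n) (T (int n) x)) \<le> exp (fwd.bsum \<phi> n x)"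
proof (induction n)
  case 0
  { case 1 show ?case using assms by (simp add: C_0) }
  { case 2 show ?case using assms by (simp add: C_0 T_0) }
next
  case (Suc n)
  have s: "int (Suc n) = int n + 1" by simp
  have y: "T (int n) x \<in> space M" using assms by simp
  { case 1
    have "mat_norm (C (int (Suc n)) x) \<le> mat_norm (C 1 (T (int n) x)) * mat_norm (C (int n) x)"
      unfolding s C_add[OF assms] by (rule mat_norm_mult)
    also have "\<dots> \<le> exp (\<phi> (T (int n) x)) * exp (fwd.bsum \<phi> n x)"
      by (intro mult_mono C_le[OF y] Suc) auto
    finally show ?case by (simp add: fwd.bsum_Suc exp_add mult.commute) }
  { case 2
    have "C (- int (Suc n)) (T (int (Suc n)) x) = C (-1 + - int n) (T 1 (T (int n) x))"
      using T_add[OF assms, of 1 "int n"] by simp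
    also have "\<dots> = C (- int n) (T (int n) x) ** C (-1) (T 1 (T (int n) x))"
      using y by (subst C_add) auto
    finally have "mat_norm (C (- int (Suc n)) (T (int (Suc n)) x))
        \<le> mat_norm (C (- int n) (T (int n) x)) * mat_norm (C (-1) (T 1 (T (int n) x)))"
      by (metis mat_norm_mult)
    also have "\<dots> \<le> exp (fwd.bsum \<phi> n x) * exp (\<phi> (T (int n) x))"
      by (intro mult_mono C_inv_le[OF y] Suc) auto
    finally show ?case by (simp add: fwd.bsum_Suc exp_add mult.commute) }
qed

lemma slow_step:
  assumes x: "x \<in> space M"
  shows "C 1 x *v v \<in> slow C c (T 1 x) \<longleftrightarrow> v \<in> slow C c x"
proof -
  have s: "C (int n) (T 1 x) *v (C 1 x *v v) = C (int (Suc n)) x *v v" for n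
    using C_add[OF x, of 1 "int n"] by (simp add: matrix_vector_mul_assoc)
  show ?thesis
  proof
    assume a: "C 1 x *v v \<in> slow C c (T 1 x)"
    show "v \<in> slow C c x" unfolding slow_def mem_Collect_eq
    proof (intro allI impI)
      fix \<epsilon> :: real assume "0 < \<epsilon>"
      from slowD[OF a this] obtain K where K: "K \<ge> 0" 
        "\<And>n::nat. norm (C (int (Suc n)) x *v v) \<le> K * exp ((c + \<epsilon>) * real n)" unfolding s by blast
      define L where "L = max (norm v) (K * exp (-(c + \<epsilon>)))"
      have "norm (C (int n) x *v v) \<le> L * exp ((c + \<epsilon>) * real n)" for n :: nat
      proof (cases n)
        case 0 then show ?thesis using x by (simp add: C_0 L_def)
      next
        case (Suc k)
        have "norm (C (int n) x *v v) \<le> K * exp ((c + \<epsilon>) * real k)" using K(2)[of k] Suc by simp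
        also have "\<dots> = (K * exp (-(c + \<epsilon>))) * exp ((c + \<epsilon>) * real n)"
          using Suc by (simp add: exp_add[symmetric] algebra_simps)
        also have "\<dots> \<le> L * exp ((c + \<epsilon>) * real n)" by (intro mult_right_mono) (auto simp: L_def)
        finally show ?thesis .
      qed
      then show "\<exists>K. \<forall>n::nat. norm (C (int n) x *v v) \<le> K * exp ((c + \<epsilon>) * real n)" by blast
    qed
  next
    assume a: "v \<in> slow C c x"
    show "C 1 x *v v \<in> slow C c (T 1 x)" unfolding slow_def mem_Collect_eq s
    proof (intro allI impI)
      fix \<epsilon> :: real assume "0 < \<epsilon>"
      from slowD[OF a this] obtain K where K: "K \<ge> 0" 
        "\<And>n::nat. norm (C (int n) x *v v) \<le> K * exp ((c + \<epsilon>) * real n)" by blast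
      have "norm (C (int (Suc n)) x *v v) \<le> (K * exp (c + \<epsilon>)) * exp ((c + \<epsilon>) * real n)" for n :: nat
        using K(2)[of "Suc n"] by (simp add: exp_add[symmetric] algebra_simps)
      then show "\<exists>K. \<forall>n::nat. norm (C (int (Suc n)) x *v v) \<le> K * exp ((c + \<epsilon>) * real n)" by blast
    qed
  qed
qed

lemma slow_equivariant:
  assumes x: "x \<in> space M"
  shows "C n x *v v \<in> slow C c (T n x) \<longleftrightarrow> v \<in> slow C c x"
  using x
proof (induction n arbitrary: x v rule: int_induct[where k = 0])
  case base then show ?case by (simp add: C_0 T_0)
next
  case (step1 i)
  have "C (i + 1) x *v v = C 1 (T i x) *v (C i x *v v)"
    using C_add[OF step1.prems, of i 1] by (simp add: matrix_vector_mul_assoc)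
  moreover have "T (i + 1) x = T 1 (T i x)" using T_add[OF step1.prems, of 1 i] by (simp add: add.commute)
  ultimately show ?case using step1.IH[OF step1.prems, of v] slow_step[of "T i x" "C i x *v v" c] step1.prems by simp
next
  case (step2 i)
  have "C i x *v v = C 1 (T (i - 1) x) *v (C (i - 1) x *v v)"
    using C_add[OF step2.prems, of "i - 1" 1] by (simp add: matrix_vector_mul_assoc)
  moreover have "T i x = T 1 (T (i - 1) x)" using T_add[OF step2.prems, of 1 "i - 1"] by simp
  ultimately show ?case using step2.IH[OF step2.prems, of v] slow_step[of "T (i - 1) x" "C (i - 1) x *v v" c] step2.prems by simp
qed

text \<open>At a fixed rate, an open set is a countable union of compact sets and the constant may
  be a natural number, so \<open>measurable_ex_compact\<close> applies. The rates
  \<open>c + 1 / real (Suc j)\<close> then give a decreasing sequence of subspaces with intersection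
  \<open>slow C c x\<close>.\<close>

lemma mfield_slow: "mfield M (slow C c)"
proof -
  define S where "S j x = {v. \<exists>K. \<forall>n::nat. norm (C (int n) x *v v) \<le> K * exp ((c + 1 / real (Suc j)) * real n)}" for j x
  have S_slow: "slow C c x = (\<Inter>j. S j x)" for x
  proof (intro set_eqI iffI)
    fix v assume v: "v \<in> slow C c x"
    have "v \<in> S j x" for j using slowD[OF v, of "1 / real (Suc j)"] by (auto simp: S_def)
    then show "v \<in> (\<Inter>j. S j x)" by blast
  next
    fix v assume "v \<in> (\<Inter>j. S j x)"
    then show "v \<in> slow C c x" by (intro slowI) (auto simp: S_def)
  qed
  have sub: "subspace (S j x)" for j x
  proof (rule subspaceI)
    let ?e = "\<lambda>n::nat. exp ((c + 1 / real (Suc j)) * real n)"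
    show "0 \<in> S j x" by (auto simp: S_def intro!: exI[of _ 0])
    fix v assume "v \<in> S j x"
    then obtain K where K: "\<And>n::nat. norm (C (int n) x *v v) \<le> K * ?e n" by (auto simp: S_def)
    have "norm (C (int n) x *v (r *\<^sub>R v)) \<le> (\<bar>r\<bar> * K) * ?e n" for r and n :: nat
      using mult_left_mono[OF K[of n], of "\<bar>r\<bar>"] by (simp add: matrix_vector_mult_scaleR mult.assoc)
    then show "r *\<^sub>R v \<in> S j x" for r unfolding S_def by blast
    fix w assume "w \<in> S j x"
    then obtain L where L: "\<And>n::nat. norm (C (int n) x *v w) \<le> L * ?e n" by (auto simp: S_def)
    have "norm (C (int n) x *v (v + w)) \<le> (K + L) * ?e n" for n :: nat
      using K[of n] L[of n] norm_triangle_ineq[of "C (int n) x *v v" "C (int n) x *v w"]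
      by (simp add: matrix_vector_right_distrib distrib_right)
    then show "v + w \<in> S j x" unfolding S_def by blast
  qed
  have dec: "S (Suc j) x \<subseteq> S j x" for j x
  proof
    fix v assume "v \<in> S (Suc j) x"
    then obtain K where K: "\<And>n::nat. norm (C (int n) x *v v) \<le> K * exp ((c + 1 / real (Suc (Suc j))) * real n)"
      unfolding S_def by blast
    have K0: "0 \<le> K" using order.trans[OF norm_ge_zero K[of 0]] by simp
    have "norm (C (int n) x *v v) \<le> K * exp ((c + 1 / real (Suc j)) * real n)" for n :: nat
    proof -
      have "(c + 1 / real (Suc (Suc j))) * real n \<le> (c + 1 / real (Suc j)) * real n"
        by (intro mult_right_mono) (auto simp: field_simps)
      then have "K * exp ((c + 1 / real (Suc (Suc j))) * real n) \<le> K * exp ((c + 1 / real (Suc j)) * real n)"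
        using K0 by (intro mult_left_mono) auto
      with K[of n] show ?thesis by linarith
    qed
    then show "v \<in> S j x" unfolding S_def by blast
  qed
  have mf: "mfield M (S j)" for j
    unfolding mfield_def
  proof (intro allI impI)
    fix G :: "(real^'m) set" assume "open G"
    then obtain D where D: "\<And>n::nat. compact (D n)" "\<Union>(range D) = G"
      using open_Union_compact_subsets by metis
    let ?e = "\<lambda>n::nat. exp ((c + 1 / real (Suc j)) * real n)"
    have "{x \<in> space M. S j x \<inter> G \<noteq> {}} =
        (\<Union>i. \<Union>K::nat. {x \<in> space M. \<exists>v\<in>D i. \<forall>n::nat. norm (C (int n) x *v v) - real K * ?e n \<le> 0})"
    proof (intro set_eqI iffI)
      fix x assume "x \<in> {x \<in> space M. S j x \<inter> G \<noteq> {}}"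
      then obtain v K where v: "x \<in> space M" "v \<in> G" "\<And>n::nat. norm (C (int n) x *v v) \<le> K * ?e n"
        by (auto simp: S_def)
      obtain i where i: "v \<in> D i" using v(2) D(2) by blast
      obtain k :: nat where k: "K \<le> real k" using real_arch_simple by blast
      have "norm (C (int n) x *v v) - real k * ?e n \<le> 0" for n
      proof -
        have "K * ?e n \<le> real k * ?e n" using k by (intro mult_right_mono) auto
        then show ?thesis using v(3)[of n] by linarith
      qed
      then show "x \<in> (\<Union>i. \<Union>K::nat. {x \<in> space M. \<exists>v\<in>D i. \<forall>n::nat. norm (C (int n) x *v v) - real K * ?e n \<le> 0})"
        using v(1) i by blast
    next
      fix x assume "x \<in> (\<Union>i. \<Union>K::nat. {x \<in> space M. \<exists>v\<in>D i. \<forall>n::nat. norm (C (int n) x *v v) - real K * ?e n \<le> 0})"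
      then obtain i k v where v: "x \<in> space M" "v \<in> D i" "\<And>n::nat. norm (C (int n) x *v v) \<le> real k * ?e n"
        by auto
      then have "v \<in> S j x \<inter> G" using D(2) unfolding S_def by blast
      then show "x \<in> {x \<in> space M. S j x \<inter> G \<noteq> {}}" using v(1) by blast
    qed
    also have "\<dots> \<in> sets M"
      by (intro sets.countable_UN'' measurable_ex_compact D(1)) (auto intro!: continuous_intros)
    finally show "{x \<in> space M. S j x \<inter> G \<noteq> {}} \<in> sets M" .
  qed
  have "mfield M (\<lambda>x. \<Inter>j. S j x)" using sub mf dec by (rule mfield_decreasing_INT)
  then show ?thesis by (simp add: S_slow[abs_def])
qed

lemma measurable_proj_slow [measurable]: "(\<lambda>x. proj_mat (slow C c x)) \<in> borel_measurable M"
  by (rule mfield_imp_measurable_proj[OF subspace_slow mfield_slow])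

end

lemma ln_le_iff: "0 < x \<Longrightarrow> ln x \<le> y \<longleftrightarrow> x \<le> exp (y::real)"
  by (metis exp_le_cancel_iff exp_ln)

section \<open>Lower growth bounds on the backward slow spaces\<close>

context lin_cocycle
begin

text \<open>A weak form of Birkhoff's theorem. If the averages exceed j infinitely often on an
  invariant set, then the integral of \<phi> is at least j times its measure. So almost no point
  belongs to these sets for every j.\<close>

lemma AE_bsum_linear: "AE x in M. \<exists>L. \<forall>n. fwd.bsum \<phi> n x \<le> L * real n"
proof -
  have sa: "fwd.subadd (space M) (fwd.bsum \<phi>) \<phi>"
    unfolding fwd.subadd_def
  proof (intro conjI allI ballI)
    show "fwd.inv_set (space M)" by (simp add: fwd.inv_set_def)
    fix x n assume x: "x \<in> space M"
    show "fwd.bsum \<phi> (n + m) x \<le> fwd.bsum \<phi> n x + fwd.bsum \<phi> m (T (int n) x)" for m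
      using fwd.bsum_add[OF x] by simp
    have nn: "0 \<le> fwd.bsum \<phi> n x" by (rule fwd.bsum_nonneg[OF \<phi>_nonneg x])
    then show "\<bar>fwd.bsum \<phi> n x\<bar> \<le> fwd.bsum \<phi> n x" by simp
    have "fwd.bsum \<phi> (Suc n) x = \<phi> x + fwd.bsum \<phi> n (T (int 1) x)" by (rule fwd.bsum_Suc_left[OF x])
    then show "fwd.bsum \<phi> n (T (int 1) x) \<le> \<phi> x + fwd.bsum \<phi> (Suc n) x"
      using \<phi>_nonneg[OF x] by simp
  qed (use \<phi>_int \<phi>_nonneg in auto)
  define B where "B j = {x \<in> space M. up (\<lambda>n. fwd.bsum \<phi> n x) (real j)}" for j :: nat
  have B: "fwd.inv_set (B j)" for j using fwd.inv_set_up[OF sa, of "real j"] by (simp add: B_def)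
  have bd: "real j * measure M (B j) \<le> (\<integral>x. \<phi> x \<partial>M)" for j
  proof -
    have "real 1 * real j * measure M (B j) \<le> (\<integral>x. indicator (B j) x * fwd.bsum \<phi> 1 x \<partial>M)"
      by (rule fwd.subadditive_integral_ge[OF fwd.subadd_subset[OF sa B]]) (auto simp: B_def)
    also have "\<dots> \<le> (\<integral>x. \<phi> x \<partial>M)"
    proof (rule integral_mono[OF fwd.integrable_ind \<phi>_int])
      show "B j \<in> sets M" using B by (simp add: fwd.inv_set_def)
      show "integrable M (fwd.bsum \<phi> 1)" by (rule fwd.integrable_bsum[OF \<phi>_int])
      show "indicator (B j) x * fwd.bsum \<phi> 1 x \<le> \<phi> x" if "x \<in> space M" for x
        using \<phi>_nonneg[OF that] that by (simp add: fwd.bsum_def T_0 indicator_def)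
    qed
    finally show ?thesis by simp
  qed
  define N where "N = (\<Inter>j. B j)"
  have Nm: "N \<in> sets M" unfolding N_def using B by (intro sets.countable_INT) (auto simp: fwd.inv_set_def)
  have "measure M N \<le> 0"
  proof (rule ccontr)
    assume "\<not> measure M N \<le> 0"
    then have p: "measure M N > 0" by simp
    obtain j :: nat where j: "real j > (\<integral>x. \<phi> x \<partial>M) / measure M N" using reals_Archimedean2 by blast
    then have "(\<integral>x. \<phi> x \<partial>M) < real j * measure M N" using p by (simp add: field_simps)
    also have "\<dots> \<le> real j * measure M (B j)"
      using B by (intro mult_left_mono finite_measure_mono) (auto simp: N_def fwd.inv_set_def)
    finally show False using bd[of j] by simp
  qed
  then have "N \<in> null_sets M" using Nm measure_nonneg[of M N]
    by (auto simp: null_sets_def emeasure_eq_measure)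
  then have "AE x in M. x \<notin> N" by (rule AE_not_in)
  with AE_space show ?thesis
  proof eventually_elim
    case (elim x)
    then obtain j where "\<not> up (\<lambda>n. fwd.bsum \<phi> n x) (real j)" by (auto simp: N_def B_def)
    then obtain N0 where N0: "\<And>n. n \<ge> N0 \<Longrightarrow> fwd.bsum \<phi> n x \<le> (real j + 1) * real n"
      unfolding not_up_iff by (meson zero_less_one)
    define K where "K = (\<Sum>n<N0. fwd.bsum \<phi> n x)"
    have K0: "0 \<le> K" unfolding K_def using fwd.bsum_nonneg[OF \<phi>_nonneg elim(1)] by (intro sum_nonneg) auto
    have "fwd.bsum \<phi> n x \<le> (real j + 1 + K) * real n" for n
    proof (cases "n \<ge> N0 \<or> n = 0")
      case True
      moreover have "0 \<le> K * real n" using K0 by simp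
      ultimately show ?thesis using N0[of n] by (auto simp: distrib_right)
    next
      case False
      then have "fwd.bsum \<phi> n x \<le> K" unfolding K_def
        using fwd.bsum_nonneg[OF \<phi>_nonneg elim(1)] by (intro member_le_sum) auto
      also have "K \<le> (real j + 1 + K) * 1" by simp
      also have "\<dots> \<le> (real j + 1 + K) * real n" using K0 False by (intro mult_left_mono) auto
      finally show ?thesis .
    qed
    then show ?case by blast
  qed
qed

lemma AE_slow_UNIV: "AE x in M. \<exists>L. slow C L x = UNIV"
  using AE_bsum_linear AE_space
proof eventually_elim
  case (elim x)
  then obtain L where L: "\<And>n. fwd.bsum \<phi> n x \<le> L * real n" by blast
  have "v \<in> slow C L x" for v
    unfolding slow_def mem_Collect_eq
  proof (intro allI impI exI)
    fix \<epsilon> :: real and n :: nat assume "0 < \<epsilon>"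
    have "norm (C (int n) x *v v) \<le> exp (fwd.bsum \<phi> n x) * norm v"
      by (rule order.trans[OF mat_norm_bound mult_right_mono[OF mat_norm_C_le(1)[OF elim(2)] norm_ge_zero]])
    also have "\<dots> \<le> exp ((L + \<epsilon>) * real n) * norm v"
      using L[of n] \<open>0 < \<epsilon>\<close> by (intro mult_right_mono) (auto simp: algebra_simps intro: add_increasing2)
    finally show "norm (C (int n) x *v v) \<le> norm v * exp ((L + \<epsilon>) * real n)" by (simp add: mult.commute)
  qed
  then show ?case by blast
qed

lemma subspace_zero_iff_proj: "proj_mat (slow C c x) \<noteq> 0 \<longleftrightarrow> (\<exists>v\<in>slow C c x. norm v = 1)"
proof
  assume "proj_mat (slow C c x) \<noteq> 0"
  then have "slow C c x \<noteq> {0}" using proj_mat_eq_0_iff[OF subspace_slow, of C c x] by simp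
  then obtain w where w: "w \<in> slow C c x" "w \<noteq> 0" using subspace_0[OF subspace_slow, of C c x] by blast
  then have "w /\<^sub>R norm w \<in> slow C c x" by (intro subspace_scale[OF subspace_slow])
  then show "\<exists>v\<in>slow C c x. norm v = 1" using w by (intro bexI[of _ "w /\<^sub>R norm w"]) auto
next
  assume "\<exists>v\<in>slow C c x. norm v = 1"
  then obtain v where v: "v \<in> slow C c x" "norm v = 1" by blast
  then show "proj_mat (slow C c x) \<noteq> 0" using proj_mat_id[OF subspace_slow v(1)] by force
qed

text \<open>By definition the log-norm \<open>b n\<close> of \<open>C (- int n)\<close> on the
  backward slow space has rate at most c. Read at \<open>T (int n) x\<close> it becomes
  \<open>c' n x\<close>, the log-norm of the inverse of \<open>C (int n) x\<close> on the invariant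
  backward slow bundle, and this sequence is subadditive. \<open>AE_not_up_pushforward\<close>
  transfers the rate, and an upper bound for the inverse is a lower bound for the cocycle.\<close>

lemma AE_expanding_on_slow_rev:
  "AE x in M. \<forall>\<epsilon>>0. \<exists>K>0. \<forall>(n::nat). \<forall>v\<in>slow (\<lambda>n. C (-n)) c x.
     norm v \<le> K * exp ((c + \<epsilon>) * real n) * norm (C (int n) x *v v)"
proof -
  interpret r: lin_cocycle M "\<lambda>n. T (-n)" "\<lambda>n. C (-n)" "\<lambda>x. \<phi> (T (-1) x)" by (rule rev_cocycle)
  let ?F = "slow (\<lambda>n. C (-n)) c"
  define P where "P x = proj_mat (?F x)" for x
  have [measurable]: "P \<in> borel_measurable M" unfolding P_def[abs_def] by (rule r.measurable_proj_slow)
  have eqv: "C n x *v v \<in> ?F (T n x) \<longleftrightarrow> v \<in> ?F x" if "x \<in> space M" for n x v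
    using r.slow_equivariant[OF that, of "-n" v c] by simp
  \<comment> \<open>Where the backward slow space is zero the claim is trivial, and the norms below
    would vanish.\<close>
  define B where "B = {x \<in> space M. P x \<noteq> 0}"
  have Bm [measurable]: "B \<in> sets M" unfolding B_def by measurable
  have Piff: "P x \<noteq> 0 \<longleftrightarrow> (\<exists>v\<in>?F x. norm v = 1)" for x unfolding P_def by (rule r.subspace_zero_iff_proj)
  have Pmove: "P (T n x) \<noteq> 0 \<longleftrightarrow> P x \<noteq> 0" if x: "x \<in> space M" for n x
  proof -
    have one: "P (T n x) \<noteq> 0" if x: "x \<in> space M" and P: "P x \<noteq> 0" for n x
    proof -
      obtain v where v: "v \<in> ?F x" "norm v = 1" using P Piff by blast
      have "C n x *v v \<noteq> 0" using C_invv(1)[OF x, of n v] v(2) by force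
      moreover have "C n x *v v \<in> ?F (T n x)" using v(1) eqv[OF x] by blast
      ultimately have "?F (T n x) \<noteq> {0}" by blast
      then show ?thesis using proj_mat_eq_0_iff[OF subspace_slow, of "\<lambda>n. C (-n)" c "T n x"] by (simp add: P_def)
    qed
    from one[OF x, of n] one[of "T n x" "-n"] x show ?thesis by auto
  qed
  have B: "fwd.inv_set B" using Bm Pmove[of _ 1] by (auto simp: fwd.inv_set_def B_def)
  define b where "b n x = ln (mat_norm (C (- int n) x ** P x))" for n x
  define c' where "c' n x = b n (T (int n) x)" for n x
  define N where "N n x = mat_norm (C (- int n) (T (int n) x) ** P (T (int n) x))" for n x
  have c'N: "c' n x = ln (N n x)" for n x by (simp add: c'_def b_def N_def)
  have Pid: "P x *v v = v" if "v \<in> ?F x" for x v unfolding P_def by (rule proj_mat_id[OF subspace_slow that])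
  have Npos: "0 < mat_norm (C (- int n) x ** P x)" if "x \<in> B" for n x
  proof -
    have "P x \<noteq> 0" using that by (simp add: B_def)
    then obtain v where v: "v \<in> ?F x" "norm v = 1" unfolding Piff by blast
    have x: "x \<in> space M" using that by (simp add: B_def)
    have "C (- int n) x *v v \<noteq> 0" using C_invv(1)[OF x, of "- int n" v] v(2) by force
    then have "(C (- int n) x ** P x) *v v \<noteq> 0" by (simp add: matrix_vector_mul_assoc[symmetric] Pid[OF v(1)])
    then show ?thesis by (rule mat_norm_pos)
  qed
  have TB: "T (int n) x \<in> B" if "x \<in> B" for n x
    using that Pmove[of x "int n"] by (auto simp: B_def)
  have Npos': "0 < N n x" if "x \<in> B" for n x unfolding N_def by (rule Npos[OF TB[OF that]])
  have sa: "fwd.subadd B c' \<phi>"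
    unfolding fwd.subadd_def
  proof (intro conjI allI ballI B \<phi>_int \<phi>_nonneg)
    show "c' n \<in> borel_measurable M" for n unfolding c'_def[abs_def] b_def by measurable
  next
    fix x n m assume xB: "x \<in> B"
    then have x: "x \<in> space M" by (simp add: B_def)
    define y where "y = T (int n) x"
    define z where "z = T (int m) y"
    have y: "y \<in> space M" "y \<in> B" using TB[OF xB] by (auto simp: y_def B_def)
    have z: "z = T (int (n + m)) x" "z \<in> space M"
      using T_add[OF x, of "int m" "int n"] y(1) by (auto simp: z_def y_def add.commute)
    have "C (- int (n + m)) z = C (- int m + - int n) z" by (simp add: algebra_simps)
    also have "\<dots> = C (- int n) (T (- int m) z) ** C (- int m) z" by (rule C_add[OF z(2)])
    also have "T (- int m) z = y" using y(1) by (simp add: z_def)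
    finally have e1: "C (- int (n + m)) z = C (- int n) y ** C (- int m) z" .
    \<comment> \<open>Invariance of the bundle allows a projection to be inserted between the two
      factors, which makes N submultiplicative.\<close>
    have e2: "C (- int m) z ** P z = P y ** (C (- int m) z ** P z)"
      unfolding P_def
    proof (rule proj_mat_intertwine(1)[OF subspace_slow subspace_slow])
      fix v assume "v \<in> ?F z"
      then have "C (- int m) z *v v \<in> ?F (T (- int m) z)" using eqv[OF z(2)] by blast
      then show "C (- int m) z *v v \<in> ?F y" using y(1) by (simp add: z_def)
    qed
    have "C (- int (n + m)) z ** P z = C (- int n) y ** (C (- int m) z ** P z)"
      unfolding e1 by (simp add: matrix_mul_assoc)
    also have "\<dots> = (C (- int n) y ** P y) ** (C (- int m) z ** P z)"
      by (subst e2) (simp add: matrix_mul_assoc)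
    finally have e3: "C (- int (n + m)) z ** P z = (C (- int n) y ** P y) ** (C (- int m) z ** P z)" .
    have "N (n + m) x = mat_norm (C (- int (n + m)) z ** P z)" by (simp only: N_def z(1))
    moreover have "N n x = mat_norm (C (- int n) y ** P y)" by (simp only: N_def y_def)
    moreover have "N m y = mat_norm (C (- int m) z ** P z)" by (simp only: N_def z_def)
    ultimately have "N (n + m) x \<le> N n x * N m y" by (simp only: e3 mat_norm_mult)
    then have "ln (N (n + m) x) \<le> ln (N n x * N m y)"
      using Npos'[OF xB] Npos'[OF y(2)] by (subst ln_le_cancel_iff) auto
    then show "c' (n + m) x \<le> c' n x + c' m (T (int n) x)"
      using Npos'[OF xB, of n] Npos'[OF y(2), of m] by (simp add: c'N ln_mult y_def)
  next
    fix x n assume xB: "x \<in> B"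
    then have x: "x \<in> space M" by (simp add: B_def)
    have "N n x \<le> mat_norm (C (- int n) (T (int n) x)) * mat_norm (P (T (int n) x))"
      unfolding N_def by (rule mat_norm_mult)
    also have "\<dots> \<le> exp (fwd.bsum \<phi> n x) * 1"
      unfolding P_def by (intro mult_mono mat_norm_C_le x mat_norm_proj_mat_le subspace_slow) auto
    finally have up: "c' n x \<le> fwd.bsum \<phi> n x"
      unfolding c'N using Npos'[OF xB, of n] by (subst ln_le_iff) auto
    have "P (T (int n) x) \<noteq> 0" using TB[OF xB, of n] by (simp add: B_def)
    then obtain v where v: "v \<in> ?F (T (int n) x)" "norm v = 1" unfolding Piff by blast
    let ?D = "C (- int n) (T (int n) x)"
    have "1 = norm (C (int n) x *v (?D *v v))" using v(2) C_invv(2)[OF x] by simp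
    also have "\<dots> \<le> mat_norm (C (int n) x) * norm (?D *v v)" by (rule mat_norm_bound)
    also have "norm (?D *v v) = norm ((?D ** P (T (int n) x)) *v v)"
      using Pid[OF v(1)] by (simp add: matrix_vector_mul_assoc[symmetric])
    also have "mat_norm (C (int n) x) * \<dots> \<le> exp (fwd.bsum \<phi> n x) * N n x"
      using mat_norm_bound[of "?D ** P (T (int n) x)" v] v(2)
      by (intro mult_mono mat_norm_C_le x) (auto simp: N_def)
    finally have "exp (- fwd.bsum \<phi> n x) \<le> N n x" by (simp add: exp_minus field_simps)
    then have "- fwd.bsum \<phi> n x \<le> c' n x"
      unfolding c'N using Npos'[OF xB, of n] by (subst ln_ge_iff) auto
    with up show "\<bar>c' n x\<bar> \<le> fwd.bsum \<phi> n x" by simp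
    have y: "T 1 x \<in> B" using TB[OF xB, of 1] by simp
    have z: "T (int n) (T 1 x) = T (int (Suc n)) x" 
      using T_add[OF x, of "int n" 1] by (simp add: add.commute)
    have zs: "T (int (Suc n)) x \<in> space M" using x by simp
    have "C (- int n) (T (int (Suc n)) x) = C (- int (Suc n) + 1) (T (int (Suc n)) x)" by simp
    also have "\<dots> = C 1 (T (- int (Suc n)) (T (int (Suc n)) x)) ** C (- int (Suc n)) (T (int (Suc n)) x)"
      by (rule C_add[OF zs])
    also have "T (- int (Suc n)) (T (int (Suc n)) x) = x" by (rule T_inv(1)[OF x])
    finally have "N n (T 1 x) = mat_norm (C 1 x ** (C (- int (Suc n)) (T (int (Suc n)) x) ** P (T (int (Suc n)) x)))"
      unfolding N_def z by (simp only: matrix_mul_assoc)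
    also have "\<dots> \<le> mat_norm (C 1 x) * N (Suc n) x" unfolding N_def by (rule mat_norm_mult)
    also have "\<dots> \<le> exp (\<phi> x) * N (Suc n) x"
      by (intro mult_right_mono C_le x) (simp add: N_def)
    finally have "ln (N n (T 1 x)) \<le> ln (exp (\<phi> x) * N (Suc n) x)"
      using Npos'[OF xB, of "Suc n"] Npos'[OF y, of n] by (subst ln_le_cancel_iff) auto
    then show "c' n (T (int 1) x) \<le> \<phi> x + c' (Suc n) x"
      using Npos'[OF xB, of "Suc n"] by (simp add: c'N ln_mult)
  qed
  have nup: "\<not> up (\<lambda>n. b n x) c" if xB: "x \<in> B" for x
    unfolding not_up_iff
  proof (intro allI impI)
    fix \<delta> :: real assume "0 < \<delta>"
    then have "0 < \<delta> / 2" by simp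
    then obtain K where K: "0 < K"
      "\<And>n::nat. mat_norm ((\<lambda>n. C (-n)) (int n) x ** proj_mat (?F x)) \<le> K * exp ((c + \<delta>/2) * real n)"
      by (rule slow_uniform[where C = "\<lambda>n. C (-n)" and c = c and x = x]) blast
    obtain N0 where N0: "real N0 > 2 * ln K / \<delta>" using reals_Archimedean2 by blast
    have "b n x \<le> (c + \<delta>) * real n" if "n \<ge> N0" for n
    proof -
      have "b n x \<le> ln (K * exp ((c + \<delta>/2) * real n))"
        unfolding b_def using K(2)[of n] Npos[OF xB, of n] K(1) by (subst ln_le_cancel_iff) (auto simp: P_def)
      also have "\<dots> = ln K + (c + \<delta>/2) * real n" using K(1) by (simp add: ln_mult)
      also have "ln K \<le> \<delta>/2 * real n"
      proof -
        have "2 * ln K < \<delta> * real N0" using N0 \<open>0 < \<delta>\<close> by (simp add: field_simps)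
        also have "\<dots> \<le> \<delta> * real n" using that \<open>0 < \<delta>\<close> by simp
        finally show ?thesis by simp
      qed
      finally show ?thesis by (simp add: algebra_simps)
    qed
    then show "\<exists>N. \<forall>n\<ge>N. b n x \<le> (c + \<delta>) * real n" by blast
  qed
  have [measurable]: "b n \<in> borel_measurable M" for n unfolding b_def[abs_def] by measurable
  have "AE x in M. x \<in> B \<longrightarrow> \<not> up (\<lambda>n. c' n x) c"
    by (rule fwd.AE_not_up_pushforward[OF sa _ _ nup]) (simp_all add: c'_def)
  then show ?thesis using AE_space
  proof eventually_elim
    case (elim x)
    show ?case
    proof (intro allI impI)
      fix \<epsilon> :: real assume e: "0 < \<epsilon>"
      show "\<exists>K>0. \<forall>(n::nat). \<forall>v\<in>?F x. norm v \<le> K * exp ((c + \<epsilon>) * real n) * norm (C (int n) x *v v)"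
      proof (cases "x \<in> B")
        case False
        then have "?F x = {0}" using elim(2) proj_mat_eq_0_iff[OF subspace_slow, of "\<lambda>n. C (-n)" c x] by (simp add: B_def P_def)
        then show ?thesis by (intro exI[of _ 1]) auto
      next
        case True
        then have "\<exists>N0. \<forall>n\<ge>N0. c' n x \<le> (c + \<epsilon>) * real n" using elim(1) e by (simp only: not_up_iff simp_thms)
        then have "\<exists>N0. \<forall>n\<ge>N0. N n x \<le> exp ((c + \<epsilon>) * real n)"
          using Npos'[OF True] by (simp add: c'N ln_le_iff)
        then obtain K where K: "K > 0" "\<And>n. N n x \<le> K * exp ((c + \<epsilon>) * real n)"
          using ex_global_bound[of "\<lambda>n. N n x" "\<lambda>n. exp ((c + \<epsilon>) * real n)"] by auto
        have "norm v \<le> K * exp ((c + \<epsilon>) * real n) * norm (C (int n) x *v v)" if v: "v \<in> ?F x" for n v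
        proof -
          have Cv: "C (int n) x *v v \<in> ?F (T (int n) x)" using v eqv[OF elim(2)] by blast
          have "v = (C (- int n) (T (int n) x) ** P (T (int n) x)) *v (C (int n) x *v v)"
            unfolding matrix_vector_mul_assoc[symmetric] Pid[OF Cv] using C_invv(1)[OF elim(2)] by (simp add: matrix_vector_mul_assoc)
          then have "norm v \<le> N n x * norm (C (int n) x *v v)" unfolding N_def by (metis mat_norm_bound)
          also have "\<dots> \<le> K * exp ((c + \<epsilon>) * real n) * norm (C (int n) x *v v)"
            by (intro mult_right_mono K) auto
          finally show ?thesis .
        qed
        with K(1) show ?thesis by blast
      qed
    qed
  qed
qed

end

section \<open>Orthogonal complements of slow spaces and the dual cocycle\<close>

context lin_cocycle
begin

text \<open>G is, up to the lower cutoff 1, the best constant in the slow bound at rate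
  \<open>c + \<epsilon>\<close>. One step along the orbit changes its logarithm by at most
  \<open>\<phi> x + \<bar>c + \<epsilon>\<bar>\<close>. Hence \<open>tempered\<close> makes G
  subexponential along the orbit, although nothing is known about the integrability of
  \<open>ln (G x)\<close>.\<close>

lemma AE_tempered_slow_bound:
  assumes e: "0 < \<epsilon>"
  shows "AE x in M. \<forall>\<eta>>0. \<exists>K. \<forall>n k::nat. 
    mat_norm (C (int k) (T (int n) x) ** proj_mat (slow C c (T (int n) x))) \<le> exp (K + \<eta> * real n + (c + \<epsilon>) * real k)"
proof -
  define P where "P x = proj_mat (slow C c x)" for x
  have [measurable]: "P \<in> borel_measurable M" unfolding P_def[abs_def] by (rule measurable_proj_slow)
  \<comment> \<open>The 1 keeps G away from 0, so that its logarithm makes sense also where the slow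
    space is zero.\<close>
  define s where "s k x = max 1 (mat_norm (C (int k) x ** P x) * exp (- (c + \<epsilon>) * real k))" for k x
  define G where "G x = (SUP k. s k x)" for x
  have bdd: "bdd_above (range (\<lambda>k. s k x))" for x
  proof -
    obtain K where K: "0 < K" "\<And>n::nat. mat_norm (C (int n) x ** P x) \<le> K * exp ((c + \<epsilon>) * real n)"
      unfolding P_def by (rule slow_uniform[OF e, of C x c]) blast
    have "s k x \<le> max 1 K" for k
    proof -
      have "mat_norm (C (int k) x ** P x) * exp (- (c + \<epsilon>) * real k) \<le> (K * exp ((c + \<epsilon>) * real k)) * exp (- (c + \<epsilon>) * real k)"
        by (intro mult_right_mono K) auto
      also have "\<dots> = K" by (simp add: mult.assoc exp_add[symmetric]) (simp add: algebra_simps)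
      finally show ?thesis by (auto simp: s_def)
    qed
    then show ?thesis by (intro bdd_aboveI[of _ "max 1 K"]) auto
  qed
  have sG: "s k x \<le> G x" for k x unfolding G_def by (rule cSUP_upper[OF _ bdd]) simp
  have Gle: "G x \<le> b" if "\<And>k. s k x \<le> b" for x b unfolding G_def by (rule cSUP_least) (use that in auto)
  have G1: "1 \<le> G x" for x using sG[of 0 x] by (simp add: s_def)
  have [measurable]: "s k \<in> borel_measurable M" for k unfolding s_def[abs_def] by measurable
  have [measurable]: "G \<in> borel_measurable M" unfolding G_def[abs_def]
    by (rule borel_measurable_cSUP) (use bdd in auto)
  have eqv: "C 1 x *v v \<in> slow C c (T 1 x) \<longleftrightarrow> v \<in> slow C c x" if "x \<in> space M" for x v
    by (rule slow_step[OF that])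
  have g1: "G x \<le> exp (\<phi> x + \<bar>c + \<epsilon>\<bar>) * G (T 1 x)" if x: "x \<in> space M" for x
  proof (rule Gle)
    fix k
    have big: "1 \<le> exp (\<phi> x + \<bar>c + \<epsilon>\<bar>) * G (T 1 x)"
      using mult_mono[of 1 "exp (\<phi> x + \<bar>c + \<epsilon>\<bar>)" 1 "G (T 1 x)"] \<phi>_nonneg[OF x] G1[of "T 1 x"] by simp
    have "mat_norm (C (int k) x ** P x) * exp (- (c + \<epsilon>) * real k) \<le> exp (\<phi> x + \<bar>c + \<epsilon>\<bar>) * G (T 1 x)"
    proof (cases k)
      case 0
      have "mat_norm (P x) \<le> 1" unfolding P_def by (rule mat_norm_proj_mat_le[OF subspace_slow])
      then show ?thesis using big 0 x by (simp add: C_0)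
    next
      case (Suc j)
      have "C (int k) x = C (int j) (T 1 x) ** C 1 x" using C_add[OF x, of 1 "int j"] Suc by simp
      moreover have "C 1 x ** P x = P (T 1 x) ** (C 1 x ** P x)"
        unfolding P_def by (rule proj_mat_intertwine(1)[OF subspace_slow subspace_slow]) (simp add: eqv[OF x])
      ultimately have "C (int k) x ** P x = (C (int j) (T 1 x) ** P (T 1 x)) ** (C 1 x ** P x)"
        by (metis matrix_mul_assoc)
      then have "mat_norm (C (int k) x ** P x) \<le> mat_norm (C (int j) (T 1 x) ** P (T 1 x)) * mat_norm (C 1 x ** P x)"
        by (simp add: mat_norm_mult)
      also have "mat_norm (C 1 x ** P x) \<le> mat_norm (C 1 x) * mat_norm (P x)" by (rule mat_norm_mult)
      also have "\<dots> \<le> exp (\<phi> x) * 1"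
        unfolding P_def by (intro mult_mono C_le x mat_norm_proj_mat_le[OF subspace_slow]) auto
      finally have m: "mat_norm (C (int k) x ** P x) \<le> mat_norm (C (int j) (T 1 x) ** P (T 1 x)) * exp (\<phi> x)"
        by (simp add: mult_left_mono)
      have "mat_norm (C (int k) x ** P x) * exp (- (c + \<epsilon>) * real k) 
          \<le> mat_norm (C (int j) (T 1 x) ** P (T 1 x)) * exp (\<phi> x) * exp (- (c + \<epsilon>) * real k)"
        by (intro mult_right_mono m) auto
      also have "\<dots> = (mat_norm (C (int j) (T 1 x) ** P (T 1 x)) * exp (- (c + \<epsilon>) * real j)) * exp (\<phi> x - (c + \<epsilon>))"
        using Suc by (simp add: mult.assoc exp_add[symmetric] algebra_simps)
      also have "\<dots> \<le> s j (T 1 x) * exp (\<phi> x + \<bar>c + \<epsilon>\<bar>)"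
        by (intro mult_mono) (auto simp: s_def)
      also have "\<dots> \<le> G (T 1 x) * exp (\<phi> x + \<bar>c + \<epsilon>\<bar>)" by (intro mult_right_mono sG) auto
      finally show ?thesis by (simp add: mult.commute)
    qed
    with big show "s k x \<le> exp (\<phi> x + \<bar>c + \<epsilon>\<bar>) * G (T 1 x)" by (simp add: s_def)
  qed
  have g2: "G (T 1 x) \<le> exp (\<phi> x + \<bar>c + \<epsilon>\<bar>) * G x" if x: "x \<in> space M" for x
  proof (rule Gle)
    fix k
    have big: "1 \<le> exp (\<phi> x + \<bar>c + \<epsilon>\<bar>) * G x"
      using mult_mono[of 1 "exp (\<phi> x + \<bar>c + \<epsilon>\<bar>)" 1 "G x"] \<phi>_nonneg[OF x] G1[of "x"] by simp
    have "C (int k) (T 1 x) = C (int (Suc k)) x ** C (-1) (T 1 x)"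
      using C_add[of "T 1 x" "-1" "int (Suc k)"] x T_inv(1)[OF x, of 1] by simp
    moreover have "C (-1) (T 1 x) ** P (T 1 x) = P x ** (C (-1) (T 1 x) ** P (T 1 x))"
      unfolding P_def
    proof (rule proj_mat_intertwine(1)[OF subspace_slow subspace_slow])
      fix v assume "v \<in> slow C c (T 1 x)"
      then have "C 1 x *v (C (-1) (T 1 x) *v v) \<in> slow C c (T 1 x)" using C_invv(2)[OF x, of 1] by simp
      then show "C (-1) (T 1 x) *v v \<in> slow C c x" using eqv[OF x] by blast
    qed
    ultimately have "C (int k) (T 1 x) ** P (T 1 x) = (C (int (Suc k)) x ** P x) ** (C (-1) (T 1 x) ** P (T 1 x))"
      by (metis matrix_mul_assoc)
    then have "mat_norm (C (int k) (T 1 x) ** P (T 1 x)) \<le> mat_norm (C (int (Suc k)) x ** P x) * mat_norm (C (-1) (T 1 x) ** P (T 1 x))"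
      using mat_norm_mult by metis
    also have "mat_norm (C (-1) (T 1 x) ** P (T 1 x)) \<le> mat_norm (C (-1) (T 1 x)) * mat_norm (P (T 1 x))" by (rule mat_norm_mult)
    also have "\<dots> \<le> exp (\<phi> x) * 1"
      unfolding P_def by (intro mult_mono C_inv_le x mat_norm_proj_mat_le[OF subspace_slow]) auto
    finally have m: "mat_norm (C (int k) (T 1 x) ** P (T 1 x)) \<le> mat_norm (C (int (Suc k)) x ** P x) * exp (\<phi> x)"
      by (simp add: mult_left_mono)
    have "mat_norm (C (int k) (T 1 x) ** P (T 1 x)) * exp (- (c + \<epsilon>) * real k) 
        \<le> mat_norm (C (int (Suc k)) x ** P x) * exp (\<phi> x) * exp (- (c + \<epsilon>) * real k)"
      by (intro mult_right_mono m) auto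
    also have "\<dots> = (mat_norm (C (int (Suc k)) x ** P x) * exp (- (c + \<epsilon>) * real (Suc k))) * exp (\<phi> x + (c + \<epsilon>))"
      by (simp add: mult.assoc exp_add[symmetric] algebra_simps)
    also have "\<dots> \<le> s (Suc k) x * exp (\<phi> x + \<bar>c + \<epsilon>\<bar>)"
      by (intro mult_mono) (auto simp: s_def)
    also have "\<dots> \<le> G x * exp (\<phi> x + \<bar>c + \<epsilon>\<bar>)" by (intro mult_right_mono sG) auto
    finally have "mat_norm (C (int k) (T 1 x) ** P (T 1 x)) * exp (- (c + \<epsilon>) * real k) \<le> exp (\<phi> x + \<bar>c + \<epsilon>\<bar>) * G x"
      by (simp add: mult.commute)
    with big show "s k (T 1 x) \<le> exp (\<phi> x + \<bar>c + \<epsilon>\<bar>) * G x" by (simp add: s_def)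
  qed
  have "AE x in M. \<forall>\<eta>>0. \<exists>K. \<forall>n. ln (G (T (int n) x)) \<le> K + \<eta> * real n"
  proof (rule fwd.tempered)
    show "integrable M (\<lambda>x. \<phi> x + \<bar>c + \<epsilon>\<bar>)" using \<phi>_int by simp
    fix x assume x: "x \<in> space M"
    have p: "0 < G x" "0 < G (T 1 x)" using G1[of x] G1[of "T 1 x"] by auto
    have "ln (G x) \<le> ln (exp (\<phi> x + \<bar>c + \<epsilon>\<bar>) * G (T 1 x))"
      using g1[OF x] p by (subst ln_le_cancel_iff) auto
    moreover have "ln (G (T 1 x)) \<le> ln (exp (\<phi> x + \<bar>c + \<epsilon>\<bar>) * G x)"
      using g2[OF x] p by (subst ln_le_cancel_iff) auto
    ultimately show "\<bar>ln (G (T (int 1) x)) - ln (G x)\<bar> \<le> \<phi> x + \<bar>c + \<epsilon>\<bar>"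
      using p by (simp add: ln_mult)
  qed measurable
  then show ?thesis
  proof eventually_elim
    case (elim x)
    show ?case
    proof (intro allI impI)
      fix \<eta> :: real assume "0 < \<eta>"
      then obtain K where K: "\<And>n. ln (G (T (int n) x)) \<le> K + \<eta> * real n" using elim by blast
      have "mat_norm (C (int k) (T (int n) x) ** P (T (int n) x)) \<le> exp (K + \<eta> * real n + (c + \<epsilon>) * real k)" for n k
      proof -
        let ?y = "T (int n) x"
        have "mat_norm (C (int k) ?y ** P ?y) * exp (- (c + \<epsilon>) * real k) \<le> G ?y"
          using sG[of k ?y] by (simp add: s_def)
        also have "G ?y \<le> exp (K + \<eta> * real n)"
          using K[of n] G1[of ?y] by (subst (asm) ln_le_iff) auto
        finally have "mat_norm (C (int k) ?y ** P ?y) * exp (- (c + \<epsilon>) * real k) * exp ((c + \<epsilon>) * real k)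
           \<le> exp (K + \<eta> * real n) * exp ((c + \<epsilon>) * real k)" by (intro mult_right_mono) auto
        moreover have "exp (- (c + \<epsilon>) * real k) * exp ((c + \<epsilon>) * real k) = 1"
          unfolding exp_add[symmetric] by (simp add: algebra_simps)
        ultimately show ?thesis by (simp only: mult.assoc exp_add mult_1_right)
      qed
      then show "\<exists>K. \<forall>n k::nat. mat_norm (C (int k) (T (int n) x) ** proj_mat (slow C c (T (int n) x)))
          \<le> exp (K + \<eta> * real n + (c + \<epsilon>) * real k)" unfolding P_def by blast
    qed
  qed
qed

text \<open>The component of the orbit inside the slow bundle is driven by the quotient component;
  the induction keeps track of all future images of it.\<close>
lemma slow_if_quotient_decays:
  assumes x: "x \<in> space M" and \<delta>: "0 < \<delta>" and \<epsilon>: "0 < \<epsilon>"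
    and v0: "proj_mat (slow C c x) *v v = 0"
    and w: "\<And>k::nat. norm ((mat 1 - proj_mat (slow C c (T (int k) x))) *v (C (int k) x *v v)) \<le> exp ((c - \<delta>) * real k)"
    and \<phi>: "\<forall>\<eta>>0. \<exists>K. \<forall>n. \<phi> (T (int n) x) \<le> K + \<eta> * real n"
    and temp: "\<forall>\<eta>>0. \<exists>K. \<forall>n k::nat. 
    mat_norm (C (int k) (T (int n) x) ** proj_mat (slow C c (T (int n) x))) \<le> exp (K + \<eta> * real n + (c + \<epsilon>) * real k)"
  shows "\<exists>K. \<forall>n::nat. norm (C (int n) x *v v) \<le> K * exp ((c + \<epsilon>) * real n)"
proof -
  define P where "P n = proj_mat (slow C c (T (int n) x))" for n :: nat
  define y where "y n = C (int n) x *v v" for n :: nat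
  define p where "p n = P n *v y n" for n
  define u where "u n = y n - p n" for n
  have un: "norm (u k) \<le> exp ((c - \<delta>) * real k)" for k
    using w[of k] by (simp add: u_def p_def P_def y_def matrix_vector_mult_diff_rdistrib)
  obtain K1 where K1: "\<And>n. \<phi> (T (int n) x) \<le> K1 + \<epsilon>/2 * real n" using \<phi> \<epsilon> half_gt_zero by blast
  obtain K2 where K2: "\<And>n k::nat. mat_norm (C (int k) (T (int n) x) ** P n) \<le> exp (K2 + \<epsilon>/2 * real n + (c + \<epsilon>) * real k)"
    using temp \<epsilon> half_gt_zero unfolding P_def by blast
  \<comment> \<open>The two losses of \<open>\<epsilon>/2\<close> per time step use up the
    \<epsilon> in the rate \<open>c + \<epsilon>\<close>. The gap \<delta> of the quotient remains
    as a geometric ratio, so the contributions of all times have a bounded sum.\<close>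
  define r where "r k = exp (K1 + K2 + \<epsilon>/2 - (c + \<epsilon>)) * exp (- \<delta>) ^ k" for k :: nat
  have step: "y (Suc n) = C 1 (T (int n) x) *v y n" for n
    using C_add[OF x, of "int n" 1] by (simp add: y_def matrix_vector_mul_assoc add.commute)
  have claim: "norm (C (int j) (T (int N) x) *v p N) \<le> exp ((c + \<epsilon>) * real (N + j)) * (\<Sum>k<N. r k)" for N j
  proof (induction N arbitrary: j)
    case 0
    have "p 0 = 0" using v0 x by (simp add: p_def y_def P_def C_0 T_0)
    then show ?case by simp
  next
    case (Suc N)
    let ?z = "T (int N) x"
    have z: "?z \<in> space M" using x by simp
    have Tz: "T (int (Suc N)) x = T 1 ?z" using T_add[OF x, of 1 "int N"] by (simp add: add.commute)
    have "p (Suc N) = P (Suc N) *v (C 1 ?z *v (p N + u N))" by (simp add: p_def step u_def)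
    also have "\<dots> = P (Suc N) *v (C 1 ?z *v p N) + P (Suc N) *v (C 1 ?z *v u N)"
      by (simp add: matrix_vector_right_distrib)
    also have "P (Suc N) *v (C 1 ?z *v p N) = C 1 ?z *v p N"
      unfolding P_def
    proof (rule proj_mat_id[OF subspace_slow])
      have "p N \<in> slow C c ?z" unfolding p_def P_def by (rule proj_mat_in[OF subspace_slow])
      then show "C 1 ?z *v p N \<in> slow C c (T (int (Suc N)) x)" unfolding Tz by (simp add: slow_step[OF z])
    qed
    finally have pS: "p (Suc N) = C 1 ?z *v p N + P (Suc N) *v (C 1 ?z *v u N)" .
    have cc: "C (int j) (T 1 ?z) *v (C 1 ?z *v p N) = C (int (Suc j)) ?z *v p N"
      using C_add[OF z, of 1 "int j"] by (simp add: matrix_vector_mul_assoc)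
    have "C (int j) (T (int (Suc N)) x) *v p (Suc N) = C (int (Suc j)) ?z *v p N 
        + (C (int j) (T (int (Suc N)) x) ** P (Suc N)) *v (C 1 ?z *v u N)"
      unfolding pS matrix_vector_right_distrib cc[folded Tz] by (simp only: matrix_vector_mul_assoc matrix_mul_assoc)
    then have "norm (C (int j) (T (int (Suc N)) x) *v p (Suc N)) \<le> norm (C (int (Suc j)) ?z *v p N)
        + norm ((C (int j) (T (int (Suc N)) x) ** P (Suc N)) *v (C 1 ?z *v u N))"
      by (simp add: norm_triangle_ineq)
    also have "norm (C (int (Suc j)) ?z *v p N) \<le> exp ((c + \<epsilon>) * real (N + Suc j)) * (\<Sum>k<N. r k)"
      by (rule Suc)
    also have "norm ((C (int j) (T (int (Suc N)) x) ** P (Suc N)) *v (C 1 ?z *v u N))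
        \<le> mat_norm (C (int j) (T (int (Suc N)) x) ** P (Suc N)) * norm (C 1 ?z *v u N)"
      by (rule mat_norm_bound)
    also have "\<dots> \<le> exp (K2 + \<epsilon>/2 * real (Suc N) + (c + \<epsilon>) * real j) * (exp (K1 + \<epsilon>/2 * real N) * exp ((c - \<delta>) * real N))"
    proof (intro mult_mono K2)
      have "norm (C 1 ?z *v u N) \<le> mat_norm (C 1 ?z) * norm (u N)" by (rule mat_norm_bound)
      also have "\<dots> \<le> exp (K1 + \<epsilon>/2 * real N) * exp ((c - \<delta>) * real N)"
      proof (intro mult_mono un)
        have "mat_norm (C 1 ?z) \<le> exp (\<phi> ?z)" by (rule C_le[OF z])
        also have "\<dots> \<le> exp (K1 + \<epsilon>/2 * real N)" using K1[of N] by simp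
        finally show "mat_norm (C 1 ?z) \<le> exp (K1 + \<epsilon>/2 * real N)" .
      qed auto
      finally show "norm (C 1 ?z *v u N) \<le> exp (K1 + \<epsilon>/2 * real N) * exp ((c - \<delta>) * real N)" .
    qed auto
    also have "\<dots> = exp ((c + \<epsilon>) * real (N + Suc j)) * r N"
      by (simp add: r_def exp_add[symmetric] exp_of_nat_mult[symmetric] algebra_simps) (simp add: field_simps)
    finally show ?case by (simp add: distrib_left)
  qed
  define R where "R = exp (K1 + K2 + \<epsilon>/2 - (c + \<epsilon>)) * (1 / (1 - exp (- \<delta>)))"
  have Rs: "(\<Sum>k<N. r k) \<le> R" for N
  proof -
    have ed: "exp (- \<delta>) < 1" using \<delta> by simp
    have "(\<Sum>k<N. exp (- \<delta>) ^ k) \<le> (\<Sum>k. exp (- \<delta>) ^ k)"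
      using ed by (intro sum_le_suminf) (auto intro: summable_geometric)
    also have "\<dots> = 1 / (1 - exp (- \<delta>))" using ed by (intro suminf_geometric) simp
    finally show ?thesis unfolding r_def R_def sum_distrib_left[symmetric] by (intro mult_left_mono) auto
  qed
  have "norm (C (int n) x *v v) \<le> (R + 1) * exp ((c + \<epsilon>) * real n)" for n
  proof -
    have "norm (p n) \<le> exp ((c + \<epsilon>) * real n) * (\<Sum>k<n. r k)"
      using claim[of 0 n] x by (simp add: C_0)
    also have "\<dots> \<le> exp ((c + \<epsilon>) * real n) * R" by (intro mult_left_mono Rs) auto
    finally have a: "norm (p n) \<le> exp ((c + \<epsilon>) * real n) * R" .
    have "(c - \<delta>) * real n \<le> (c + \<epsilon>) * real n" using \<delta> \<epsilon> by (intro mult_right_mono) auto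
    then have "norm (u n) \<le> exp ((c + \<epsilon>) * real n)" using un[of n] by (meson exp_le_cancel_iff order.trans)
    moreover have "norm (y n) \<le> norm (p n) + norm (u n)"
      using norm_triangle_ineq[of "p n" "u n"] by (simp add: u_def)
    ultimately show ?thesis using a by (simp add: y_def algebra_simps)
  qed
  then show ?thesis by blast
qed

text \<open>\<open>a n x\<close> is the log-norm of the inverse of the quotient cocycle. If its rate
  exceeded \<open>- c\<close> on a set of positive measure, then points forming no null set would
  have infinitely many good times. Each good time n yields a unit vector orthogonal to the slow
  space whose quotient component decays at rate \<open>c - \<delta>\<close> up to time n. A vector
  with this decay at all times is slow by \<open>slow_if_quotient_decays\<close>, which is absurd.
  The upper bound for the inverse quotient obtained in this way is the claim after
  transposition.\<close>

lemma AE_orthogonal_slow_dual: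
  "AE x in M. (slow C c x)\<^sup>\<bottom> \<subseteq> slow (\<lambda>n x. transpose (C (-n) (T n x))) (- c) x"
proof -
  define P where "P x = proj_mat (slow C c x)" for x
  have [measurable]: "P \<in> borel_measurable M" unfolding P_def[abs_def] by (rule measurable_proj_slow)
  define Q where "Q x = mat 1 - P x" for x
  have [measurable]: "Q \<in> borel_measurable M" unfolding Q_def[abs_def] by measurable
  have Qorth: "Q x = proj_mat ((slow C c x)\<^sup>\<bottom>)" for x
    by (simp add: Q_def P_def proj_mat_orthogonal_comp[OF subspace_slow])
  have so: "subspace ((slow C c x)\<^sup>\<bottom>)" for x by (rule subspace_orthogonal_comp)
  have Qid: "Q x *v v = v" if "v \<in> (slow C c x)\<^sup>\<bottom>" for x v
    unfolding Qorth by (rule proj_mat_id[OF so that])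
  have QP: "Q x *v (P x *v v) = 0" "P x *v (Q x *v v) = 0" for x v
    using proj_mat_id[OF subspace_slow proj_mat_in[OF subspace_slow], of C c x v]
    by (simp_all add: Q_def P_def matrix_vector_mult_diff_rdistrib matrix_vector_mult_diff_distrib)
  have QQ: "Q x *v (Q x *v v) = Q x *v v" for x v
  proof -
    have "Q x *v (Q x *v v) = Q x *v (v - P x *v v)"
      by (simp add: Q_def[of x] matrix_vector_mult_diff_rdistrib)
    also have "\<dots> = Q x *v v" using QP(1)[of x v] by (simp add: matrix_vector_mult_diff_distrib)
    finally show ?thesis .
  qed
  have eqv: "C n x *v v \<in> slow C c (T n x) \<longleftrightarrow> v \<in> slow C c x" if "x \<in> space M" for n x v
    by (rule slow_equivariant[OF that])
  have QC: "Q (T n x) ** C n x = (Q (T n x) ** C n x) ** Q x" if x: "x \<in> space M" for n x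
    unfolding Q_def P_def by (rule proj_mat_intertwine(2)[OF subspace_slow subspace_slow]) (simp add: eqv[OF x])
  have QCr: "Q x ** C (-n) (T n x) = (Q x ** C (-n) (T n x)) ** Q (T n x)" if x: "x \<in> space M" for n x
    using QC[of "T n x" "-n"] x by simp
  have Qle: "mat_norm (Q x) \<le> 1" for x unfolding Q_def P_def by (rule mat_norm_residual_le[OF subspace_slow])
  have Qmove1: "Q (T n x) \<noteq> 0" if x: "x \<in> space M" and q: "Q x \<noteq> 0" for n x
  proof
    assume 0: "Q (T n x) = 0"
    have "Q x = (Q x ** C (-n) (T n x)) ** C n x" using C_inv(1)[OF x] by (simp add: matrix_mul_assoc[symmetric])
    also have "\<dots> = (Q x ** C (-n) (T n x)) ** Q (T n x) ** C n x" using QCr[OF x] by simp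
    also have "\<dots> = 0" by (simp add: 0)
    finally show False using q by simp
  qed
  have Qmove: "Q (T n x) \<noteq> 0 \<longleftrightarrow> Q x \<noteq> 0" if x: "x \<in> space M" for n x
    using Qmove1[OF x, of n] Qmove1[of "T n x" "-n"] x by auto
  define B where "B = {x \<in> space M. Q x \<noteq> 0}"
  have Bm [measurable]: "B \<in> sets M" unfolding B_def by measurable
  have B: "fwd.inv_set B" using Bm Qmove[of _ 1] by (auto simp: fwd.inv_set_def B_def)
  define N where "N n x = mat_norm (Q x ** C (- int n) (T (int n) x))" for n x
  define a where "a n x = ln (N n x)" for n x
  have TB: "T (int n) x \<in> B" if "x \<in> B" for n x
    using that Qmove[of x "int n"] by (auto simp: B_def)
  have ex_unit: "\<exists>v. norm v = 1 \<and> Q x *v v = v" if "x \<in> B" for x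
  proof -
    have "Q x \<noteq> 0" using that by (simp add: B_def)
    then obtain w where w: "Q x *v w \<noteq> 0" by (metis matrix_eq matrix_vector_mult_0)
    let ?v = "(Q x *v w) /\<^sub>R norm (Q x *v w)"
    have "norm ?v = 1" using w by simp
    moreover have "Q x *v ?v = ?v" by (simp add: matrix_vector_mult_scaleR QQ)
    ultimately show ?thesis by blast
  qed
  have Nlow: "exp (- fwd.bsum \<phi> n x) \<le> N n x" if xB: "x \<in> B" for n x
  proof -
    have x: "x \<in> space M" using xB by (simp add: B_def)
    obtain v where v: "norm v = 1" "Q x *v v = v" using ex_unit[OF xB] by blast
    let ?D = "C (- int n) (T (int n) x)"
    have "v = (Q x ** ?D) *v (C (int n) x *v v)"
      using v(2) C_invv(1)[OF x, of "int n" v] by (simp add: matrix_vector_mul_assoc[symmetric])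
    then have "1 \<le> N n x * norm (C (int n) x *v v)" using v(1) unfolding N_def by (metis mat_norm_bound)
    also have "\<dots> \<le> N n x * (mat_norm (C (int n) x) * norm v)"
      by (intro mult_left_mono mat_norm_bound) (simp add: N_def)
    also have "\<dots> \<le> N n x * exp (fwd.bsum \<phi> n x)"
      using mat_norm_C_le(1)[OF x, of n] v(1) by (intro mult_left_mono) (auto simp: N_def)
    finally show ?thesis by (simp add: exp_minus field_simps)
  qed
  have Npos: "0 < N n x" if "x \<in> B" for n x using Nlow[OF that, of n] exp_gt_zero less_le_trans by blast
  have sa: "fwd.subadd B a \<phi>"
    unfolding fwd.subadd_def
  proof (intro conjI allI ballI B \<phi>_int \<phi>_nonneg)
    show "a n \<in> borel_measurable M" for n unfolding a_def[abs_def] N_def by measurable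
  next
    fix x n m assume xB: "x \<in> B"
    then have x: "x \<in> space M" by (simp add: B_def)
    define y where "y = T (int n) x"
    define z where "z = T (int m) y"
    have y: "y \<in> space M" "y \<in> B" using TB[OF xB] by (auto simp: y_def B_def)
    have z: "z = T (int (n + m)) x" "z \<in> space M"
      using T_add[OF x, of "int m" "int n"] y(1) by (auto simp: z_def y_def add.commute)
    have "C (- int (n + m)) z = C (- int m + - int n) z" by (simp add: algebra_simps)
    also have "\<dots> = C (- int n) (T (- int m) z) ** C (- int m) z" by (rule C_add[OF z(2)])
    also have "T (- int m) z = y" using y(1) by (simp add: z_def)
    finally have e1: "C (- int (n + m)) z = C (- int n) y ** C (- int m) z" .
    have "Q x ** C (- int (n + m)) z = (Q x ** C (- int n) y) ** C (- int m) z"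
      unfolding e1 by (simp add: matrix_mul_assoc)
    also have "Q x ** C (- int n) y = (Q x ** C (- int n) y) ** Q y"
      unfolding y_def using QCr[OF x, of "int n"] by simp
    also have "(Q x ** C (- int n) y) ** Q y ** C (- int m) z = (Q x ** C (- int n) y) ** (Q y ** C (- int m) z)"
      by (simp add: matrix_mul_assoc)
    finally have e3: "Q x ** C (- int (n + m)) z = (Q x ** C (- int n) y) ** (Q y ** C (- int m) z)" .
    have "N (n + m) x = mat_norm (Q x ** C (- int (n + m)) z)" by (simp only: N_def z(1))
    moreover have "N n x = mat_norm (Q x ** C (- int n) y)" by (simp only: N_def y_def)
    moreover have "N m y = mat_norm (Q y ** C (- int m) z)" by (simp only: N_def z_def)
    ultimately have "N (n + m) x \<le> N n x * N m y" by (simp only: e3 mat_norm_mult)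
    then have "ln (N (n + m) x) \<le> ln (N n x * N m y)"
      using Npos[OF xB] Npos[OF y(2)] by (subst ln_le_cancel_iff) auto
    then show "a (n + m) x \<le> a n x + a m (T (int n) x)"
      using Npos[OF xB, of n] Npos[OF y(2), of m] by (simp add: a_def ln_mult y_def)
  next
    fix x n assume xB: "x \<in> B"
    then have x: "x \<in> space M" by (simp add: B_def)
    have "N n x \<le> mat_norm (Q x) * mat_norm (C (- int n) (T (int n) x))"
      unfolding N_def by (rule mat_norm_mult)
    also have "\<dots> \<le> 1 * exp (fwd.bsum \<phi> n x)"
      by (intro mult_mono mat_norm_C_le x Qle) auto
    finally have "a n x \<le> fwd.bsum \<phi> n x"
      unfolding a_def using Npos[OF xB, of n] by (subst ln_le_iff) auto
    moreover have "- fwd.bsum \<phi> n x \<le> a n x"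
      unfolding a_def using Npos[OF xB, of n] Nlow[OF xB, of n] by (subst ln_ge_iff) auto
    ultimately show "\<bar>a n x\<bar> \<le> fwd.bsum \<phi> n x" by simp
    have y: "T 1 x \<in> B" using TB[OF xB, of 1] by simp
    have z: "T (int n) (T 1 x) = T (int (Suc n)) x" 
      using T_add[OF x, of "int n" 1] by (simp add: add.commute)
    have zs: "T (int (Suc n)) x \<in> space M" using x by simp
    let ?E = "C (- int (Suc n)) (T (int (Suc n)) x)"
    have "C (- int n) (T (int (Suc n)) x) = C (- int (Suc n) + 1) (T (int (Suc n)) x)" by simp
    also have "\<dots> = C 1 (T (- int (Suc n)) (T (int (Suc n)) x)) ** ?E"
      by (rule C_add[OF zs])
    also have "T (- int (Suc n)) (T (int (Suc n)) x) = x" by (rule T_inv(1)[OF x])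
    finally have "Q (T 1 x) ** C (- int n) (T (int (Suc n)) x) = (Q (T 1 x) ** C 1 x) ** ?E"
      by (simp only: matrix_mul_assoc)
    also have "\<dots> = (Q (T 1 x) ** C 1 x) ** (Q x ** ?E)"
      by (subst QC[OF x]) (simp only: matrix_mul_assoc)
    finally have "N n (T 1 x) \<le> mat_norm (Q (T 1 x) ** C 1 x) * N (Suc n) x"
      unfolding N_def z using mat_norm_mult by metis
    also have "\<dots> \<le> exp (\<phi> x) * N (Suc n) x"
    proof (intro mult_right_mono)
      have "mat_norm (Q (T 1 x) ** C 1 x) \<le> mat_norm (Q (T 1 x)) * mat_norm (C 1 x)" by (rule mat_norm_mult)
      also have "\<dots> \<le> 1 * exp (\<phi> x)" by (intro mult_mono Qle C_le x) auto
      finally show "mat_norm (Q (T 1 x) ** C 1 x) \<le> exp (\<phi> x)" by simp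
    qed (simp add: N_def)
    finally have "ln (N n (T 1 x)) \<le> ln (exp (\<phi> x) * N (Suc n) x)"
      using Npos[OF xB, of "Suc n"] Npos[OF y, of n] by (subst ln_le_cancel_iff) auto
    then show "a n (T (int 1) x) \<le> \<phi> x + a (Suc n) x"
      using Npos[OF xB, of "Suc n"] by (simp add: a_def ln_mult)
  qed
  have AE1: "AE x in M. \<forall>\<eta>>0. \<exists>K. \<forall>n. \<phi> (T (int n) x) \<le> K + \<eta> * real n"
    by (rule fwd.tempered_integrable[OF \<phi>_int])
  have AE2: "AE x in M. \<forall>i::nat. \<forall>\<eta>>0. \<exists>K. \<forall>n k::nat. 
    mat_norm (C (int k) (T (int n) x) ** proj_mat (slow C c (T (int n) x))) \<le> exp (K + \<eta> * real n + (c + 1 / real (Suc i)) * real k)"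
    unfolding AE_all_countable by (intro allI AE_tempered_slow_bound) simp
  have no_good: "AE x in M. x \<in> B \<longrightarrow> (\<exists>N. \<forall>n\<ge>N. \<not> fwd.good_time a (- c + \<delta>) n x)" if \<delta>: "0 < \<delta>" for \<delta>
    using AE1 AE2
  proof eventually_elim
    case (elim x)
    show ?case
    proof (intro impI, rule ccontr)
      assume xB: "x \<in> B" and "\<not> (\<exists>N. \<forall>n\<ge>N. \<not> fwd.good_time a (- c + \<delta>) n x)"
      then have inf: "\<And>N. \<exists>n\<ge>N. fwd.good_time a (- c + \<delta>) n x" by blast
      have x: "x \<in> space M" using xB by (simp add: B_def)
      \<comment> \<open>Nested compact sets: a vector in all of them has the required decay at all
        times.\<close>
      define W where "W n = {v. norm v = 1 \<and> P x *v v = 0 \<and>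
        (\<forall>k\<in>{..n}. norm (Q (T (int k) x) *v (C (int k) x *v v)) \<le> exp ((c - \<delta>) * real k))}" for n :: nat
      have good_W: "W n \<noteq> {}" if g: "fwd.good_time a (- c + \<delta>) n x" for n
      proof -
        let ?D = "C (- int n) (T (int n) x)"
        obtain u where u: "norm u = 1" "norm ((Q x ** ?D) *v u) = N n x"
          unfolding N_def by (rule mat_norm_attained)
        have Np: "0 < N n x" by (rule Npos[OF xB])
        \<comment> \<open>The normalised image of a maximising vector under the inverse quotient
          cocycle. Pushing v forward by k steps leaves the inverse over n - k steps applied to u,
          and the good-time inequality bounds the resulting ratio of norms.\<close>
        define v where "v = (1 / N n x) *\<^sub>R ((Q x ** ?D) *v u)"
        have "norm v = 1" using u Np by (simp add: v_def)
        moreover have "P x *v v = 0"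
          by (simp add: v_def matrix_vector_mult_scaleR matrix_vector_mul_assoc[symmetric] QP)
        moreover have "norm (Q (T (int k) x) *v (C (int k) x *v v)) \<le> exp ((c - \<delta>) * real k)" if k: "k \<le> n" for k
        proof (cases "k = 0")
          case True
          have "norm (Q x *v v) \<le> mat_norm (Q x) * norm v" by (rule mat_norm_bound)
          also have "\<dots> \<le> 1" using Qle[of x] \<open>norm v = 1\<close> by simp
          finally show ?thesis using True x by (simp add: T_0 C_0)
        next
          case False
          let ?y = "T (int k) x"
          have y: "?y \<in> space M" "?y \<in> B" using x TB[OF xB] by auto
          have z: "T (int (n - k)) ?y = T (int n) x" using T_add[OF x, of "int (n - k)" "int k"] k by simp
          have "C (- int n) (T (int n) x) = C (- int (n - k) + - int k) (T (int (n-k)) ?y)" using k z by (simp add: of_nat_diff)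
          also have "\<dots> = C (- int k) (T (- int (n - k)) (T (int (n-k)) ?y)) ** C (- int (n - k)) (T (int (n-k)) ?y)"
            using y(1) by (intro C_add) simp
          also have "T (- int (n - k)) (T (int (n-k)) ?y) = ?y" by (rule T_inv(1)[OF y(1)])
          finally have e: "?D = C (- int k) ?y ** C (- int (n - k)) (T (int (n-k)) ?y)" .
          have "Q ?y *v (C (int k) x *v (Q x *v (?D *v u))) = ((Q ?y ** C (int k) x) ** Q x) *v (?D *v u)"
            by (simp only: matrix_vector_mul_assoc matrix_mul_assoc)
          also have "\<dots> = (Q ?y ** C (int k) x) *v (?D *v u)" using QC[OF x, of "int k"] by simp
          also have "\<dots> = Q ?y *v (C (int k) x *v (C (- int k) ?y *v (C (- int (n - k)) (T (int (n-k)) ?y) *v u)))"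
            by (simp only: e matrix_vector_mul_assoc matrix_mul_assoc)
          also have "\<dots> = (Q ?y ** C (- int (n - k)) (T (int (n-k)) ?y)) *v u"
            unfolding C_invv(2)[OF x] by (simp only: matrix_vector_mul_assoc)
          also have "norm \<dots> \<le> N (n - k) ?y * norm u" unfolding N_def by (rule mat_norm_bound)
          finally have "norm (Q ?y *v (C (int k) x *v (Q x *v (?D *v u)))) \<le> N (n - k) ?y" using u by simp
          then have "norm (Q ?y *v (C (int k) x *v v)) \<le> N (n - k) ?y / N n x"
            using Np by (simp add: v_def matrix_vector_mult_scaleR matrix_vector_mul_assoc[symmetric] field_simps)
          also have "\<dots> = exp (a (n - k) ?y - a n x)"
            using Np Npos[OF y(2), of "n - k"] by (simp add: a_def exp_diff)
          also have "\<dots> \<le> exp ((c - \<delta>) * real k)"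
          proof -
            have "a n x \<ge> a (n - k) ?y + (- c + \<delta>) * real k"
              using g False k unfolding fwd.good_time_def by (auto dest!: bspec[of _ _ k])
            then have "a (n - k) ?y - a n x \<le> (c - \<delta>) * real k" by (simp add: algebra_simps)
            then show ?thesis by (simp only: exp_le_cancel_iff)
          qed
          finally show ?thesis .
        qed
        ultimately show ?thesis unfolding W_def by blast
      qed
      have anti: "W n \<subseteq> W m" if "m \<le> n" for m n using that by (auto simp: W_def)
      have ne: "W n \<noteq> {}" for n
      proof -
        obtain m where "m \<ge> n" "fwd.good_time a (- c + \<delta>) m x" using inf by blast
        then show ?thesis using good_W anti by blast
      qed
      have W_eq: "W n = sphere 0 1 \<inter> {v. P x *v v = 0} \<inter> (\<Inter>k\<in>{..n}. {v. norm (Q (T (int k) x) *v (C (int k) x *v v)) \<le> exp ((c - \<delta>) * real k)})" for n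
        by (auto simp: W_def)
      have cont: "continuous_on UNIV (\<lambda>v. Q (T (int k) x) *v (C (int k) x *v v))" for k :: nat
        unfolding matrix_vector_mul_assoc by (intro continuous_intros)
      have "compact (W n)" for n unfolding W_eq
        by (intro compact_Int_closed compact_sphere closed_INT closed_Collect_eq closed_Collect_le ballI continuous_intros cont)
      then have "(\<Inter>n. W n) \<noteq> {}" using compact_nest[of W] ne anti by blast
      then obtain v where "\<And>n. v \<in> W n" by blast
      then have v: "norm v = 1" "P x *v v = 0"
        "\<And>k::nat. norm (Q (T (int k) x) *v (C (int k) x *v v)) \<le> exp ((c - \<delta>) * real k)"
        unfolding W_def by auto
      have "v \<in> slow C c x"
      proof (rule slowI)
        fix i :: nat
        show "\<exists>K. \<forall>n::nat. norm (C (int n) x *v v) \<le> K * exp ((c + 1 / real (Suc i)) * real n)"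
          by (rule slow_if_quotient_decays[OF x \<delta> _ _ _ elim(1)])
             (use v elim(2) in \<open>auto simp: P_def Q_def\<close>)
      qed
      then have "P x *v v = v" unfolding P_def by (rule proj_mat_id[OF subspace_slow])
      with v show False by simp
    qed
  qed
  have "AE x in M. \<forall>j::nat. x \<in> B \<longrightarrow> \<not> up (\<lambda>n. a n x) (- c + 1 / real (Suc j))"
    unfolding AE_all_countable
  proof
    fix j :: nat
    define D where "D = {x \<in> B. up (\<lambda>n. a n x) (- c + 1 / real (Suc j))}"
    have D: "fwd.inv_set D" unfolding D_def by (rule fwd.inv_set_up[OF sa])
    have "AE x in M. x \<notin> D"
    proof (rule fwd.null_of_no_good_times[OF fwd.subadd_subset[OF sa D]])
      show "D \<subseteq> B" by (auto simp: D_def)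
      show "up (\<lambda>n. a n x) (- c + 1 / real (Suc j))" if "x \<in> D" for x using that by (simp add: D_def)
      have "0 < 1 / real (Suc j)" by simp
      from no_good[OF this] show "AE x in M. x \<in> D \<longrightarrow> (\<exists>N. \<forall>n\<ge>N. \<not> fwd.good_time a (- c + 1 / real (Suc j)) n x)"
        by eventually_elim (auto simp: D_def)
    qed
    then show "AE x in M. x \<in> B \<longrightarrow> \<not> up (\<lambda>n. a n x) (- c + 1 / real (Suc j))"
      by eventually_elim (auto simp: D_def)
  qed
  then show ?thesis using AE_space
  proof eventually_elim
    case (elim x)
    show ?case
    proof (cases "x \<in> B")
      case False
      then have "Q x = 0" using elim(2) by (simp add: B_def)
      show ?thesis
      proof
        fix v assume "v \<in> (slow C c x)\<^sup>\<bottom>"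
        then have "v = 0" using Qid[of v x] \<open>Q x = 0\<close> by simp
        then show "v \<in> slow (\<lambda>n x. transpose (C (-n) (T n x))) (- c) x"
          by (simp add: subspace_0[OF subspace_slow])
      qed
    next
      case True
      have nup: "\<not> up (\<lambda>n. a n x) (- c)" using elim(1) True up_gap by blast
      show ?thesis
      proof
        fix w assume w: "w \<in> (slow C c x)\<^sup>\<bottom>"
        show "w \<in> slow (\<lambda>n x. transpose (C (-n) (T n x))) (- c) x"
          unfolding slow_def mem_Collect_eq
        proof (intro allI impI)
          fix \<epsilon> :: real assume e: "0 < \<epsilon>"
          have "\<exists>N0. \<forall>n\<ge>N0. a n x \<le> (- c + \<epsilon>) * real n" using nup e by (simp only: not_up_iff simp_thms)
          then have "\<exists>N0. \<forall>n\<ge>N0. N n x \<le> exp ((- c + \<epsilon>) * real n)"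
            using Npos[OF True] by (simp add: a_def ln_le_iff)
          then obtain K where K: "K > 0" "\<And>n. N n x \<le> K * exp ((- c + \<epsilon>) * real n)"
            using ex_global_bound[of "\<lambda>n. N n x" "\<lambda>n. exp ((- c + \<epsilon>) * real n)"] by auto
          have "norm (transpose (C (- int n) (T (int n) x)) *v w) \<le> (K * norm w) * exp ((- c + \<epsilon>) * real n)" for n :: nat
          proof -
            let ?D = "C (- int n) (T (int n) x)"
            have Qt: "transpose (Q x) = Q x" unfolding Qorth by (rule transpose_proj_mat[OF so])
            \<comment> \<open>Transposition moves the projection next to w, which it fixes; so the
              norm of the inverse quotient bounds the dual cocycle on w.\<close>
            have "transpose ?D *v w = transpose (Q x ** ?D) *v w"
              by (simp add: matrix_transpose_mul Qt matrix_vector_mul_assoc[symmetric] Qid[OF w])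
            then have "norm (transpose ?D *v w) \<le> mat_norm (transpose (Q x ** ?D)) * norm w"
              by (metis mat_norm_bound)
            also have "\<dots> = N n x * norm w" by (simp only: mat_norm_transpose N_def)
            also have "\<dots> \<le> K * exp ((- c + \<epsilon>) * real n) * norm w" by (intro mult_right_mono K) auto
            finally show ?thesis by (simp add: mult.assoc mult.commute mult.left_commute)
          qed
          then show "\<exists>K. \<forall>n::nat. norm (transpose (C (- int n) (T (int n) x)) *v w) \<le> K * exp ((- c + \<epsilon>) * real n)" by blast
        qed
      qed
    qed
  qed
qed

end

section \<open>Limits of roots of positive definite matrices\<close>

text \<open>A maximiser v of the quadratic form on the unit sphere of S is an eigenvector: moving v
  along its residual z would increase the form to first order, so z is 0.\<close>

lemma symmetric_eigenvector_exists:
  fixes B :: "real^'m^'m"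
  assumes S: "subspace S" "S \<noteq> {0}" and sym: "transpose B = B" and inv: "\<And>v. v \<in> S \<Longrightarrow> B *v v \<in> S"
  obtains v l where "v \<in> S" "norm v = 1" "B *v v = l *\<^sub>R v"
proof -
  have symi: "(B *v v) \<bullet> w = v \<bullet> (B *v w)" for v w using transpose_inner[of B v w] by (simp add: sym)
  obtain w where w: "w \<in> S" "w \<noteq> 0" using S subspace_0[OF S(1)] by blast
  let ?C = "S \<inter> sphere 0 1"
  have "w /\<^sub>R norm w \<in> ?C" using w S(1) by (simp add: subspace_scale)
  then have ne: "?C \<noteq> {}" by blast
  have "compact ?C" using closed_Int_compact[OF closed_subspace[OF S(1)] compact_sphere] .
  moreover have "continuous_on ?C (\<lambda>v. (B *v v) \<bullet> v)" by (intro continuous_intros)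
  ultimately obtain v where v: "v \<in> ?C" "\<And>u. u \<in> ?C \<Longrightarrow> (B *v u) \<bullet> u \<le> (B *v v) \<bullet> v"
    using continuous_attains_sup[OF _ ne, of "\<lambda>v. (B *v v) \<bullet> v"] by blast
  define l where "l = (B *v v) \<bullet> v"
  have vv: "v \<bullet> v = 1" "v \<in> S" using v(1) by (auto simp: dot_square_norm)
  have le: "(B *v u) \<bullet> u \<le> l * (u \<bullet> u)" if u: "u \<in> S" for u
  proof (cases "u = 0")
    case False
    have "u /\<^sub>R norm u \<in> ?C" using False u S(1) by (simp add: subspace_scale)
    from v(2)[OF this] have "((B *v u) \<bullet> u) / (norm u * norm u) \<le> l"
      by (simp add: l_def matrix_vector_mult_scaleR divide_inverse mult.assoc mult.commute mult.left_commute)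
    then show ?thesis using False by (simp add: divide_le_eq dot_square_norm power2_eq_square)
  qed simp
  define z where "z = B *v v - l *\<^sub>R v"
  have zS: "z \<in> S" unfolding z_def using vv(2) inv S(1) by (simp add: subspace_diff subspace_scale)
  have zv: "z \<bullet> v = 0" by (simp add: z_def inner_diff_left l_def vv)
  have "z \<bullet> z = 0"
  proof (rule ccontr)
    assume "z \<bullet> z \<noteq> 0"
    then have p: "0 < z \<bullet> z" using inner_ge_zero[of z] by linarith
    define q where "q = l * (z \<bullet> z) - (B *v z) \<bullet> z"
    have main: "2 * s * (z \<bullet> z) \<le> s\<^sup>2 * q" for s :: real
    proof -
      have "v + s *\<^sub>R z \<in> S" using vv(2) zS S(1) by (simp add: subspace_add subspace_scale)
      from le[OF this] have "(B *v v) \<bullet> v + 2 * s * ((B *v v) \<bullet> z) + s\<^sup>2 * ((B *v z) \<bullet> z) \<le> l * (v \<bullet> v + 2 * s * (v \<bullet> z) + s\<^sup>2 * (z \<bullet> z))"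
        using symi[of z v] by (simp add: matrix_vector_right_distrib matrix_vector_mult_scaleR inner_add_left inner_add_right power2_eq_square inner_commute algebra_simps)
      moreover have "(B *v v) \<bullet> z = z \<bullet> z"
        using zv by (simp add: z_def inner_diff_left inner_diff_right inner_commute)
      moreover have "v \<bullet> z = 0" using zv by (simp add: inner_commute)
      ultimately show ?thesis using vv(1) by (simp add: l_def q_def algebra_simps)
    qed
    show False
    proof (cases "q \<le> 0")
      case True
      then show ?thesis using main[of 1] p by simp
    next
      case False
      \<comment> \<open>For positive q this value of s makes the right-hand side half of the
        left-hand side.\<close>
      have "2 * ((z \<bullet> z) / q) * (z \<bullet> z) \<le> ((z \<bullet> z) / q)\<^sup>2 * q" by (rule main)
      then have "2 * ((z \<bullet> z) * (z \<bullet> z)) \<le> (z \<bullet> z) * (z \<bullet> z)" using False by (simp add: power2_eq_square field_simps)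
      then show ?thesis using p by (simp add: mult_le_0_iff)
    qed
  qed
  then have "B *v v = l *\<^sub>R v" by (simp add: z_def)
  with v(1) show thesis by (intro that[of v l]) auto
qed

lemma symmetric_orthonormal_eigenbasis:
  fixes B :: "real^'m^'m"
  assumes S: "subspace S" and sym: "transpose B = B" and inv: "\<And>v. v \<in> S \<Longrightarrow> B *v v \<in> S"
  shows "\<exists>E\<subseteq>S. pairwise orthogonal E \<and> (\<forall>e\<in>E. norm e = 1 \<and> (\<exists>l. B *v e = l *\<^sub>R e)) \<and> span E = S"
  using S inv
proof (induction "dim S" arbitrary: S rule: less_induct)
  case less
  show ?case
  proof (cases "S = {0}")
    case True
    then show ?thesis by (intro exI[of _ "{}"]) auto
  next
    case False
    have symi: "(B *v v) \<bullet> w = v \<bullet> (B *v w)" for v w using transpose_inner[of B v w] by (simp add: sym)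
    obtain v l where v: "v \<in> S" "norm v = 1" "B *v v = l *\<^sub>R v"
      using symmetric_eigenvector_exists[OF less.prems(1) False sym less.prems(2)] by blast
    have vv: "v \<bullet> v = 1" using v(2) by (simp add: dot_square_norm)
    define S' where "S' = {w \<in> S. w \<bullet> v = 0}"
    have sub: "subspace S'" unfolding S'_def using less.prems(1)
      by (auto simp: subspace_def inner_add_left)
    have inv': "B *v w \<in> S'" if "w \<in> S'" for w
      using that less.prems(2)[of w] symi[of w v] v(3) by (simp add: S'_def)
    have "v \<notin> S'" using vv by (simp add: S'_def)
    moreover have "S' \<subseteq> S" unfolding S'_def by blast
    ultimately have "S' \<subset> S" using v(1) by blast
    then have "dim S' < dim S" using sub less.prems(1) by (intro dim_psubset) (simp add: span_eq_iff[THEN iffD2])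
    from less.hyps[OF this sub inv'] obtain E where E: "E \<subseteq> S'" "pairwise orthogonal E"
      "\<And>e. e \<in> E \<Longrightarrow> norm e = 1 \<and> (\<exists>l. B *v e = l *\<^sub>R e)" "span E = S'" by auto
    have "span (insert v E) = S"
    proof
      show "span (insert v E) \<subseteq> S" using v(1) E(1) by (intro span_minimal less.prems(1)) (auto simp: S'_def)
      show "S \<subseteq> span (insert v E)"
      proof
        fix w assume w: "w \<in> S"
        have "w - (w \<bullet> v) *\<^sub>R v \<in> S'" using w v(1) vv less.prems(1)
          by (simp add: S'_def subspace_diff subspace_scale inner_diff_left)
        then have "w - (w \<bullet> v) *\<^sub>R v \<in> span (insert v E)" using E(4) span_mono[of E "insert v E"] by blast
        moreover have "(w \<bullet> v) *\<^sub>R v \<in> span (insert v E)" by (intro span_scale span_base) simp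
        ultimately have "(w - (w \<bullet> v) *\<^sub>R v) + (w \<bullet> v) *\<^sub>R v \<in> span (insert v E)" by (rule span_add)
        then show "w \<in> span (insert v E)" by simp
      qed
    qed
    moreover have "pairwise orthogonal (insert v E)"
      using E(1,2) by (auto simp: pairwise_insert S'_def orthogonal_def inner_commute)
    moreover have "insert v E \<subseteq> S" using v(1) E(1) by (auto simp: S'_def)
    ultimately show ?thesis using v E(3) by (intro exI[of _ "insert v E"]) auto
  qed
qed

section \<open>Diagonalisation and powers of positive definite matrices\<close>

lemma diag_mat_mult_nth: "(diag_mat d ** B) $ i $ j = d $ i * B $ i $ j"
proof -
  have "(diag_mat d ** B) $ i $ j = (\<Sum>k\<in>UNIV. (if i = k then d $ i * B $ k $ j else 0))"
    unfolding matrix_matrix_mult_def diag_mat_def by (simp add: if_distrib[of "\<lambda>z. z * _"] cong: if_cong)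
  then show ?thesis by simp
qed

lemma mult_diag_mat_nth: "(B ** diag_mat d) $ i $ j = B $ i $ j * d $ j"
proof -
  have "(B ** diag_mat d) $ i $ j = (\<Sum>k\<in>UNIV. (if k = j then B $ i $ k * d $ k else 0))"
    unfolding matrix_matrix_mult_def diag_mat_def by (simp add: if_distrib[of "\<lambda>z. _ * z"] cong: if_cong)
  then show ?thesis by simp
qed

lemma transpose_diag_mat: "transpose (diag_mat d) = diag_mat d"
  by (simp add: transpose_def diag_mat_def vec_eq_iff)

lemma orthogonal_matrixD:
  fixes Q :: "real^'m^'m"
  assumes "orthogonal_matrix Q"
  shows "transpose Q ** Q = mat 1" "Q ** transpose Q = mat 1"
  using assms by (auto simp: orthogonal_matrix_def)

lemma spectral_matrix_iff:
  fixes Q S :: "real^'m^'m"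
  assumes Q: "orthogonal_matrix Q"
  shows "S = Q ** diag_mat d ** transpose Q \<longleftrightarrow> (\<forall>j. S *v column j Q = d $ j *\<^sub>R column j Q)"
proof -
  have "S = Q ** diag_mat d ** transpose Q \<longleftrightarrow> S ** Q = Q ** diag_mat d"
  proof
    assume "S = Q ** diag_mat d ** transpose Q"
    then show "S ** Q = Q ** diag_mat d"
      using orthogonal_matrixD(1)[OF Q] by (simp add: matrix_mul_assoc[symmetric])
  next
    assume "S ** Q = Q ** diag_mat d"
    then have "S ** Q ** transpose Q = Q ** diag_mat d ** transpose Q" by simp
    then show "S = Q ** diag_mat d ** transpose Q"
      using orthogonal_matrixD(2)[OF Q] by (simp add: matrix_mul_assoc[symmetric])
  qed
  also have "\<dots> \<longleftrightarrow> (\<forall>i j. (S ** Q) $ i $ j = (Q ** diag_mat d) $ i $ j)" by (simp add: vec_eq_iff)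
  also have "\<dots> \<longleftrightarrow> (\<forall>i j. (S *v column j Q) $ i = (d $ j *\<^sub>R column j Q) $ i)"
    unfolding mult_diag_mat_nth
    by (simp add: matrix_matrix_mult_def matrix_vector_mult_def column_def mult.commute)
  also have "\<dots> \<longleftrightarrow> (\<forall>j. S *v column j Q = d $ j *\<^sub>R column j Q)" by (auto simp: vec_eq_iff)
  finally show ?thesis .
qed

lemma column_inner: "column i Q \<bullet> column j R = (transpose Q ** (R :: real^'m^'m)) $ i $ j"
  by (simp add: column_def inner_vec_def transpose_def matrix_matrix_mult_def)

lemma orthogonal_matrix_columns_inner:
  fixes Q :: "real^'m^'m"
  assumes "orthogonal_matrix Q"
  shows "column i Q \<bullet> column j Q = (if i = j then 1 else 0)"
  using orthogonal_matrixD(1)[OF assms] by (simp add: column_inner mat_def)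

lemma orthogonal_matrix_expand:
  fixes Q :: "real^'m^'m"
  assumes "orthogonal_matrix Q"
  shows "v = (\<Sum>j\<in>UNIV. (v \<bullet> column j Q) *\<^sub>R column j Q)"
proof -
  have "v = Q *v (transpose Q *v v)"
    by (simp only: matrix_vector_mul_assoc orthogonal_matrixD(2)[OF assms] matrix_vector_mul_lid)
  also have "\<dots> = (\<Sum>j\<in>UNIV. (transpose Q *v v) $ j *s column j Q)" by (rule matrix_mult_sum)
  also have "\<dots> = (\<Sum>j\<in>UNIV. (v \<bullet> column j Q) *\<^sub>R column j Q)"
    by (intro sum.cong refl) (simp add: scalar_mult_eq_scaleR matrix_vector_mult_def transpose_def column_def inner_vec_def mult.commute)
  finally show ?thesis .
qed

theorem spectral_theorem_symmetric:
  fixes B :: "real^'m^'m"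
  assumes sym: "transpose B = B"
  obtains Q d where "orthogonal_matrix Q" "B = Q ** diag_mat d ** transpose Q"
proof -
  obtain E where E: "pairwise orthogonal E" "\<And>e. e \<in> E \<Longrightarrow> norm e = 1" "\<And>e. e \<in> E \<Longrightarrow> \<exists>l. B *v e = l *\<^sub>R e" "span E = (UNIV :: (real^'m) set)"
    using symmetric_orthonormal_eigenbasis[OF subspace_UNIV sym] by auto
  have "0 \<notin> E" using E(2) by force
  then have "independent E" using E(1) by (rule pairwise_orthogonal_independent[rotated])
  then have "card E = dim (span E)" "finite E" by (simp_all add: indep_card_eq_dim_span independent_imp_finite)
  then have "card E = CARD('m)" using E(4) by (simp add: dim_UNIV)
  then obtain f where f: "bij_betw f (UNIV::'m set) E"
    using \<open>finite E\<close> finite_same_card_bij[of "UNIV::'m set" E] by auto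
  define Q where "Q = (\<chi> r c. f c $ r)"
  have col: "column j Q = f j" for j by (simp add: Q_def column_def vec_eq_iff)
  have fE: "f j \<in> E" for j using f by (auto simp: bij_betw_def)
  have Q: "orthogonal_matrix Q"
    unfolding orthogonal_matrix_orthonormal_columns col
  proof (intro conjI allI impI)
    show "norm (f i) = 1" for i using E(2) fE by blast
    show "orthogonal (f i) (f j)" if "i \<noteq> j" for i j
    proof -
      have "f i \<noteq> f j" using that f by (auto simp: bij_betw_def inj_on_def)
      then show ?thesis using E(1) fE by (auto simp: pairwise_def)
    qed
  qed
  have "\<exists>l. B *v f j = l *\<^sub>R f j" for j by (rule E(3)[OF fE])
  then have "\<exists>d. \<forall>j. B *v f j = d j *\<^sub>R f j" by (intro choice allI)
  then obtain d where d: "\<And>j. B *v f j = d j *\<^sub>R f j" by blast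
  have "B = Q ** diag_mat (\<chi> j. d j) ** transpose Q"
    unfolding spectral_matrix_iff[OF Q] using d by (simp add: col)
  with Q show thesis by (rule that)
qed

text \<open>An entry of N can be nonzero only where the two diagonals agree, so N still intertwines
  them after one function has been applied to both. This is why functions of a symmetric matrix do
  not depend on the diagonalisation.\<close>

lemma diag_intertwine:
  assumes "diag_mat d' ** N = N ** diag_mat d"
    "\<And>i j. d' $ i = d $ j \<Longrightarrow> e' $ i = e $ j"
  shows "diag_mat e' ** N = N ** diag_mat e"
proof -
  have "e' $ i * N $ i $ j = N $ i $ j * e $ j" for i j
  proof -
    have "(diag_mat d' ** N) $ i $ j = (N ** diag_mat d) $ i $ j" using assms(1) by simp
    then have "N $ i $ j = 0 \<or> d' $ i = d $ j" by (simp add: diag_mat_mult_nth mult_diag_mat_nth)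
    then show ?thesis using assms(2)[of i j] by auto
  qed
  then show ?thesis by (simp add: vec_eq_iff diag_mat_mult_nth mult_diag_mat_nth)
qed

lemma orthogonal_conj_eq_iff:
  fixes Q Q' :: "real^'m^'m"
  assumes Q: "orthogonal_matrix Q" and Q': "orthogonal_matrix Q'"
  shows "Q ** diag_mat d ** transpose Q = Q' ** diag_mat d' ** transpose Q' \<longleftrightarrow>
    diag_mat d' ** (transpose Q' ** Q) = (transpose Q' ** Q) ** diag_mat d"
proof
  assume "Q ** diag_mat d ** transpose Q = Q' ** diag_mat d' ** transpose Q'"
  then have "transpose Q' ** (Q ** diag_mat d ** transpose Q) ** Q = transpose Q' ** (Q' ** diag_mat d' ** transpose Q') ** Q" by simp
  then have "(transpose Q' ** Q) ** diag_mat d ** (transpose Q ** Q) = (transpose Q' ** Q') ** diag_mat d' ** (transpose Q' ** Q)"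
    by (simp add: matrix_mul_assoc)
  then show "diag_mat d' ** (transpose Q' ** Q) = (transpose Q' ** Q) ** diag_mat d"
    using orthogonal_matrixD(1)[OF Q] orthogonal_matrixD(1)[OF Q'] by simp
next
  assume "diag_mat d' ** (transpose Q' ** Q) = (transpose Q' ** Q) ** diag_mat d"
  then have "Q' ** (diag_mat d' ** (transpose Q' ** Q)) ** transpose Q = Q' ** ((transpose Q' ** Q) ** diag_mat d) ** transpose Q" by simp
  then have "Q' ** diag_mat d' ** transpose Q' ** (Q ** transpose Q) = (Q' ** transpose Q') ** Q ** diag_mat d ** transpose Q"
    by (simp add: matrix_mul_assoc)
  then show "Q ** diag_mat d ** transpose Q = Q' ** diag_mat d' ** transpose Q'"
    using orthogonal_matrixD(2)[OF Q] orthogonal_matrixD(2)[OF Q'] by simp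
qed

lemma posdef_powr_eq:
  fixes Q :: "real^'m^'m"
  assumes Q: "orthogonal_matrix Q" and d: "\<And>i. 0 < d $ i"
  shows "posdef_powr (Q ** diag_mat d ** transpose Q) s = Q ** diag_mat (\<chi> i. d $ i powr s) ** transpose Q"
  unfolding posdef_powr_def
proof (rule the_equality)
  show "\<exists>Qa da. orthogonal_matrix Qa \<and> (\<forall>i. 0 < da $ i) \<and>
      Q ** diag_mat d ** transpose Q = Qa ** diag_mat da ** transpose Qa \<and>
      Q ** diag_mat (\<chi> i. d $ i powr s) ** transpose Q = Qa ** diag_mat (\<chi> i. da $ i powr s) ** transpose Qa"
    using Q d by blast
next
  fix P assume "\<exists>Qa da. orthogonal_matrix Qa \<and> (\<forall>i. 0 < da $ i) \<and>
      Q ** diag_mat d ** transpose Q = Qa ** diag_mat da ** transpose Qa \<and>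
      P = Qa ** diag_mat (\<chi> i. da $ i powr s) ** transpose Qa"
  then obtain Q' d' where Q': "orthogonal_matrix Q'" "\<And>i. 0 < d' $ i"
    "Q ** diag_mat d ** transpose Q = Q' ** diag_mat d' ** transpose Q'"
    "P = Q' ** diag_mat (\<chi> i. d' $ i powr s) ** transpose Q'" by blast
  have "diag_mat d' ** (transpose Q' ** Q) = (transpose Q' ** Q) ** diag_mat d"
    using Q'(3) by (simp only: orthogonal_conj_eq_iff[OF Q Q'(1)])
  then have "diag_mat (\<chi> i. d' $ i powr s) ** (transpose Q' ** Q) = (transpose Q' ** Q) ** diag_mat (\<chi> i. d $ i powr s)"
    by (rule diag_intertwine) simp
  then show "P = Q ** diag_mat (\<chi> i. d $ i powr s) ** transpose Q"
    unfolding Q'(4) by (simp only: orthogonal_conj_eq_iff[OF Q Q'(1), symmetric])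
qed

text \<open>E and D stand for the forward slow spaces, at one point, of a cocycle and of its dual.
  Stated for abstract flags, the argument serves both the sampling at integers, which produces a
  frame, and the limit along real times.\<close>

locale growth_flag =
  fixes E D :: "real \<Rightarrow> (real^'m) set"
  assumes subspace_E: "subspace (E c)" and subspace_D: "subspace (D c)"
    and E_mono: "c \<le> c' \<Longrightarrow> E c \<subseteq> E c'"
    and E_right: "(\<And>r. c < r \<Longrightarrow> v \<in> E r) \<Longrightarrow> v \<in> E c"
    and E_orth: "(E c)\<^sup>\<bottom> \<subseteq> D (- c)"
    and E_top: "\<exists>L. E L = UNIV" and D_top: "\<exists>L. D L = UNIV"
begin

text \<open>\<^term>\<open>B' n\<close> plays the role of the inverse transpose of \<^term>\<open>B n\<close>.\<close>
definition adapted :: "(nat \<Rightarrow> real^'m^'m) \<Rightarrow> (nat \<Rightarrow> real^'m^'m) \<Rightarrow> (nat \<Rightarrow> real) \<Rightarrow> bool" where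
  "adapted B B' t \<longleftrightarrow> filterlim t at_top sequentially \<and> (\<forall>n. 1 \<le> t n) \<and>
     (\<forall>n. transpose (B' n) ** B n = mat 1) \<and>
     (\<forall>c. \<forall>\<epsilon>>0. \<exists>K. \<forall>n. \<forall>v\<in>E c. norm (B n *v v) \<le> K * exp ((c + \<epsilon>) * t n) * norm v) \<and>
     (\<forall>c. \<forall>\<epsilon>>0. \<exists>K. \<forall>n. \<forall>v\<in>D c. norm (B' n *v v) \<le> K * exp ((c + \<epsilon>) * t n) * norm v)"

text \<open>An orthonormal basis adapted to the flag E, the entries of a being the levels at which E
  jumps. Limits of eigenbases of \<open>transpose (B n) ** B n\<close> have this form.\<close>

definition frame :: "real^'m^'m \<Rightarrow> real^'m \<Rightarrow> bool" where
  "frame Q a \<longleftrightarrow> orthogonal_matrix Q \<and> (\<forall>j. column j Q \<in> E (a $ j)) \<and>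
     (\<forall>j. \<forall>c<a $ j. \<forall>v\<in>E c. v \<bullet> column j Q = 0)"

text \<open>A unit eigenvector with eigenvalue \<open>exp (2 * \<alpha> * t)\<close> is stretched by
  \<open>exp (\<alpha> * t)\<close> under B. Pairing through B shows that vectors of E c are nearly
  orthogonal to eigenvectors with \<alpha> above c. Pairing through B' shows the same for vectors of
  D (- c), in particular for those orthogonal to E c, and eigenvectors with \<alpha> below c. In the
  limit a column is orthogonal to all lower levels of E and lies in every higher one;
  \<open>E_right\<close> gives its own level.\<close>

lemma adapted_subseq:
  assumes B: "adapted B B' t"
    and Q: "\<And>n. orthogonal_matrix (Q n)" and d: "\<And>n j. 0 < d n $ j"
    and S: "\<And>n. transpose (B n) ** B n = Q n ** diag_mat (d n) ** transpose (Q n)"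
  obtains r Q' a where "strict_mono r" "frame Q' a" "(\<lambda>n. Q (r n)) \<longlonglongrightarrow> Q'"
    "\<And>j. (\<lambda>n. ln (d (r n) $ j) / (2 * t (r n))) \<longlonglongrightarrow> a $ j"
proof -
  have t: "filterlim t at_top sequentially" "\<And>n. 1 \<le> t n" using B by (auto simp: adapted_def)
  have BB: "(B n *v v) \<bullet> (B' n *v w) = v \<bullet> w" for n v w
  proof -
    have "(B n *v v) \<bullet> (B' n *v w) = (B' n *v w) \<bullet> (B n *v v)" by (rule inner_commute)
    also have "\<dots> = w \<bullet> (transpose (B' n) *v (B n *v v))" using transpose_inner[of "B' n" "B n *v v" w] by (simp add: inner_commute)
    also have "\<dots> = w \<bullet> v" using B by (simp add: adapted_def matrix_vector_mul_assoc)
    finally show ?thesis by (simp add: inner_commute)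
  qed
  define q where "q n j = column j (Q n)" for n j
  have qn: "norm (q n j) = 1" for n j
    using orthogonal_matrix_columns_inner[OF Q, of j n j] by (simp add: q_def norm_eq_sqrt_inner)
  have eig: "(transpose (B n) ** B n) *v q n j = d n $ j *\<^sub>R q n j" for n j
    using S[of n] unfolding spectral_matrix_iff[OF Q] q_def by blast
  have Binner: "(B n *v v) \<bullet> (B n *v q n j) = d n $ j * (v \<bullet> q n j)" for n v j
  proof -
    have "(B n *v v) \<bullet> (B n *v q n j) = (transpose (B n) *v (B n *v v)) \<bullet> q n j"
      by (rule transpose_inner[symmetric])
    also have "\<dots> = ((transpose (B n) ** B n) *v v) \<bullet> q n j" by (simp add: matrix_vector_mul_assoc)
    also have "\<dots> = v \<bullet> ((transpose (B n) ** B n) *v q n j)"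
      using transpose_inner[of "transpose (B n) ** B n" v "q n j"] by (simp add: matrix_transpose_mul)
    also have "\<dots> = d n $ j * (v \<bullet> q n j)" by (simp add: eig)
    finally show ?thesis .
  qed
  define \<alpha> where "\<alpha> n = (\<chi> j. ln (d n $ j) / (2 * t n))" for n
  have \<alpha>t: "exp (\<alpha> n $ j * t n) = sqrt (d n $ j)" for n j
  proof -
    have "\<alpha> n $ j * t n = ln (d n $ j) / 2" using t(2)[of n] by (simp add: \<alpha>_def field_simps)
    also have "\<dots> = ln (sqrt (d n $ j))" using d[of n j] by (simp add: ln_sqrt)
    finally show ?thesis using d[of n j] by simp
  qed
  have nBq: "norm (B n *v q n j) = exp (\<alpha> n $ j * t n)" for n j
    using Binner[of n "q n j" j] qn[of n j] by (simp add: \<alpha>t norm_eq_sqrt_inner)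
  have small1: "\<bar>v \<bullet> q n j\<bar> \<le> norm (B n *v v) * exp (- (\<alpha> n $ j * t n))" for n v j
  proof -
    have "d n $ j * \<bar>v \<bullet> q n j\<bar> = \<bar>(B n *v v) \<bullet> (B n *v q n j)\<bar>"
      using d[of n j] by (simp add: Binner abs_mult)
    also have "\<dots> \<le> norm (B n *v v) * norm (B n *v q n j)" by (rule Cauchy_Schwarz_ineq2)
    finally have *: "d n $ j * \<bar>v \<bullet> q n j\<bar> \<le> norm (B n *v v) * exp (\<alpha> n $ j * t n)" by (simp add: nBq)
    have "d n $ j = exp (\<alpha> n $ j * t n) * exp (\<alpha> n $ j * t n)" using d[of n j] by (simp add: \<alpha>t)
    with * have "exp (\<alpha> n $ j * t n) * (exp (\<alpha> n $ j * t n) * \<bar>v \<bullet> q n j\<bar>) \<le> exp (\<alpha> n $ j * t n) * norm (B n *v v)"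
      by (simp add: mult.commute mult.left_commute)
    then have "exp (\<alpha> n $ j * t n) * \<bar>v \<bullet> q n j\<bar> \<le> norm (B n *v v)" by simp
    then show ?thesis by (simp add: exp_minus field_simps)
  qed
  have small2: "\<bar>w \<bullet> q n j\<bar> \<le> norm (B' n *v w) * exp (\<alpha> n $ j * t n)" for n w j
  proof -
    have "\<bar>w \<bullet> q n j\<bar> = \<bar>(B n *v q n j) \<bullet> (B' n *v w)\<bar>" unfolding BB by (simp add: inner_commute)
    also have "\<dots> \<le> norm (B n *v q n j) * norm (B' n *v w)" by (rule Cauchy_Schwarz_ineq2)
    finally show ?thesis by (simp add: nBq mult.commute)
  qed
  have Ebd: "\<exists>K. \<forall>n. \<forall>v\<in>E c. norm (B n *v v) \<le> K * exp ((c + \<epsilon>) * t n) * norm v" if "0 < \<epsilon>" for c \<epsilon>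
    using B that by (simp add: adapted_def)
  have Dbd: "\<exists>K. \<forall>n. \<forall>v\<in>D c. norm (B' n *v v) \<le> K * exp ((c + \<epsilon>) * t n) * norm v" if "0 < \<epsilon>" for c \<epsilon>
    using B that by (simp add: adapted_def)
  have arith: "x \<le> \<bar>ln K\<bar> + L" if "exp (x * s) \<le> K * exp (L * s)" "1 \<le> s" "0 < K" for x s K L :: real
  proof -
    have "x * s \<le> ln (K * exp (L * s))" using that by (subst ln_ge_iff) auto
    also have "\<dots> = ln K + L * s" using that by (simp add: ln_mult)
    also have "\<dots> \<le> \<bar>ln K\<bar> * s + L * s" using that mult_left_mono[of 1 s "\<bar>ln K\<bar>"] by linarith
    finally have "x * s \<le> (\<bar>ln K\<bar> + L) * s" by (simp add: algebra_simps)
    then show ?thesis using that by simp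
  qed
  \<comment> \<open>The top levels of E and D bound the exponents from above and from below, as
    compactness requires.\<close>
  obtain L1 where "E L1 = UNIV" using E_top by blast
  then obtain K1 where K1: "\<And>n v. norm (B n *v v) \<le> K1 * exp ((L1 + 1) * t n) * norm v" using Ebd[of 1 L1] by auto
  obtain L2 where "D L2 = UNIV" using D_top by blast
  then obtain K2 where K2: "\<And>n v. norm (B' n *v v) \<le> K2 * exp ((L2 + 1) * t n) * norm v" using Dbd[of 1 L2] by auto
  have up: "\<alpha> n $ j \<le> \<bar>ln (max 1 K1)\<bar> + (L1 + 1)" for n j
  proof (rule arith[OF _ t(2)[of n]])
    have "exp (\<alpha> n $ j * t n) \<le> K1 * exp ((L1 + 1) * t n)" using K1[of n "q n j"] qn by (simp add: nBq)
    also have "\<dots> \<le> max 1 K1 * exp ((L1 + 1) * t n)" by (intro mult_right_mono) auto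
    finally show "exp (\<alpha> n $ j * t n) \<le> max 1 K1 * exp ((L1 + 1) * t n)" .
  qed auto
  have lo: "- (\<alpha> n $ j) \<le> \<bar>ln (max 1 K2)\<bar> + (L2 + 1)" for n j
  proof (rule arith[OF _ t(2)[of n]])
    have "1 \<le> norm (B' n *v q n j) * exp (\<alpha> n $ j * t n)"
      using small2[of "q n j" n j] qn[of n j] by (simp add: dot_square_norm)
    then have "exp (- (\<alpha> n $ j) * t n) \<le> norm (B' n *v q n j)" by (simp add: exp_minus field_simps)
    also have "\<dots> \<le> K2 * exp ((L2 + 1) * t n)" using K2[of n "q n j"] qn by simp
    also have "\<dots> \<le> max 1 K2 * exp ((L2 + 1) * t n)" by (intro mult_right_mono) auto
    finally show "exp (- (\<alpha> n $ j) * t n) \<le> max 1 K2 * exp ((L2 + 1) * t n)" .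
  qed auto
  have "bounded (range \<alpha>)"
  proof -
    define R where "R = (\<bar>ln (max 1 K1)\<bar> + \<bar>L1 + 1\<bar>) + (\<bar>ln (max 1 K2)\<bar> + \<bar>L2 + 1\<bar>)"
    have "\<bar>\<alpha> n $ j\<bar> \<le> R" for n j using up[of n j] lo[of n j] unfolding R_def by linarith
    then have "norm (\<alpha> n) \<le> (\<Sum>j\<in>(UNIV::'m set). R)" for n
      by (intro order.trans[OF norm_le_l1_cart] sum_mono) auto
    then show ?thesis by (intro boundedI[of _ "\<Sum>j\<in>(UNIV::'m set). R"]) auto
  qed
  moreover have "bounded (range Q)"
  proof -
    have "\<bar>Q n $ i $ j\<bar> \<le> 1" for n i j
    proof -
      have "\<bar>Q n $ i $ j\<bar> = \<bar>q n j $ i\<bar>" by (simp add: q_def column_def)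
      also have "\<dots> \<le> 1" using component_le_norm_cart[of "q n j" i] qn by simp
      finally show ?thesis .
    qed
    then have *: "(\<Sum>j\<in>UNIV. \<bar>Q n $ i $ j\<bar>) \<le> (\<Sum>j\<in>(UNIV::'m set). 1)" for n i
      by (intro sum_mono)
    have rn: "norm (Q n $ i) \<le> (\<Sum>j\<in>(UNIV::'m set). 1)" for n i
      by (rule order.trans[OF norm_le_l1_cart *])
    have "norm (Q n) \<le> (\<Sum>i\<in>UNIV. norm (Q n $ i))" for n
      unfolding norm_vec_def by (rule L2_set_le_sum) simp
    moreover have "(\<Sum>i\<in>UNIV. norm (Q n $ i)) \<le> (\<Sum>i\<in>(UNIV::'m set). (\<Sum>j\<in>(UNIV::'m set). 1))" for n
      by (intro sum_mono rn)
    ultimately have "norm (Q n) \<le> (\<Sum>i\<in>(UNIV::'m set). (\<Sum>j\<in>(UNIV::'m set). 1))" for n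
      by (rule order.trans)
    then have "norm (Q n) \<le> (\<Sum>i\<in>(UNIV::'m set). real CARD('m))" for n by simp
    then show ?thesis by (intro boundedI[of _ "\<Sum>i\<in>(UNIV::'m set). real CARD('m)"]) auto
  qed
  ultimately have "bounded (range Q \<times> range \<alpha>)" by (intro bounded_Times)
  then have "bounded (range (\<lambda>n. (Q n, \<alpha> n)))" by (rule bounded_subset) auto
  then obtain r l where r: "strict_mono r" "((\<lambda>n. (Q n, \<alpha> n)) \<circ> r) \<longlonglongrightarrow> l"
    using bounded_imp_convergent_subsequence by blast
  define Q' where "Q' = fst l"
  define a where "a = snd l"
  have limQ: "(\<lambda>n. Q (r n)) \<longlonglongrightarrow> Q'" using tendsto_fst[OF r(2)] by (simp add: Q'_def o_def)
  have lim\<alpha>: "(\<lambda>n. \<alpha> (r n)) \<longlonglongrightarrow> a" using tendsto_snd[OF r(2)] by (simp add: a_def o_def)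
  have limQn: "(\<lambda>n. Q (r n) $ i $ j) \<longlonglongrightarrow> Q' $ i $ j" for i j by (intro tendsto_vec_nth limQ)
  have lima: "(\<lambda>n. \<alpha> (r n) $ j) \<longlonglongrightarrow> a $ j" for j by (intro tendsto_vec_nth lim\<alpha>)
  have limq: "(\<lambda>n. q (r n) j) \<longlonglongrightarrow> column j Q'" for j
    unfolding q_def column_def by (rule vec_tendstoI) (simp add: limQn)
  have tr: "filterlim (\<lambda>n. t (r n)) at_top sequentially"
    using filterlim_compose[OF t(1) filterlim_subseq[OF r(1)]] .
  have expo: "(\<lambda>n. K * exp (s (r n) * t (r n))) \<longlonglongrightarrow> 0" if "(\<lambda>n. s (r n)) \<longlonglongrightarrow> s'" "s' < 0" for s s' K
  proof -
    have "filterlim (\<lambda>n. s (r n) * t (r n)) at_bot sequentially"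
      using that tr by (rule filterlim_tendsto_neg_mult_at_bot)
    then have "(\<lambda>n. exp (s (r n) * t (r n))) \<longlonglongrightarrow> 0" by (rule filterlim_compose[OF exp_at_bot])
    then show ?thesis by (rule tendsto_mult_right_zero)
  qed
  have Q'o: "orthogonal_matrix Q'"
    unfolding orthogonal_matrix
  proof (simp only: vec_eq_iff, intro allI)
    fix i j
    have "(\<lambda>n. q (r n) i \<bullet> q (r n) j) \<longlonglongrightarrow> column i Q' \<bullet> column j Q'" by (intro tendsto_inner limq)
    moreover have "q (r n) i \<bullet> q (r n) j = (mat 1 :: real^'m^'m) $ i $ j" for n
      unfolding q_def using orthogonal_matrix_columns_inner[OF Q] by (simp add: mat_def)
    ultimately show "(transpose Q' ** Q') $ i $ j = (mat 1 :: real^'m^'m) $ i $ j"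
      by (simp add: LIMSEQ_const_iff column_inner)
  qed
  have orth: "v \<bullet> column j Q' = 0" if c: "c < a $ j" and v: "v \<in> E c" for v c j
  proof -
    define \<epsilon> where "\<epsilon> = (a $ j - c) / 2"
    have e: "0 < \<epsilon>" "c + \<epsilon> - a $ j < 0" using c by (auto simp: \<epsilon>_def field_simps)
    obtain K where K: "\<And>n. norm (B n *v v) \<le> K * exp ((c + \<epsilon>) * t n) * norm v" using Ebd[OF e(1), of c] v by blast
    have "\<bar>v \<bullet> q n j\<bar> \<le> (K * norm v) * exp ((c + \<epsilon> - \<alpha> n $ j) * t n)" for n
    proof -
      have "\<bar>v \<bullet> q n j\<bar> \<le> (K * exp ((c + \<epsilon>) * t n) * norm v) * exp (- (\<alpha> n $ j * t n))"
        by (rule order.trans[OF small1 mult_right_mono[OF K]]) simp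
      also have "\<dots> = (K * norm v) * exp ((c + \<epsilon> - \<alpha> n $ j) * t n)"
        by (simp add: left_diff_distrib exp_diff exp_minus divide_inverse)
      finally show ?thesis .
    qed
    moreover have "(\<lambda>n. (K * norm v) * exp ((c + \<epsilon> - \<alpha> (r n) $ j) * t (r n))) \<longlonglongrightarrow> 0"
      by (rule expo[OF _ e(2)]) (intro tendsto_intros lima)
    ultimately have "(\<lambda>n. v \<bullet> q (r n) j) \<longlonglongrightarrow> 0"
      by (intro Lim_null_comparison[of "\<lambda>n. v \<bullet> q (r n) j"]) auto
    moreover have "(\<lambda>n. v \<bullet> q (r n) j) \<longlonglongrightarrow> v \<bullet> column j Q'" by (intro tendsto_intros limq)
    ultimately show ?thesis using LIMSEQ_unique by blast
  qed
  have inE: "column j Q' \<in> E c" if c: "a $ j < c" for c j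
  proof -
    have "w \<bullet> column j Q' = 0" if w: "w \<in> (E c)\<^sup>\<bottom>" for w
    proof -
      define \<epsilon> where "\<epsilon> = (c - a $ j) / 2"
      have e: "0 < \<epsilon>" "- c + \<epsilon> + a $ j < 0" using c by (auto simp: \<epsilon>_def field_simps)
      have "w \<in> D (- c)" using E_orth w by blast
      then obtain K where K: "\<And>n. norm (B' n *v w) \<le> K * exp ((- c + \<epsilon>) * t n) * norm w" using Dbd[OF e(1), of "- c"] by blast
      have "\<bar>w \<bullet> q n j\<bar> \<le> (K * norm w) * exp ((- c + \<epsilon> + \<alpha> n $ j) * t n)" for n
      proof -
        have "\<bar>w \<bullet> q n j\<bar> \<le> (K * exp ((- c + \<epsilon>) * t n) * norm w) * exp (\<alpha> n $ j * t n)"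
          by (rule order.trans[OF small2 mult_right_mono[OF K]]) simp
        also have "\<dots> = (K * norm w) * exp ((- c + \<epsilon> + \<alpha> n $ j) * t n)"
          unfolding distrib_right[of "- c + \<epsilon>" "\<alpha> n $ j"] exp_add by (simp only: mult.assoc mult.commute mult.left_commute)
        finally show ?thesis .
      qed
      moreover have "(\<lambda>n. (K * norm w) * exp ((- c + \<epsilon> + \<alpha> (r n) $ j) * t (r n))) \<longlonglongrightarrow> 0"
        by (rule expo[OF _ e(2)]) (intro tendsto_intros lima)
      ultimately have "(\<lambda>n. w \<bullet> q (r n) j) \<longlonglongrightarrow> 0"
        by (intro Lim_null_comparison[of "\<lambda>n. w \<bullet> q (r n) j"]) auto
      moreover have "(\<lambda>n. w \<bullet> q (r n) j) \<longlonglongrightarrow> w \<bullet> column j Q'" by (intro tendsto_intros limq)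
      ultimately show ?thesis using LIMSEQ_unique by blast
    qed
    then have "column j Q' \<in> (E c)\<^sup>\<bottom>\<^sup>\<bottom>" by (auto simp: orthogonal_comp_def orthogonal_def)
    then show ?thesis by (simp add: orthogonal_comp_self[OF subspace_E])
  qed
  have "frame Q' a" unfolding frame_def
    using Q'o orth E_right inE by auto
  moreover have "(\<lambda>n. ln (d (r n) $ j) / (2 * t (r n))) \<longlonglongrightarrow> a $ j" for j using lima[of j] by (simp add: \<alpha>_def)
  ultimately show thesis using r(1) limQ by (intro that) auto
qed

text \<open>Columns of the two frames with different exponents are orthogonal, so the transition
  matrix intertwines the two diagonals. The matrix thus depends on the flag only, and subsequential
  limits of the roots are all equal.\<close>

lemma frame_conj_unique:
  assumes F: "frame Q a" and F': "frame Q' a'"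
  shows "Q ** diag_mat (\<chi> i. exp (a $ i)) ** transpose Q = Q' ** diag_mat (\<chi> i. exp (a' $ i)) ** transpose Q'"
proof -
  have Q: "orthogonal_matrix Q" "orthogonal_matrix Q'" using F F' by (auto simp: frame_def)
  have "diag_mat a' ** (transpose Q' ** Q) = (transpose Q' ** Q) ** diag_mat a"
  proof -
    have "a' $ i * (transpose Q' ** Q) $ i $ j = (transpose Q' ** Q) $ i $ j * a $ j" for i j
    proof (cases "a' $ i = a $ j")
      case False
      have "column i Q' \<bullet> column j Q = 0"
      proof (cases "a' $ i < a $ j")
        case True then show ?thesis using F F' unfolding frame_def by blast
      next
        case False
        with \<open>a' $ i \<noteq> a $ j\<close> have "a $ j < a' $ i" by simp
        then have "column j Q \<bullet> column i Q' = 0" using F F' unfolding frame_def by blast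
        then show ?thesis by (simp add: inner_commute)
      qed
      then show ?thesis by (simp add: column_inner)
    qed simp
    then show ?thesis by (simp add: vec_eq_iff diag_mat_mult_nth mult_diag_mat_nth)
  qed
  then have "diag_mat (\<chi> i. exp (a' $ i)) ** (transpose Q' ** Q) = (transpose Q' ** Q) ** diag_mat (\<chi> i. exp (a $ i))"
    by (rule diag_intertwine) simp
  then show ?thesis by (simp only: orthogonal_conj_eq_iff[OF Q])
qed

lemma frame_span:
  assumes F: "frame Q a"
  shows "v \<in> E c \<longleftrightarrow> (\<forall>j. c < a $ j \<longrightarrow> v \<bullet> column j Q = 0)"
proof
  assume "v \<in> E c" then show "\<forall>j. c < a $ j \<longrightarrow> v \<bullet> column j Q = 0" using F unfolding frame_def by blast
next
  assume 0: "\<forall>j. c < a $ j \<longrightarrow> v \<bullet> column j Q = 0"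
  have "v = (\<Sum>j\<in>UNIV. (v \<bullet> column j Q) *\<^sub>R column j Q)"
    using F by (intro orthogonal_matrix_expand) (simp add: frame_def)
  moreover have "(v \<bullet> column j Q) *\<^sub>R column j Q \<in> E c" for j
  proof (cases "c < a $ j")
    case True then show ?thesis using 0 subspace_0[OF subspace_E] by simp
  next
    case False
    then have "column j Q \<in> E c" using F E_mono[of "a $ j" c] by (auto simp: frame_def)
    then show ?thesis by (rule subspace_scale[OF subspace_E])
  qed
  ultimately show "v \<in> E c" using subspace_sum[OF subspace_E, of UNIV "\<lambda>j. (v \<bullet> column j Q) *\<^sub>R column j Q" c] by simp
qed

end

lemma dim_orthogonal_coordinates:
  fixes Q :: "real^'m^'m"
  assumes Q: "orthogonal_matrix Q"
  shows "dim {v. \<forall>j. P j \<longrightarrow> v \<bullet> column j Q = 0} = card {j. \<not> P j}"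
proof -
  have cc: "column i Q \<bullet> column j Q = (if i = j then 1 else 0)" for i j
    by (rule orthogonal_matrix_columns_inner[OF Q])
  let ?B = "(\<lambda>j. column j Q) ` {j. \<not> P j}"
  have inj: "inj (\<lambda>j. column j Q)"
  proof (rule injI)
    fix i j assume "column i Q = column j Q"
    then show "i = j" using cc[of i i] cc[of i j] by (auto split: if_splits)
  qed
  have "pairwise orthogonal ?B" using cc by (auto simp: pairwise_def orthogonal_def)
  moreover have "0 \<notin> ?B" using cc by (metis (no_types, lifting) imageE inner_zero_left zero_neq_one)
  ultimately have ind: "independent ?B" by (rule pairwise_orthogonal_independent)
  have "dim {v. \<forall>j. P j \<longrightarrow> v \<bullet> column j Q = 0} = card ?B"
  proof (rule dim_unique[OF _ _ ind refl])
    show "?B \<subseteq> {v. \<forall>j. P j \<longrightarrow> v \<bullet> column j Q = 0}" using cc by auto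
    show "{v. \<forall>j. P j \<longrightarrow> v \<bullet> column j Q = 0} \<subseteq> span ?B"
    proof
      fix v assume v: "v \<in> {v. \<forall>j. P j \<longrightarrow> v \<bullet> column j Q = 0}"
      have "(v \<bullet> column j Q) *\<^sub>R column j Q \<in> span ?B" for j
        using v by (cases "P j") (auto intro: span_scale span_base span_zero)
      then have "(\<Sum>j\<in>UNIV. (v \<bullet> column j Q) *\<^sub>R column j Q) \<in> span ?B" by (intro span_sum)
      then show "v \<in> span ?B" using orthogonal_matrix_expand[OF Q, of v] by simp
    qed
  qed
  then show ?thesis using inj by (simp add: card_image inj_on_subset)
qed

lemma eventually_off_at_top: "eventually P (off at_top \<tau>) \<longleftrightarrow> (\<exists>N::real. \<forall>t\<ge>N. t \<notin> \<tau> \<longrightarrow> P t)"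
  by (simp add: off_def eventually_inf_principal eventually_at_top_linorder)

lemma orthogonal_conj_nth:
  "(Q ** diag_mat d ** transpose Q) $ i $ k = (\<Sum>j\<in>UNIV. Q $ i $ j * d $ j * Q $ k $ j)"
proof -
  have "(Q ** diag_mat d ** transpose Q) $ i $ k = (\<Sum>j\<in>UNIV. (Q ** diag_mat d) $ i $ j * transpose Q $ j $ k)"
    by (simp add: matrix_matrix_mult_def)
  then show ?thesis by (simp add: mult_diag_mat_nth transpose_def)
qed

text \<open>If convergence failed, some sequence of times outside \<tau> would stay away from the
  limit. \<open>adapted_subseq\<close> extracts a subsequence converging to the matrix of some
  frame, and by \<open>frame_conj_unique\<close> that is the claimed limit.\<close>

lemma (in growth_flag) root_tendsto:
  fixes B B' :: "real \<Rightarrow> real^'m^'m"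
  assumes fr: "frame Q a"
    and BB: "\<And>t. transpose (B' t) ** B t = mat 1"
    and E_bd: "\<And>c \<epsilon>. 0 < \<epsilon> \<Longrightarrow> \<exists>K. \<forall>t\<ge>1. t \<notin> \<tau> \<longrightarrow> (\<forall>v\<in>E c. norm (B t *v v) \<le> K * exp ((c + \<epsilon>) * t) * norm v)"
    and D_bd: "\<And>c \<epsilon>. 0 < \<epsilon> \<Longrightarrow> \<exists>K. \<forall>t\<ge>1. t \<notin> \<tau> \<longrightarrow> (\<forall>v\<in>D c. norm (B' t *v v) \<le> K * exp ((c + \<epsilon>) * t) * norm v)"
  shows "((\<lambda>t. posdef_powr (transpose (B t) ** B t) (1 / (2 * t))) \<longlongrightarrow>
     Q ** diag_mat (\<chi> i. exp (a $ i)) ** transpose Q) (off at_top \<tau>)"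
    (is "(?f \<longlongrightarrow> ?L) _")
  unfolding tendsto_iff eventually_off_at_top
proof (rule ccontr)
  assume "\<not> (\<forall>e>0. \<exists>N. \<forall>t\<ge>N. t \<notin> \<tau> \<longrightarrow> dist (?f t) ?L < e)"
  then obtain e where e: "0 < e" "\<And>N. \<exists>t\<ge>N. t \<notin> \<tau> \<and> \<not> dist (?f t) ?L < e" by blast
  have "\<exists>t. t \<ge> max 1 (real n) \<and> t \<notin> \<tau> \<and> \<not> dist (?f t) ?L < e" for n :: nat using e(2) by blast
  then obtain t where t: "\<And>n::nat. t n \<ge> max 1 (real n)" "\<And>n. t n \<notin> \<tau>" "\<And>n. \<not> dist (?f (t n)) ?L < e"
    by metis
  define S where "S n = transpose (B (t n)) ** B (t n)" for n
  have "\<exists>Q d. orthogonal_matrix Q \<and> S n = Q ** diag_mat d ** transpose Q" for n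
  proof -
    have "transpose (S n) = S n" by (simp add: S_def matrix_transpose_mul)
    then show ?thesis using spectral_theorem_symmetric by blast
  qed
  then obtain Q' d where Q': "\<And>n. orthogonal_matrix (Q' n)" "\<And>n. S n = Q' n ** diag_mat (d n) ** transpose (Q' n)"
    by metis
  have d: "0 < d n $ j" for n j
  proof -
    let ?q = "column j (Q' n)"
    have q: "?q \<bullet> ?q = 1" using orthogonal_matrix_columns_inner[OF Q'(1), of j n j] by simp
    have "S n *v ?q = d n $ j *\<^sub>R ?q" using Q'(2)[of n] unfolding spectral_matrix_iff[OF Q'(1)] by blast
    then have "d n $ j = ?q \<bullet> (S n *v ?q)" using q by simp
    also have "\<dots> = (B (t n) *v ?q) \<bullet> (B (t n) *v ?q)"
      using transpose_inner[of "B (t n)" "B (t n) *v ?q" ?q]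
      by (simp add: S_def matrix_vector_mul_assoc[symmetric] inner_commute)
    finally have eq: "d n $ j = (B (t n) *v ?q) \<bullet> (B (t n) *v ?q)" .
    have "B (t n) *v ?q \<noteq> 0"
    proof
      assume "B (t n) *v ?q = 0"
      then have "transpose (B' (t n)) *v (B (t n) *v ?q) = 0" by (simp only: matrix_vector_mult_0_right)
      then have "?q = 0" by (simp only: matrix_vector_mul_assoc BB matrix_vector_mul_lid)
      then show False using q by simp
    qed
    then show ?thesis by (simp add: eq)
  qed
  have S': "transpose (B (t n)) ** B (t n) = Q' n ** diag_mat (d n) ** transpose (Q' n)" for n
    using Q'(2)[of n] by (simp add: S_def)
  have ad: "adapted (\<lambda>n. B (t n)) (\<lambda>n. B' (t n)) t"
    unfolding adapted_def
  proof (intro conjI allI impI)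
    show "filterlim t at_top sequentially"
      by (rule filterlim_at_top_mono[OF filterlim_real_sequentially]) (use t(1) in auto)
    show t1: "1 \<le> t n" for n using t(1)[of n] by simp
    show "transpose (B' (t n)) ** B (t n) = mat 1" for n by (rule BB)
    fix c \<epsilon> :: real assume \<epsilon>: "0 < \<epsilon>"
    obtain K where "\<forall>t\<ge>1. t \<notin> \<tau> \<longrightarrow> (\<forall>v\<in>E c. norm (B t *v v) \<le> K * exp ((c + \<epsilon>) * t) * norm v)" using E_bd[OF \<epsilon>] by blast
    then show "\<exists>K. \<forall>n. \<forall>v\<in>E c. norm (B (t n) *v v) \<le> K * exp ((c + \<epsilon>) * t n) * norm v" using t1 t(2) by blast
    obtain K where "\<forall>t\<ge>1. t \<notin> \<tau> \<longrightarrow> (\<forall>v\<in>D c. norm (B' t *v v) \<le> K * exp ((c + \<epsilon>) * t) * norm v)" using D_bd[OF \<epsilon>] by blast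
    then show "\<exists>K. \<forall>n. \<forall>v\<in>D c. norm (B' (t n) *v v) \<le> K * exp ((c + \<epsilon>) * t n) * norm v" using t1 t(2) by blast
  qed
  obtain r R b where r: "strict_mono r" "frame R b" "(\<lambda>n. Q' (r n)) \<longlonglongrightarrow> R"
    "\<And>j. (\<lambda>n. ln (d (r n) $ j) / (2 * t (r n))) \<longlonglongrightarrow> b $ j"
    by (rule adapted_subseq[OF ad Q'(1) d S']) blast
  have "(\<lambda>n. ?f (t (r n))) \<longlonglongrightarrow> R ** diag_mat (\<chi> i. exp (b $ i)) ** transpose R"
  proof (intro vec_tendstoI)
    fix i k
    have Qn: "(\<lambda>n. Q' (r n) $ i $ j) \<longlonglongrightarrow> R $ i $ j" for i j by (intro tendsto_vec_nth r(3))
    have ex: "(\<lambda>n. d (r n) $ j powr (1 / (2 * t (r n)))) \<longlonglongrightarrow> exp (b $ j)" for j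
    proof -
      have "d (r n) $ j powr (1 / (2 * t (r n))) = exp (ln (d (r n) $ j) / (2 * t (r n)))" for n
        using d[of "r n" j] by (simp add: powr_def)
      then show ?thesis using tendsto_exp[OF r(4)[of j]] by simp
    qed
    have "?f (t (r n)) $ i $ k = (\<Sum>j\<in>UNIV. Q' (r n) $ i $ j * (d (r n) $ j powr (1 / (2 * t (r n)))) * Q' (r n) $ k $ j)" for n
    proof -
      have "?f (t (r n)) = posdef_powr (Q' (r n) ** diag_mat (d (r n)) ** transpose (Q' (r n))) (1 / (2 * t (r n)))"
        using Q'(2)[of "r n"] by (simp add: S_def)
      also have "\<dots> = Q' (r n) ** diag_mat (\<chi> i. d (r n) $ i powr (1 / (2 * t (r n)))) ** transpose (Q' (r n))"
        by (rule posdef_powr_eq[OF Q'(1) d])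
      finally show ?thesis by (simp add: orthogonal_conj_nth)
    qed
    moreover have "(\<lambda>n. \<Sum>j\<in>UNIV. Q' (r n) $ i $ j * (d (r n) $ j powr (1 / (2 * t (r n)))) * Q' (r n) $ k $ j)
       \<longlonglongrightarrow> (\<Sum>j\<in>UNIV. R $ i $ j * exp (b $ j) * R $ k $ j)"
      by (intro tendsto_sum tendsto_mult Qn ex)
    ultimately show "(\<lambda>n. ?f (t (r n)) $ i $ k) \<longlonglongrightarrow> (R ** diag_mat (\<chi> i. exp (b $ i)) ** transpose R) $ i $ k"
      by (simp add: orthogonal_conj_nth)
  qed
  also have "R ** diag_mat (\<chi> i. exp (b $ i)) ** transpose R = ?L" by (rule frame_conj_unique[OF r(2) fr])
  finally have "eventually (\<lambda>n. dist (?f (t (r n))) ?L < e) sequentially"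
    using e(1) by (rule tendstoD)
  then show False using t(3) by (auto simp: eventually_sequentially)
qed

section \<open>The splitting of two transversal flags\<close>

text \<open>Ranks, unlike the exponents themselves, can be read off from the dimensions of E at
  rational levels, hence measurably; so the exponents are numbered through them, beginning with
  1.\<close>

definition rank_in :: "real set \<Rightarrow> real \<Rightarrow> nat" where
  "rank_in S s = card {s'\<in>S. s' \<le> s}"

definition nth_smallest :: "real set \<Rightarrow> nat \<Rightarrow> real" where
  "nth_smallest S i = the_inv_into S (rank_in S) i"

lemma rank_in_strict_mono:
  assumes "finite S" "s' \<in> S" "s < s'" shows "rank_in S s < rank_in S s'"
proof -
  have "s' \<in> {t\<in>S. t \<le> s'}" "s' \<notin> {t\<in>S. t \<le> s}" using assms by auto
  moreover have "{t\<in>S. t \<le> s} \<subseteq> {t\<in>S. t \<le> s'}" using assms(3) by auto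
  ultimately have "{t\<in>S. t \<le> s} \<subset> {t\<in>S. t \<le> s'}" by blast
  then show ?thesis unfolding rank_in_def using assms(1) by (intro psubset_card_mono) auto
qed

lemma bij_rank_in:
  assumes "finite S" shows "bij_betw (rank_in S) S {1..card S}"
proof -
  have inj: "inj_on (rank_in S) S"
  proof (rule inj_onI)
    fix s s' assume "s \<in> S" "s' \<in> S" "rank_in S s = rank_in S s'"
    then show "s = s'" using rank_in_strict_mono[OF assms, of s' s] rank_in_strict_mono[OF assms, of s s'] by force
  qed
  have "rank_in S s \<in> {1..card S}" if "s \<in> S" for s
  proof -
    have "{s'\<in>S. s' \<le> s} \<noteq> {}" using that by auto
    then have "0 < rank_in S s" unfolding rank_in_def using assms by (simp add: card_gt_0_iff)
    moreover have "rank_in S s \<le> card S" unfolding rank_in_def using assms by (intro card_mono) auto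
    ultimately show ?thesis by auto
  qed
  then have "rank_in S ` S \<subseteq> {1..card S}" by blast
  moreover have "card (rank_in S ` S) = card {1..card S}" using inj by (simp add: card_image)
  ultimately have "rank_in S ` S = {1..card S}" by (intro card_subset_eq) auto
  with inj show ?thesis by (simp add: bij_betw_def)
qed

lemma bij_nth_smallest: "finite S \<Longrightarrow> bij_betw (nth_smallest S) {1..card S} S"
  unfolding nth_smallest_def[abs_def] by (intro bij_betw_the_inv_into bij_rank_in)

lemma nth_smallest_eqI:
  assumes "finite S" "s \<in> S" "rank_in S s = i" shows "nth_smallest S i = s"
  unfolding nth_smallest_def using bij_rank_in[OF assms(1)] assms(2,3)
  by (auto simp: bij_betw_def the_inv_into_f_f)

lemma rank_nth_smallest:
  assumes "finite S" "i \<in> {1..card S}"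
  shows "rank_in S (nth_smallest S i) = i" "nth_smallest S i \<in> S"
  using bij_rank_in[OF assms(1)] assms(2) bij_betw_apply[OF bij_nth_smallest[OF assms(1)]]
  by (auto simp: nth_smallest_def bij_betw_def intro!: f_the_inv_into_f)

text \<open>F is the backward filtration, decreasing in c. Transversality is assumed only for levels
  with a gap between them; left continuity of F and finiteness of the set of exponents close the
  gap.\<close>

locale splitting = growth_flag E D for E D :: "real \<Rightarrow> (real^'m) set" +
  fixes F :: "real \<Rightarrow> (real^'m) set" and Q :: "real^'m^'m" and a :: "real^'m"
  assumes subspace_F: "subspace (F c)"
    and F_anti: "c \<le> c' \<Longrightarrow> F c' \<subseteq> F c"
    and F_left: "(\<And>r. r < c \<Longrightarrow> v \<in> F r) \<Longrightarrow> v \<in> F c"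
    and EF_0: "c < c' \<Longrightarrow> E c \<inter> F c' = {0}"
    and EF_UNIV: "c' < c \<Longrightarrow> \<exists>x\<in>E c. \<exists>y\<in>F c'. v = x + y"
    and frame_Qa: "frame Q a"
begin

definition V :: "real \<Rightarrow> (real^'m) set" where "V c = E c \<inter> F c"

definition exponents :: "real set" where "exponents = range (\<lambda>j. a $ j)"

lemma finite_exponents [simp]: "finite exponents" by (simp add: exponents_def)

lemma subspace_V: "subspace (V c)" unfolding V_def by (intro subspace_inter subspace_E subspace_F)

lemma orthogonal_Q: "orthogonal_matrix Q" using frame_Qa by (simp add: frame_def)

lemma dim_E: "dim (E c) = card {j. a $ j \<le> c}"
proof -
  have "E c = {v. \<forall>j. c < a $ j \<longrightarrow> v \<bullet> column j Q = 0}" using frame_span[OF frame_Qa] by blast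
  then show ?thesis using dim_orthogonal_coordinates[OF orthogonal_Q, of "\<lambda>j. c < a $ j"] by (simp add: not_less)
qed

lemma E_eqI: "(\<And>j. a $ j \<le> c \<longleftrightarrow> a $ j \<le> c') \<Longrightarrow> E c = E c'"
  using frame_span[OF frame_Qa] by (auto simp: not_less[symmetric])

lemma E_subset_exponents: "(\<And>s. s \<in> exponents \<Longrightarrow> s \<le> c \<longleftrightarrow> s \<le> c') \<Longrightarrow> E c = E c'"
  by (rule E_eqI) (auto simp: exponents_def)

lemma left_gap:
  obtains r where "r < c" "\<And>s. s \<in> exponents \<Longrightarrow> s < c \<Longrightarrow> s \<le> r" "d < c \<Longrightarrow> d \<le> r"
proof -
  \<comment> \<open>The element \<open>c - 1\<close> keeps the set nonempty; d is a further level
    that r must not fall below, provided that d is below c.\<close>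
  define S where "S = {s\<in>exponents. s < c} \<union> {c - 1} \<union> {s. s = d \<and> d < c}"
  have fin: "finite S" by (simp add: S_def)
  define m where "m = Max S"
  have "c - 1 \<in> S" by (simp add: S_def)
  then have "m \<in> S" unfolding m_def using fin by (intro Max_in) auto
  then have "m < c" by (auto simp: S_def)
  moreover have "s \<le> m" if "s \<in> S" for s using that fin unfolding m_def by (intro Max_ge)
  ultimately show thesis by (intro that[of m]) (simp_all add: S_def)
qed

lemma right_gap:
  obtains r where "c < r" "\<And>s. s \<in> exponents \<Longrightarrow> c < s \<Longrightarrow> r < s" 
proof -
  define S where "S = {s\<in>exponents. c < s} \<union> {c + 1}"
  have fin: "finite S" by (simp add: S_def)
  define m where "m = Min S"
  have "c + 1 \<in> S" by (simp add: S_def)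
  then have "m \<in> S" unfolding m_def using fin by (intro Min_in) auto
  then have m: "c < m" by (auto simp: S_def)
  have "m \<le> s" if "s \<in> S" for s using that fin unfolding m_def by (intro Min_le)
  then have le: "m \<le> s" if "s \<in> exponents" "c < s" for s using that by (simp add: S_def)
  show thesis
  proof (rule that[of "(c + m) / 2"])
    show "c < (c + m) / 2" using m by (simp add: field_simps)
    show "(c + m) / 2 < s" if "s \<in> exponents" "c < s" for s using le[OF that] m by (simp add: field_simps)
  qed
qed

text \<open>In finite dimension, left continuity of a decreasing family of subspaces means that it
  is constant just to the left of c.\<close>

lemma F_left_stable: obtains r where "r < c" "\<And>r'. r \<le> r' \<Longrightarrow> r' < c \<Longrightarrow> F r' = F c"
proof -
  define S where "S n = F (c - 1 / real (Suc n))" for n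
  have "S (Suc n) \<subseteq> S n" for n unfolding S_def by (intro F_anti) (simp add: field_simps)
  then obtain J where J: "\<And>n. n \<ge> J \<Longrightarrow> S n = S J"
    using subspace_chain_stabilizes[of S] subspace_F unfolding S_def by blast
  have "S J \<subseteq> F c"
  proof
    fix v assume v: "v \<in> S J"
    show "v \<in> F c"
    proof (rule F_left)
      fix r assume "r < c"
      then obtain i :: nat where i: "1 / real (Suc i) < c - r" using nat_approx_posE[of "c - r"] by auto
      define n where "n = max i J"
      have "1 / real (Suc n) \<le> 1 / real (Suc i)" by (simp add: n_def field_simps)
      then have "r \<le> c - 1 / real (Suc n)" using i by simp
      moreover have "v \<in> S n" using J[of n] v by (simp add: n_def)
      ultimately show "v \<in> F r" using F_anti unfolding S_def by blast
    qed
  qed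
  then have le: "F (c - 1 / real (Suc J)) \<subseteq> F c" by (simp add: S_def)
  show thesis
  proof (rule that[of "c - 1 / real (Suc J)"])
    fix r' assume "c - 1 / real (Suc J) \<le> r'" "r' < c"
    then show "F r' = F c" using le F_anti[of "c - 1 / real (Suc J)" r'] F_anti[of r' c] by force
  qed simp
qed

text \<open>\<open>EF_UNIV\<close> is applied just left of c, where F already equals
  \<open>F c\<close>. By \<open>EF_0\<close> the spaces \<open>E r\<close> and \<open>F c\<close>
  obtained are even complementary.\<close>

lemma left_complement:
  obtains r where "r < c" "\<And>s. s \<in> exponents \<Longrightarrow> s < c \<Longrightarrow> s \<le> r" "\<And>v. \<exists>x\<in>E r. \<exists>y\<in>F c. v = x + y"
proof -
  obtain d where d: "d < c" "\<And>r'. d \<le> r' \<Longrightarrow> r' < c \<Longrightarrow> F r' = F c" using F_left_stable by blast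
  obtain r where r: "r < c" "\<And>s. s \<in> exponents \<Longrightarrow> s < c \<Longrightarrow> s \<le> r" "d \<le> r"
    using left_gap[of c d] d(1) by metis
  define r' where "r' = (r + c) / 2"
  have r': "r < r'" "r' < c" using r(1) by (auto simp: r'_def)
  show thesis
  proof (rule that[of r'])
    show "s \<le> r'" if "s \<in> exponents" "s < c" for s using r(2)[OF that] r'(1) by simp
    show "\<exists>x\<in>E r'. \<exists>y\<in>F c. v = x + y" for v using EF_UNIV[OF r'(1), of v] d(2)[OF r(3) r(1)] by simp
  qed (rule r'(2))
qed

text \<open>Two dimension counts: \<open>E r\<close> and \<open>F c\<close> are complementary, while
  \<open>E c\<close> and \<open>F c\<close> span and meet in \<open>V c\<close>. So
  \<open>V c\<close> has the dimension by which E grows between r and c.\<close>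

lemma dim_V: "dim (V c) = card {j. a $ j = c}"
proof -
  obtain r where r: "r < c" "\<And>s. s \<in> exponents \<Longrightarrow> s < c \<Longrightarrow> s \<le> r" "\<And>v. \<exists>x\<in>E r. \<exists>y\<in>F c. v = x + y"
    using left_complement by blast
  have UN: "{x + y |x y. x \<in> E r \<and> y \<in> F c} = UNIV" using r(3) by blast
  have UN': "{x + y |x y. x \<in> E c \<and> y \<in> F c} = UNIV" using r(3) E_mono[of r c] r(1) by fastforce
  have d1: "dim (UNIV :: (real^'m) set) + dim ({0} :: (real^'m) set) = dim (E r) + dim (F c)"
    using dim_sums_Int[OF subspace_E subspace_F, of r c] unfolding UN EF_0[OF r(1)] .
  have d2: "dim (UNIV :: (real^'m) set) + dim (V c) = dim (E c) + dim (F c)"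
    using dim_sums_Int[OF subspace_E subspace_F, of c c] unfolding UN' V_def .
  have "card {j. a $ j \<le> c} = card {j. a $ j \<le> r} + card {j. a $ j = c}"
  proof -
    have "{j. a $ j \<le> c} = {j. a $ j \<le> r} \<union> {j. a $ j = c}"
      using r(1) r(2) by (force simp: exponents_def)
    moreover have "{j. a $ j \<le> r} \<inter> {j. a $ j = c} = {}" using r(1) by auto
    ultimately show ?thesis by (simp add: card_Un_disjoint)
  qed
  then show ?thesis using d1 d2 by (simp add: dim_E)
qed

lemma exponents_eq: "{c. V c \<noteq> {0}} = exponents"
proof -
  have "V c \<noteq> {0} \<longleftrightarrow> dim (V c) \<noteq> 0" for c using subspace_0[OF subspace_V, of c] by (auto simp: dim_eq_0)
  also have "\<dots> c \<longleftrightarrow> c \<in> exponents" for c unfolding dim_V by (auto simp: exponents_def)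
  finally show ?thesis by blast
qed

text \<open>With c0 the largest exponent not above c, \<open>left_complement\<close> splits a vector
  of \<open>E c0\<close> into one of \<open>V c0\<close> and one of a smaller \<open>E r\<close>.
  The induction is on the dimension of \<open>E c\<close>, written as a number of
  coordinates.\<close>

lemma decompose_E:
  "v \<in> E c \<Longrightarrow> \<exists>u. (\<forall>s. u s \<in> V s) \<and> (\<forall>s. s \<notin> exponents \<or> c < s \<longrightarrow> u s = 0) \<and> v = (\<Sum>s\<in>exponents. u s)"
proof (induction "card {j. a $ j \<le> c}" arbitrary: c v rule: less_induct)
  case less
  show ?case
  proof (cases "{s\<in>exponents. s \<le> c} = {}")
    case True
    moreover have "a $ j \<in> exponents" for j by (simp add: exponents_def)
    ultimately have "\<not> a $ j \<le> c" for j by blast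
    then have "c < a $ j" for j by (simp add: not_le)
    then have "v \<bullet> column j Q = 0" for j using less.prems frame_span[OF frame_Qa] by blast
    then have "v = 0" using orthogonal_matrix_expand[OF orthogonal_Q, of v] by simp
    then show ?thesis using subspace_0[OF subspace_V] by (intro exI[of _ "\<lambda>_. 0"]) auto
  next
    case False
    define c0 where "c0 = Max {s\<in>exponents. s \<le> c}"
    have c0: "c0 \<in> exponents" "c0 \<le> c" "\<And>s. s \<in> exponents \<Longrightarrow> s \<le> c \<Longrightarrow> s \<le> c0"
      using Max_in[OF _ False] unfolding c0_def by auto
    have "E c = E c0" using c0 by (intro E_subset_exponents) force
    then have v: "v \<in> E c0" using less.prems by simp
    obtain r where r: "r < c0" "\<And>s. s \<in> exponents \<Longrightarrow> s < c0 \<Longrightarrow> s \<le> r" "\<And>v. \<exists>x\<in>E r. \<exists>y\<in>F c0. v = x + y"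
      using left_complement by blast
    obtain x y where xy: "x \<in> E r" "y \<in> F c0" "v = x + y" using r(3) by blast
    have "y = v - x" using xy by simp
    moreover have "x \<in> E c0" using xy(1) E_mono[of r c0] r(1) by auto
    ultimately have yV: "y \<in> V c0" unfolding V_def using xy(2) v subspace_diff[OF subspace_E, of v c0 x] by simp
    obtain j0 where "a $ j0 = c0" using c0(1) by (auto simp: exponents_def)
    then have "j0 \<in> {j. a $ j \<le> c}" "j0 \<notin> {j. a $ j \<le> r}" using c0(2) r(1) by auto
    moreover have "{j. a $ j \<le> r} \<subseteq> {j. a $ j \<le> c}" using r(1) c0(2) by auto
    ultimately have "card {j. a $ j \<le> r} < card {j. a $ j \<le> c}" by (intro psubset_card_mono) auto
    from less.hyps[OF this xy(1)] obtain u where u: "\<And>s. u s \<in> V s" "\<And>s. s \<notin> exponents \<or> r < s \<Longrightarrow> u s = 0"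
      "x = (\<Sum>s\<in>exponents. u s)" by blast
    have "u c0 = 0" using u(2) r(1) by blast
    then have "(\<Sum>s\<in>exponents. (u(c0 := y)) s) = (\<Sum>s\<in>exponents. u s + (if s = c0 then y else 0))"
      by (intro sum.cong) auto
    also have "\<dots> = x + y" using c0(1) by (simp add: sum.distrib u(3))
    finally have "v = (\<Sum>s\<in>exponents. (u(c0 := y)) s)" using xy(3) by simp
    moreover have "(u(c0 := y)) s \<in> V s" for s using u(1) yV by simp
    moreover have "(u(c0 := y)) s = 0" if "s \<notin> exponents \<or> c < s" for s using that u(2)[of s] c0 r(1) by auto
    ultimately show ?thesis by blast
  qed
qed

text \<open>Take the largest exponent m with a nonzero component. That component is minus the sum of
  the others, so it lies in \<open>E r\<close> for some r below m, and also in \<open>F m\<close>;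
  these meet only in 0.\<close>

lemma V_independent:
  assumes u: "\<And>s. s \<in> exponents \<Longrightarrow> u s \<in> V s" and 0: "(\<Sum>s\<in>exponents. u s) = 0" and s: "s \<in> exponents"
  shows "u s = 0"
proof (rule ccontr)
  assume "u s \<noteq> 0"
  let ?N = "{s\<in>exponents. u s \<noteq> 0}"
  have ne: "?N \<noteq> {}" using s \<open>u s \<noteq> 0\<close> by blast
  define m where "m = Max ?N"
  have m: "m \<in> exponents" "u m \<noteq> 0" "\<And>s. s \<in> exponents \<Longrightarrow> u s \<noteq> 0 \<Longrightarrow> s \<le> m"
    using Max_in[OF _ ne] unfolding m_def by auto
  obtain r where r: "r < m" "\<And>s. s \<in> exponents \<Longrightarrow> s < m \<Longrightarrow> s \<le> r" using left_gap[of m m] by metis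
  have "u m + (\<Sum>s\<in>exponents - {m}. u s) = 0" using 0 m(1) by (simp add: sum.remove)
  then have "u m = - (\<Sum>s\<in>exponents - {m}. u s)" by (simp add: add_eq_0_iff2)
  moreover have "(\<Sum>s\<in>exponents - {m}. u s) \<in> E r"
  proof (rule subspace_sum[OF subspace_E])
    fix s assume s: "s \<in> exponents - {m}"
    show "u s \<in> E r"
    proof (cases "u s = 0")
      case False
      then have "s \<le> r" using m(3)[of s] s r(2)[of s] by force
      then show ?thesis using u[of s] s E_mono by (auto simp: V_def)
    qed (simp add: subspace_0[OF subspace_E])
  qed
  ultimately have "u m \<in> E r" by (simp add: subspace_neg[OF subspace_E])
  moreover have "u m \<in> F m" using u[OF m(1)] by (simp add: V_def)
  ultimately have "u m \<in> E r \<inter> F m" by blast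
  then show False using EF_0[OF r(1)] m(2) by blast
qed

lemma direct_sum_decomp_V:
  "direct_sum_decomp {1..card exponents} (\<lambda>i. V (nth_smallest exponents i))"
proof -
  let ?I = "{1..card exponents}" and ?l = "nth_smallest exponents"
  have bij: "bij_betw ?l ?I exponents" by (rule bij_nth_smallest) simp
  define h where "h = the_inv_into ?I ?l"
  have h: "h (?l i) = i" if "i \<in> ?I" for i
    using bij that by (simp add: h_def bij_betw_def the_inv_into_f_f)
  have hI: "h s \<in> ?I" "?l (h s) = s" if "s \<in> exponents" for s
    using bij that f_the_inv_into_f_bij_betw[OF bij] bij_betw_apply[OF bij_betw_the_inv_into[OF bij]] by (auto simp: h_def)
  have re: "(\<Sum>i\<in>?I. g (?l i)) = (\<Sum>s\<in>exponents. g s)" for g :: "real \<Rightarrow> real^'m"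
    by (rule sum.reindex_bij_betw[OF bij])
  show ?thesis unfolding direct_sum_decomp_def
  proof (intro conjI ballI allI subspace_V)
    fix v
    obtain L where "E L = UNIV" using E_top by blast
    then obtain u where u: "\<And>s. u s \<in> V s" "v = (\<Sum>s\<in>exponents. u s)" using decompose_E[of v L] by blast
    show "\<exists>!u. u \<in> (\<Pi>\<^sub>E i\<in>?I. V (?l i)) \<and> v = (\<Sum>i\<in>?I. u i)"
    proof (rule ex1I[of _ "\<lambda>i\<in>?I. u (?l i)"])
      show "(\<lambda>i\<in>?I. u (?l i)) \<in> (\<Pi>\<^sub>E i\<in>?I. V (?l i)) \<and> v = (\<Sum>i\<in>?I. (\<lambda>i\<in>?I. u (?l i)) i)"
        using u re[of u] by auto
    next
      fix w assume w: "w \<in> (\<Pi>\<^sub>E i\<in>?I. V (?l i)) \<and> v = (\<Sum>i\<in>?I. w i)"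
      define z where "z s = w (h s) - u s" for s
      have zV: "z s \<in> V s" if "s \<in> exponents" for s
      proof -
        have "w \<in> (\<Pi>\<^sub>E i\<in>?I. V (?l i))" using w by blast
        from PiE_mem[OF this hI(1)[OF that]] have "w (h s) \<in> V (?l (h s))" .
        then show ?thesis using u(1) hI(2)[OF that] unfolding z_def by (simp add: subspace_diff[OF subspace_V])
      qed
      have "(\<Sum>s\<in>exponents. w (h s)) = (\<Sum>i\<in>?I. w (h (?l i)))" by (rule re[symmetric])
      also have "\<dots> = (\<Sum>i\<in>?I. w i)" using h by (intro sum.cong) auto
      finally have "(\<Sum>s\<in>exponents. z s) = 0" using w u(2) by (simp add: z_def sum_subtractf)
      then have z0: "z s = 0" if "s \<in> exponents" for s using V_independent[OF zV _ that] by blast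
      show "w = (\<lambda>i\<in>?I. u (?l i))"
      proof
        fix i
        show "w i = (\<lambda>i\<in>?I. u (?l i)) i"
        proof (cases "i \<in> ?I")
          case True
          then have "?l i \<in> exponents" using bij by (auto simp: bij_betw_def)
          from z0[OF this] show ?thesis using h[OF True] True by (simp add: z_def)
        next
          case False
          have "w \<in> (\<Pi>\<^sub>E i\<in>?I. V (?l i))" using w by blast
          then have "w i = undefined" by (rule PiE_arb[OF _ False])
          then show ?thesis using False by auto
        qed
      qed
    qed
  qed
qed

lemma eigen_iff:
  "(Q ** diag_mat (\<chi> i. exp (a $ i)) ** transpose Q) *v v = l *\<^sub>R v \<longleftrightarrow> (\<forall>j. exp (a $ j) \<noteq> l \<longrightarrow> v \<bullet> column j Q = 0)"
proof -
  let ?L = "Q ** diag_mat (\<chi> i. exp (a $ i)) ** transpose Q"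
  have col: "?L *v column j Q = exp (a $ j) *\<^sub>R column j Q" for j
    using spectral_matrix_iff[OF orthogonal_Q, of ?L "\<chi> i. exp (a $ i)"] by simp
  have symL: "transpose ?L = ?L" by (simp add: matrix_transpose_mul transpose_diag_mat matrix_mul_assoc)
  have co: "(?L *v v) \<bullet> column j Q = exp (a $ j) * (v \<bullet> column j Q)" for j
    using transpose_inner[of ?L v "column j Q"] unfolding symL col by simp
  have "?L *v v = l *\<^sub>R v \<longleftrightarrow> (\<forall>j. (?L *v v) \<bullet> column j Q = (l *\<^sub>R v) \<bullet> column j Q)"
  proof
    assume *: "\<forall>j. (?L *v v) \<bullet> column j Q = (l *\<^sub>R v) \<bullet> column j Q"
    have "?L *v v = (\<Sum>j\<in>UNIV. ((?L *v v) \<bullet> column j Q) *\<^sub>R column j Q)"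
      by (rule orthogonal_matrix_expand[OF orthogonal_Q])
    also have "\<dots> = (\<Sum>j\<in>UNIV. ((l *\<^sub>R v) \<bullet> column j Q) *\<^sub>R column j Q)" by (simp only: *)
    also have "\<dots> = l *\<^sub>R v" by (rule orthogonal_matrix_expand[OF orthogonal_Q, symmetric])
    finally show "?L *v v = l *\<^sub>R v" .
  qed simp
  also have "\<dots> \<longleftrightarrow> (\<forall>j. exp (a $ j) \<noteq> l \<longrightarrow> v \<bullet> column j Q = 0)" unfolding co by auto
  finally show ?thesis .
qed

lemma eigenvalues_with_mult_V:
  "eigenvalues_with_mult (Q ** diag_mat (\<chi> i. exp (a $ i)) ** transpose Q) {1..card exponents}
     (\<lambda>i. exp (nth_smallest exponents i)) (\<lambda>i. dim (V (nth_smallest exponents i)))"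
proof -
  let ?I = "{1..card exponents}" and ?l = "nth_smallest exponents"
  have bij: "bij_betw ?l ?I exponents" by (rule bij_nth_smallest) simp
  have img: "?l ` ?I = exponents" using bij by (simp add: bij_betw_def)
  show ?thesis unfolding eigenvalues_with_mult_def
  proof (intro conjI ballI)
    have inj: "inj_on ?l ?I" using bij by (rule bij_betw_imp_inj_on)
    show "inj_on (\<lambda>i. exp (?l i)) ?I"
    proof (rule inj_onI)
      fix i j assume ij: "i \<in> ?I" "j \<in> ?I" "exp (?l i) = exp (?l j)"
      then have "?l i = ?l j" by simp
      with inj ij(1,2) show "i = j" by (blast dest: inj_onD)
    qed
    show "eigenvalues (Q ** diag_mat (\<chi> i. exp (a $ i)) ** transpose Q) = (\<lambda>i. exp (?l i)) ` ?I"
    proof -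
      have "l \<in> eigenvalues (Q ** diag_mat (\<chi> i. exp (a $ i)) ** transpose Q) \<longleftrightarrow> l \<in> exp ` exponents" for l
      proof
        assume "l \<in> eigenvalues (Q ** diag_mat (\<chi> i. exp (a $ i)) ** transpose Q)"
        then obtain v where v: "v \<noteq> 0" "\<forall>j. exp (a $ j) \<noteq> l \<longrightarrow> v \<bullet> column j Q = 0"
          unfolding eigenvalues_def mem_Collect_eq eigen_iff by blast
        have "\<exists>j. v \<bullet> column j Q \<noteq> 0"
        proof (rule ccontr)
          assume "\<not> ?thesis"
          then show False using v(1) orthogonal_matrix_expand[OF orthogonal_Q, of v] by simp
        qed
        then show "l \<in> exp ` exponents" using v(2) by (auto simp: exponents_def)
      next
        assume "l \<in> exp ` exponents"
        then obtain j where l: "l = exp (a $ j)" by (auto simp: exponents_def)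
        have n: "column j Q \<bullet> column i Q = (if j = i then 1 else 0)" for i
          by (rule orthogonal_matrix_columns_inner[OF orthogonal_Q])
        have "column j Q \<noteq> 0" using n[of j] by auto
        then show "l \<in> eigenvalues (Q ** diag_mat (\<chi> i. exp (a $ i)) ** transpose Q)"
          unfolding eigenvalues_def mem_Collect_eq eigen_iff using l n by (intro exI[of _ "column j Q"]) auto
      qed
      then have "eigenvalues (Q ** diag_mat (\<chi> i. exp (a $ i)) ** transpose Q) = exp ` exponents" by blast
      moreover have "(\<lambda>i. exp (?l i)) ` ?I = exp ` exponents"
        using arg_cong[OF img, of "image exp"] by (simp only: image_image)
      ultimately show ?thesis by (simp only:)
    qed
    fix i
    show "dim (eigenspace (Q ** diag_mat (\<chi> i. exp (a $ i)) ** transpose Q) (exp (?l i))) = dim (V (?l i))"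
      unfolding eigenspace_def eigen_iff dim_V
      using dim_orthogonal_coordinates[OF orthogonal_Q, of "\<lambda>j. exp (a $ j) \<noteq> exp (?l i)"] by simp
  qed
qed

text \<open>Expresses the rank of an exponent through countably many dimensions, which depend measurably on
  the base point.\<close>
lemma rank_in_eq_card_dims:
  "rank_in exponents r = card {n\<in>{1..dim (E r)}. \<exists>q\<in>\<rat>. dim (E q) = n}"
proof -
  have e_strict: "dim (E c) < dim (E s)" if s: "s \<in> exponents" "c < s" for c s
  proof -
    obtain j where j: "a $ j = s" using s(1) by (auto simp: exponents_def)
    have "j \<in> {j. a $ j \<le> s}" "j \<notin> {j. a $ j \<le> c}" using j s(2) by auto
    moreover have "{j. a $ j \<le> c} \<subseteq> {j. a $ j \<le> s}" using s(2) by auto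
    ultimately show ?thesis unfolding dim_E by (intro psubset_card_mono) auto
  qed
  have e_mono: "dim (E c) \<le> dim (E c')" if "c \<le> c'" for c c'
    using E_mono[OF that] by (rule dim_subset)
  have "bij_betw (\<lambda>s. dim (E s)) {s\<in>exponents. s \<le> r} {n\<in>{1..dim (E r)}. \<exists>q\<in>\<rat>. dim (E q) = n}"
    unfolding bij_betw_def
  proof
    show "inj_on (\<lambda>s. dim (E s)) {s\<in>exponents. s \<le> r}"
    proof (rule inj_onI)
      fix s s' assume s: "s \<in> {s\<in>exponents. s \<le> r}" "s' \<in> {s\<in>exponents. s \<le> r}" "dim (E s) = dim (E s')"
      show "s = s'"
      proof (rule ccontr)
        assume "s \<noteq> s'"
        then consider "s < s'" | "s' < s" by linarith
        then show False using e_strict[of s s'] e_strict[of s' s] s by cases auto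
      qed
    qed
    show "(\<lambda>s. dim (E s)) ` {s\<in>exponents. s \<le> r} = {n\<in>{1..dim (E r)}. \<exists>q\<in>\<rat>. dim (E q) = n}"
    proof (intro set_eqI iffI)
      fix n assume "n \<in> (\<lambda>s. dim (E s)) ` {s\<in>exponents. s \<le> r}"
      then obtain s where s: "s \<in> exponents" "s \<le> r" "n = dim (E s)" by blast
      \<comment> \<open>E does not change between s and the next exponent, so a rational level in
        this gap sees the dimension of \<open>E s\<close>.\<close>
      obtain g where g: "s < g" "\<And>s'. s' \<in> exponents \<Longrightarrow> s < s' \<Longrightarrow> g < s'" using right_gap by blast
      obtain q where q: "q \<in> \<rat>" "s < q" "q < g" using Rats_dense_in_real[OF g(1)] by blast
      have "E q = E s"
      proof (rule E_subset_exponents)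
        fix s' assume "s' \<in> exponents"
        then show "s' \<le> q \<longleftrightarrow> s' \<le> s" using g(2)[of s'] q by (cases "s < s'") auto
      qed
      moreover have "0 < n" using e_strict[OF s(1), of "s - 1"] s(3) by simp
      ultimately show "n \<in> {n\<in>{1..dim (E r)}. \<exists>q\<in>\<rat>. dim (E q) = n}" using s q(1) e_mono[OF s(2)]
        by (auto intro!: bexI[of _ q])
    next
      fix n assume "n \<in> {n\<in>{1..dim (E r)}. \<exists>q\<in>\<rat>. dim (E q) = n}"
      then obtain q where n: "1 \<le> n" "n \<le> dim (E r)" "dim (E q) = n" by auto
      have ne: "{s\<in>exponents. s \<le> q} \<noteq> {}"
      proof
        assume "{s\<in>exponents. s \<le> q} = {}"
        then have "{j. a $ j \<le> q} = {}" by (auto simp: exponents_def)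
        then show False using n by (simp add: dim_E)
      qed
      define s where "s = Max {s\<in>exponents. s \<le> q}"
      have s: "s \<in> exponents" "s \<le> q" "\<And>s'. s' \<in> exponents \<Longrightarrow> s' \<le> q \<Longrightarrow> s' \<le> s"
        using Max_in[OF _ ne] unfolding s_def by auto
      have "E q = E s" using s by (intro E_subset_exponents) force
      then have ds: "dim (E s) = n" using n by simp
      have "s \<le> r" using e_strict[OF s(1), of r] ds n(2) by linarith
      then show "n \<in> (\<lambda>s. dim (E s)) ` {s\<in>exponents. s \<le> r}" using s(1) ds by blast
    qed
  qed
  then show ?thesis unfolding rank_in_def by (rule bij_betw_same_card)
qed

text \<open>This replaces the unknown exponent s by two levels around it, which can be chosen
  rational. A vector on the left-hand side has no component below s, because such a component would
  lie in \<open>F r\<close> and in \<open>E p\<close> for some p below r.\<close>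

lemma E_Int_F_isolate:
  assumes rq: "r < q" and r: "r \<notin> exponents" and s: "s \<in> exponents" "r < s" "s \<le> q"
    and only: "\<And>s'. s' \<in> exponents \<Longrightarrow> r < s' \<Longrightarrow> s' \<le> q \<Longrightarrow> s' = s"
  shows "E q \<inter> F r = V s"
proof
  have Eq: "E q = E s"
  proof (rule E_subset_exponents)
    fix s' assume "s' \<in> exponents"
    then show "s' \<le> q \<longleftrightarrow> s' \<le> s" using only[of s'] s rq by force
  qed
  show "V s \<subseteq> E q \<inter> F r" using Eq F_anti[of r s] s(2) by (auto simp: V_def)
  show "E q \<inter> F r \<subseteq> V s"
  proof
    fix v assume v: "v \<in> E q \<inter> F r"
    obtain r' where r': "r' < s" "\<And>s'. s' \<in> exponents \<Longrightarrow> s' < s \<Longrightarrow> s' \<le> r'" "\<And>v. \<exists>x\<in>E r'. \<exists>y\<in>F s. v = x + y"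
      using left_complement by blast
    obtain x y where xy: "x \<in> E r'" "y \<in> F s" "v = x + y" using r'(3) by blast
    obtain p where p: "p < r" "\<And>s'. s' \<in> exponents \<Longrightarrow> s' < r \<Longrightarrow> s' \<le> p" using left_gap[of r r] by metis
    have "E r' \<subseteq> E p"
    proof
      fix z assume z: "z \<in> E r'"
      show "z \<in> E p" unfolding frame_span[OF frame_Qa]
      proof (intro allI impI)
        fix j assume "p < a $ j"
        then have "r < a $ j" using p(2)[of "a $ j"] r by (force simp: exponents_def)
        then have "s \<le> a $ j" using only[of "a $ j"] s by (force simp: exponents_def)
        then have "r' < a $ j" using r'(1) by simp
        then show "z \<bullet> column j Q = 0" using z frame_span[OF frame_Qa] by blast
      qed
    qed
    then have "x \<in> E p" using xy(1) by blast
    moreover have "x = v - y" using xy(3) by simp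
    then have "x \<in> F r" using v xy(2) F_anti[of r s] s(2) by (auto intro!: subspace_diff[OF subspace_F])
    ultimately have "x \<in> E p \<inter> F r" by blast
    then have "x = 0" using EF_0[OF p(1)] by blast
    then show "v \<in> V s" using v xy Eq by (simp add: V_def)
  qed
qed

text \<open>Expresses the i-th summand through slow spaces at rational levels, for measurability.
  \<open>E r \<inter> F r = {0}\<close> says that r is not an exponent, and the two ranks say that
  exactly one exponent, the i-th, lies between r and q.\<close>

lemma V_meets_iff:
  assumes i: "1 \<le> i"
  shows "i \<le> card exponents \<and> V (nth_smallest exponents i) \<inter> G \<noteq> {} \<longleftrightarrow>
    (\<exists>r\<in>\<rat>. \<exists>q\<in>\<rat>. r < q \<and> E r \<inter> F r = {0} \<and> Suc (rank_in exponents r) = i \<and> rank_in exponents q = i \<and> E q \<inter> F r \<inter> G \<noteq> {})"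
proof
  assume L: "i \<le> card exponents \<and> V (nth_smallest exponents i) \<inter> G \<noteq> {}"
  define s where "s = nth_smallest exponents i"
  have s: "rank_in exponents s = i" "s \<in> exponents"
    using rank_nth_smallest[OF finite_exponents, of i] L i by (auto simp: s_def)
  obtain g where g: "s < g" "\<And>s'. s' \<in> exponents \<Longrightarrow> s < s' \<Longrightarrow> g < s'" using right_gap by blast
  obtain q where q: "q \<in> \<rat>" "s < q" "q < g" using Rats_dense_in_real[OF g(1)] by blast
  obtain p where p: "p < s" "\<And>s'. s' \<in> exponents \<Longrightarrow> s' < s \<Longrightarrow> s' \<le> p" using left_gap[of s s] by metis
  obtain r where r: "r \<in> \<rat>" "p < r" "r < s" using Rats_dense_in_real[OF p(1)] by blast
  have rn: "r \<notin> exponents" using p(2)[of r] r by auto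
  have only: "s' = s" if "s' \<in> exponents" "r < s'" "s' \<le> q" for s'
    using that g(2)[of s'] p(2)[of s'] q r by force
  have "r < q" "s \<le> q" using r(3) q(2) by simp_all
  have eq: "E q \<inter> F r = V s" by (rule E_Int_F_isolate[OF \<open>r < q\<close> rn s(2) r(3) \<open>s \<le> q\<close> only])
  have "{s'\<in>exponents. s' \<le> s} = insert s {s'\<in>exponents. s' \<le> r}" using s(2) r p(2) by force
  then have "rank_in exponents s = Suc (rank_in exponents r)"
    unfolding rank_in_def using r(3) by simp
  moreover have "{s'\<in>exponents. s' \<le> q} = {s'\<in>exponents. s' \<le> s}" using q g(2) by force
  then have "rank_in exponents q = i" using s(1) by (simp add: rank_in_def)
  moreover have "E r \<inter> F r = {0}" using rn exponents_eq by (auto simp: V_def)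
  ultimately show "\<exists>r\<in>\<rat>. \<exists>q\<in>\<rat>. r < q \<and> E r \<inter> F r = {0} \<and> Suc (rank_in exponents r) = i \<and> rank_in exponents q = i \<and> E q \<inter> F r \<inter> G \<noteq> {}"
    using s(1) r q L eq by (intro bexI[of _ r] bexI[of _ q]) (auto simp: s_def)
next
  assume "\<exists>r\<in>\<rat>. \<exists>q\<in>\<rat>. r < q \<and> E r \<inter> F r = {0} \<and> Suc (rank_in exponents r) = i \<and> rank_in exponents q = i \<and> E q \<inter> F r \<inter> G \<noteq> {}"
  then obtain r q where rq: "r < q" "E r \<inter> F r = {0}" "Suc (rank_in exponents r) = i" "rank_in exponents q = i" "E q \<inter> F r \<inter> G \<noteq> {}" by blast
  have rn: "r \<notin> exponents" using rq(2) exponents_eq by (auto simp: V_def)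
  have "{s\<in>exponents. s \<le> q} = {s\<in>exponents. s \<le> r} \<union> {s\<in>exponents. r < s \<and> s \<le> q}" using rq(1) by auto
  then have "rank_in exponents q = rank_in exponents r + card {s\<in>exponents. r < s \<and> s \<le> q}"
    unfolding rank_in_def by (simp add: card_Un_disjoint disjoint_iff)
  then have "card {s\<in>exponents. r < s \<and> s \<le> q} = 1" using rq(3,4) by simp
  then obtain s where s: "{s\<in>exponents. r < s \<and> s \<le> q} = {s}" using card_1_singletonE by blast
  then have s': "s \<in> exponents" "r < s" "s \<le> q" by auto
  have only: "s' = s" if "s' \<in> exponents" "r < s'" "s' \<le> q" for s' using s that by auto
  have "E q \<inter> F r = V s" by (rule E_Int_F_isolate[OF rq(1) rn s' only])
  moreover have "{s'\<in>exponents. s' \<le> s} = {s'\<in>exponents. s' \<le> q}" using s'(2,3) only by force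
  then have "rank_in exponents s = i" using rq(4) by (simp add: rank_in_def)
  then have "nth_smallest exponents i = s" using s'(1) by (intro nth_smallest_eqI) auto
  moreover have "i \<le> card exponents" unfolding rq(4)[symmetric] rank_in_def by (intro card_mono) auto
  ultimately show "i \<le> card exponents \<and> V (nth_smallest exponents i) \<inter> G \<noteq> {}" using rq(5) by simp
qed

text \<open>At a level above all exponents the rank formula counts dimensions in a range that is the
  same for every base point.\<close>

lemma card_exponents: "card exponents = card {n\<in>{1..CARD('m)}. \<exists>q\<in>\<rat>. dim (E q) = n}"
proof -
  define L where "L = Max exponents"
  have "s \<le> L" if "s \<in> exponents" for s unfolding L_def using that by (intro Max_ge) auto
  then have "a $ j \<le> L" for j by (auto simp: exponents_def)
  then have "dim (E L) = CARD('m)" by (simp add: dim_E)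
  moreover have "rank_in exponents L = card exponents"
  proof -
    have "{s\<in>exponents. s \<le> L} = exponents" using \<open>\<And>s. s \<in> exponents \<Longrightarrow> s \<le> L\<close> by blast
    then show ?thesis by (simp add: rank_in_def)
  qed
  ultimately show ?thesis using rank_in_eq_card_dims[of L] by simp
qed

end

lemma posdef_diag_pos:
  fixes Q B B' :: "real^'m^'m"
  assumes Q: "orthogonal_matrix Q" and BB: "transpose B' ** B = mat 1"
    and S: "transpose B ** B = Q ** diag_mat d ** transpose Q"
  shows "0 < d $ j"
proof -
  let ?q = "column j Q"
  have q: "?q \<bullet> ?q = 1" using orthogonal_matrix_columns_inner[OF Q, of j j] by simp
  have "(transpose B ** B) *v ?q = d $ j *\<^sub>R ?q" using S unfolding spectral_matrix_iff[OF Q] by blast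
  then have "d $ j = ?q \<bullet> ((transpose B ** B) *v ?q)" using q by simp
  also have "\<dots> = (B *v ?q) \<bullet> (B *v ?q)"
    using transpose_inner[of B "B *v ?q" ?q]
    by (simp add: matrix_vector_mul_assoc[symmetric] inner_commute)
  finally have eq: "d $ j = (B *v ?q) \<bullet> (B *v ?q)" .
  have "B *v ?q \<noteq> 0"
  proof
    assume "B *v ?q = 0"
    then have "transpose B' *v (B *v ?q) = 0" by (simp only: matrix_vector_mult_0_right)
    then have "?q = 0" by (simp only: matrix_vector_mul_assoc BB matrix_vector_mul_lid)
    then show False using q by simp
  qed
  then show ?thesis by (simp add: eq)
qed

section \<open>Regular points\<close>

definition expanding_at :: "(int \<Rightarrow> 'x \<Rightarrow> real^'m^'m) \<Rightarrow> 'x \<Rightarrow> bool" where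
  "expanding_at C x \<longleftrightarrow> (\<forall>c. \<forall>\<epsilon>>0. \<exists>K>0. \<forall>(n::nat). \<forall>v\<in>slow (\<lambda>n. C (-n)) c x.
     norm v \<le> K * exp ((c + \<epsilon>) * real n) * norm (C (int n) x *v v))"

text \<open>The null set in \<open>AE_expanding_on_slow_rev\<close> depends on c. Rational levels
  suffice, because c may be replaced by a rational between c and \<open>c + \<epsilon>\<close> and
  slow spaces increase with the level.\<close>

lemma (in lin_cocycle) AE_expanding_at: "AE x in M. expanding_at C x"
proof -
  have "AE x in M. \<forall>c\<in>\<rat>. \<forall>\<epsilon>>0. \<exists>K>0. \<forall>(n::nat). \<forall>v\<in>slow (\<lambda>n. C (-n)) c x.
     norm v \<le> K * exp ((c + \<epsilon>) * real n) * norm (C (int n) x *v v)"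
    unfolding AE_ball_countable[OF countable_rat] using AE_expanding_on_slow_rev by blast
  then show ?thesis
  proof eventually_elim
    case (elim x)
    show ?case unfolding expanding_at_def
    proof (intro allI impI)
      fix c \<epsilon> :: real assume "0 < \<epsilon>"
      then obtain r where r: "r \<in> \<rat>" "c < r" "r < c + \<epsilon>" using Rats_dense_in_real[of c "c + \<epsilon>"] by auto
      have "0 < c + \<epsilon> - r" using r by simp
      then have "\<exists>K>0. \<forall>(n::nat). \<forall>v\<in>slow (\<lambda>n. C (-n)) r x.
          norm v \<le> K * exp ((r + (c + \<epsilon> - r)) * real n) * norm (C (int n) x *v v)"
        using elim r(1) by blast
      moreover have "r + (c + \<epsilon> - r) = c + \<epsilon>" by simp
      moreover have "slow (\<lambda>n. C (-n)) c x \<subseteq> slow (\<lambda>n. C (-n)) r x" using r(2) by (intro slow_mono) simp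
      ultimately show "\<exists>K>0. \<forall>(n::nat). \<forall>v\<in>slow (\<lambda>n. C (-n)) c x.
          norm v \<le> K * exp ((c + \<epsilon>) * real n) * norm (C (int n) x *v v)" by (metis subsetD)
    qed
  qed
qed

text \<open>A nonzero v would grow forward at a rate of at least \<open>- c'\<close> and of at most
  c, but c is smaller than \<open>- c'\<close>.\<close>

lemma slow_rev_Int:
  assumes ex: "expanding_at C x" and cc: "c + c' < 0"
    and v: "v \<in> slow C c x" "v \<in> slow (\<lambda>n. C (-n)) c' x"
  shows "v = 0"
proof -
  \<comment> \<open>One third, so that after two losses of \<epsilon> the total exponent
    \<open>c + c' + 2 * \<epsilon>\<close> equals \<open>- \<epsilon>\<close>.\<close>
  define \<epsilon> where "\<epsilon> = - (c + c') / 3"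
  have \<epsilon>: "0 < \<epsilon>" using cc by (simp add: \<epsilon>_def)
  obtain K where K: "\<And>n::nat. norm v \<le> K * exp ((c' + \<epsilon>) * real n) * norm (C (int n) x *v v)" "K > 0"
    using ex v(2) \<epsilon> unfolding expanding_at_def by blast
  obtain L where L: "\<And>n::nat. norm (C (int n) x *v v) \<le> L * exp ((c + \<epsilon>) * real n)" 
    using slowD[OF v(1) \<epsilon>] by blast
  have "norm v \<le> (K * L) * exp (- \<epsilon> * real n)" for n :: nat
  proof -
    have "norm v \<le> K * exp ((c' + \<epsilon>) * real n) * (L * exp ((c + \<epsilon>) * real n))"
      using K(2) by (intro order.trans[OF K(1) mult_left_mono[OF L]]) simp
    also have "\<dots> = (K * L) * exp ((c' + \<epsilon>) * real n + (c + \<epsilon>) * real n)" by (simp add: exp_add)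
    also have "(c' + \<epsilon>) * real n + (c + \<epsilon>) * real n = - \<epsilon> * real n" by (simp add: \<epsilon>_def field_simps)
    finally show ?thesis .
  qed
  moreover have "(\<lambda>n. (K * L) * exp (- \<epsilon> * real n)) \<longlonglongrightarrow> (K * L) * 0"
  proof (intro tendsto_mult tendsto_const filterlim_compose[OF exp_at_bot])
    show "filterlim (\<lambda>n. - \<epsilon> * real n) at_bot sequentially"
      using \<epsilon> by (intro filterlim_tendsto_neg_mult_at_bot[OF tendsto_const _ filterlim_real_sequentially]) simp
  qed
  ultimately have "norm v \<le> (K * L) * 0" by (intro LIMSEQ_le_const[of _ "(K * L) * 0"]) auto
  then show ?thesis by simp
qed

context lin_cocycle
begin

abbreviation "rev_C \<equiv> (\<lambda>n. C (-n))"
abbreviation "dual_C \<equiv> (\<lambda>n x. transpose (C (-n) (T n x)))"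

definition regular :: "'x \<Rightarrow> bool" where
  "regular x \<longleftrightarrow> x \<in> space M \<and> expanding_at C x \<and> expanding_at rev_C x \<and>
     (\<exists>Q a. splitting (\<lambda>c. slow C c x) (\<lambda>c. slow dual_C c x) (\<lambda>c. slow rev_C (- c) x) Q a)"

text \<open>The intersections are trivial because C expands on its backward slow spaces. For the
  sums, a vector orthogonal to both spaces is slow for the dual cocycle, forwards at level
  \<open>- q\<close> and backwards at level \<open>q'\<close>; since \<open>q' < q\<close>,
  expansion of the dual cocycle makes it zero. The frame is a limit of eigenbases along the
  integers.\<close>

lemma AE_regular: "AE x in M. regular x"
proof -
  interpret r: lin_cocycle M "\<lambda>n. T (-n)" rev_C "\<lambda>x. \<phi> (T (-1) x)" by (rule rev_cocycle)
  interpret d: lin_cocycle M T dual_C \<phi> by (rule dual_cocycle)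
  let ?dr = "\<lambda>n x. transpose (C n (T (-n) x))"
  have e1: "AE x in M. expanding_at C x" by (rule AE_expanding_at)
  have e2: "AE x in M. expanding_at rev_C x" by (rule r.AE_expanding_at)
  have e3: "AE x in M. expanding_at dual_C x" by (rule d.AE_expanding_at)
  have o1: "AE x in M. \<forall>c\<in>\<rat>. (slow C c x)\<^sup>\<bottom> \<subseteq> slow dual_C (- c) x"
    unfolding AE_ball_countable[OF countable_rat] using AE_orthogonal_slow_dual by blast
  have o2: "AE x in M. \<forall>c\<in>\<rat>. (slow rev_C c x)\<^sup>\<bottom> \<subseteq> slow (\<lambda>n. dual_C (-n)) (- c) x"
  proof -
    have "AE x in M. (slow rev_C c x)\<^sup>\<bottom> \<subseteq> slow (\<lambda>n. dual_C (-n)) (- c) x" for c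
      using r.AE_orthogonal_slow_dual[of c] by simp
    then show ?thesis unfolding AE_ball_countable[OF countable_rat] by blast
  qed
  show ?thesis
    using AE_space e1 e2 e3 o1 o2 AE_slow_UNIV r.AE_slow_UNIV d.AE_slow_UNIV
  proof eventually_elim
    case (elim x)
    note x = elim(1)
    let ?E = "\<lambda>c. slow C c x" and ?D = "\<lambda>c. slow dual_C c x" and ?F = "\<lambda>c. slow rev_C (- c) x"
    interpret growth_flag ?E ?D
    proof
      fix c :: real
      show "(?E c)\<^sup>\<bottom> \<subseteq> ?D (- c)"
      proof
        fix v assume v: "v \<in> (?E c)\<^sup>\<bottom>"
        show "v \<in> ?D (- c)"
        proof (rule slow_right_limit)
          fix r assume "- c < r"
          then have "- r < c" by simp
          then obtain q where q: "q \<in> \<rat>" "- r < q" "q < c" using Rats_dense_in_real by blast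
          have "?E q \<subseteq> ?E c" using q(3) by (intro slow_mono) simp
          then have "v \<in> (?E q)\<^sup>\<bottom>" using v orthogonal_comp_anti_mono by blast
          then have "v \<in> ?D (- q)" using elim(5) q(1) by blast
          moreover have "?D (- q) \<subseteq> ?D r" using q(2) by (intro slow_mono) simp
          ultimately show "v \<in> ?D r" by blast
        qed
      qed
      show "v \<in> ?E c" if "\<And>r. c < r \<Longrightarrow> v \<in> ?E r" for v using that by (rule slow_right_limit)
    qed (use elim in \<open>auto simp: subspace_slow dest: slow_mono[THEN subsetD, rotated]\<close>)
    have EF0: "?E c \<inter> ?F c' = {0}" if c: "c < c'" for c c'
    proof -
      have "v = 0" if "v \<in> ?E c" "v \<in> ?F c'" for v
        by (rule slow_rev_Int[OF elim(2) _ that]) (use c in simp)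
      then show ?thesis using subspace_0[OF subspace_slow[of C c x]] subspace_0[OF subspace_slow[of rev_C "- c'" x]] by blast
    qed
    have EFU: "\<exists>y\<in>?E c. \<exists>z\<in>?F c'. v = y + z" if c: "c' < c" for c c' v
    proof -
      \<comment> \<open>The inclusions \<open>o1\<close> and \<open>o2\<close> hold at rational
        levels only, and a gap must remain between the two levels used; hence two rationals between
        c' and c.\<close>
      obtain q where q: "q \<in> \<rat>" "c' < q" "q < c" using Rats_dense_in_real[OF c] by blast
      obtain q' where q': "q' \<in> \<rat>" "c' < q'" "q' < q" using Rats_dense_in_real[OF q(2)] by blast
      have sE: "?E q \<subseteq> ?E c" using q(3) by (intro slow_mono) simp
      have sF: "?F q' \<subseteq> ?F c'" using q'(2) by (intro slow_mono) simp
      let ?S = "{y + z |y z. y \<in> ?E q \<and> z \<in> ?F q'}"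
      have sub: "subspace ?S" by (rule subspace_sums[OF subspace_slow subspace_slow])
      have "w = 0" if w: "w \<in> ?S\<^sup>\<bottom>" for w
      proof -
        have "?E q \<subseteq> ?S" using subspace_0[OF subspace_slow[of rev_C "- q'" x]] by force
        then have "w \<in> (?E q)\<^sup>\<bottom>" using w orthogonal_comp_anti_mono by blast
        then have w1: "w \<in> slow dual_C (- q) x" using elim(5) q(1) by blast
        have "?F q' \<subseteq> ?S" using subspace_0[OF subspace_slow[of C q x]] by force
        then have "w \<in> (?F q')\<^sup>\<bottom>" using w orthogonal_comp_anti_mono by blast
        moreover have "- q' \<in> \<rat>" using q'(1) by simp
        ultimately have w2: "w \<in> slow (\<lambda>n. dual_C (-n)) q' x" using elim(6) by force
        show "w = 0" by (rule slow_rev_Int[OF elim(4) _ w1 w2]) (use q' in simp)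
      qed
      then have "?S\<^sup>\<bottom> = {0}" using subspace_0[OF subspace_orthogonal_comp[of ?S]] by blast
      then have "?S\<^sup>\<bottom>\<^sup>\<bottom> = UNIV" by simp
      then have "?S = UNIV" by (simp only: orthogonal_comp_self[OF sub])
      then obtain y z where "y \<in> ?E q" "z \<in> ?F q'" "v = y + z" by blast
      then show ?thesis using sE sF by blast
    qed
    have "\<exists>Q a. frame Q a"
    proof -
      \<comment> \<open>Shifted by one, since \<open>adapted\<close> asks for times that are at
        least 1.\<close>
      define B where "B n = C (int (Suc n)) x" for n
      define B' where "B' n = dual_C (int (Suc n)) x" for n
      have BB: "transpose (B' n) ** B n = mat 1" for n
        unfolding B_def B'_def transpose_transpose by (rule C_inv(1)[OF x])
      have ad: "adapted B B' (\<lambda>n. real (Suc n))"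
        unfolding adapted_def
      proof (intro conjI allI impI BB)
        show "filterlim (\<lambda>n. real (Suc n)) at_top sequentially"
          by (rule filterlim_compose[OF filterlim_real_sequentially filterlim_Suc])
        fix c \<epsilon> :: real assume e: "0 < \<epsilon>"
        obtain K where "\<And>(n::nat) v. v \<in> ?E c \<Longrightarrow> norm (C (int n) x *v v) \<le> K * exp ((c + \<epsilon>) * real n) * norm v"
          by (rule slow_uniform[OF e, of C x c]) blast
        then show "\<exists>K. \<forall>n. \<forall>v\<in>?E c. norm (B n *v v) \<le> K * exp ((c + \<epsilon>) * real (Suc n)) * norm v"
          unfolding B_def by blast
        obtain K where "\<And>(n::nat) v. v \<in> ?D c \<Longrightarrow> norm (dual_C (int n) x *v v) \<le> K * exp ((c + \<epsilon>) * real n) * norm v"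
          by (rule slow_uniform[OF e, of dual_C x c]) blast
        then show "\<exists>K. \<forall>n. \<forall>v\<in>?D c. norm (B' n *v v) \<le> K * exp ((c + \<epsilon>) * real (Suc n)) * norm v"
          unfolding B'_def by blast
      qed auto
      have "\<exists>Q d. orthogonal_matrix Q \<and> transpose (B n) ** B n = Q ** diag_mat d ** transpose Q" for n
      proof -
        have "transpose (transpose (B n) ** B n) = transpose (B n) ** B n" by (simp add: matrix_transpose_mul)
        then show ?thesis using spectral_theorem_symmetric by blast
      qed
      then obtain Q d where Q: "\<And>n. orthogonal_matrix (Q n)" "\<And>n. transpose (B n) ** B n = Q n ** diag_mat (d n) ** transpose (Q n)"
        by metis
      show ?thesis by (rule adapted_subseq[OF ad Q(1) posdef_diag_pos[OF Q(1) BB Q(2)] Q(2)]) blast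
    qed
    then obtain Q a where "frame Q a" by blast
    then have "splitting ?E ?D ?F Q a"
    proof (unfold_locales)
      show "v \<in> ?F c" if v: "\<And>r. r < c \<Longrightarrow> v \<in> ?F r" for c v
      proof (rule slow_right_limit)
        fix r assume "- c < r"
        then show "v \<in> slow rev_C r x" using v[of "- r"] by simp
      qed
      show "?F c' \<subseteq> ?F c" if "c \<le> c'" for c c' using that by (intro slow_mono) simp
    qed (use EF0 EFU in \<open>auto simp: subspace_slow\<close>)
    then show ?case using elim x unfolding regular_def by blast
  qed
qed

end

section \<open>From integer times to real times at a regular point\<close>

lemma invertible_matrix_inv:
  assumes "invertible (A :: real^'m^'m)"
  shows "A ** matrix_inv A = mat 1" "matrix_inv A ** A = mat 1"
proof -
  have "A ** matrix_inv A = mat 1 \<and> matrix_inv A ** A = mat 1"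
    unfolding matrix_inv_def using assms unfolding invertible_def by (rule someI_ex)
  then show "A ** matrix_inv A = mat 1" "matrix_inv A ** A = mat 1" by auto
qed

lemma matrix_inv_unique':
  assumes "A ** B = mat 1" "B ** A = mat 1"
  shows "matrix_inv A = (B :: real^'m^'m)"
proof -
  have "invertible A" using assms unfolding invertible_def by blast
  then have "matrix_inv A ** (A ** B) = B" using invertible_matrix_inv(2)[of A] by (simp add: matrix_mul_assoc)
  then show ?thesis by (simp add: assms)
qed

lemma eventually_off_at_bot: "eventually P (off at_bot \<tau>) \<longleftrightarrow> (\<exists>N::real. \<forall>t\<le>N. t \<notin> \<tau> \<longrightarrow> P t)"
  by (simp add: off_def eventually_inf_principal eventually_at_bot_linorder)

text \<open>One estimate, linear in t, gives limits of opposite sign at the two ends because the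
  average is taken over \<open>\<bar>t\<bar>\<close>.\<close>

lemma uniform_limit_average:
  fixes f :: "real \<Rightarrow> 'v \<Rightarrow> real"
  assumes f: "\<And>\<epsilon>. 0 < \<epsilon> \<Longrightarrow> \<exists>K. \<forall>t. t \<notin> \<tau> \<longrightarrow> (\<forall>v\<in>S. \<bar>f t v - t * \<kappa>\<bar> \<le> K + \<epsilon> * \<bar>t\<bar>)"
  shows "uniform_limit S (\<lambda>t v. 1 / \<bar>t\<bar> * f t v) (\<lambda>_. \<kappa>) (off at_top \<tau>)"
    and "uniform_limit S (\<lambda>t v. 1 / \<bar>t\<bar> * f t v) (\<lambda>_. - \<kappa>) (off at_bot \<tau>)"
proof -
  have main: "\<exists>N>0. \<forall>t. t \<notin> \<tau> \<longrightarrow> \<bar>t\<bar> \<ge> N \<longrightarrow> (\<forall>v\<in>S. \<bar>1 / \<bar>t\<bar> * f t v - sgn t * \<kappa>\<bar> < e)" if e: "0 < e" for e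
  proof -
    obtain K where K: "\<forall>t. t \<notin> \<tau> \<longrightarrow> (\<forall>v\<in>S. \<bar>f t v - t * \<kappa>\<bar> \<le> K + e / 2 * \<bar>t\<bar>)" using f[of "e/2"] e by auto
    define N where "N = 2 * \<bar>K\<bar> / e + 1"
    have N: "N > 0" using e by (simp add: N_def add_nonneg_pos)
    have "\<bar>1 / \<bar>t\<bar> * f t v - sgn t * \<kappa>\<bar> < e" if t: "t \<notin> \<tau>" "\<bar>t\<bar> \<ge> N" "v \<in> S" for t v
    proof -
      have tp: "0 < \<bar>t\<bar>" using t(2) N by linarith
      have "1 / \<bar>t\<bar> * f t v - sgn t * \<kappa> = (f t v - t * \<kappa>) / \<bar>t\<bar>"
        using tp by (simp add: field_simps sgn_if abs_if)
      then have "\<bar>1 / \<bar>t\<bar> * f t v - sgn t * \<kappa>\<bar> = \<bar>f t v - t * \<kappa>\<bar> / \<bar>t\<bar>" by simp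
      also have "\<dots> \<le> (K + e / 2 * \<bar>t\<bar>) / \<bar>t\<bar>" using K t by (intro divide_right_mono) auto
      also have "\<dots> < e"
      proof -
        have "2 * \<bar>K\<bar> / e < \<bar>t\<bar>" using t(2) by (simp add: N_def)
        then have "2 * \<bar>K\<bar> < e * \<bar>t\<bar>" using e by (simp add: field_simps)
        then have "K + e / 2 * \<bar>t\<bar> < e * \<bar>t\<bar>" by simp
        then show ?thesis using tp by (simp add: field_simps)
      qed
      finally show ?thesis .
    qed
    with N show ?thesis by blast
  qed
  show "uniform_limit S (\<lambda>t v. 1 / \<bar>t\<bar> * f t v) (\<lambda>_. \<kappa>) (off at_top \<tau>)"
    unfolding uniform_limit_iff eventually_off_at_top
  proof (intro allI impI)
    fix e :: real assume "0 < e"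
    from main[OF this] obtain N where N: "N > 0" "\<forall>t. t \<notin> \<tau> \<longrightarrow> \<bar>t\<bar> \<ge> N \<longrightarrow> (\<forall>v\<in>S. \<bar>1 / \<bar>t\<bar> * f t v - sgn t * \<kappa>\<bar> < e)" by blast
    have "\<forall>v\<in>S. dist (1 / \<bar>t\<bar> * f t v) \<kappa> < e" if "t \<ge> N" "t \<notin> \<tau>" for t
      using N(2)[rule_format, of t] that N(1) by (auto simp: dist_real_def)
    then show "\<exists>N. \<forall>t\<ge>N. t \<notin> \<tau> \<longrightarrow> (\<forall>v\<in>S. dist (1 / \<bar>t\<bar> * f t v) \<kappa> < e)" by blast
  qed
  show "uniform_limit S (\<lambda>t v. 1 / \<bar>t\<bar> * f t v) (\<lambda>_. - \<kappa>) (off at_bot \<tau>)"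
    unfolding uniform_limit_iff eventually_off_at_bot
  proof (intro allI impI)
    fix e :: real assume "0 < e"
    from main[OF this] obtain N where N: "N > 0" "\<forall>t. t \<notin> \<tau> \<longrightarrow> \<bar>t\<bar> \<ge> N \<longrightarrow> (\<forall>v\<in>S. \<bar>1 / \<bar>t\<bar> * f t v - sgn t * \<kappa>\<bar> < e)" by blast
    have "\<forall>v\<in>S. dist (1 / \<bar>t\<bar> * f t v) (- \<kappa>) < e" if "t \<le> - N" "t \<notin> \<tau>" for t
      using N(2)[rule_format, of t] that N(1) by (auto simp: dist_real_def)
    then show "\<exists>N. \<forall>t\<le>N. t \<notin> \<tau> \<longrightarrow> (\<forall>v\<in>S. dist (1 / \<bar>t\<bar> * f t v) (- \<kappa>) < e)" by blast
  qed
qed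

text \<open>Both the matrix relative to the preceding integer time and its inverse are
  subexponential outside \<tau>. This is what carries upper and lower growth bounds from integers to
  real times.\<close>

definition tempered_off :: "(real \<Rightarrow> real^'m^'m) \<Rightarrow> real set \<Rightarrow> bool" where
  "tempered_off B \<tau> \<longleftrightarrow> (\<forall>\<epsilon>>0. \<exists>K. \<forall>t. t \<notin> \<tau> \<longrightarrow>
     mat_norm (B t ** matrix_inv (B (of_int \<lfloor>t\<rfloor>))) \<le> exp (K + \<epsilon> * \<bar>t\<bar>) \<and>
     mat_norm (B (of_int \<lfloor>t\<rfloor>) ** matrix_inv (B t)) \<le> exp (K + \<epsilon> * \<bar>t\<bar>))"

context lin_cocycle
begin

text \<open>Four one-sided bounds. Lying in the forward and in the backward slow space bounds the
  growth from above in both time directions; expansion of C and of its reversal on these spaces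
  bounds it from below.\<close>

lemma regular_integer_growth:
  assumes reg: "regular x" and \<epsilon>: "0 < \<epsilon>"
  obtains K where "0 < K" "\<And>(n::int) v. v \<in> slow C \<kappa> x \<inter> slow rev_C (- \<kappa>) x \<Longrightarrow>
    norm (C n x *v v) \<le> K * exp (\<kappa> * of_int n + \<epsilon> * of_int \<bar>n\<bar>) * norm v \<and>
    norm v \<le> K * exp (- \<kappa> * of_int n + \<epsilon> * of_int \<bar>n\<bar>) * norm (C n x *v v)"
proof -
  obtain K1 where K1: "0 < K1" "\<And>(n::nat) v. v \<in> slow C \<kappa> x \<Longrightarrow> norm (C (int n) x *v v) \<le> K1 * exp ((\<kappa> + \<epsilon>) * real n) * norm v"
    by (rule slow_uniform[OF \<epsilon>, of C x \<kappa>]) blast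
  obtain K2 where K2: "0 < K2" "\<And>(n::nat) v. v \<in> slow rev_C (- \<kappa>) x \<Longrightarrow> norm (C (- int n) x *v v) \<le> K2 * exp ((- \<kappa> + \<epsilon>) * real n) * norm v"
    by (rule slow_uniform[OF \<epsilon>, of rev_C x "- \<kappa>"]) blast
  have ex1: "expanding_at C x" using reg by (simp add: regular_def)
  obtain K3 where K3: "0 < K3" "\<And>(n::nat) v. v \<in> slow rev_C (- \<kappa>) x \<Longrightarrow> norm v \<le> K3 * exp ((- \<kappa> + \<epsilon>) * real n) * norm (C (int n) x *v v)"
    using ex1[unfolded expanding_at_def, rule_format, OF \<epsilon>, of "- \<kappa>"] by blast
  have ex2: "expanding_at rev_C x" using reg by (simp add: regular_def)
  \<comment> \<open>Reversing twice gives C back, so the space on which the reversed cocycle expands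
    is the forward slow space.\<close>
  obtain K4 where K4: "0 < K4" "\<And>(n::nat) v. v \<in> slow (\<lambda>n. C (- (- n))) \<kappa> x \<Longrightarrow> norm v \<le> K4 * exp ((\<kappa> + \<epsilon>) * real n) * norm (C (- int n) x *v v)"
    using ex2[unfolded expanding_at_def, rule_format, OF \<epsilon>, of \<kappa>] by blast
  define K where "K = K1 + K2 + K3 + K4"
  have Kge: "K1 \<le> K" "K2 \<le> K" "K3 \<le> K" "K4 \<le> K" "0 < K" using K1 K2 K3 K4 by (auto simp: K_def)
  have grow: "L * a * b \<le> K * a * b" if "L \<le> K" "0 \<le> a" "0 \<le> b" for L a b :: real
    using that by (intro mult_right_mono) auto
  show thesis
  proof (rule that[OF Kge(5)])
    fix n :: int and v assume v: "v \<in> slow C \<kappa> x \<inter> slow rev_C (- \<kappa>) x"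
    show "norm (C n x *v v) \<le> K * exp (\<kappa> * of_int n + \<epsilon> * of_int \<bar>n\<bar>) * norm v \<and>
      norm v \<le> K * exp (- \<kappa> * of_int n + \<epsilon> * of_int \<bar>n\<bar>) * norm (C n x *v v)"
    proof (cases "0 \<le> n")
      case True
      then obtain k where k: "n = int k" using nonneg_int_cases by blast
      have e: "(\<kappa> + \<epsilon>) * real k = \<kappa> * of_int n + \<epsilon> * of_int \<bar>n\<bar>" "(- \<kappa> + \<epsilon>) * real k = - \<kappa> * of_int n + \<epsilon> * of_int \<bar>n\<bar>"
        by (simp_all add: k algebra_simps)
      have a1: "norm (C n x *v v) \<le> K1 * exp (\<kappa> * of_int n + \<epsilon> * of_int \<bar>n\<bar>) * norm v"
        using K1(2)[of v k] v unfolding e k[symmetric] by blast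
      have a2: "norm v \<le> K3 * exp (- \<kappa> * of_int n + \<epsilon> * of_int \<bar>n\<bar>) * norm (C n x *v v)"
        using K3(2)[of v k] v unfolding e k[symmetric] by blast
      show ?thesis
        by (rule conjI[OF order.trans[OF a1 grow[OF Kge(1) exp_ge_zero norm_ge_zero]]
              order.trans[OF a2 grow[OF Kge(3) exp_ge_zero norm_ge_zero]]])
    next
      case False
      define k where "k = nat (- n)"
      have k: "n = - int k" using False by (simp add: k_def)
      have e: "(- \<kappa> + \<epsilon>) * real k = \<kappa> * of_int n + \<epsilon> * of_int \<bar>n\<bar>" "(\<kappa> + \<epsilon>) * real k = - \<kappa> * of_int n + \<epsilon> * of_int \<bar>n\<bar>"
        by (simp_all add: k algebra_simps)
      have a1: "norm (C n x *v v) \<le> K2 * exp (\<kappa> * of_int n + \<epsilon> * of_int \<bar>n\<bar>) * norm v"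
        using K2(2)[of v k] v unfolding e k[symmetric] by blast
      have a2: "norm v \<le> K4 * exp (- \<kappa> * of_int n + \<epsilon> * of_int \<bar>n\<bar>) * norm (C n x *v v)"
        using K4(2)[of v k] v unfolding e k[symmetric] minus_minus by blast
      show ?thesis
        by (rule conjI[OF order.trans[OF a1 grow[OF Kge(2) exp_ge_zero norm_ge_zero]]
              order.trans[OF a2 grow[OF Kge(4) exp_ge_zero norm_ge_zero]]])
    qed
  qed
qed

lemma regular_growth:
  assumes reg: "regular x" and inv: "\<And>t. invertible (B t)" and BC: "\<And>n::int. B (of_int n) = C n x"
    and temp: "tempered_off B \<tau>" and \<epsilon>: "0 < \<epsilon>"
  shows "\<exists>K. \<forall>t. t \<notin> \<tau> \<longrightarrow> (\<forall>v. v \<in> slow C \<kappa> x \<inter> slow rev_C (- \<kappa>) x \<longrightarrow> norm v = 1 \<longrightarrow>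
     \<bar>ln (norm (B t *v v)) - t * \<kappa>\<bar> \<le> K + \<epsilon> * \<bar>t\<bar>)"
proof -
  define \<eta> where "\<eta> = \<epsilon> / 3"
  have \<eta>: "0 < \<eta>" using \<epsilon> by (simp add: \<eta>_def)
  obtain L where L: "\<And>t. t \<notin> \<tau> \<Longrightarrow> mat_norm (B t ** matrix_inv (B (of_int \<lfloor>t\<rfloor>))) \<le> exp (L + \<eta> * \<bar>t\<bar>) \<and>
     mat_norm (B (of_int \<lfloor>t\<rfloor>) ** matrix_inv (B t)) \<le> exp (L + \<eta> * \<bar>t\<bar>)"
    using temp \<eta> unfolding tempered_off_def by blast
  obtain K where K: "0 < K" "\<And>(n::int) v. v \<in> slow C \<kappa> x \<inter> slow rev_C (- \<kappa>) x \<Longrightarrow>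
    norm (C n x *v v) \<le> K * exp (\<kappa> * of_int n + \<eta> * of_int \<bar>n\<bar>) * norm v \<and>
    norm v \<le> K * exp (- \<kappa> * of_int n + \<eta> * of_int \<bar>n\<bar>) * norm (C n x *v v)"
    by (rule regular_integer_growth[OF reg \<eta>, of \<kappa>]) blast
  define R where "R = L + ln K + \<bar>\<kappa>\<bar> + \<eta>"
  have "\<bar>ln (norm (B t *v v)) - t * \<kappa>\<bar> \<le> R + \<epsilon> * \<bar>t\<bar>"
    if t: "t \<notin> \<tau>" and v: "v \<in> slow C \<kappa> x \<inter> slow rev_C (- \<kappa>) x" "norm v = 1" for t v
  proof -
    define n where "n = \<lfloor>t\<rfloor>"
    have nt: "of_int n \<le> t" "t < of_int n + 1" unfolding n_def by linarith+
    have absn: "of_int \<bar>n\<bar> \<le> \<bar>t\<bar> + 1" using nt by linarith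
    have diff: "\<bar>t * \<kappa> - \<kappa> * of_int n\<bar> \<le> \<bar>\<kappa>\<bar>"
    proof -
      have "\<bar>t * \<kappa> - \<kappa> * of_int n\<bar> = \<bar>t - of_int n\<bar> * \<bar>\<kappa>\<bar>" by (simp add: abs_mult[symmetric] algebra_simps)
      also have "\<dots> \<le> 1 * \<bar>\<kappa>\<bar>" using nt by (intro mult_right_mono) auto
      finally show ?thesis by simp
    qed
    have Bn: "B (of_int n) = C n x" by (rule BC)
    have e1: "B t *v v = (B t ** matrix_inv (B (of_int n))) *v (C n x *v v)"
      using invertible_matrix_inv(2)[OF inv, of "of_int n"] unfolding Bn[symmetric]
      by (simp add: matrix_vector_mul_assoc matrix_mul_assoc[symmetric])
    have e2: "C n x *v v = (B (of_int n) ** matrix_inv (B t)) *v (B t *v v)"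
      using invertible_matrix_inv(2)[OF inv, of t] unfolding Bn[symmetric]
      by (simp add: matrix_vector_mul_assoc matrix_mul_assoc[symmetric])
    have n1: "norm (B t *v v) \<le> exp (L + \<eta> * \<bar>t\<bar>) * norm (C n x *v v)"
      unfolding e1 using L[OF t] unfolding n_def[symmetric]
      by (intro order.trans[OF mat_norm_bound] mult_right_mono) auto
    have n2: "norm (C n x *v v) \<le> exp (L + \<eta> * \<bar>t\<bar>) * norm (B t *v v)"
      by (subst e2, rule order.trans[OF mat_norm_bound], rule mult_right_mono) (use L[OF t] in \<open>auto simp: n_def\<close>)
    have k1: "norm (C n x *v v) \<le> K * exp (\<kappa> * of_int n + \<eta> * of_int \<bar>n\<bar>)"
      and k2: "1 \<le> K * exp (- \<kappa> * of_int n + \<eta> * of_int \<bar>n\<bar>) * norm (C n x *v v)"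
      using K(2)[OF v(1), of n] v(2) by auto
    have Cp: "0 < norm (C n x *v v)" using k2 by (cases "norm (C n x *v v) = 0") auto
    have Bp: "0 < norm (B t *v v)" using n2 Cp by (cases "norm (B t *v v) = 0") auto
    have l1: "ln (norm (B t *v v)) \<le> L + \<eta> * \<bar>t\<bar> + ln (norm (C n x *v v))"
      using ln_le_cancel_iff[THEN iffD2, OF Bp _ n1] Cp by (simp add: ln_mult)
    have l2: "ln (norm (C n x *v v)) \<le> L + \<eta> * \<bar>t\<bar> + ln (norm (B t *v v))"
      using ln_le_cancel_iff[THEN iffD2, OF Cp _ n2] Bp by (simp add: ln_mult)
    have l3: "ln (norm (C n x *v v)) \<le> ln K + (\<kappa> * of_int n + \<eta> * of_int \<bar>n\<bar>)"
      using ln_le_cancel_iff[THEN iffD2, OF Cp _ k1] K(1) by (simp add: ln_mult)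
    have "ln 1 \<le> ln (K * exp (- \<kappa> * of_int n + \<eta> * of_int \<bar>n\<bar>) * norm (C n x *v v))"
      using k2 Cp K(1) by (subst ln_le_cancel_iff) auto
    then have l4: "0 \<le> ln K + (- \<kappa> * of_int n + \<eta> * of_int \<bar>n\<bar>) + ln (norm (C n x *v v))"
      using Cp K(1) by (simp add: ln_mult)
    have e3: "\<eta> * of_int \<bar>n\<bar> \<le> \<eta> * \<bar>t\<bar> + \<eta>"
      using mult_left_mono[OF absn, of \<eta>] \<eta> by (simp add: distrib_left)
    have e4: "2 * (\<eta> * \<bar>t\<bar>) \<le> \<epsilon> * \<bar>t\<bar>" using \<epsilon> by (simp add: \<eta>_def)
    show ?thesis
    proof (rule abs_leI)
      show "ln (norm (B t *v v)) - t * \<kappa> \<le> R + \<epsilon> * \<bar>t\<bar>"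
        using l1 l3 e3 e4 diff unfolding R_def by linarith
      show "- (ln (norm (B t *v v)) - t * \<kappa>) \<le> R + \<epsilon> * \<bar>t\<bar>"
        using l2 l4 e3 e4 diff unfolding R_def by linarith
    qed
  qed
  then show ?thesis by blast
qed

text \<open>These are the two growth bounds that \<open>root_tendsto\<close> asks for, with the
  inverse transpose in the role of \<open>B'\<close>.\<close>

lemma regular_slow_bound:
  assumes x: "x \<in> space M" and inv: "\<And>t. invertible (B t)" and BC: "\<And>n::int. B (of_int n) = C n x"
    and temp: "tempered_off B \<tau>" and \<epsilon>: "0 < \<epsilon>"
  shows "\<exists>K. \<forall>t\<ge>1. t \<notin> \<tau> \<longrightarrow> (\<forall>v\<in>slow C c x. norm (B t *v v) \<le> K * exp ((c + \<epsilon>) * t) * norm v)"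
    and "\<exists>K. \<forall>t\<ge>1. t \<notin> \<tau> \<longrightarrow> (\<forall>v\<in>slow dual_C c x. norm (transpose (matrix_inv (B t)) *v v) \<le> K * exp ((c + \<epsilon>) * t) * norm v)"
proof -
  define \<eta> where "\<eta> = \<epsilon> / 2"
  have \<eta>: "0 < \<eta>" using \<epsilon> by (simp add: \<eta>_def)
  obtain L where L: "\<And>t. t \<notin> \<tau> \<Longrightarrow> mat_norm (B t ** matrix_inv (B (of_int \<lfloor>t\<rfloor>))) \<le> exp (L + \<eta> * \<bar>t\<bar>) \<and>
     mat_norm (B (of_int \<lfloor>t\<rfloor>) ** matrix_inv (B t)) \<le> exp (L + \<eta> * \<bar>t\<bar>)"
    using temp \<eta> unfolding tempered_off_def by blast
  \<comment> \<open>Rounding t down costs at most the factor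
    \<open>exp \<bar>c + \<eta>\<bar>\<close>, whatever the sign of the rate.\<close>
  have arith: "exp (L + \<eta> * \<bar>t\<bar>) * (K * exp ((c + \<eta>) * real (nat \<lfloor>t\<rfloor>)) * w) \<le> (K * exp (L + \<bar>c + \<eta>\<bar>)) * exp ((c + \<epsilon>) * t) * w"
    if "1 \<le> t" "0 \<le> w" "0 < K" for t w K :: real
  proof -
    have r: "real (nat \<lfloor>t\<rfloor>) = of_int \<lfloor>t\<rfloor>" using that(1) by simp
    have "(c + \<eta>) * of_int \<lfloor>t\<rfloor> - (c + \<eta>) * t \<le> \<bar>c + \<eta>\<bar>"
    proof -
      have "(c + \<eta>) * of_int \<lfloor>t\<rfloor> - (c + \<eta>) * t \<le> \<bar>(c + \<eta>) * (of_int \<lfloor>t\<rfloor> - t)\<bar>" by (simp add: right_diff_distrib)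
      also have "\<dots> = \<bar>c + \<eta>\<bar> * \<bar>of_int \<lfloor>t\<rfloor> - t\<bar>" by (rule abs_mult)
      also have "\<dots> \<le> \<bar>c + \<eta>\<bar> * 1" by (intro mult_left_mono) linarith+
      finally show ?thesis by simp
    qed
    moreover have "(c + \<epsilon>) * t = (c + \<eta>) * t + \<eta> * t" by (simp add: \<eta>_def field_simps)
    ultimately have "L + \<eta> * \<bar>t\<bar> + (c + \<eta>) * of_int \<lfloor>t\<rfloor> \<le> L + \<bar>c + \<eta>\<bar> + (c + \<epsilon>) * t" using that(1) by simp
    then have "exp (L + \<eta> * \<bar>t\<bar> + (c + \<eta>) * of_int \<lfloor>t\<rfloor>) \<le> exp (L + \<bar>c + \<eta>\<bar> + (c + \<epsilon>) * t)" by simp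
    then have "K * w * exp (L + \<eta> * \<bar>t\<bar> + (c + \<eta>) * of_int \<lfloor>t\<rfloor>) \<le> K * w * exp (L + \<bar>c + \<eta>\<bar> + (c + \<epsilon>) * t)"
      using that by (intro mult_left_mono) auto
    then show ?thesis unfolding r exp_add by (simp add: mult.assoc mult.commute mult.left_commute)
  qed
  have fl: "of_int \<lfloor>t\<rfloor> = (of_int (int (nat \<lfloor>t\<rfloor>)) :: real)" if "1 \<le> t" for t :: real using that by simp
  obtain K where K: "0 < K" "\<And>(n::nat) v. v \<in> slow C c x \<Longrightarrow> norm (C (int n) x *v v) \<le> K * exp ((c + \<eta>) * real n) * norm v"
    by (rule slow_uniform[OF \<eta>, of C x c]) blast
  have "norm (B t *v v) \<le> (K * exp (L + \<bar>c + \<eta>\<bar>)) * exp ((c + \<epsilon>) * t) * norm v"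
    if t: "1 \<le> t" "t \<notin> \<tau>" and v: "v \<in> slow C c x" for t v
  proof -
    define n where "n = nat \<lfloor>t\<rfloor>"
    have Bn: "B (of_int \<lfloor>t\<rfloor>) = C (int n) x" unfolding fl[OF t(1)] n_def by (rule BC)
    have e1: "B t *v v = (B t ** matrix_inv (B (of_int \<lfloor>t\<rfloor>))) *v (C (int n) x *v v)"
      using invertible_matrix_inv(2)[OF inv, of "of_int \<lfloor>t\<rfloor>"] unfolding Bn[symmetric]
      by (simp add: matrix_vector_mul_assoc matrix_mul_assoc[symmetric])
    have "norm (B t *v v) \<le> mat_norm (B t ** matrix_inv (B (of_int \<lfloor>t\<rfloor>))) * norm (C (int n) x *v v)"
      unfolding e1 by (rule mat_norm_bound)
    also have "\<dots> \<le> exp (L + \<eta> * \<bar>t\<bar>) * (K * exp ((c + \<eta>) * real n) * norm v)"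
      using L[OF t(2)] by (intro mult_mono K(2)[OF v]) auto
    also have "\<dots> \<le> (K * exp (L + \<bar>c + \<eta>\<bar>)) * exp ((c + \<epsilon>) * t) * norm v"
      unfolding n_def by (rule arith[OF t(1) _ K(1)]) simp
    finally show ?thesis .
  qed
  then show "\<exists>K. \<forall>t\<ge>1. t \<notin> \<tau> \<longrightarrow> (\<forall>v\<in>slow C c x. norm (B t *v v) \<le> K * exp ((c + \<epsilon>) * t) * norm v)" by blast
  obtain K where K: "0 < K" "\<And>(n::nat) v. v \<in> slow dual_C c x \<Longrightarrow> norm (dual_C (int n) x *v v) \<le> K * exp ((c + \<eta>) * real n) * norm v"
    by (rule slow_uniform[OF \<eta>, of dual_C x c]) blast
  have "norm (transpose (matrix_inv (B t)) *v v) \<le> (K * exp (L + \<bar>c + \<eta>\<bar>)) * exp ((c + \<epsilon>) * t) * norm v"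
    if t: "1 \<le> t" "t \<notin> \<tau>" and v: "v \<in> slow dual_C c x" for t v
  proof -
    define n where "n = nat \<lfloor>t\<rfloor>"
    have Bn: "B (of_int \<lfloor>t\<rfloor>) = C (int n) x" unfolding fl[OF t(1)] n_def by (rule BC)
    have i: "matrix_inv (B (of_int \<lfloor>t\<rfloor>)) = C (- int n) (T (int n) x)"
      unfolding Bn by (rule matrix_inv_unique'[OF C_inv(2)[OF x] C_inv(1)[OF x]])
    have "matrix_inv (B t) = matrix_inv (B (of_int \<lfloor>t\<rfloor>)) ** (B (of_int \<lfloor>t\<rfloor>) ** matrix_inv (B t))"
      using invertible_matrix_inv(2)[OF inv, of "of_int \<lfloor>t\<rfloor>"] by (simp add: matrix_mul_assoc)
    then have "transpose (matrix_inv (B t)) = transpose (B (of_int \<lfloor>t\<rfloor>) ** matrix_inv (B t)) ** dual_C (int n) x"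
      unfolding i by (metis matrix_transpose_mul)
    then have "norm (transpose (matrix_inv (B t)) *v v) \<le> mat_norm (transpose (B (of_int \<lfloor>t\<rfloor>) ** matrix_inv (B t))) * norm (dual_C (int n) x *v v)"
      by (metis mat_norm_bound matrix_vector_mul_assoc)
    also have "\<dots> \<le> exp (L + \<eta> * \<bar>t\<bar>) * (K * exp ((c + \<eta>) * real n) * norm v)"
      using L[OF t(2)] by (intro mult_mono K(2)[OF v]) (auto simp: mat_norm_transpose)
    also have "\<dots> \<le> (K * exp (L + \<bar>c + \<eta>\<bar>)) * exp ((c + \<epsilon>) * t) * norm v"
      unfolding n_def by (rule arith[OF t(1) _ K(1)]) simp
    finally show ?thesis .
  qed
  then show "\<exists>K. \<forall>t\<ge>1. t \<notin> \<tau> \<longrightarrow> (\<forall>v\<in>slow dual_C c x. norm (transpose (matrix_inv (B t)) *v v) \<le> K * exp ((c + \<epsilon>) * t) * norm v)" by blast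
qed

definition oseledets :: "'x \<Rightarrow> real \<Rightarrow> (real^'m) set" where
  "oseledets x c = slow C c x \<inter> slow rev_C (- c) x"

lemma regular_splitting:
  assumes reg: "regular x" and inv: "\<And>t. invertible (B t)" and BC: "\<And>n::int. B (of_int n) = C n x"
    and temp: "tempered_off B \<tau>"
  shows "uniform_limit {v \<in> oseledets x \<kappa>. norm v = 1} (\<lambda>t v. 1 / \<bar>t\<bar> * ln (norm (B t *v v))) (\<lambda>_. \<kappa>) (off at_top \<tau>)"
    and "uniform_limit {v \<in> oseledets x \<kappa>. norm v = 1} (\<lambda>t v. 1 / \<bar>t\<bar> * ln (norm (B t *v v))) (\<lambda>_. - \<kappa>) (off at_bot \<tau>)"
    and "v \<in> oseledets x \<kappa> - {0} \<Longrightarrow> ((\<lambda>t. 1 / \<bar>t\<bar> * ln (norm (B t *v v))) \<longlongrightarrow> \<kappa>) (off at_top \<tau>)"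
    and "v \<in> oseledets x \<kappa> - {0} \<Longrightarrow> ((\<lambda>t. 1 / \<bar>t\<bar> * ln (norm (B t *v v))) \<longlongrightarrow> - \<kappa>) (off at_bot \<tau>)"
proof -
  have g: "\<exists>K. \<forall>t. t \<notin> \<tau> \<longrightarrow> (\<forall>v\<in>{v \<in> oseledets x \<kappa>. norm v = 1}. \<bar>ln (norm (B t *v v)) - t * \<kappa>\<bar> \<le> K + \<epsilon> * \<bar>t\<bar>)"
    if "0 < \<epsilon>" for \<epsilon>
    using regular_growth[OF reg inv BC temp that, of \<kappa>] unfolding oseledets_def by blast
  from uniform_limit_average[of \<tau> "{v \<in> oseledets x \<kappa>. norm v = 1}" "\<lambda>t v. ln (norm (B t *v v))", OF g]
  show "uniform_limit {v \<in> oseledets x \<kappa>. norm v = 1} (\<lambda>t v. 1 / \<bar>t\<bar> * ln (norm (B t *v v))) (\<lambda>_. \<kappa>) (off at_top \<tau>)"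
    "uniform_limit {v \<in> oseledets x \<kappa>. norm v = 1} (\<lambda>t v. 1 / \<bar>t\<bar> * ln (norm (B t *v v))) (\<lambda>_. - \<kappa>) (off at_bot \<tau>)"
    by blast+
  assume v: "v \<in> oseledets x \<kappa> - {0}"
  define u where "u = v /\<^sub>R norm v"
  have sub: "subspace (oseledets x \<kappa>)" unfolding oseledets_def by (intro subspace_inter subspace_slow)
  have u: "u \<in> {v \<in> oseledets x \<kappa>. norm v = 1}" using v sub by (auto simp: u_def subspace_scale)
  have vu: "v = norm v *\<^sub>R u" using v by (simp add: u_def)
  \<comment> \<open>For a vector of arbitrary length the estimate changes by the constant
    \<open>ln (norm v)\<close> only.\<close>
  have g': "\<exists>K. \<forall>t. t \<notin> \<tau> \<longrightarrow> (\<forall>w\<in>{v}. \<bar>ln (norm (B t *v w)) - t * \<kappa>\<bar> \<le> K + \<epsilon> * \<bar>t\<bar>)"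
    if e: "0 < \<epsilon>" for \<epsilon>
  proof -
    obtain K where K: "\<And>t. t \<notin> \<tau> \<Longrightarrow> \<bar>ln (norm (B t *v u)) - t * \<kappa>\<bar> \<le> K + \<epsilon> * \<bar>t\<bar>" using g[OF e] u by blast
    have "\<bar>ln (norm (B t *v v)) - t * \<kappa>\<bar> \<le> (K + \<bar>ln (norm v)\<bar>) + \<epsilon> * \<bar>t\<bar>" if t: "t \<notin> \<tau>" for t
    proof -
      have "u \<noteq> 0" using u by auto
      have "B t *v u \<noteq> 0"
      proof
        assume "B t *v u = 0"
        then have "matrix_inv (B t) *v (B t *v u) = 0" by (simp only: matrix_vector_mult_0_right)
        then show False using \<open>u \<noteq> 0\<close> invertible_matrix_inv(2)[OF inv, of t]
          by (simp only: matrix_vector_mul_assoc matrix_vector_mul_lid)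
      qed
      moreover have "norm (B t *v v) = norm v * norm (B t *v u)"
        by (subst vu) (simp add: matrix_vector_mult_scaleR)
      ultimately have "ln (norm (B t *v v)) = ln (norm v) + ln (norm (B t *v u))" using v by (simp add: ln_mult)
      then show ?thesis using K[OF t] by linarith
    qed
    then show ?thesis by blast
  qed
  note ul = uniform_limit_average[of \<tau> "{v}" "\<lambda>t v. ln (norm (B t *v v))", OF g']
  show "((\<lambda>t. 1 / \<bar>t\<bar> * ln (norm (B t *v v))) \<longlongrightarrow> \<kappa>) (off at_top \<tau>)"
    using tendsto_uniform_limitI[OF ul(1), of v] by simp
  show "((\<lambda>t. 1 / \<bar>t\<bar> * ln (norm (B t *v v))) \<longlongrightarrow> - \<kappa>) (off at_bot \<tau>)"
    using tendsto_uniform_limitI[OF ul(2), of v] by simp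
qed

end

section \<open>Continuous time\<close>

lemma (in complete_measure) measurable_AE_eq:
  fixes f g :: "'a \<Rightarrow> 'b::topological_space"
  assumes g: "g \<in> borel_measurable M" and ae: "AE x in M. f x = g x"
  shows "f \<in> borel_measurable M"
proof (rule measurableI)
  fix S :: "'b set" assume S: "S \<in> sets borel"
  show "f -` S \<inter> space M \<in> sets M"
  proof (rule in_sets_AE)
    show "AE x in M. (x \<in> g -` S \<inter> space M) = (x \<in> f -` S \<inter> space M)" using ae by eventually_elim simp
    show "g -` S \<inter> space M \<in> sets M" using g S by (rule measurable_sets)
  qed simp
qed simp

section \<open>Sections and iterated integrals for the completed product\<close>

locale complete_prob_space = prob_space M + complete_measure M for M :: "'x measure"
begin

sublocale tp: pair_sigma_finite lborel M ..

lemma space_time_product: "space (time_product M) = UNIV \<times> space M"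
  by (simp add: time_product_def space_pair_measure)

lemma AE_time_product_iff: "(AE z in time_product M. P z) \<longleftrightarrow> (AE z in lborel \<Otimes>\<^sub>M M. P z)"
  unfolding time_product_def AE_completion_iff ..

lemma AE_time_product_fst:
  assumes "AE z in time_product M. P z" shows "AE t in lborel. AE x in M. P (t, x)"
  using assms unfolding AE_time_product_iff by (rule tp.AE_pair)

lemma AE_time_product_snd:
  assumes "AE z in time_product M. P z" shows "AE x in M. AE t in lborel. P (t, x)"
proof -
  let ?N = "lborel \<Otimes>\<^sub>M M"
  have "AE z in ?N. P z" using assms unfolding AE_time_product_iff .
  then obtain Z where Z: "{z \<in> space ?N. \<not> P z} \<subseteq> Z" "emeasure ?N Z = 0" "Z \<in> sets ?N" by (rule AE_E)
  then have "AE z in ?N. z \<notin> Z" by (intro AE_not_in) (auto simp: null_sets_def)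
  then have "AE t in lborel. AE x in M. (t, x) \<notin> Z" by (rule tp.AE_pair)
  then have "AE x in M. AE t in lborel. (t, x) \<notin> Z"
  proof (subst tp.AE_commute[symmetric])
    have "{x \<in> space ?N. (fst x, snd x) \<notin> Z} = space ?N - Z" by auto
    also have "\<dots> \<in> sets ?N" by (intro sets.compl_sets Z(3))
    finally show "{x \<in> space ?N. (fst x, snd x) \<notin> Z} \<in> sets ?N" .
  qed
  then show ?thesis using AE_space
  proof eventually_elim
    case (elim x)
    from elim(1) show ?case
    proof eventually_elim
      case (elim t)
      have "(t, x) \<in> space ?N" using \<open>x \<in> space M\<close> by (simp add: space_pair_measure)
      then show ?case using Z(1) elim by blast
    qed
  qed
qed

text \<open>A function measurable for the completion agrees almost everywhere with one measurable
  for the product, and Fubini for the latter is transferred along almost all sections. The inner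
  integral over M is controlled only up to a null set of times, hence the form of the third
  claim.\<close>

lemma nn_integral_time_product:
  fixes f :: "real \<times> 'x \<Rightarrow> ennreal"
  assumes f: "f \<in> borel_measurable (time_product M)"
  shows "(\<integral>\<^sup>+z. f z \<partial>time_product M) = (\<integral>\<^sup>+t. \<integral>\<^sup>+x. f (t, x) \<partial>M \<partial>lborel)"
    and "(\<integral>\<^sup>+z. f z \<partial>time_product M) = (\<integral>\<^sup>+x. \<integral>\<^sup>+t. f (t, x) \<partial>lborel \<partial>M)"
    and "\<exists>f'. f' \<in> borel_measurable lborel \<and> (AE t in lborel. (\<integral>\<^sup>+x. f (t, x) \<partial>M) = f' t)"
    and "(\<integral>\<^sup>+z. f z \<partial>time_product M) < \<infinity> \<Longrightarrow> AE x in M. (\<integral>\<^sup>+t. f (t, x) \<partial>lborel) < \<infinity>"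
proof -
  let ?N = "lborel \<Otimes>\<^sub>M M"
  obtain g where g [measurable]: "g \<in> borel_measurable ?N" and fg: "AE z in ?N. f z = g z"
    using completion_ex_borel_measurable f unfolding time_product_def by blast
  have fg': "AE z in time_product M. f z = g z" using fg unfolding AE_time_product_iff .
  have 0: "(\<integral>\<^sup>+z. f z \<partial>time_product M) = (\<integral>\<^sup>+z. g z \<partial>?N)"
    unfolding time_product_def nn_integral_completion by (rule nn_integral_cong_AE[OF fg])
  have 1: "AE t in lborel. (\<integral>\<^sup>+x. f (t, x) \<partial>M) = (\<integral>\<^sup>+x. g (t, x) \<partial>M)"
    using AE_time_product_fst[OF fg'] by eventually_elim (rule nn_integral_cong_AE)
  have 2: "AE x in M. (\<integral>\<^sup>+t. f (t, x) \<partial>lborel) = (\<integral>\<^sup>+t. g (t, x) \<partial>lborel)"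
    using AE_time_product_snd[OF fg'] by eventually_elim (rule nn_integral_cong_AE)
  show "(\<integral>\<^sup>+z. f z \<partial>time_product M) = (\<integral>\<^sup>+t. \<integral>\<^sup>+x. f (t, x) \<partial>M \<partial>lborel)"
    unfolding 0 by (subst nn_integral_cong_AE[OF 1]) (simp add: nn_integral_fst)
  show "\<exists>f'. f' \<in> borel_measurable lborel \<and> (AE t in lborel. (\<integral>\<^sup>+x. f (t, x) \<partial>M) = f' t)"
    using 1 by (intro exI[of _ "\<lambda>t. \<integral>\<^sup>+x. g (t, x) \<partial>M"]) auto
  have s: "(\<integral>\<^sup>+z. g z \<partial>?N) = (\<integral>\<^sup>+x. \<integral>\<^sup>+t. g (t, x) \<partial>lborel \<partial>M)"
    by (simp add: tp.nn_integral_snd[symmetric])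
  show "(\<integral>\<^sup>+z. f z \<partial>time_product M) = (\<integral>\<^sup>+x. \<integral>\<^sup>+t. f (t, x) \<partial>lborel \<partial>M)"
    unfolding 0 s by (rule nn_integral_cong_AE[symmetric]) (rule 2)
  assume "(\<integral>\<^sup>+z. f z \<partial>time_product M) < \<infinity>"
  then have "(\<integral>\<^sup>+x. \<integral>\<^sup>+t. g (t, x) \<partial>lborel \<partial>M) \<noteq> \<infinity>" by (simp add: 0 s)
  then have "AE x in M. (\<integral>\<^sup>+t. g (t, x) \<partial>lborel) \<noteq> \<infinity>"
    by (intro nn_integral_PInf_AE) measurable
  with 2 show "AE x in M. (\<integral>\<^sup>+t. f (t, x) \<partial>lborel) < \<infinity>" by eventually_elim (simp add: less_top)
qed

text \<open>Almost every section agrees almost everywhere with a section of a product-measurable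
  function. Completeness of M turns this into measurability in x; in the time variable it gives
  Lebesgue measurability.\<close>

lemma sections_time_product:
  fixes f :: "real \<times> 'x \<Rightarrow> real"
  assumes f: "f \<in> borel_measurable (time_product M)"
  shows "AE t in lborel. (\<lambda>x. f (t, x)) \<in> borel_measurable M"
    and "AE x in M. (\<lambda>t. f (t, x)) \<in> borel_measurable lebesgue"
proof -
  let ?N = "lborel \<Otimes>\<^sub>M M"
  obtain g where g [measurable]: "g \<in> borel_measurable ?N" and fg: "AE z in ?N. f z = g z"
    using completion_ex_borel_measurable_real f unfolding time_product_def by blast
  have fg': "AE z in time_product M. f z = g z" using fg unfolding AE_time_product_iff .
  show "AE t in lborel. (\<lambda>x. f (t, x)) \<in> borel_measurable M"
    using AE_time_product_fst[OF fg']
  proof eventually_elim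
    case (elim t)
    show ?case by (rule measurable_AE_eq[OF _ elim]) measurable
  qed
  show "AE x in M. (\<lambda>t. f (t, x)) \<in> borel_measurable lebesgue"
    using AE_time_product_snd[OF fg'] AE_space
  proof eventually_elim
    case (elim x)
    show ?case
    proof (rule complete_measure.measurable_AE_eq[OF completion.complete_measure_axioms])
      show "AE t in lebesgue. f (t, x) = g (t, x)" using elim(1) by (rule AE_completion)
      have "(\<lambda>t. g (t, x)) \<in> borel_measurable lborel" using elim(2) by measurable
      then show "(\<lambda>t. g (t, x)) \<in> borel_measurable lebesgue" by (rule measurable_completion)
    qed
  qed
qed

lemma measurable_snd_time_product:
  assumes [measurable]: "f \<in> measurable M M'"
  shows "(\<lambda>z. f (snd z)) \<in> measurable (time_product M) M'"
  unfolding time_product_def by (intro measurable_completion) measurable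

text \<open>Measurability between completions requires preimages of null sets to be null; this is
  where invariance of the measure enters, through Fubini.\<close>

lemma measurable_time_product_map:
  assumes [measurable]: "S \<in> M \<rightarrow>\<^sub>M M" and pres: "distr M M S = M"
  shows "(\<lambda>(t, x). (t, S x)) \<in> time_product M \<rightarrow>\<^sub>M time_product M"
proof -
  let ?N = "lborel \<Otimes>\<^sub>M M :: (real \<times> 'x) measure" and ?f = "\<lambda>(t::real, x). (t, S x)"
  have fm: "?f \<in> ?N \<rightarrow>\<^sub>M ?N" by measurable
  have "?f \<in> completion ?N \<rightarrow>\<^sub>M completion ?N"
  proof (rule complete_measure.measurable_completion2[OF completion.complete_measure_axioms])
    show "?f \<in> completion ?N \<rightarrow>\<^sub>M ?N" using fm by (rule measurable_completion)
    show "null_sets ?N \<subseteq> null_sets (distr (completion ?N) ?N ?f)"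
    proof
      fix Z assume Z: "Z \<in> null_sets ?N"
      then have Zs [measurable]: "Z \<in> sets ?N" and Z0: "emeasure ?N Z = 0" by auto
      have "emeasure (distr ?N ?N ?f) Z = (\<integral>\<^sup>+z. indicator Z z \<partial>distr ?N ?N ?f)"
        by (rule nn_integral_indicator[symmetric]) (simp only: sets_distr Zs)
      also have "\<dots> = (\<integral>\<^sup>+z. indicator Z (?f z) \<partial>?N)"
        by (rule nn_integral_distr[OF fm]) (simp add: Zs borel_measurable_indicator)
      also have "\<dots> = (\<integral>\<^sup>+t. \<integral>\<^sup>+x. indicator Z (t, S x) \<partial>M \<partial>lborel)"
        by (subst nn_integral_fst[symmetric]) auto
      also have "\<dots> = (\<integral>\<^sup>+t. \<integral>\<^sup>+x. indicator Z (t, x) \<partial>distr M M S \<partial>lborel)"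
        by (intro nn_integral_cong) (subst nn_integral_distr, auto)
      also have "\<dots> = (\<integral>\<^sup>+z. indicator Z z \<partial>?N)"
        unfolding pres by (rule nn_integral_fst) simp
      also have "\<dots> = 0" using nn_integral_indicator[OF Zs] Z0 by (rule trans)
      finally show "Z \<in> null_sets (distr (completion ?N) ?N ?f)"
        using fm Zs by (simp add: null_sets_def distr_completion)
    qed
  qed
  then show ?thesis by (simp add: time_product_def)
qed

end

text \<open>A Steinhaus argument. For large n the function is at most n on almost all of a set
  \<open>H n\<close> in \<open>{0..2}\<close> of measure above 3/2. \<open>H n\<close> and its
  translate by \<open>- t\<close> both lie in \<open>{-1..2}\<close>, which has length 3, so they
  overlap. Some s therefore has both \<open>I s\<close> and \<open>I (t + s)\<close> at most n, and
  evenness and subadditivity bound \<open>I t\<close> by \<open>2 * n\<close>.\<close>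

lemma even_subadditive_bounded:
  fixes I I' :: "real \<Rightarrow> ennreal"
  assumes I': "I' \<in> borel_measurable lborel" and ae: "AE t in lborel. I t = I' t"
    and fin: "\<And>t. I t < \<infinity>" and sub: "\<And>s t. I (s + t) \<le> I s + I t" and even: "\<And>t. I (- t) = I t"
  obtains L :: nat where "\<And>t. t \<in> {0..1} \<Longrightarrow> I t \<le> ennreal (real L)"
proof -
  have [measurable]: "I' \<in> borel_measurable borel" using I' by simp
  define H where "H n = {s \<in> {0..2}. I' s \<le> ennreal (real n)}" for n :: nat
  have Hm [measurable]: "H n \<in> sets borel" for n unfolding H_def by measurable
  have inc: "incseq H" unfolding incseq_def H_def
    by (auto intro: order.trans simp: ennreal_leI)
  have ae_fin: "AE t in lborel. I' t < \<infinity>" using ae by eventually_elim (metis fin)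
  have "emeasure lborel (\<Union>n. H n) = emeasure lborel {0..2::real}"
  proof (rule emeasure_eq_AE)
    show "AE s in lborel. (s \<in> (\<Union>n. H n)) = (s \<in> {0..2})"
      using ae_fin
    proof eventually_elim
      case (elim s)
      then obtain r where r: "I' s = ennreal r" "0 \<le> r" by (cases "I' s") auto
      obtain n :: nat where "r \<le> real n" using real_arch_simple by blast
      then show ?case using r by (auto simp: H_def ennreal_leI intro!: exI[of _ n])
    qed
  qed auto
  then have "(SUP n. emeasure lborel (H n)) = 2"
    using SUP_emeasure_incseq[of H lborel] inc by (simp add: image_subset_iff)
  moreover have "ennreal (3/2) < 2" using ennreal_less_iff[of "3/2" 2] by simp
  ultimately obtain n where n: "ennreal (3/2) < emeasure lborel (H n)"
    using less_SUP_iff[of "ennreal (3/2)" "\<lambda>n. emeasure lborel (H n)" UNIV] by auto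
  have "I t \<le> ennreal (real (2 * n))" if t: "t \<in> {0..1}" for t
  proof -
    define G where "G = (+) t -` H n"
    have Gm [measurable]: "G \<in> sets borel" unfolding G_def
      using measurable_sets[of "(+) t" borel borel "H n"] by simp
    have eG: "emeasure lborel G = emeasure lborel (H n)"
    proof -
      have "emeasure lborel (H n) = emeasure (distr lborel borel ((+) t)) (H n)" by (simp add: lborel_distr_plus)
      also have "\<dots> = emeasure lborel G" by (subst emeasure_distr) (auto simp: G_def)
      finally show ?thesis by simp
    qed
    \<comment> \<open>The overlap must have positive measure and not merely be nonempty, because I
      agrees with the measurable \<open>I'\<close> only almost everywhere.\<close>
    have notae: "\<not> (AE s in lborel. s \<notin> H n \<inter> G)"
    proof
      assume "AE s in lborel. s \<notin> H n \<inter> G"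
      then have z: "emeasure lborel (H n \<inter> G) = 0"
        by (subst (asm) AE_iff_measurable[of "H n \<inter> G"]) auto
      have "emeasure lborel (H n) + emeasure lborel G = emeasure lborel (H n \<union> G) + emeasure lborel (H n \<inter> G)"
        by (rule emeasure_Un_Int) auto
      also have "\<dots> = emeasure lborel (H n \<union> G)" using z by simp
      also have "\<dots> \<le> emeasure lborel {-1..2::real}"
        using t by (intro emeasure_mono) (auto simp: H_def G_def)
      also have "\<dots> = ennreal 3" by simp
      finally have le: "emeasure lborel (H n) + emeasure lborel G \<le> ennreal 3" .
      have "ennreal (3/2) + ennreal (3/2) < emeasure lborel (H n) + emeasure lborel G"
        unfolding eG using n by (intro add_strict_mono) auto
      also have "ennreal (3/2) + ennreal (3/2) = ennreal 3" by (subst ennreal_plus[symmetric]) auto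
      finally show False using le by simp
    qed
    have "AE s in lborel. I (t + s) = I' (t + s)"
    proof -
      have "AE s in distr lborel borel ((+) t). I s = I' s" using ae by (simp only: lborel_distr_plus)
      then show ?thesis by (rule AE_distrD[rotated]) simp
    qed
    then have imp: "AE s in lborel. s \<in> H n \<inter> G \<longrightarrow> I s \<le> ennreal (real n) \<and> I (t + s) \<le> ennreal (real n)"
      using ae by eventually_elim (auto simp: H_def G_def)
    have "\<exists>s. I s \<le> ennreal (real n) \<and> I (t + s) \<le> ennreal (real n)"
    proof (rule ccontr)
      assume no: "\<not> ?thesis"
      from imp have "AE s in lborel. s \<notin> H n \<inter> G" by eventually_elim (use no in blast)
      with \<open>\<not> (AE s in lborel. s \<notin> H n \<inter> G)\<close> show False by contradiction
    qed
    then obtain s where s: "I s \<le> ennreal (real n)" "I (t + s) \<le> ennreal (real n)" by blast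
    have "I t \<le> I (t + s) + I (- s)" using sub[of "t + s" "- s"] by simp
    also have "\<dots> \<le> ennreal (real n) + ennreal (real n)" using s even[of s] by (intro add_mono) auto
    also have "\<dots> = ennreal (real (2 * n))" by (subst ennreal_plus[symmetric]) auto
    finally show ?thesis .
  qed
  then show thesis by (rule that)
qed

text \<open>A bound on the norm of the inverse is a family of inequalities about B itself, and by
  density countably many vectors suffice.\<close>

lemma measurable_mat_norm_inv:
  fixes B :: "'z \<Rightarrow> real^'m^'m"
  assumes [measurable]: "B \<in> borel_measurable N" and inv: "\<And>z. z \<in> space N \<Longrightarrow> invertible (B z)"
  shows "(\<lambda>z. mat_norm (matrix_inv (B z))) \<in> borel_measurable N"
proof (subst borel_measurable_iff_le, intro allI)
  fix r :: real
  obtain D :: "(real^'m) set" where D: "countable D" "\<And>X. open X \<Longrightarrow> X \<noteq> {} \<Longrightarrow> \<exists>d\<in>D. d \<in> X"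
    using countable_dense_setE by blast
  have "{z \<in> space N. mat_norm (matrix_inv (B z)) \<le> r} = {z \<in> space N. \<forall>v\<in>D. norm v \<le> r * norm (B z *v v)}"
  proof (intro Collect_cong conj_cong refl)
    fix z assume z: "z \<in> space N"
    note i = invertible_matrix_inv[OF inv[OF z]]
    have "mat_norm (matrix_inv (B z)) \<le> r \<longleftrightarrow> (\<forall>v. norm v \<le> r * norm (B z *v v))"
    proof
      assume le: "mat_norm (matrix_inv (B z)) \<le> r"
      show "\<forall>v. norm v \<le> r * norm (B z *v v)"
      proof
        fix v
        have "v = matrix_inv (B z) *v (B z *v v)" by (simp add: matrix_vector_mul_assoc i)
        then have "norm v \<le> mat_norm (matrix_inv (B z)) * norm (B z *v v)" by (metis mat_norm_bound)
        also have "\<dots> \<le> r * norm (B z *v v)" by (intro mult_right_mono le) simp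
        finally show "norm v \<le> r * norm (B z *v v)" .
      qed
    next
      assume a: "\<forall>v. norm v \<le> r * norm (B z *v v)"
      show "mat_norm (matrix_inv (B z)) \<le> r"
      proof (rule mat_norm_le)
        fix w
        have "norm (matrix_inv (B z) *v w) \<le> r * norm (B z *v (matrix_inv (B z) *v w))" using a by blast
        then show "norm (matrix_inv (B z) *v w) \<le> r * norm w" by (simp add: matrix_vector_mul_assoc i)
      qed
    qed
    also have "\<dots> \<longleftrightarrow> (\<forall>v\<in>D. norm v \<le> r * norm (B z *v v))"
    proof
      assume d: "\<forall>v\<in>D. norm v \<le> r * norm (B z *v v)"
      show "\<forall>v. norm v \<le> r * norm (B z *v v)"
      proof (rule ccontr)
        assume "\<not> ?thesis"
        then obtain v where v: "r * norm (B z *v v) < norm v" by (auto simp: not_le)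
        let ?X = "{v. r * norm (B z *v v) < norm v}"
        have "open ?X" by (intro open_Collect_less continuous_intros)
        moreover have "?X \<noteq> {}" using v by blast
        ultimately have "\<exists>d\<in>D. d \<in> ?X" by (rule D(2))
        then show False using d by force
      qed
    qed blast
    finally show "mat_norm (matrix_inv (B z)) \<le> r \<longleftrightarrow> (\<forall>v\<in>D. norm v \<le> r * norm (B z *v v))" .
  qed
  also have "\<dots> = space N - (\<Union>v\<in>D. {z \<in> space N. \<not> norm v \<le> r * norm (B z *v v)})" by blast
  also have "\<dots> \<in> sets N"
  proof (intro sets.compl_sets sets.countable_UN' D(1))
    have "{z \<in> space N. \<not> norm v \<le> r * norm (B z *v v)} \<in> sets N" for v by measurable
    then show "(\<lambda>v. {z \<in> space N. \<not> norm v \<le> r * norm (B z *v v)}) ` D \<subseteq> sets N" by blast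
  qed
  finally show "{z \<in> space N. mat_norm (matrix_inv (B z)) \<le> r} \<in> sets N" .
qed

section \<open>The logarithmic size of a matrix\<close>

lemma ln_plus_nonneg: "0 \<le> ln_plus r" by (simp add: ln_plus_def)

lemma le_exp_ln_plus: "r \<le> exp (ln_plus r)"
  by (cases "0 < r") (auto simp: ln_plus_def max_def intro: order.trans[OF _ exp_ge_zero])

lemma ln_plus_mult_le:
  assumes "0 \<le> a" "0 \<le> b" "c \<le> a * b" "0 \<le> c" shows "ln_plus c \<le> ln_plus a + ln_plus b"
proof (cases "0 < c")
  case True
  then have "0 < a * b" using assms(3) by linarith
  then have p: "0 < a" "0 < b" using assms(1,2) by (auto simp: zero_less_mult_iff)
  have "ln c \<le> ln (a * b)" using True p assms(3) by (subst ln_le_cancel_iff) auto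
  then have "ln c \<le> ln a + ln b" using p by (simp add: ln_mult)
  then show ?thesis by (auto simp: ln_plus_def)
next
  case False
  then have "c = 0" using assms(4) by simp
  then show ?thesis using ln_plus_nonneg[of a] ln_plus_nonneg[of b] by (simp add: ln_plus_def)
qed

lemma measurable_ln_plus [measurable]: "ln_plus \<in> borel_measurable borel"
  unfolding ln_plus_def[abs_def] by measurable

lemma ennreal_suminf_tail:
  fixes f :: "nat \<Rightarrow> ennreal"
  assumes "(\<Sum>k. f k) \<noteq> top" "0 < e"
  shows "\<exists>N. (\<Sum>k. f (k + N)) \<le> ennreal e"
proof -
  have fin: "f k \<noteq> top" for k
  proof
    assume "f k = top"
    moreover have "f k \<le> (\<Sum>k. f k)" using sum_le_suminf[of f "{k}"] by simp
    ultimately show False using assms(1) by (simp add: top_unique)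
  qed
  define r where "r k = enn2real (f k)" for k
  have f: "f k = ennreal (r k)" for k using fin[of k] by (simp add: r_def ennreal_enn2real_if)
  have r0: "0 \<le> r k" for k by (simp add: r_def)
  have sr: "summable r" using assms(1) r0 unfolding f by (intro summable_suminf_not_top)
  obtain N where N: "norm (\<Sum>i. r (i + N)) < e" using suminf_exist_split[OF assms(2) sr] by blast
  have "(\<Sum>k. f (k + N)) = ennreal (\<Sum>k. r (k + N))"
    unfolding f using r0 sr by (intro suminf_ennreal2) (auto simp: summable_iff_shift)
  also have "\<dots> \<le> ennreal e" using N by (intro ennreal_leI) auto
  finally show ?thesis by blast
qed

text \<open>Subadditive under products and unchanged by inversion of an invertible matrix; along an
  invariant flow these two properties make its mean subadditive and even in time.\<close>

definition log_size :: "real^'m^'m \<Rightarrow> real" where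
  "log_size B = ln_plus (mat_norm B) + ln_plus (mat_norm (matrix_inv B))"

lemma log_size_nonneg: "0 \<le> log_size B" by (simp add: log_size_def ln_plus_nonneg)

lemma mat_norm_le_log_size: "mat_norm B \<le> exp (log_size B)" "mat_norm (matrix_inv B) \<le> exp (log_size B)"
proof -
  have "mat_norm B \<le> exp (ln_plus (mat_norm B))" by (rule le_exp_ln_plus)
  also have "\<dots> \<le> exp (log_size B)" by (simp add: log_size_def ln_plus_nonneg)
  finally show "mat_norm B \<le> exp (log_size B)" .
  have "mat_norm (matrix_inv B) \<le> exp (ln_plus (mat_norm (matrix_inv B)))" by (rule le_exp_ln_plus)
  also have "\<dots> \<le> exp (log_size B)" by (simp add: log_size_def ln_plus_nonneg)
  finally show "mat_norm (matrix_inv B) \<le> exp (log_size B)" .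
qed

lemma matrix_inv_mult:
  fixes B D :: "real^'m^'m"
  assumes "invertible B" "invertible D"
  shows "matrix_inv (B ** D) = matrix_inv D ** matrix_inv B"
proof (rule matrix_inv_unique')
  note b = invertible_matrix_inv[OF assms(1)] and d = invertible_matrix_inv[OF assms(2)]
  have "B ** D ** (matrix_inv D ** matrix_inv B) = B ** (D ** matrix_inv D) ** matrix_inv B"
    by (simp only: matrix_mul_assoc)
  then show "B ** D ** (matrix_inv D ** matrix_inv B) = mat 1" by (simp add: b d)
  have "matrix_inv D ** matrix_inv B ** (B ** D) = matrix_inv D ** (matrix_inv B ** B) ** D"
    by (simp only: matrix_mul_assoc)
  then show "matrix_inv D ** matrix_inv B ** (B ** D) = mat 1" by (simp add: b d)
qed

lemma log_size_mult:
  assumes "invertible B" "invertible D"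
  shows "log_size (B ** D) \<le> log_size B + log_size D"
proof -
  have "ln_plus (mat_norm (B ** D)) \<le> ln_plus (mat_norm B) + ln_plus (mat_norm D)"
    by (intro ln_plus_mult_le mat_norm_mult mat_norm_nonneg)
  moreover have "ln_plus (mat_norm (matrix_inv (B ** D))) \<le> ln_plus (mat_norm (matrix_inv D)) + ln_plus (mat_norm (matrix_inv B))"
    unfolding matrix_inv_mult[OF assms] by (intro ln_plus_mult_le mat_norm_mult mat_norm_nonneg)
  ultimately show ?thesis by (simp add: log_size_def)
qed

lemma log_size_matrix_inv:
  assumes "invertible B" shows "log_size (matrix_inv B) = log_size B"
  using matrix_inv_unique'[OF invertible_matrix_inv(2,1)[OF assms]] by (simp add: log_size_def)

lemma measurable_log_size:
  fixes B :: "'z \<Rightarrow> real^'m^'m"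
  assumes [measurable]: "B \<in> borel_measurable N" and inv: "\<And>z. z \<in> space N \<Longrightarrow> invertible (B z)"
  shows "(\<lambda>z. log_size (B z)) \<in> borel_measurable N"
proof -
  have [measurable]: "(\<lambda>z. mat_norm (matrix_inv (B z))) \<in> borel_measurable N"
    using assms by (rule measurable_mat_norm_inv)
  show ?thesis unfolding log_size_def by measurable
qed

section \<open>The cocycle over the flow and its sampling at integer times\<close>

locale met_flow = complete_prob_space M for M :: "'x measure" +
  fixes T :: "real \<Rightarrow> 'x \<Rightarrow> 'x" and A :: "real \<Rightarrow> 'x \<Rightarrow> real^'m^'m"
  assumes flow: "mp_flow M T" and cocycle: "GL_cocycle M T A"
    and int1: "\<And>t. integrable M (\<lambda>x. ln_plus (mat_norm (A t x)))"
    and int2: "\<And>t. integrable M (\<lambda>x. ln_plus (mat_norm (matrix_inv (A t x))))"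
begin

lemma T_measurable [measurable]: "T t \<in> M \<rightarrow>\<^sub>M M" and T_pres: "distr M M (T t) = M"
  and T0: "x \<in> space M \<Longrightarrow> T 0 x = x" and Tadd: "x \<in> space M \<Longrightarrow> T (t + s) x = T t (T s x)"
  using flow by (auto simp: mp_flow_def)

lemma T_in_space [simp]: "x \<in> space M \<Longrightarrow> T t x \<in> space M"
  using measurable_space[OF T_measurable] by blast

lemma T_neg [simp]: "x \<in> space M \<Longrightarrow> T (- t) (T t x) = x" "x \<in> space M \<Longrightarrow> T t (T (- t) x) = x"
  using Tadd[of x "- t" t] Tadd[of x t "- t"] T0 by auto

lemma A_invertible: "x \<in> space M \<Longrightarrow> invertible (A t x)"
  and Aadd: "x \<in> space M \<Longrightarrow> A (t + s) x = A s (T t x) ** A t x"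
  using cocycle by (auto simp: GL_cocycle_def)

lemma A0: assumes "x \<in> space M" shows "A 0 x = mat 1"
proof -
  have "A 0 x = A 0 x ** A 0 x" using Aadd[OF assms, of 0 0] T0[OF assms] by simp
  then have "matrix_inv (A 0 x) ** A 0 x = matrix_inv (A 0 x) ** (A 0 x ** A 0 x)" by simp
  then show ?thesis using invertible_matrix_inv(2)[OF A_invertible[OF assms, of 0]] by (simp add: matrix_mul_assoc)
qed

lemma A_shift: assumes "x \<in> space M" shows "A (t - s) (T s x) = A t x ** matrix_inv (A s x)"
proof -
  have "A t x = A (t - s) (T s x) ** A s x" using Aadd[OF assms, of s "t - s"] by simp
  then have "A t x ** matrix_inv (A s x) = A (t - s) (T s x) ** (A s x ** matrix_inv (A s x))"
    by (simp add: matrix_mul_assoc)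
  then show ?thesis using invertible_matrix_inv(1)[OF A_invertible[OF assms, of s]] by simp
qed

lemma A_neg: "x \<in> space M \<Longrightarrow> A (- s) (T s x) = matrix_inv (A s x)"
  using A_shift[of x 0 s] A0 by simp

lemma A_joint: "(\<lambda>(t, x). A t x) \<in> borel_measurable (time_product M)"
  using cocycle by (simp add: GL_cocycle_def)

lemma AE_lborel_reflect: "AE s in lborel. P s \<Longrightarrow> AE s in lborel. P (t - s :: real)"
proof -
  assume "AE s in lborel. P s"
  then have "AE s in distr lborel borel ((+) t). P s" by (simp only: lborel_distr_plus)
  then have "AE s in lborel. P (t + s)" by (rule AE_distrD[rotated]) simp
  then have "AE s in distr lborel borel uminus. P (t + s)" by (simp only: lborel_distr_uminus)
  then have "AE s in lborel. P (t + - s)" by (rule AE_distrD[rotated]) simp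
  then show ?thesis by simp
qed

lemma AE_lborel_ex: "AE s in (lborel :: real measure). P s \<Longrightarrow> \<exists>s. P s"
proof (rule ccontr)
  assume ae: "AE s in lborel. P s" and no: "\<not> (\<exists>s. P s)"
  have "AE s in (lborel :: real measure). False" using ae by eventually_elim (use no in blast)
  then show False by (simp add: AE_iff_null null_sets_def)
qed

text \<open>Joint measurability controls \<open>A s\<close> for almost every s only. For any t, both
  s and t - s can be chosen outside the exceptional null set, and the cocycle rule expresses
  \<open>A t\<close> through these two.\<close>

lemma A_measurable [measurable]: "A t \<in> borel_measurable M"
proof -
  have 1: "AE s in lborel. A s \<in> borel_measurable M"
  proof -
    have "AE s in lborel. \<forall>i\<in>UNIV. \<forall>j\<in>UNIV. (\<lambda>x. A s x $ i $ j) \<in> borel_measurable M"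
    proof (intro AE_finite_allI finite)
      fix i j
      have "(\<lambda>z. (case z of (s, x) \<Rightarrow> A s x) $ i $ j) \<in> borel_measurable (time_product M)"
        using A_joint by (rule measurable_matrix_nth)
      from sections_time_product(1)[OF this] show "AE s in lborel. (\<lambda>x. A s x $ i $ j) \<in> borel_measurable M" by simp
    qed
    then show ?thesis by eventually_elim (simp add: measurable_matrix_iff)
  qed
  have "\<exists>s. A s \<in> borel_measurable M \<and> A (t - s) \<in> borel_measurable M"
    by (intro AE_lborel_ex AE_conjI 1 AE_lborel_reflect[OF 1])
  then obtain s where [measurable]: "A s \<in> borel_measurable M" "A (t - s) \<in> borel_measurable M" by blast
  have "A t x = A (t - s) (T s x) ** A s x" if x: "x \<in> space M" for x
    using Aadd[OF x, of s "t - s"] by simp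
  moreover have "(\<lambda>x. A (t - s) (T s x) ** A s x) \<in> borel_measurable M" by measurable
  ultimately show ?thesis by (subst measurable_cong[where g = "\<lambda>x. A (t - s) (T s x) ** A s x"]) auto
qed

definition g :: "real \<Rightarrow> 'x \<Rightarrow> real" where "g t x = log_size (A t x)"

lemma g_nonneg: "0 \<le> g t x" by (simp add: g_def log_size_nonneg)

lemma g_integrable: "integrable M (g t)"
  unfolding g_def[abs_def] log_size_def using int1[of t] int2[of t] by (rule Bochner_Integration.integrable_add)

lemma g_measurable [measurable]: "g t \<in> borel_measurable M"
  using g_integrable by (rule borel_measurable_integrable)

lemma g_add: "x \<in> space M \<Longrightarrow> g (t + s) x \<le> g s (T t x) + g t x"
  unfolding g_def Aadd by (intro log_size_mult A_invertible) auto

lemma g_neg: "x \<in> space M \<Longrightarrow> g (- t) (T t x) = g t x"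
  by (simp add: g_def A_neg log_size_matrix_inv A_invertible)

lemma g_joint: "(\<lambda>(t, x). g t x) \<in> borel_measurable (time_product M)"
proof -
  have "(\<lambda>z. log_size (case z of (t, x) \<Rightarrow> A t x)) \<in> borel_measurable (time_product M)"
    by (rule measurable_log_size[OF A_joint]) (auto simp: space_time_product A_invertible)
  then show ?thesis by (simp add: g_def split_def)
qed

lemma nn_integral_T: "f \<in> borel_measurable M \<Longrightarrow> (\<integral>\<^sup>+x. f (T t x) \<partial>M) = (\<integral>\<^sup>+x. f x \<partial>M)"
  using nn_integral_distr[OF T_measurable[of t], of f] by (simp add: T_pres)

lemma mean_g_bounded: obtains L :: nat where "\<And>t. t \<in> {0..1} \<Longrightarrow> (\<integral>\<^sup>+x. ennreal (g t x) \<partial>M) \<le> ennreal (real L)"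
proof -
  define I where "I t = (\<integral>\<^sup>+x. ennreal (g t x) \<partial>M)" for t
  have "(\<lambda>z. ennreal (case z of (t, x) \<Rightarrow> g t x)) \<in> borel_measurable (time_product M)"
    using g_joint by measurable
  from nn_integral_time_product(3)[OF this] obtain I' where
    I': "I' \<in> borel_measurable lborel" "AE t in lborel. I t = I' t" by (auto simp: I_def)
  have fin: "I t < \<infinity>" for t
    unfolding I_def using g_integrable[of t] g_nonneg[of t] by (simp add: integrable_iff_bounded)
  have sub: "I (s + t) \<le> I s + I t" for s t
  proof -
    have "I (s + t) \<le> (\<integral>\<^sup>+x. ennreal (g t (T s x)) + ennreal (g s x) \<partial>M)"
      unfolding I_def
      by (intro nn_integral_mono) (simp add: g_nonneg ennreal_plus[symmetric] g_add ennreal_leI del: ennreal_plus)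
    also have "\<dots> = I t + I s"
      unfolding I_def using nn_integral_T[of "\<lambda>x. ennreal (g t x)" s] by (subst nn_integral_add) auto
    finally show ?thesis by (simp add: add.commute)
  qed
  have even: "I (- t) = I t" for t
  proof -
    have "I (- t) = (\<integral>\<^sup>+x. ennreal (g (- t) (T t x)) \<partial>M)"
      unfolding I_def using nn_integral_T[of "\<lambda>x. ennreal (g (- t) x)" t] by simp
    also have "\<dots> = I t" unfolding I_def by (intro nn_integral_cong) (simp add: g_neg)
    finally show ?thesis .
  qed
  obtain L :: nat where "\<And>t. t \<in> {0..1} \<Longrightarrow> I t \<le> ennreal (real L)"
    by (rule even_subadditive_bounded[OF I' fin sub even]) blast
  then show thesis unfolding I_def by (rule that)
qed

sublocale disc: lin_cocycle M "\<lambda>n::int. T (of_int n)" "\<lambda>n. A (of_int n)" "g 1"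
proof
  show "T (of_int (m + n)) x = T (of_int m) (T (of_int n) x)" if "x \<in> space M" for x m n
    using Tadd[OF that, of "of_int m" "of_int n"] by simp
  show "A (of_int (n + m)) x = A (of_int m) (T (of_int n) x) ** A (of_int n) x" if "x \<in> space M" for x n m
    using Aadd[OF that, of "of_int n" "of_int m"] by simp
  show "mat_norm (A (of_int 1) x) \<le> exp (g 1 x)" if "x \<in> space M" for x
    using mat_norm_le_log_size(1)[of "A 1 x"] by (simp add: g_def)
  show "mat_norm (A (of_int (- 1)) (T (of_int 1) x)) \<le> exp (g 1 x)" if "x \<in> space M" for x
    using mat_norm_le_log_size(2)[of "A 1 x"] A_neg[OF that, of 1] by (simp add: g_def)
qed (auto simp: T_pres T0 A0 g_integrable g_nonneg)

section \<open>The exceptional times\<close>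

definition exceed :: "real \<Rightarrow> (real \<times> 'x) set" where
  "exceed r = {(s, x). x \<in> space M \<and> 0 \<le> s \<and> s < 1 \<and> r < g s x}"

definition exceed_at :: "int \<Rightarrow> real \<Rightarrow> (real \<times> 'x) set" where
  "exceed_at n r = {(t, x). x \<in> space M \<and> of_int n \<le> t \<and> t < of_int n + 1 \<and> r < g (t - of_int n) (T (of_int n) x)}"

lemma measurable_fst_time_product: "fst \<in> time_product M \<rightarrow>\<^sub>M borel"
  unfolding time_product_def by (intro measurable_completion) measurable

lemma exceed_at_sets: "exceed_at n r \<in> sets (time_product M)"
proof -
  have [measurable]: "fst \<in> time_product M \<rightarrow>\<^sub>M borel" by (rule measurable_fst_time_product)
  have [measurable]: "(\<lambda>z. A (fst z) (snd z)) \<in> borel_measurable (time_product M)" using A_joint by (simp add: split_def)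
  have [measurable]: "(\<lambda>z. A (- of_int n) (T (of_int n) (snd z))) \<in> borel_measurable (time_product M)"
    by (rule measurable_snd_time_product) measurable
  have eq: "A (t - of_int n) (T (of_int n) x) = A t x ** A (- of_int n) (T (of_int n) x)" if "x \<in> space M" for t x
    using that by (simp add: A_shift A_neg)
  have inv: "invertible (A (fst z) (snd z) ** A (- of_int n) (T (of_int n) (snd z)))" if "z \<in> space (time_product M)" for z
    using that by (auto simp: space_time_product eq[symmetric] A_invertible)
  have [measurable]: "(\<lambda>z. log_size (A (fst z) (snd z) ** A (- of_int n) (T (of_int n) (snd z)))) \<in> borel_measurable (time_product M)"
    by (rule measurable_log_size[OF _ inv]) measurable
  have "exceed_at n r = {z \<in> space (time_product M). of_int n \<le> fst z \<and> fst z < of_int n + 1 \<and>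
      r < log_size (A (fst z) (snd z) ** A (- of_int n) (T (of_int n) (snd z)))}"
    by (auto simp: exceed_at_def space_time_product g_def eq)
  also have "\<dots> \<in> sets (time_product M)" by measurable
  finally show ?thesis .
qed

lemma exceed_sets: "exceed r \<in> sets (time_product M)"
proof -
  have "exceed r = exceed_at 0 r" unfolding exceed_def exceed_at_def by (auto simp: T0)
  then show ?thesis using exceed_at_sets by simp
qed

text \<open>At a fixed time the section of \<open>exceed_at n r\<close> is the preimage under
  \<open>T (of_int n)\<close> of a section of \<open>exceed r\<close>, so the two have the same
  measure. Translation invariance in time does the rest.\<close>

lemma emeasure_exceed_at: "emeasure (time_product M) (exceed_at n r) = emeasure (time_product M) (exceed r)"
proof -
  have e: "emeasure (time_product M) Z = (\<integral>\<^sup>+t. \<integral>\<^sup>+x. indicator Z (t, x) \<partial>M \<partial>lborel)" if "Z \<in> sets (time_product M)" for Z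
    using nn_integral_time_product(1)[of "indicator Z"] that by simp
  define F where "F s = (\<integral>\<^sup>+x. indicator (exceed r) (s, x) \<partial>M :: ennreal)" for s
  have shift: "(\<integral>\<^sup>+x. indicator (exceed_at n r) (t, x) \<partial>M) = F (t - of_int n)" for t
  proof -
    have "(\<integral>\<^sup>+x. indicator (exceed_at n r) (t, x) \<partial>M) = (\<integral>\<^sup>+x. indicator (exceed r) (t - of_int n, T (of_int n) x) \<partial>M :: ennreal)"
      by (intro nn_integral_cong) (auto simp: exceed_def exceed_at_def indicator_def)
    also have "\<dots> = F (t - of_int n)"
      unfolding F_def
    proof (rule nn_integral_T)
      have "(\<lambda>x. indicator (exceed r) (t - of_int n, x) :: ennreal) \<in> borel_measurable M \<longleftrightarrow>
        (\<lambda>x. if 0 \<le> t - of_int n \<and> t - of_int n < 1 \<and> r < g (t - of_int n) x then 1 else 0 :: ennreal) \<in> borel_measurable M"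
        by (rule measurable_cong) (auto simp: exceed_def indicator_def)
      moreover have "(\<lambda>x. if 0 \<le> t - of_int n \<and> t - of_int n < 1 \<and> r < g (t - of_int n) x then 1 else 0 :: ennreal) \<in> borel_measurable M"
        by measurable
      ultimately show "(\<lambda>x. indicator (exceed r) (t - of_int n, x) :: ennreal) \<in> borel_measurable M" by blast
    qed
    finally show ?thesis .
  qed
  obtain F' where F' [measurable]: "F' \<in> borel_measurable lborel" and FF': "AE t in lborel. F t = F' t"
    using nn_integral_time_product(3)[of "indicator (exceed r)"] exceed_sets[of r] by (auto simp: F_def)
  have sh: "AE t in lborel. F (- of_int n + t) = F' (- of_int n + t)"
  proof -
    have "AE s in distr lborel borel ((+) (- of_int n)). F s = F' s" using FF' by (simp only: lborel_distr_plus)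
    then show ?thesis by (rule AE_distrD[rotated]) simp
  qed
  have "emeasure (time_product M) (exceed_at n r) = (\<integral>\<^sup>+t. F (- of_int n + t) \<partial>lborel)"
    by (simp add: e exceed_at_sets shift)
  also have "\<dots> = (\<integral>\<^sup>+t. F' (- of_int n + t) \<partial>lborel)" by (rule nn_integral_cong_AE[OF sh])
  also have "\<dots> = (\<integral>\<^sup>+t. F' t \<partial>distr lborel borel ((+) (- of_int n)))"
    by (rule nn_integral_distr[symmetric]) auto
  also have "\<dots> = (\<integral>\<^sup>+t. F' t \<partial>lborel)" by (simp only: lborel_distr_plus)
  also have "\<dots> = (\<integral>\<^sup>+t. F t \<partial>lborel)" by (rule nn_integral_cong_AE) (use FF' in eventually_elim, simp)
  also have "\<dots> = emeasure (time_product M) (exceed r)" by (simp add: e exceed_sets F_def)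
  finally show ?thesis .
qed

text \<open>At most \<open>Suc j * g s x + 1\<close> of the k satisfy
  \<open>k / Suc j < g s x\<close>. The sum is thus bounded by an integral over the unit time
  interval, which \<open>mean_g_bounded\<close> makes finite.\<close>

lemma suminf_exceed_finite: "(\<Sum>k. emeasure (time_product M) (exceed (real k / real (Suc j)))) \<noteq> top"
proof -
  obtain L :: nat where L: "\<And>t. t \<in> {0..1} \<Longrightarrow> (\<integral>\<^sup>+x. ennreal (g t x) \<partial>M) \<le> ennreal (real L)"
    by (rule mean_g_bounded) blast
  have pt: "(\<Sum>k. indicator (exceed (real k / real (Suc j))) (s, x) :: ennreal) 
     \<le> indicator {0..1} s * (ennreal (real (Suc j)) * ennreal (g s x) + 1)" for s x
  proof (cases "x \<in> space M \<and> 0 \<le> s \<and> s < 1")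
    case False
    then have "indicator (exceed (real k / real (Suc j))) (s, x) = (0::ennreal)" for k by (auto simp: exceed_def indicator_def)
    then show ?thesis by simp
  next
    case True
    define y where "y = real (Suc j) * g s x"
    have y: "0 \<le> y" by (simp add: y_def g_nonneg)
    have ind: "indicator (exceed (real k / real (Suc j))) (s, x) = (if real k < y then 1 else 0 :: ennreal)" for k
      using True by (simp add: exceed_def y_def indicator_def field_simps)
    have "(\<Sum>k. if real k < y then 1 else 0 :: ennreal) = (\<Sum>k<nat \<lceil>y\<rceil>. if real k < y then 1 else 0 :: ennreal)"
    proof (rule suminf_finite)
      fix k assume "k \<notin> {..<nat \<lceil>y\<rceil>}"
      then have "y \<le> real k" by (simp add: not_less)
      then show "(if real k < y then 1 else 0 :: ennreal) = 0" by simp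
    qed simp
    also have "\<dots> \<le> (\<Sum>k<nat \<lceil>y\<rceil>. 1)" by (intro sum_mono) auto
    also have "\<dots> = ennreal (real (nat \<lceil>y\<rceil>))" by (simp add: ennreal_of_nat_eq_real_of_nat)
    also have "\<dots> \<le> ennreal (y + 1)" using y by (intro ennreal_leI) linarith
    also have "\<dots> = ennreal (real (Suc j)) * ennreal (g s x) + 1"
      using y g_nonneg[of s x] by (simp add: y_def ennreal_mult)
    finally show ?thesis using True unfolding ind by simp
  qed
  have jm: "(\<lambda>z. ennreal (g (fst z) (snd z))) \<in> borel_measurable (time_product M)"
    using g_joint by (simp add: split_def)
  have m2: "(\<lambda>z. indicator {0..1} (fst z) * (ennreal (real (Suc j)) * ennreal (g (fst z) (snd z)) + 1)) \<in> borel_measurable (time_product M)"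
    using jm measurable_fst_time_product by measurable
  have "(\<Sum>k. emeasure (time_product M) (exceed (real k / real (Suc j))))
     = (\<Sum>k. \<integral>\<^sup>+z. indicator (exceed (real k / real (Suc j))) z \<partial>time_product M)"
    by (simp add: exceed_sets)
  also have "\<dots> = (\<integral>\<^sup>+z. (\<Sum>k. indicator (exceed (real k / real (Suc j))) z) \<partial>time_product M)"
    by (rule nn_integral_suminf[symmetric]) (intro borel_measurable_indicator exceed_sets)
  also have "\<dots> \<le> (\<integral>\<^sup>+z. indicator {0..1} (fst z) * (ennreal (real (Suc j)) * ennreal (g (fst z) (snd z)) + 1) \<partial>time_product M)"
  proof (rule nn_integral_mono)
    fix z :: "real \<times> 'x"
    show "(\<Sum>k. indicator (exceed (real k / real (Suc j))) z) 
       \<le> indicator {0..1} (fst z) * (ennreal (real (Suc j)) * ennreal (g (fst z) (snd z)) + 1)"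
      using pt[of "fst z" "snd z"] by simp
  qed
  also have "\<dots> = (\<integral>\<^sup>+t. \<integral>\<^sup>+x. indicator {0..1} t * (ennreal (real (Suc j)) * ennreal (g t x) + 1) \<partial>M \<partial>lborel)"
    using nn_integral_time_product(1)[OF m2] by simp
  also have "\<dots> \<le> (\<integral>\<^sup>+t. ennreal (real (Suc j) * real L + 1) * indicator {0..1::real} t \<partial>lborel)"
  proof (rule nn_integral_mono)
    fix t :: real
    show "(\<integral>\<^sup>+x. indicator {0..1} t * (ennreal (real (Suc j)) * ennreal (g t x) + 1) \<partial>M) \<le> ennreal (real (Suc j) * real L + 1) * indicator {0..1} t"
    proof (cases "t \<in> {0..1}")
      case True
      have "(\<integral>\<^sup>+x. indicator {0..1} t * (ennreal (real (Suc j)) * ennreal (g t x) + 1) \<partial>M)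
          = ennreal (real (Suc j)) * (\<integral>\<^sup>+x. ennreal (g t x) \<partial>M) + 1"
        using True by (simp add: nn_integral_add nn_integral_cmult emeasure_space_1)
      also have "\<dots> \<le> ennreal (real (Suc j)) * ennreal (real L) + 1"
        using L[OF True] by (intro add_right_mono mult_left_mono) auto
      also have "\<dots> = ennreal (real (Suc j) * real L + 1)"
        by (simp add: ennreal_mult del: of_nat_Suc)
      finally show ?thesis using True by simp
    qed simp
  qed
  also have "\<dots> = ennreal (real (Suc j) * real L + 1)"
    by (simp add: nn_integral_cmult_indicator)
  finally show ?thesis by (metis ennreal_neq_top top_unique)
qed

lemma ex_thresholds: "\<exists>N :: nat \<Rightarrow> nat. \<forall>j. (\<Sum>k. emeasure (time_product M) (exceed (real (k + N j) / real (Suc j)))) \<le> ennreal ((1/2) ^ j)"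
  by (intro choice allI ennreal_suminf_tail[OF suminf_exceed_finite]) simp

text \<open>For level j the tail of a convergent series is cut so late that the measures of all
  levels together form a geometric series.\<close>

definition threshold :: "nat \<Rightarrow> nat" where
  "threshold = (SOME N. \<forall>j. (\<Sum>k. emeasure (time_product M) (exceed (real (k + N j) / real (Suc j)))) \<le> ennreal ((1/2) ^ j))"

lemma threshold: "(\<Sum>k. emeasure (time_product M) (exceed (real (k + threshold j) / real (Suc j)))) \<le> ennreal ((1/2) ^ j)"
  using someI_ex[OF ex_thresholds] unfolding threshold_def by blast

text \<open>The first part makes sure that the bound with \<^term>\<open>j = 0\<close> holds at every time outside the set.\<close>
definition tau :: "'x \<Rightarrow> real set" where
  "tau x = {t. \<bar>\<lfloor>t\<rfloor>\<bar> < int (threshold 0) \<or>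
     (\<exists>j. int (threshold j) \<le> \<bar>\<lfloor>t\<rfloor>\<bar> \<and> of_int \<bar>\<lfloor>t\<rfloor>\<bar> / real (Suc j) < g (t - of_int \<lfloor>t\<rfloor>) (T (of_int \<lfloor>t\<rfloor>) x))}"

definition tau_graph :: "(real \<times> 'x) set" where
  "tau_graph = {(t, x). x \<in> space M \<and> t \<in> tau x}"

lemma tau_graph_eq: "tau_graph = {(t, x). x \<in> space M \<and> \<bar>\<lfloor>t\<rfloor>\<bar> < int (threshold 0)} \<union>
   (\<Union>j. \<Union>k. exceed_at (int (k + threshold j)) (real (k + threshold j) / real (Suc j)) \<union>
            exceed_at (- int (k + threshold j)) (real (k + threshold j) / real (Suc j)))"
(is "_ = ?E \<union> ?R")
proof (intro set_eqI iffI)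
  fix z assume z: "z \<in> tau_graph"
  obtain t x where tx: "z = (t, x)" by (cases z)
  have x: "x \<in> space M" and t: "t \<in> tau x" using z by (auto simp: tau_graph_def tx)
  show "z \<in> ?E \<union> ?R"
  proof (rule ccontr)
    assume n0: "\<not> ?thesis"
    then obtain j where j: "int (threshold j) \<le> \<bar>\<lfloor>t\<rfloor>\<bar>" "of_int \<bar>\<lfloor>t\<rfloor>\<bar> / real (Suc j) < g (t - of_int \<lfloor>t\<rfloor>) (T (of_int \<lfloor>t\<rfloor>) x)"
      using t x unfolding tau_def tx by blast
    define k where "k = nat \<bar>\<lfloor>t\<rfloor>\<bar> - threshold j"
    have k: "int (k + threshold j) = \<bar>\<lfloor>t\<rfloor>\<bar>" using j(1) by (simp add: k_def)
    have k': "real (k + threshold j) = of_int \<bar>\<lfloor>t\<rfloor>\<bar>" using k by (metis of_int_of_nat_eq)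
    have "\<lfloor>t\<rfloor> = int (k + threshold j) \<or> \<lfloor>t\<rfloor> = - int (k + threshold j)" using k by linarith
    moreover have "(t, x) \<in> exceed_at \<lfloor>t\<rfloor> (real (k + threshold j) / real (Suc j))"
      unfolding exceed_at_def k' using j(2) x by simp
    ultimately have "(t, x) \<in> exceed_at (int (k + threshold j)) (real (k + threshold j) / real (Suc j)) \<union>
            exceed_at (- int (k + threshold j)) (real (k + threshold j) / real (Suc j))"
      by (elim disjE) (simp_all only: Un_iff simp_thms)
    then show False using n0 unfolding tx by blast
  qed
next
  fix z assume "z \<in> ?E \<union> ?R"
  moreover obtain t x where tx: "z = (t, x)" by (cases z)
  ultimately consider "x \<in> space M" "\<bar>\<lfloor>t\<rfloor>\<bar> < int (threshold 0)"
    | j k where "(t, x) \<in> exceed_at (int (k + threshold j)) (real (k + threshold j) / real (Suc j))"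
    | j k where "(t, x) \<in> exceed_at (- int (k + threshold j)) (real (k + threshold j) / real (Suc j))"
    by blast
  then show "z \<in> tau_graph"
  proof cases
    case 1
    then show ?thesis by (simp add: tx tau_graph_def tau_def)
  next
    case (2 j k)
    then have "\<lfloor>t\<rfloor> = int (k + threshold j)" by (simp add: exceed_at_def floor_eq_iff)
    then show ?thesis using 2 by (auto simp: tx tau_graph_def tau_def exceed_at_def intro!: exI[of _ j])
  next
    case (3 j k)
    then have "\<lfloor>t\<rfloor> = - int (k + threshold j)" by (simp add: exceed_at_def floor_eq_iff)
    then show ?thesis using 3 by (auto simp: tx tau_graph_def tau_def exceed_at_def add.commute intro!: exI[of _ j])
  qed
qed

lemma early_sets: "{(t, x). x \<in> space M \<and> \<bar>\<lfloor>t\<rfloor>\<bar> < int (threshold 0)} \<in> sets (time_product M)"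
proof -
  have [measurable]: "fst \<in> time_product M \<rightarrow>\<^sub>M borel" by (rule measurable_fst_time_product)
  have fl: "\<bar>\<lfloor>t\<rfloor>\<bar> < int N \<longleftrightarrow> 1 - real N \<le> t \<and> t < real N" for t :: real and N :: nat
    by (auto simp: abs_less_iff floor_less_iff) linarith+
  have "{(t, x). x \<in> space M \<and> \<bar>\<lfloor>t\<rfloor>\<bar> < int (threshold 0)} =
      {z \<in> space (time_product M). 1 - real (threshold 0) \<le> fst z \<and> fst z < real (threshold 0)}"
    unfolding fl by (auto simp: space_time_product)
  also have "\<dots> \<in> sets (time_product M)" by measurable
  finally show ?thesis .
qed

lemma tau_graph_sets: "tau_graph \<in> sets (time_product M)"
  unfolding tau_graph_eq by (intro sets.Un early_sets sets.countable_UN'' exceed_at_sets) auto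

lemma emeasure_tau_graph: "emeasure (time_product M) tau_graph < \<infinity>"
proof -
  let ?E = "\<lambda>j k. exceed_at (int (k + threshold j)) (real (k + threshold j) / real (Suc j)) \<union>
            exceed_at (- int (k + threshold j)) (real (k + threshold j) / real (Suc j))"
  let ?R0 = "{(t, x). x \<in> space M \<and> \<bar>\<lfloor>t::real\<rfloor>\<bar> < int (threshold 0)}"
  have "emeasure (time_product M) ?R0 = (\<integral>\<^sup>+t. \<integral>\<^sup>+x. indicator ?R0 (t, x) \<partial>M \<partial>lborel)"
    using nn_integral_time_product(1)[of "indicator ?R0"] early_sets by simp
  also have "\<dots> \<le> (\<integral>\<^sup>+t. indicator {- real (threshold 0) - 1..real (threshold 0) + 1} t \<partial>lborel)"
  proof (rule nn_integral_mono)
    fix t :: real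
    have "indicator ?R0 (t, x) \<le> (indicator {- real (threshold 0) - 1..real (threshold 0) + 1} t :: ennreal)" for x
      by (auto simp: indicator_def) linarith+
    then have "(\<integral>\<^sup>+x. indicator ?R0 (t, x) \<partial>M) \<le> (\<integral>\<^sup>+x. indicator {- real (threshold 0) - 1..real (threshold 0) + 1} t \<partial>M)"
      by (intro nn_integral_mono)
    also have "\<dots> = indicator {- real (threshold 0) - 1..real (threshold 0) + 1} t" by (simp add: emeasure_space_1)
    finally show "(\<integral>\<^sup>+x. indicator ?R0 (t, x) \<partial>M) \<le> indicator {- real (threshold 0) - 1..real (threshold 0) + 1} t" .
  qed
  also have "\<dots> < \<infinity>" by simp
  finally have f0: "emeasure (time_product M) ?R0 < \<infinity>" .
  have Em: "?E j k \<in> sets (time_product M)" for j k by (intro sets.Un exceed_at_sets)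
  have "emeasure (time_product M) (\<Union>k. ?E j k) \<le> 2 * ennreal ((1/2) ^ j)" for j
  proof -
    have "emeasure (time_product M) (\<Union>k. ?E j k) \<le> (\<Sum>k. emeasure (time_product M) (?E j k))"
      using Em by (intro emeasure_subadditive_countably) auto
    \<comment> \<open>Each k stands for two integers, \<open>k + threshold j\<close> and its
      negative, and \<open>emeasure_exceed_at\<close> gives both pieces the same measure.\<close>
    also have "\<dots> \<le> (\<Sum>k. 2 * emeasure (time_product M) (exceed (real (k + threshold j) / real (Suc j))))"
    proof (intro suminf_le summableI)
      fix k
      have "emeasure (time_product M) (?E j k) \<le> emeasure (time_product M) (exceed_at (int (k + threshold j)) (real (k + threshold j) / real (Suc j)))
         + emeasure (time_product M) (exceed_at (- int (k + threshold j)) (real (k + threshold j) / real (Suc j)))"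
        by (intro emeasure_subadditive exceed_at_sets)
      then show "emeasure (time_product M) (?E j k) \<le> 2 * emeasure (time_product M) (exceed (real (k + threshold j) / real (Suc j)))"
        unfolding emeasure_exceed_at by (simp add: mult_2)
    qed
    also have "\<dots> = 2 * (\<Sum>k. emeasure (time_product M) (exceed (real (k + threshold j) / real (Suc j))))"
      by (rule ennreal_suminf_cmult)
    also have "\<dots> \<le> 2 * ennreal ((1/2) ^ j)" by (intro mult_left_mono threshold) simp
    finally show ?thesis .
  qed
  then have "(\<Sum>j. emeasure (time_product M) (\<Union>k. ?E j k)) \<le> (\<Sum>j. 2 * ennreal ((1/2) ^ j))"
    by (intro suminf_le summableI)
  also have "\<dots> = 2 * (\<Sum>j. ennreal ((1/2) ^ j))" by (rule ennreal_suminf_cmult)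
  also have "(\<Sum>j. ennreal ((1/2) ^ j)) = ennreal (\<Sum>j. (1/2) ^ j)" by (intro suminf_ennreal2) auto
  finally have "(\<Sum>j. emeasure (time_product M) (\<Union>k. ?E j k)) \<le> 2 * ennreal (\<Sum>j. (1/2) ^ j)" .
  moreover have "emeasure (time_product M) (\<Union>j. \<Union>k. ?E j k) \<le> (\<Sum>j. emeasure (time_product M) (\<Union>k. ?E j k))"
    using Em by (intro emeasure_subadditive_countably) auto
  ultimately have "emeasure (time_product M) (\<Union>j. \<Union>k. ?E j k) \<le> 2 * ennreal (\<Sum>j. (1/2) ^ j)" by (rule order.trans[rotated])
  also have "\<dots> < \<infinity>" by (simp add: ennreal_mult_less_top)
  finally have f1: "emeasure (time_product M) (\<Union>j. \<Union>k. ?E j k) < \<infinity>" .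
  have "emeasure (time_product M) tau_graph \<le> emeasure (time_product M) ?R0 + emeasure (time_product M) (\<Union>j. \<Union>k. ?E j k)"
    unfolding tau_graph_eq using Em by (intro emeasure_subadditive early_sets sets.countable_UN'') auto
  also have "\<dots> < \<infinity>" using f0 f1 by simp
  finally show ?thesis .
qed

lemma AE_tau_lmeasurable: "AE x in M. tau x \<in> lmeasurable"
proof -
  have s: "AE x in M. (\<lambda>t. indicator tau_graph (t, x) :: real) \<in> borel_measurable lebesgue"
    using sections_time_product(2)[of "indicator tau_graph"] tau_graph_sets by simp
  have "(\<integral>\<^sup>+z. indicator tau_graph z \<partial>time_product M) < \<infinity>" using emeasure_tau_graph tau_graph_sets by simp
  then have f: "AE x in M. (\<integral>\<^sup>+t. indicator tau_graph (t, x) \<partial>lborel) < \<infinity>"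
    using nn_integral_time_product(4)[of "indicator tau_graph"] tau_graph_sets by simp
  show ?thesis using s f AE_space
  proof eventually_elim
    case (elim x)
    have i: "indicator tau_graph (t, x) = (indicator (tau x) t :: 'b::zero_neq_one)" for t :: real
      using elim(3) by (simp add: tau_graph_def indicator_def)
    have m: "tau x \<in> sets lebesgue" using elim(1) unfolding i by (simp add: borel_measurable_indicator_iff)
    have "emeasure lebesgue (tau x) = (\<integral>\<^sup>+t. indicator (tau x) t \<partial>lebesgue)" using m by simp
    also have "\<dots> = (\<integral>\<^sup>+t. indicator (tau x) t \<partial>lborel)" by (rule nn_integral_completion)
    also have "\<dots> < \<infinity>" using elim(2) unfolding i .
    finally show ?case using m by (simp add: fmeasurable_def)
  qed
qed

text \<open>Given \<epsilon>, a level j with \<open>1 / real (Suc j) < \<epsilon>\<close> controls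
  all integers n with \<open>\<bar>n\<bar>\<close> at least \<open>threshold j\<close>. For the
  finitely many smaller ones the bound of level 0 holds outside \<open>tau x\<close> and is absorbed
  by the constant.\<close>

lemma tempered_off_tau: assumes x: "x \<in> space M" shows "tempered_off (\<lambda>t. A t x) (tau x)"
  unfolding tempered_off_def
proof (intro allI impI)
  fix \<epsilon> :: real assume \<epsilon>: "0 < \<epsilon>"
  then obtain j where j: "1 / real (Suc j) < \<epsilon>" using nat_approx_posE by blast
  define K where "K = real (threshold j) + 1"
  have main: "g (t - of_int \<lfloor>t\<rfloor>) (T (of_int \<lfloor>t\<rfloor>) x) \<le> (K + \<epsilon>) + \<epsilon> * \<bar>t\<bar>" if t: "t \<notin> tau x" for t
  proof -
    define n where "n = \<lfloor>t\<rfloor>"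
    have nt: "of_int \<bar>n\<bar> \<le> \<bar>t\<bar> + 1" unfolding n_def by linarith
    have b: "g (t - of_int n) (T (of_int n) x) \<le> of_int \<bar>n\<bar> / real (Suc i)" if "int (threshold i) \<le> \<bar>n\<bar>" for i
      using t that unfolding tau_def n_def by (auto simp: not_less)
    show ?thesis
    proof (cases "int (threshold j) \<le> \<bar>n\<bar>")
      case True
      have "of_int \<bar>n\<bar> / real (Suc j) = (1 / real (Suc j)) * of_int \<bar>n\<bar>" by simp
      also have "\<dots> \<le> \<epsilon> * (\<bar>t\<bar> + 1)" using j nt \<epsilon> by (intro mult_mono) auto
      finally show ?thesis using b[OF True] by (simp add: n_def[symmetric] K_def distrib_left)
    next
      case False
      have "int (threshold 0) \<le> \<bar>n\<bar>" using t unfolding tau_def n_def by (auto simp: not_less)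
      from b[OF this] have "g (t - of_int n) (T (of_int n) x) \<le> of_int \<bar>n\<bar>" by simp
      also have "\<dots> \<le> K" using False by (simp add: K_def not_le)
      finally show ?thesis using \<epsilon> by (simp add: n_def[symmetric] add_increasing2)
    qed
  qed
  show "\<exists>K. \<forall>t. t \<notin> tau x \<longrightarrow> mat_norm (A t x ** matrix_inv (A (of_int \<lfloor>t\<rfloor>) x)) \<le> exp (K + \<epsilon> * \<bar>t\<bar>) \<and>
     mat_norm (A (of_int \<lfloor>t\<rfloor>) x ** matrix_inv (A t x)) \<le> exp (K + \<epsilon> * \<bar>t\<bar>)"
  proof (intro exI[of _ "K + \<epsilon>"] allI impI)
    fix t assume t: "t \<notin> tau x"
    let ?n = "of_int \<lfloor>t\<rfloor> :: real"
    let ?H = "A (t - ?n) (T ?n x)"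
    have H: "A t x ** matrix_inv (A ?n x) = ?H" using A_shift[OF x] by simp
    have inv: "invertible (matrix_inv (A ?n x))"
      using invertible_matrix_inv[OF A_invertible[OF x, of ?n]] unfolding invertible_def by blast
    have "matrix_inv ?H = matrix_inv (matrix_inv (A ?n x)) ** matrix_inv (A t x)"
      unfolding H[symmetric] by (rule matrix_inv_mult[OF A_invertible[OF x] inv])
    also have "matrix_inv (matrix_inv (A ?n x)) = A ?n x"
      by (rule matrix_inv_unique'[OF invertible_matrix_inv(2,1)[OF A_invertible[OF x]]])
    finally have H': "A ?n x ** matrix_inv (A t x) = matrix_inv ?H" by simp
    have "log_size ?H \<le> (K + \<epsilon>) + \<epsilon> * \<bar>t\<bar>" using main[OF t] by (simp add: g_def)
    then show "mat_norm (A t x ** matrix_inv (A ?n x)) \<le> exp ((K + \<epsilon>) + \<epsilon> * \<bar>t\<bar>) \<and>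
       mat_norm (A ?n x ** matrix_inv (A t x)) \<le> exp ((K + \<epsilon>) + \<epsilon> * \<bar>t\<bar>)"
      unfolding H H' using mat_norm_le_log_size[of ?H] by (meson exp_le_cancel_iff order.trans)
  qed
qed

end

text \<open>\<open>density_zero\<close> asks for a Borel subset of the half-line. So \<tau> is
  enlarged to a Borel set of the same measure; the union with the reflected set serves both time
  directions. The density vanishes because a finite measure is divided by t.\<close>

lemma dominating_density_zero:
  assumes "\<tau> \<in> lmeasurable"
  obtains \<sigma> where "density_zero \<sigma>" "off at_top \<sigma> \<le> off at_top \<tau>"
    "filterlim uminus (off at_bot \<tau>) (off at_top \<sigma>)"
proof -
  obtain H where H [measurable]: "H \<in> sets borel" and sub: "\<tau> \<subseteq> H" and H': "emeasure lebesgue \<tau> = emeasure lborel H"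
    using completion_upper[of \<tau> lborel] assms by (auto simp: fmeasurable_def)
  have fin: "H \<in> fmeasurable lborel" using assms H H' by (simp add: fmeasurable_def)
  define H2 where "H2 = uminus -` H"
  have H2 [measurable]: "H2 \<in> sets borel"
    using measurable_sets_borel[of uminus borel H] unfolding H2_def by simp
  have "emeasure lborel H2 = emeasure (distr lborel borel uminus) H"
    by (subst emeasure_distr) (auto simp: H2_def)
  then have fin2: "H2 \<in> fmeasurable lborel" using fin H2 by (simp add: fmeasurable_def lborel_distr_uminus)
  define S where "S = H \<union> H2"
  have S: "S \<in> fmeasurable lborel" unfolding S_def using fin fin2 by (rule fmeasurable.Un)
  then have Sb [measurable]: "S \<in> sets borel" by (auto dest: fmeasurableD)
  define \<sigma> where "\<sigma> = S \<inter> {0..}"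
  have \<sigma>b [measurable]: "\<sigma> \<in> sets borel" unfolding \<sigma>_def by measurable
  show thesis
  proof (rule that[of \<sigma>])
    have le: "measure lborel (\<sigma> \<inter> {0..t}) / t \<le> measure lborel S / t" if "0 < t" for t
      using that S by (intro divide_right_mono measure_mono_fmeasurable) (auto simp: \<sigma>_def)
    have "((\<lambda>t. measure lborel (\<sigma> \<inter> {0..t}) / t) \<longlongrightarrow> 0) at_top"
    proof (rule tendsto_sandwich[of "\<lambda>_. 0" _ _ "\<lambda>t. measure lborel S / t"])
      show "\<forall>\<^sub>F t in at_top. 0 \<le> measure lborel (\<sigma> \<inter> {0..t}) / t"
        using eventually_gt_at_top[of 0] by eventually_elim simp
      show "\<forall>\<^sub>F t in at_top. measure lborel (\<sigma> \<inter> {0..t}) / t \<le> measure lborel S / t"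
        using eventually_gt_at_top[of 0] by eventually_elim (rule le)
      show "((\<lambda>t. measure lborel S / t) \<longlongrightarrow> 0) at_top"
        by (intro tendsto_divide_0[OF tendsto_const] filterlim_at_top_imp_at_infinity filterlim_ident)
    qed simp
    then have "((\<lambda>t. ereal (measure lborel (\<sigma> \<inter> {0..t}) / t)) \<longlongrightarrow> ereal 0) at_top" by simp
    then have "Limsup at_top (\<lambda>t. ereal (measure lborel (\<sigma> \<inter> {0..t}) / t)) = ereal 0"
      by (intro lim_imp_Limsup) auto
    then show "density_zero \<sigma>" unfolding density_zero_def upper_density_def by (simp add: \<sigma>_def)
    show "off at_top \<sigma> \<le> off at_top \<tau>"
    proof (rule filter_leI)
      fix P :: "real \<Rightarrow> bool" assume "eventually P (off at_top \<tau>)"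
      then obtain N where N: "\<And>t. t \<ge> N \<Longrightarrow> t \<notin> \<tau> \<Longrightarrow> P t" unfolding eventually_off_at_top by blast
      show "eventually P (off at_top \<sigma>)" unfolding eventually_off_at_top
        by (rule exI[of _ "max N 0"]) (use N sub in \<open>auto simp: \<sigma>_def S_def\<close>)
    qed
    show "filterlim uminus (off at_bot \<tau>) (off at_top \<sigma>)"
      unfolding filterlim_iff
    proof (intro allI impI)
      fix P :: "real \<Rightarrow> bool" assume "eventually P (off at_bot \<tau>)"
      then obtain N where N: "\<And>t. t \<le> N \<Longrightarrow> t \<notin> \<tau> \<Longrightarrow> P t" unfolding eventually_off_at_bot by blast
      show "\<forall>\<^sub>F t in off at_top \<sigma>. P (- t)" unfolding eventually_off_at_top
      proof (intro exI[of _ "max (- N) 0"] allI impI)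
        fix t assume t: "max (- N) 0 \<le> t" "t \<notin> \<sigma>"
        then have "- t \<notin> \<tau>" using sub by (auto simp: \<sigma>_def S_def H2_def)
        then show "P (- t)" using N t(1) by simp
      qed
    qed
  qed
qed

lemma dlimI:
  assumes "\<tau> \<in> lmeasurable"
  shows "(f \<longlongrightarrow> l) (off at_top \<tau>) \<Longrightarrow> dlim_at_top f l"
    and "(f \<longlongrightarrow> l) (off at_bot \<tau>) \<Longrightarrow> dlim_at_bot f l"
    and "uniform_limit S h l' (off at_top \<tau>) \<Longrightarrow> unif_dlim_at_top S h l'"
    and "uniform_limit S h l' (off at_bot \<tau>) \<Longrightarrow> unif_dlim_at_bot S h l'"
proof -
  obtain \<sigma> where \<sigma>: "density_zero \<sigma>" "off at_top \<sigma> \<le> off at_top \<tau>" "filterlim uminus (off at_bot \<tau>) (off at_top \<sigma>)"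
    using dominating_density_zero[OF assms] by blast
  show "(f \<longlongrightarrow> l) (off at_top \<tau>) \<Longrightarrow> dlim_at_top f l"
    unfolding dlim_at_top_def using \<sigma>(1) tendsto_mono[OF \<sigma>(2)] by blast
  show "(f \<longlongrightarrow> l) (off at_bot \<tau>) \<Longrightarrow> dlim_at_bot f l"
    unfolding dlim_at_bot_def dlim_at_top_def using \<sigma>(1) filterlim_compose[OF _ \<sigma>(3)] by blast
  show "uniform_limit S h l' (off at_top \<tau>) \<Longrightarrow> unif_dlim_at_top S h l'"
    unfolding unif_dlim_at_top_def using \<sigma>(1) filterlim_mono[OF _ order_refl \<sigma>(2)] by blast
  show "uniform_limit S h l' (off at_bot \<tau>) \<Longrightarrow> unif_dlim_at_bot S h l'"
    unfolding unif_dlim_at_bot_def unif_dlim_at_top_def using \<sigma>(1) filterlim_compose[OF _ \<sigma>(3)] by blast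
qed

section \<open>Equivariance of the splitting under all real times\<close>

context met_flow
begin

text \<open>The integer-time cocycles at x and at \<open>T s x\<close> are related by the matrices
  \<open>A s\<close> along the orbit. When these are subexponential, together with their inverses,
  \<open>A s x\<close> maps slow spaces to slow spaces of the same level.\<close>

definition tame :: "real \<Rightarrow> 'x \<Rightarrow> bool" where
  "tame s x \<longleftrightarrow> (\<forall>\<epsilon>>0. \<exists>K. \<forall>n::int. g s (T (of_int n) x) \<le> K + \<epsilon> * of_int \<bar>n\<bar>)"

text \<open>A countable form of the condition, for joint measurability in s and x.\<close>

lemma tame_iff: "tame s x \<longleftrightarrow> (\<forall>i::nat. \<exists>K::nat. \<forall>n::int. g s (T (of_int n) x) \<le> real K + 1 / real (Suc i) * of_int \<bar>n\<bar>)"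
proof
  assume L: "tame s x"
  show "\<forall>i::nat. \<exists>K::nat. \<forall>n::int. g s (T (of_int n) x) \<le> real K + 1 / real (Suc i) * of_int \<bar>n\<bar>"
  proof
    fix i :: nat
    obtain K where K: "\<And>n::int. g s (T (of_int n) x) \<le> K + 1 / real (Suc i) * of_int \<bar>n\<bar>"
      using L unfolding tame_def by (metis of_nat_0_less_iff zero_less_Suc zero_less_divide_1_iff)
    obtain N :: nat where "K \<le> real N" using real_arch_simple by blast
    then have "\<forall>n::int. g s (T (of_int n) x) \<le> real N + 1 / real (Suc i) * of_int \<bar>n\<bar>"
      by (intro allI order.trans[OF K] add_right_mono)
    then show "\<exists>K::nat. \<forall>n::int. g s (T (of_int n) x) \<le> real K + 1 / real (Suc i) * of_int \<bar>n\<bar>" by blast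
  qed
next
  assume R: "\<forall>i::nat. \<exists>K::nat. \<forall>n::int. g s (T (of_int n) x) \<le> real K + 1 / real (Suc i) * of_int \<bar>n\<bar>"
  show "tame s x" unfolding tame_def
  proof (intro allI impI)
    fix \<epsilon> :: real assume "0 < \<epsilon>"
    then obtain i where i: "1 / real (Suc i) < \<epsilon>" using nat_approx_posE by blast
    obtain K :: nat where K: "\<And>n::int. g s (T (of_int n) x) \<le> real K + 1 / real (Suc i) * of_int \<bar>n\<bar>" using R by blast
    have "\<forall>n::int. g s (T (of_int n) x) \<le> real K + \<epsilon> * of_int \<bar>n\<bar>"
      using i by (intro allI order.trans[OF K] add_left_mono mult_right_mono) auto
    then show "\<exists>K. \<forall>n::int. g s (T (of_int n) x) \<le> K + \<epsilon> * of_int \<bar>n\<bar>" by blast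
  qed
qed

lemma AE_tame: "AE x in M. tame s x"
proof -
  interpret r: lin_cocycle M "\<lambda>n::int. T (of_int (- n))" "\<lambda>n. A (of_int (- n))" "\<lambda>x. g 1 (T (of_int (- 1)) x)"
    by (rule disc.rev_cocycle)
  show ?thesis
    using disc.fwd.tempered_integrable[OF g_integrable[of s]] r.fwd.tempered_integrable[OF g_integrable[of s]]
  proof eventually_elim
    case (elim x)
    show ?case unfolding tame_def
    proof (intro allI impI)
      fix \<epsilon> :: real assume \<epsilon>: "0 < \<epsilon>"
      obtain K where K: "\<And>n::nat. g s (T (of_int (int n)) x) \<le> K + \<epsilon> * real n" using elim(1) \<epsilon> by blast
      obtain L where L: "\<And>n::nat. g s (T (of_int (- int n)) x) \<le> L + \<epsilon> * real n" using elim(2) \<epsilon> by blast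
      have "g s (T (of_int n) x) \<le> max K L + \<epsilon> * of_int \<bar>n\<bar>" for n
      proof (cases n rule: int_cases2)
        case (nonneg k) then show ?thesis using K[of k] by simp
      next
        case (nonpos k) then show ?thesis using L[of k] by simp
      qed
      then show "\<exists>K. \<forall>n::int. g s (T (of_int n) x) \<le> K + \<epsilon> * of_int \<bar>n\<bar>" by blast
    qed
  qed
qed

text \<open>For each s almost every x is tame, with a null set that depends on s; Fubini on the
  completed product exchanges the two quantifiers.\<close>

lemma AE_AE_tame: "AE x in M. AE s in lborel. tame s x"
proof -
  define N where "N = {z \<in> space (time_product M). \<not> tame (fst z) (snd z)}"
  have [measurable]: "(\<lambda>z. g (fst z) (T (of_int n) (snd z))) \<in> borel_measurable (time_product M)" for n :: int
    using measurable_compose[OF measurable_time_product_map[OF T_measurable T_pres, of "of_int n"] g_joint]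
    by (simp add: split_def)
  have N: "N \<in> sets (time_product M)" unfolding N_def tame_iff by measurable
  have "emeasure (time_product M) N = (\<integral>\<^sup>+z. indicator N z \<partial>time_product M)" using N by simp
  also have "\<dots> = (\<integral>\<^sup>+s. \<integral>\<^sup>+x. indicator N (s, x) \<partial>M \<partial>lborel)"
    using N by (intro nn_integral_time_product(1)) simp
  also have "\<dots> = (\<integral>\<^sup>+s. 0 \<partial>(lborel :: real measure))"
  proof (rule nn_integral_cong)
    fix s :: real
    have "(\<integral>\<^sup>+x. indicator N (s, x) \<partial>M) = (\<integral>\<^sup>+x. 0 \<partial>M :: ennreal)"
      by (rule nn_integral_cong_AE) (use AE_tame[of s] in eventually_elim, simp add: N_def)
    then show "(\<integral>\<^sup>+x. indicator N (s, x) \<partial>M) = (0 :: ennreal)" by simp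
  qed
  finally have "N \<in> null_sets (time_product M)" using N by (simp add: null_sets_def)
  from AE_time_product_snd[OF AE_not_in[OF this]] AE_space show ?thesis
  proof eventually_elim
    case (elim x)
    from elim(1) show ?case
      by eventually_elim (use elim(2) in \<open>simp add: N_def space_time_product\<close>)
  qed
qed

lemma tame_neg: assumes x: "x \<in> space M" and t: "tame s x" shows "tame (- s) (T s x)"
proof -
  have "g (- s) (T (of_int n) (T s x)) = g s (T (of_int n) x)" for n :: int
    using g_neg[of "T (of_int n) x" s] x Tadd[OF x, of s "of_int n"] Tadd[OF x, of "of_int n" s] by (simp add: add.commute)
  then show ?thesis using t by (simp add: tame_def)
qed

text \<open>With h the identity or the negation this covers forward and backward slow spaces at
  once.\<close>

lemma tame_slow:
  assumes x: "x \<in> space M" and t: "tame s x" and h: "\<And>n. \<bar>h n\<bar> = \<bar>n\<bar>"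
    and v: "v \<in> slow (\<lambda>n. A (of_int (h n))) c x"
  shows "A s x *v v \<in> slow (\<lambda>n. A (of_int (h n))) c (T s x)"
  unfolding slow_def mem_Collect_eq
proof (intro allI impI)
  fix \<epsilon> :: real assume "0 < \<epsilon>"
  then have \<epsilon>: "0 < \<epsilon> / 2" by simp
  obtain K where K: "\<And>n::int. g s (T (of_int n) x) \<le> K + \<epsilon> / 2 * of_int \<bar>n\<bar>" using t \<epsilon> unfolding tame_def by blast
  obtain L where L: "\<And>n::nat. norm (A (of_int (h (int n))) x *v v) \<le> L * exp ((c + \<epsilon> / 2) * real n)"
    using slowD[OF v \<epsilon>] by blast
  have "norm (A (of_int (h (int n))) (T s x) *v (A s x *v v)) \<le> exp K * L * exp ((c + \<epsilon>) * real n)" for n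
  proof -
    let ?m = "of_int (h (int n)) :: real"
    have "A ?m (T s x) ** A s x = A s (T ?m x) ** A ?m x"
      using Aadd[OF x, of s ?m] Aadd[OF x, of ?m s] by (simp add: add.commute)
    then have "A ?m (T s x) *v (A s x *v v) = A s (T ?m x) *v (A ?m x *v v)"
      by (simp add: matrix_vector_mul_assoc)
    then have "norm (A ?m (T s x) *v (A s x *v v)) \<le> mat_norm (A s (T ?m x)) * norm (A ?m x *v v)"
      by (simp add: mat_norm_bound)
    also have "\<dots> \<le> exp (K + \<epsilon> / 2 * real n) * (L * exp ((c + \<epsilon> / 2) * real n))"
    proof (rule mult_mono)
      have "mat_norm (A s (T ?m x)) \<le> exp (g s (T ?m x))" unfolding g_def by (rule mat_norm_le_log_size)
      also have "\<dots> \<le> exp (K + \<epsilon> / 2 * real n)" using K[of "h (int n)"] by (simp add: h)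
      finally show "mat_norm (A s (T ?m x)) \<le> exp (K + \<epsilon> / 2 * real n)" .
    qed (use L in auto)
    also have "\<dots> = exp K * L * exp (\<epsilon> / 2 * real n + (c + \<epsilon> / 2) * real n)"
      by (simp only: exp_add mult.assoc mult.left_commute)
    also have "\<epsilon> / 2 * real n + (c + \<epsilon> / 2) * real n = (c + \<epsilon>) * real n" by (simp add: field_simps)
    finally show ?thesis .
  qed
  then show "\<exists>K. \<forall>n::nat. norm (A (of_int (h (int n))) (T s x) *v (A s x *v v)) \<le> K * exp ((c + \<epsilon>) * real n)" by blast
qed

lemma A_inv_apply: "x \<in> space M \<Longrightarrow> A (- s) (T s x) *v (A s x *v v) = v"
  "x \<in> space M \<Longrightarrow> A s x *v (A (- s) (T s x) *v v) = v"
  by (simp_all add: A_neg matrix_vector_mul_assoc invertible_matrix_inv A_invertible)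

lemma tame_oseledets:
  assumes x: "x \<in> space M" and t: "tame s x"
  shows "disc.oseledets (T s x) c = (*v) (A s x) ` disc.oseledets x c"
proof -
  have h: "\<bar>n\<bar> = \<bar>n\<bar>" "\<bar>- n\<bar> = \<bar>n\<bar>" for n :: int by auto
  have fwd: "A s x *v v \<in> disc.oseledets (T s x) c" if "x \<in> space M" "tame s x" "v \<in> disc.oseledets x c" for s x v
    using that tame_slow[OF that(1,2) h(1), of v c] tame_slow[OF that(1,2) h(2), of v "- c"]
    unfolding disc.oseledets_def by simp
  have "w \<in> (*v) (A s x) ` disc.oseledets x c" if w: "w \<in> disc.oseledets (T s x) c" for w
  proof -
    have "A (- s) (T s x) *v w \<in> disc.oseledets (T (- s) (T s x)) c"
      by (rule fwd[OF T_in_space[OF x] tame_neg[OF x t] w])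
    then have "A (- s) (T s x) *v w \<in> disc.oseledets x c" using x by simp
    then show ?thesis using A_inv_apply(2)[OF x, of s w] by (metis image_eqI)
  qed
  then show ?thesis using fwd[OF x t] by blast
qed

text \<open>The discrete-time splitting is equivariant only under almost every real time; it agrees almost
  everywhere with the following one, which is equivariant under all times.\<close>
definition covariant :: "'x \<Rightarrow> (real \<Rightarrow> (real^'m) set) \<Rightarrow> bool" where
  "covariant x W \<longleftrightarrow> (AE s in lborel. \<forall>c. disc.oseledets (T s x) c = (*v) (A s x) ` W c)"

definition field :: "'x \<Rightarrow> real \<Rightarrow> (real^'m) set" where
  "field x = (THE W. covariant x W)"

lemma inj_A: "x \<in> space M \<Longrightarrow> inj ((*v) (A s x))"
  by (intro inj_matrix_vector_mult A_invertible)

text \<open>A single time s common to both conditions determines W, because \<open>A s x\<close> is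
  injective.\<close>

lemma covariant_unique:
  assumes x: "x \<in> space M" and W: "covariant x W" "covariant x W'"
  shows "W = W'"
proof -
  have "AE s in lborel. (\<forall>c. disc.oseledets (T s x) c = (*v) (A s x) ` W c) \<and> (\<forall>c. disc.oseledets (T s x) c = (*v) (A s x) ` W' c)"
    using W unfolding covariant_def by (rule AE_conjI)
  from AE_lborel_ex[OF this] obtain s
    where s: "\<And>c. disc.oseledets (T s x) c = (*v) (A s x) ` W c" "\<And>c. disc.oseledets (T s x) c = (*v) (A s x) ` W' c"
    by blast
  show ?thesis
  proof
    fix c
    have "(*v) (A s x) ` W c = (*v) (A s x) ` W' c" using s[of c] by simp
    then show "W c = W' c" unfolding inj_image_eq_iff[OF inj_A[OF x, of s]] .
  qed
qed

lemma field_eqI: "x \<in> space M \<Longrightarrow> covariant x W \<Longrightarrow> field x = W"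
  unfolding field_def by (rule the_equality) (auto intro: covariant_unique)

lemma AE_covariant: "AE x in M. covariant x (disc.oseledets x)"
  using AE_AE_tame AE_space
proof eventually_elim
  case (elim x)
  from elim(1) show ?case unfolding covariant_def
    by eventually_elim (use tame_oseledets[OF elim(2)] in blast)
qed

text \<open>\<open>covariant\<close> ignores null sets of times and is therefore stable under
  translation of time by any r; uniqueness at \<open>T r x\<close> then gives an equality for every
  r.\<close>

lemma field_shift:
  assumes x: "x \<in> space M" and W: "covariant x W"
  shows "field (T r x) = (\<lambda>c. (*v) (A r x) ` field x c)"
proof -
  have "AE s in distr lborel borel ((+) r). \<forall>c. disc.oseledets (T s x) c = (*v) (A s x) ` W c"
    using W unfolding covariant_def by (simp only: lborel_distr_plus)
  then have ae: "AE s in lborel. \<forall>c. disc.oseledets (T (r + s) x) c = (*v) (A (r + s) x) ` W c"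
    by (rule AE_distrD[rotated]) simp
  have "T (r + s) x = T s (T r x)" for s using Tadd[OF x, of s r] by (simp add: add.commute)
  moreover have "(*v) (A (r + s) x) ` S = (*v) (A s (T r x)) ` (*v) (A r x) ` S" for s S
    unfolding Aadd[OF x] image_image by (simp add: matrix_vector_mul_assoc)
  ultimately have "covariant (T r x) (\<lambda>c. (*v) (A r x) ` W c)" using ae unfolding covariant_def by simp
  then show ?thesis using field_eqI[OF x W] field_eqI[OF T_in_space[OF x]] by simp
qed

section \<open>Exponents, summands and the limit matrix as functions of the point\<close>

definition exps :: "'x \<Rightarrow> real set" where "exps x = {c. field x c \<noteq> {0}}"
definition count :: "'x \<Rightarrow> nat" where "count x = card (exps x)"
definition lyap :: "nat \<Rightarrow> 'x \<Rightarrow> real" where "lyap i x = nth_smallest (exps x) i"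
definition U :: "nat \<Rightarrow> 'x \<Rightarrow> (real^'m) set" where "U i x = field x (lyap i x)"

text \<open>All objects are defined through \<open>field\<close>, so \<open>field_shift\<close>
  yields their behaviour under every t from \<open>covariant\<close> at the single point x.\<close>

lemma invariance:
  assumes x: "x \<in> space M" and W: "covariant x W"
  shows "exps (T t x) = exps x" "U i (T t x) = (*v) (A t x) ` U i x" "dim (U i (T t x)) = dim (U i x)"
proof -
  have "(*v) (A t x) ` S = {0} \<longleftrightarrow> S = {0}" for S
    using inj_image_eq_iff[OF inj_A[OF x, of t], of S "{0}"] by simp
  then show e: "exps (T t x) = exps x" unfolding exps_def field_shift[OF x W] by simp
  show u: "U i (T t x) = (*v) (A t x) ` U i x" unfolding U_def lyap_def e field_shift[OF x W] ..
  show "dim (U i (T t x)) = dim (U i x)" unfolding u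
    by (intro dim_image_eq inj_on_subset[OF inj_A[OF x]] matrix_vector_mul_linear) auto
qed

definition splitting_at :: "'x \<Rightarrow> real^'m^'m \<Rightarrow> real^'m \<Rightarrow> bool" where
  "splitting_at x Q a \<longleftrightarrow> splitting (\<lambda>c. slow (\<lambda>n. A (of_int n)) c x) (\<lambda>c. slow disc.dual_C c x)
     (\<lambda>c. slow disc.rev_C (- c) x) Q a"

text \<open>By \<open>frame_conj_unique\<close> the matrix is the same for all frames that can be
  chosen here.\<close>

definition lim_root :: "'x \<Rightarrow> real^'m^'m" where
  "lim_root x = (SOME L. \<exists>Q a. splitting_at x Q a \<and> L = Q ** diag_mat (\<chi> i. exp (a $ i)) ** transpose Q)"

definition good :: "'x \<Rightarrow> bool" where
  "good x \<longleftrightarrow> disc.regular x \<and> covariant x (disc.oseledets x) \<and> tau x \<in> lmeasurable"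

lemma AE_good: "AE x in M. good x"
  using disc.AE_regular AE_covariant AE_tau_lmeasurable by eventually_elim (simp add: good_def)

lemma good_space: "good x \<Longrightarrow> x \<in> space M" by (simp add: good_def disc.regular_def)

lemma good_field: "good x \<Longrightarrow> field x = disc.oseledets x"
  using good_space[of x] field_eqI[of x "disc.oseledets x"] by (simp add: good_def)

lemma splitting_at_facts:
  assumes g: "good x" and s: "splitting_at x Q a"
  shows "exps x = splitting.exponents a"
    "field x = splitting.V (\<lambda>c. slow (\<lambda>n. A (of_int n)) c x) (\<lambda>c. slow disc.rev_C (- c) x)"
proof -
  interpret splitting "\<lambda>c. slow (\<lambda>n. A (of_int n)) c x" "\<lambda>c. slow disc.dual_C c x" "\<lambda>c. slow disc.rev_C (- c) x" Q a
    using s unfolding splitting_at_def .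
  show f: "field x = V" unfolding good_field[OF g] disc.oseledets_def V_def ..
  show "exps x = exponents" unfolding exps_def f by (rule exponents_eq)
qed

lemma good_splitting:
  assumes g: "good x"
  obtains Q a where "splitting_at x Q a" "lim_root x = Q ** diag_mat (\<chi> i. exp (a $ i)) ** transpose Q"
proof -
  have "\<exists>L Q a. splitting_at x Q a \<and> L = Q ** diag_mat (\<chi> i. exp (a $ i)) ** transpose Q"
    using g unfolding good_def disc.regular_def splitting_at_def by blast
  from someI_ex[OF this] that show thesis unfolding lim_root_def by blast
qed

lemma good_structure:
  assumes g: "good x"
  shows "direct_sum_decomp {1..count x} (\<lambda>i. U i x)"
    "eigenvalues_with_mult (lim_root x) {1..count x} (\<lambda>i. exp (lyap i x)) (\<lambda>i. dim (U i x))"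
    "(cocycle_root A x \<longlongrightarrow> lim_root x) (off at_top (tau x))"
proof -
  obtain Q a where s: "splitting_at x Q a" and L: "lim_root x = Q ** diag_mat (\<chi> i. exp (a $ i)) ** transpose Q"
    using good_splitting[OF g] by blast
  note x = good_space[OF g]
  interpret splitting "\<lambda>c. slow (\<lambda>n. A (of_int n)) c x" "\<lambda>c. slow disc.dual_C c x" "\<lambda>c. slow disc.rev_C (- c) x" Q a
    using s unfolding splitting_at_def .
  note f = splitting_at_facts[OF g s]
  show "direct_sum_decomp {1..count x} (\<lambda>i. U i x)"
    unfolding count_def U_def lyap_def f by (rule direct_sum_decomp_V)
  show "eigenvalues_with_mult (lim_root x) {1..count x} (\<lambda>i. exp (lyap i x)) (\<lambda>i. dim (U i x))"
    unfolding count_def U_def lyap_def f L by (rule eigenvalues_with_mult_V)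
  show "(cocycle_root A x \<longlongrightarrow> lim_root x) (off at_top (tau x))"
    unfolding L cocycle_root_def[abs_def]
  proof (rule root_tendsto[OF frame_Qa])
    show "transpose (transpose (matrix_inv (A t x))) ** A t x = mat 1" for t
      by (simp add: invertible_matrix_inv A_invertible x)
    note bd = disc.regular_slow_bound[of x "\<lambda>t. A t x", OF x A_invertible[OF x] refl tempered_off_tau[OF x]]
    show "\<exists>K. \<forall>t\<ge>1. t \<notin> tau x \<longrightarrow> (\<forall>v\<in>slow (\<lambda>n. A (of_int n)) c x. norm (A t x *v v) \<le> K * exp ((c + \<epsilon>) * t) * norm v)"
      if "0 < \<epsilon>" for c \<epsilon> by (rule bd(1)[OF that])
    show "\<exists>K. \<forall>t\<ge>1. t \<notin> tau x \<longrightarrow> (\<forall>v\<in>slow disc.dual_C c x. norm (transpose (matrix_inv (A t x)) *v v) \<le> K * exp ((c + \<epsilon>) * t) * norm v)"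
      if "0 < \<epsilon>" for c \<epsilon> by (rule bd(2)[OF that])
  qed
qed

lemma good_growth:
  assumes g: "good x"
  shows "uniform_limit {v \<in> U i x. norm v = 1} (growth_rate A x) (\<lambda>_. lyap i x) (off at_top (tau x))"
    and "uniform_limit {v \<in> U i x. norm v = 1} (growth_rate A x) (\<lambda>_. - lyap i x) (off at_bot (tau x))"
    and "v \<in> U i x - {0} \<Longrightarrow> ((\<lambda>t. growth_rate A x t v) \<longlongrightarrow> lyap i x) (off at_top (tau x))"
    and "v \<in> U i x - {0} \<Longrightarrow> ((\<lambda>t. growth_rate A x t v) \<longlongrightarrow> - lyap i x) (off at_bot (tau x))"
proof -
  note x = good_space[OF g]
  have reg: "disc.regular x" using g by (simp add: good_def)
  note sp = disc.regular_splitting[OF reg, where B = "\<lambda>t. A t x" and \<tau> = "tau x" and \<kappa> = "lyap i x", OF A_invertible[OF x] refl tempered_off_tau[OF x]]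
  show "uniform_limit {v \<in> U i x. norm v = 1} (growth_rate A x) (\<lambda>_. lyap i x) (off at_top (tau x))"
    "uniform_limit {v \<in> U i x. norm v = 1} (growth_rate A x) (\<lambda>_. - lyap i x) (off at_bot (tau x))"
    "v \<in> U i x - {0} \<Longrightarrow> ((\<lambda>t. growth_rate A x t v) \<longlongrightarrow> lyap i x) (off at_top (tau x))"
    "v \<in> U i x - {0} \<Longrightarrow> ((\<lambda>t. growth_rate A x t v) \<longlongrightarrow> - lyap i x) (off at_bot (tau x))"
    unfolding U_def good_field[OF g] growth_rate_def[abs_def] by (rule sp; assumption)+
qed

text \<open>At good points the number of exponents and the summands are expressed by slow spaces at
  rational levels, whose measurability is known. The other points form a null set, which
  completeness of M removes through \<open>in_sets_AE\<close>.\<close>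

lemma measurable_splitting_U: "measurable_splitting M count U"
proof -
  interpret r: lin_cocycle M "\<lambda>n::int. T (of_int (- n))" "\<lambda>n. A (of_int (- n))" "\<lambda>x. g 1 (T (of_int (- 1)) x)"
    by (rule disc.rev_cocycle)
  let ?E = "\<lambda>q. slow (\<lambda>n. A (of_int n)) q" and ?F = "\<lambda>q. slow disc.rev_C (- q)"
  have mE: "mfield M (?E q)" for q by (rule disc.mfield_slow)
  have mF: "mfield M (?F q)" for q by (rule r.mfield_slow)
  have mEF: "mfield M (\<lambda>x. ?E q x \<inter> ?F r x)" for q r by (intro mfield_Int subspace_slow mE mF)
  have [measurable]: "(\<lambda>x. dim (?E q x)) \<in> M \<rightarrow>\<^sub>M count_space UNIV" for q
    by (rule mfield_dim[OF subspace_slow mE])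
  have [measurable]: "(\<lambda>x. dim (?E q x \<inter> ?F r x)) \<in> M \<rightarrow>\<^sub>M count_space UNIV" for q r
    by (rule mfield_dim[OF subspace_inter[OF subspace_slow subspace_slow] mEF])
  define rk where "rk r x = card {n \<in> {1..dim (?E r x)}. \<exists>q\<in>\<rat>. dim (?E q x) = n}" for r x
  have [measurable]: "Measurable.pred M (\<lambda>x. \<exists>q\<in>\<rat>. dim (?E q x) = n)" for n
  proof -
    have "{x \<in> space M. \<exists>q\<in>\<rat>. dim (?E q x) = n} = (\<Union>q\<in>\<rat>. {x \<in> space M. dim (?E q x) = n})" by auto
    also have "\<dots> \<in> sets M" by (intro sets.countable_UN'' countable_rat) measurable
    finally show ?thesis unfolding pred_def .
  qed
  have [measurable]: "rk r \<in> M \<rightarrow>\<^sub>M count_space UNIV" for r unfolding rk_def[abs_def] by measurable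
  have [measurable]: "(\<lambda>x. card {n \<in> {1..CARD('m)}. \<exists>q\<in>\<rat>. dim (?E q x) = n}) \<in> M \<rightarrow>\<^sub>M count_space UNIV" by measurable
  show ?thesis unfolding measurable_splitting_def
  proof (intro conjI allI impI)
    show "count \<in> M \<rightarrow>\<^sub>M count_space UNIV"
    proof (rule measurableI)
      fix S :: "nat set"
      show "count -` S \<inter> space M \<in> sets M"
      proof (rule in_sets_AE)
        show "{x \<in> space M. card {n \<in> {1..CARD('m)}. \<exists>q\<in>\<rat>. dim (?E q x) = n} \<in> S} \<in> sets M" by measurable
        show "AE x in M. x \<in> {x \<in> space M. card {n \<in> {1..CARD('m)}. \<exists>q\<in>\<rat>. dim (?E q x) = n} \<in> S} \<longleftrightarrow> x \<in> count -` S \<inter> space M"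
          using AE_good
        proof eventually_elim
          case (elim x)
          obtain Q a where s: "splitting_at x Q a" using good_splitting[OF elim] by blast
          show ?case using splitting.card_exponents[OF s[unfolded splitting_at_def]] 
            by (simp add: count_def splitting_at_facts[OF elim s] conj_commute)
        qed
      qed simp
    qed simp
    fix i :: nat and G :: "(real^'m) set" assume i: "1 \<le> i" and G: "open G"
    have mG [measurable]: "{x \<in> space M. ?E q x \<inter> ?F r x \<inter> G \<noteq> {}} \<in> sets M" for q r
      using mEF[of q r] G by (simp add: mfield_def)
    \<comment> \<open>Triviality of the intersection is stated through its dimension, which is known
      to be measurable.\<close>
    let ?R = "\<lambda>x r q. r < q \<and> dim (?E r x \<inter> ?F r x) = 0 \<and> Suc (rk r x) = i \<and> rk q x = i \<and> ?E q x \<inter> ?F r x \<inter> G \<noteq> {}"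
    show "{x \<in> space M. i \<le> count x \<and> U i x \<inter> G \<noteq> {}} \<in> sets M"
    proof (rule in_sets_AE)
      have "{x \<in> space M. \<exists>r\<in>\<rat>. \<exists>q\<in>\<rat>. ?R x r q} = (\<Union>r\<in>\<rat>. \<Union>q\<in>\<rat>. {x \<in> space M. ?R x r q})" by auto
      also have "\<dots> \<in> sets M"
        by (intro sets.countable_UN'' countable_rat) measurable
      finally show "{x \<in> space M. \<exists>r\<in>\<rat>. \<exists>q\<in>\<rat>. ?R x r q} \<in> sets M" .
      show "AE x in M. x \<in> {x \<in> space M. \<exists>r\<in>\<rat>. \<exists>q\<in>\<rat>. ?R x r q} \<longleftrightarrow> x \<in> {x \<in> space M. i \<le> count x \<and> U i x \<inter> G \<noteq> {}}"
        using AE_good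
      proof eventually_elim
        case (elim x)
        obtain Q a where s: "splitting_at x Q a" using good_splitting[OF elim] by blast
        interpret splitting "\<lambda>c. slow (\<lambda>n. A (of_int n)) c x" "\<lambda>c. slow disc.dual_C c x" "\<lambda>c. slow disc.rev_C (- c) x" Q a
          using s unfolding splitting_at_def .
        have d: "dim (?E r x \<inter> ?F r x) = 0 \<longleftrightarrow> ?E r x \<inter> ?F r x = {0}" for r
          using subspace_0[OF subspace_E[of r]] subspace_0[OF subspace_F[of r]] by (auto simp: dim_eq_0)
        have rk: "rk r x = rank_in exponents r" for r unfolding rk_def by (rule rank_in_eq_card_dims[symmetric])
        show ?case
          using V_meets_iff[OF i, of G] good_space[OF elim]
          unfolding count_def U_def lyap_def splitting_at_facts[OF elim s] mem_Collect_eq d rk by blast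
      qed
    qed auto
  qed
qed

end

lemma lebesgue_space_complete_prob: "lebesgue_space M \<Longrightarrow> complete_prob_space M"
  unfolding lebesgue_space_def complete_prob_space_def by blast

theorem theorem4:
  fixes M :: "'x measure"
    and T :: "real \<Rightarrow> 'x \<Rightarrow> 'x"
    and A :: "real \<Rightarrow> 'x \<Rightarrow> real^'m^'m"
  assumes "lebesgue_space M"
    and "mp_flow M T"
    and "GL_cocycle M T A"
    and "\<And>t. integrable M (\<lambda>x. ln_plus (mat_norm (A t x)))"
    and "\<And>t. integrable M (\<lambda>x. ln_plus (mat_norm (matrix_inv (A t x))))"
  shows "\<exists>(\<Lambda> :: 'x \<Rightarrow> real^'m^'m) (k :: 'x \<Rightarrow> nat) (lyap :: nat \<Rightarrow> 'x \<Rightarrow> real)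
            (U :: nat \<Rightarrow> 'x \<Rightarrow> (real^'m) set).
     measurable_splitting M k U \<and>
     (AE x in M.
        dlim_at_top (cocycle_root A x) (\<Lambda> x) \<and>
        direct_sum_decomp {1..k x} (\<lambda>i. U i x) \<and>
        (\<forall>t. \<forall>i\<in>{1..k x}. U i (T t x) = (\<lambda>v. A t x *v v) ` U i x) \<and>
        (\<forall>i\<in>{1..k x}.
           (\<forall>v\<in>U i x - {0}.
              dlim_at_top (\<lambda>t. growth_rate A x t v) (lyap i x) \<and>
              dlim_at_bot (\<lambda>t. growth_rate A x t v) (- lyap i x)) \<and>
           unif_dlim_at_top {v \<in> U i x. norm v = 1} (growth_rate A x) (\<lambda>_. lyap i x) \<and>
           unif_dlim_at_bot {v \<in> U i x. norm v = 1} (growth_rate A x) (\<lambda>_. - lyap i x)) \<and>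
        (\<forall>t. k (T t x) = k x \<and>
           (\<forall>i\<in>{1..k x}. lyap i (T t x) = lyap i x \<and> dim (U i (T t x)) = dim (U i x))) \<and>
        eigenvalues_with_mult (\<Lambda> x) {1..k x} (\<lambda>i. exp (lyap i x)) (\<lambda>i. dim (U i x))) \<and>
     (\<exists>\<tau> :: 'x \<Rightarrow> real set.
        {(t, x). x \<in> space M \<and> t \<in> \<tau> x} \<in> sets (time_product M) \<and>
        (AE x in M.
           \<tau> x \<in> lmeasurable \<and>
           (cocycle_root A x \<longlongrightarrow> \<Lambda> x) (off at_top (\<tau> x)) \<and>
           (\<forall>i\<in>{1..k x}.
              (\<forall>v\<in>U i x - {0}.
                 ((\<lambda>t. growth_rate A x t v) \<longlongrightarrow> lyap i x) (off at_top (\<tau> x)) \<and>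
                 ((\<lambda>t. growth_rate A x t v) \<longlongrightarrow> - lyap i x) (off at_bot (\<tau> x))) \<and>
              uniform_limit {v \<in> U i x. norm v = 1} (growth_rate A x) (\<lambda>_. lyap i x)
                (off at_top (\<tau> x)) \<and>
              uniform_limit {v \<in> U i x. norm v = 1} (growth_rate A x) (\<lambda>_. - lyap i x)
                (off at_bot (\<tau> x)))))"
proof -
  interpret complete_prob_space M by (rule lebesgue_space_complete_prob[OF assms(1)])
  interpret met_flow M T A by unfold_locales (rule assms)+
  show ?thesis
  proof (rule exI[of _ lim_root], rule exI[of _ count], rule exI[of _ lyap], rule exI[of _ U],
      intro conjI measurable_splitting_U exI[of _ tau])
    show "{(t, x). x \<in> space M \<and> t \<in> tau x} \<in> sets (time_product M)"
      using tau_graph_sets by (simp add: tau_graph_def)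
    show "AE x in M. tau x \<in> lmeasurable \<and> (cocycle_root A x \<longlongrightarrow> lim_root x) (off at_top (tau x)) \<and>
      (\<forall>i\<in>{1..count x}. (\<forall>v\<in>U i x - {0}. ((\<lambda>t. growth_rate A x t v) \<longlongrightarrow> lyap i x) (off at_top (tau x)) \<and>
          ((\<lambda>t. growth_rate A x t v) \<longlongrightarrow> - lyap i x) (off at_bot (tau x))) \<and>
        uniform_limit {v \<in> U i x. norm v = 1} (growth_rate A x) (\<lambda>_. lyap i x) (off at_top (tau x)) \<and>
        uniform_limit {v \<in> U i x. norm v = 1} (growth_rate A x) (\<lambda>_. - lyap i x) (off at_bot (tau x)))"
      using AE_good
    proof eventually_elim
      case (elim x)
      then have "tau x \<in> lmeasurable" by (simp add: good_def)
      then show ?case using good_growth[OF elim] good_structure(3)[OF elim] by blast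
    qed
  next
    show "AE x in M. dlim_at_top (cocycle_root A x) (lim_root x) \<and>
        direct_sum_decomp {1..count x} (\<lambda>i. U i x) \<and>
        (\<forall>t. \<forall>i\<in>{1..count x}. U i (T t x) = (\<lambda>v. A t x *v v) ` U i x) \<and>
        (\<forall>i\<in>{1..count x}.
           (\<forall>v\<in>U i x - {0}.
              dlim_at_top (\<lambda>t. growth_rate A x t v) (lyap i x) \<and>
              dlim_at_bot (\<lambda>t. growth_rate A x t v) (- lyap i x)) \<and>
           unif_dlim_at_top {v \<in> U i x. norm v = 1} (growth_rate A x) (\<lambda>_. lyap i x) \<and>
           unif_dlim_at_bot {v \<in> U i x. norm v = 1} (growth_rate A x) (\<lambda>_. - lyap i x)) \<and>
        (\<forall>t. count (T t x) = count x \<and>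
           (\<forall>i\<in>{1..count x}. lyap i (T t x) = lyap i x \<and> dim (U i (T t x)) = dim (U i x))) \<and>
        eigenvalues_with_mult (lim_root x) {1..count x} (\<lambda>i. exp (lyap i x)) (\<lambda>i. dim (U i x))"
      using AE_good
    proof eventually_elim
      case (elim x)
      have tau: "tau x \<in> lmeasurable" and cov: "covariant x (disc.oseledets x)" using elim by (simp_all add: good_def)
      note inv = invariance[OF good_space[OF elim] cov]
      show ?case
        by (intro conjI ballI allI dlimI(1,3)[OF tau] dlimI(2,4)[OF tau] good_structure[OF elim] good_growth[OF elim] inv(2,3))
          (simp_all add: inv(1) count_def lyap_def)
    qed
  qed
qed

end
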